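(* Let $\Bbbk$ be a field of characteristic zero. Let $\bar{\mathsf M}$ be a finite-type bisymmetric sequence and let $(\bar{\mathsf N},\mathsf N)$ be a relative bisymmetric sequence, with $\bar{\mathsf N}$ and $\mathsf N$ of finite type and such that $\bar{\mathsf N}(0,0)$ and $\mathsf N(0)$ are concentrated in strictly positive degrees. Then $$\mathrm{ch}\bigl(\bar{\mathsf M}\,\bar\circ\,(\bar{\mathsf N},\mathsf N)\bigr)=\mathrm{ch}(\bar{\mathsf M})\,\bar\circ\,\bigl(\mathrm{ch}(\bar{\mathsf N}),\mathrm{ch}(\mathsf N)\bigr),$$ where $\bar\circ$ on the left is the relative composition product and $\bar\circ$ on the right is the relative plethysm.
   Context: Gradings and sequences. All modules are non-negatively graded $\Bbbk$-vector spaces, with the Koszul sign rule for permuting tensor factors. A symmetric sequence is a family $\mathsf N=(\mathsf N(n))_{n\ge0}$ with an action of the symmetric group $\mathfrak S_n$ on $\mathsf N(n)$. A bisymmetric sequence is a family $\bar{\mathsf M}=(\bar{\mathsf M}(m,n))_{m,n\ge 0}$ with a right action of $\mathfrak S_m\times\mathfrak S_n$ on $\bar{\mathsf M}(m,n)$. Finite type means that each $\mathsf N(n)$ (resp. $\bar{\mathsf M}(m,n)$) is finite-dimensional. A relative bisymmetric sequence is a pair $(\bar{\mathsf N},\mathsf N)$ of a bisymmetric sequence and a symmetric sequence. Relative composition product. The tensor product of bisymmetric sequences is $(\bar{\mathsf M}\otimes\bar{\mathsf N})(m,n)=\bigoplus_{k+l=m,\,k'+l'=n}\mathrm{Ind}_{\mathfrak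 S_k\times\mathfrak S_l\times\mathfrak S_{k'}\times\mathfrak S_{l'}}^{\mathfrak S_m\times\mathfrak S_n}\bar{\mathsf M}(k,k')\otimes\bar{\mathsf N}(l,l')$. A symmetric sequence $\mathsf N$ is viewed as a bisymmetric sequence concentrated in biarities $(0,n)$. Set $$\bar{\mathsf M}\,\bar\circ\,(\bar{\mathsf N},\mathsf N)=\bigoplus_{m,n\ge0}\bigl(\bar{\mathsf M}(m,n)\otimes\bar{\mathsf N}^{\otimes m}\otimes\mathsf N^{\otimes n}\bigr)^{\mathfrak S_m\times\mathfrak S_n}$$ (invariants; canonically isomorphic to coinvariants in characteristic zero). Characters. For a degree-0 endomorphism $T$ of a graded vector space with finite-dimensional graded pieces, its graded trace is $\mathrm{tr}(T)=\sum_d(-\hbar)^d\,\mathrm{tr}(T_d)$. For a bisymmetric sequence with finite-dimensional graded pieces in each biarity, put $\mathcal F_{\bar{\mathsf M}}(V,W)=\bigoplus_{m,n}(\bar{\mathsf M}(m,n)\otimes V^{\otimes m}\otimes W^{\otimes n})_{\mathfrak S_m\times\mathfrak S_n}$. Then $\mathrm{ch}(\bar{\mathsf M})$ is the series in $\hbar$ with coefficients in $\hat\Lambda_{x,y}$ whose projection to polynomials in $x_1,\dots,x_r,y_1,\dots,y_s$, for all $r,s\ge 1$, is the graded trace (computed separately in each biarity) of the endomorphism of $\mathcal F_{\bar{\mathsf M}}(\Bbbk^r,\Bbbk^s)$ induced by $(\mathrm{diag}(x_1,\dots,x_r),\mathrm{diag}(y_1,\dots,y_s))$, with $\Bbbk^r,\Bbbk^s$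 in degree 0. Similarly $\mathrm{ch}(\mathsf N)$, written in the variables $y$, is the graded trace of $\mathrm{diag}(y_1,\dots,y_s)$ acting on $\bigoplus_n(\mathsf N(n)\otimes(\Bbbk^s)^{\otimes n})_{\mathfrak S_n}$. Here $\Lambda_x,\Lambda_y$ are the rings of symmetric functions in $x_1,x_2,\dots$ and $y_1,y_2,\dots$, $\Lambda_{x,y}=\Lambda_x\otimes\Lambda_y$, and hats denote completion with respect to polynomial degree. Relative plethysm. For functions without $\hbar$ and with non-negative coefficients $\bar g=\sum\bar g_{\alpha,\beta}x^\alpha y^\beta$, $g=\sum g_\beta y^\beta$, define formal variables by $\prod_i(1+z_it)=\prod_{\alpha,\beta}(1+x^\alpha y^\beta t)^{\bar g_{\alpha,\beta}}$ and $\prod_j(1+w_jt)=\prod_\beta(1+y^\beta t)^{g_\beta}$, and put $\bar f\,\bar\circ\,(\bar g,g)=\bar f(z_1,z_2,\dots;w_1,w_2,\dots)$. In general (arbitrary coefficients, completions, series in $\hbar$) $\bar f\,\bar\circ\,(\bar g,g)$ is characterized by: $\bar f\mapsto\bar f\,\bar\circ\,(\bar g,g)$ is a continuous ring homomorphism, linear over series in $\hbar$, and with $p_n$ the $n$-th power sum, for $n\ge1$, $p_n(x)\,\bar\circ\,(\bar g,g)=\bar g(x_1^n,x_2^n,\dots;y_1^n,y_2^n,\dots;\hbar^n)$ and $p_n(y)\,\bar\circ\,(\bar g,g)=g(y_1^n,y_2^n,\dots;\hbar^n)$. It is defined when the constant terms (in $x,y$) of $\bar g$ and $g$ are concentrated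 in strictly positive $\hbar$-degree. *)

theory Defs
  imports
    "HOL-Algebra.Ring"
    "HOL-Combinatorics.Permutations"
    "HOL-Computational_Algebra.Formal_Power_Series"
    "HOL-Library.Function_Algebras"
    "HOL-Library.Poly_Mapping"
    "HOL-Library.Product_Plus"
begin

section \<open>Linear algebra\<close>

text \<open>
  A vector space over \<open>'k\<close> is a subspace of an ambient type carrying a \<^locale>\<open>vector_space\<close>
  structure. Function types carry the pointwise structure.
\<close>

definition pscale :: "('k \<Rightarrow> 'v \<Rightarrow> 'v) \<Rightarrow> 'k \<Rightarrow> ('i \<Rightarrow> 'v) \<Rightarrow> 'i \<Rightarrow> 'v" where
  "pscale s c f = (\<lambda>i. s c (f i))"

abbreviation fscale :: "'k::times \<Rightarrow> ('i \<Rightarrow> 'k) \<Rightarrow> 'i \<Rightarrow> 'k" where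
  "fscale \<equiv> pscale (*)"

definition linear_on ::
  "('k \<Rightarrow> 'v \<Rightarrow> 'v) \<Rightarrow> ('k \<Rightarrow> 'w \<Rightarrow> 'w) \<Rightarrow> 'v::plus set \<Rightarrow> ('v \<Rightarrow> 'w::plus) \<Rightarrow> bool" where
  "linear_on s t V f \<longleftrightarrow>
     (\<forall>x\<in>V. \<forall>y\<in>V. f (x + y) = f x + f y) \<and> (\<forall>c. \<forall>x\<in>V. f (s c x) = t c (f x))"

definition finite_dim :: "('k::field \<Rightarrow> 'v::ab_group_add \<Rightarrow> 'v) \<Rightarrow> 'v set \<Rightarrow> bool" where
  "finite_dim s V \<longleftrightarrow> (\<exists>B. finite B \<and> B \<subseteq> V \<and> V \<subseteq> module.span s B)"

text \<open>
  Trace of the endomorphism of \<open>X / U\<close> induced by \<open>T\<close>, computed from the matrix \<open>A\<close> of that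
  endomorphism in a finite family \<open>B\<close> of representatives of a basis of \<open>X / U\<close>.
\<close>

definition quotient_basis ::
  "('k::field \<Rightarrow> 'v::ab_group_add \<Rightarrow> 'v) \<Rightarrow> 'v set \<Rightarrow> 'v set \<Rightarrow> 'v set \<Rightarrow> bool" where
  "quotient_basis s X U B \<longleftrightarrow> finite B \<and> B \<subseteq> X \<and>
     (\<forall>x\<in>X. \<exists>c. x - (\<Sum>b\<in>B. s (c b) b) \<in> U) \<and>
     (\<forall>c. (\<Sum>b\<in>B. s (c b) b) \<in> U \<longrightarrow> (\<forall>b\<in>B. c b = 0))"

definition quotient_trace ::
  "('k::field \<Rightarrow> 'v::ab_group_add \<Rightarrow> 'v) \<Rightarrow> 'v set \<Rightarrow> 'v set \<Rightarrow> ('v \<Rightarrow> 'v) \<Rightarrow> 'k" where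
  "quotient_trace s X U T = (THE t. \<exists>B A. quotient_basis s X U B \<and>
     (\<forall>b\<in>B. T b - (\<Sum>b'\<in>B. s (A b' b) b') \<in> U) \<and> t = (\<Sum>b\<in>B. A b b))"


subsection \<open>Tensor products\<close>

text \<open>
  The tensor product of \<open>A\<close> and \<open>B\<close> is realised inside the dual of the space of bilinear forms on
  \<open>A \<times> B\<close>: the pure tensor of \<open>x\<close> and \<open>y\<close> is evaluation at \<open>(x, y)\<close>. Over a field the canonical map
  from the tensor product to this dual is injective, so that its image, the span of the
  evaluations, is the tensor product. The same is done for finite lists of spaces.
\<close>

definition bilinear_on ::
  "('k::field \<Rightarrow> 'u::plus \<Rightarrow> 'u) \<Rightarrow> 'u set \<Rightarrow> ('k \<Rightarrow> 'v::plus \<Rightarrow> 'v) \<Rightarrow> 'v set \<Rightarrow> ('u \<Rightarrow> 'v \<Rightarrow> 'k) \<Rightarrow> bool" where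
  "bilinear_on s A t B \<phi> \<longleftrightarrow>
     (\<forall>y\<in>B. linear_on s (*) A (\<lambda>x. \<phi> x y)) \<and> (\<forall>x\<in>A. linear_on t (*) B (\<phi> x))"

type_synonym ('k, 'u, 'v) tensor2 = "('u \<Rightarrow> 'v \<Rightarrow> 'k) \<Rightarrow> 'k"

definition pure2 ::
  "('k::field \<Rightarrow> 'u::plus \<Rightarrow> 'u) \<Rightarrow> 'u set \<Rightarrow> ('k \<Rightarrow> 'v::plus \<Rightarrow> 'v) \<Rightarrow> 'v set \<Rightarrow> 'u \<Rightarrow> 'v \<Rightarrow> ('k, 'u, 'v) tensor2"
  where
  "pure2 s A t B x y = (\<lambda>\<phi>. if bilinear_on s A t B \<phi> then \<phi> x y else 0)"

definition tensor2 ::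
  "('k::field \<Rightarrow> 'u::plus \<Rightarrow> 'u) \<Rightarrow> 'u set \<Rightarrow> ('k \<Rightarrow> 'v::plus \<Rightarrow> 'v) \<Rightarrow> 'v set \<Rightarrow> ('k, 'u, 'v) tensor2 set"
  where
  "tensor2 s A t B = module.span fscale {pure2 s A t B x y |x y. x \<in> A \<and> y \<in> B}"

text \<open>
  The map induced by \<open>F\<close> and \<open>G\<close>, taking \<open>x \<otimes> y\<close> to \<open>F x \<otimes> G y\<close>. The spaces \<open>A\<close>, \<open>B\<close> are the targets
  of \<open>F\<close>, \<open>G\<close>.
\<close>

definition map_tensor2 ::
  "('k::field \<Rightarrow> 'u::plus \<Rightarrow> 'u) \<Rightarrow> 'u set \<Rightarrow> ('k \<Rightarrow> 'v::plus \<Rightarrow> 'v) \<Rightarrow> 'v set \<Rightarrow>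
   ('u0 \<Rightarrow> 'u) \<Rightarrow> ('v0 \<Rightarrow> 'v) \<Rightarrow> ('k, 'u0, 'v0) tensor2 \<Rightarrow> ('k, 'u, 'v) tensor2" where
  "map_tensor2 s A t B F G \<zeta> = (\<lambda>\<phi>. if bilinear_on s A t B \<phi> then \<zeta> (\<lambda>x y. \<phi> (F x) (G y)) else 0)"

definition multilinear_on ::
  "('k::field \<Rightarrow> 'v::plus \<Rightarrow> 'v) \<Rightarrow> 'v set list \<Rightarrow> ('v list \<Rightarrow> 'k) \<Rightarrow> bool" where
  "multilinear_on s Vs \<phi> \<longleftrightarrow>
     (\<forall>vs\<in>listset Vs. \<forall>i<length Vs. linear_on s (*) (Vs ! i) (\<lambda>x. \<phi> (vs[i := x])))"

type_synonym ('k, 'v) tensor = "('v list \<Rightarrow> 'k) \<Rightarrow> 'k"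

definition pure ::
  "('k::field \<Rightarrow> 'v::plus \<Rightarrow> 'v) \<Rightarrow> 'v set list \<Rightarrow> 'v list \<Rightarrow> ('k, 'v) tensor" where
  "pure s Vs vs = (\<lambda>\<phi>. if multilinear_on s Vs \<phi> then \<phi> vs else 0)"

definition tensor :: "('k::field \<Rightarrow> 'v::plus \<Rightarrow> 'v) \<Rightarrow> 'v set list \<Rightarrow> ('k, 'v) tensor set" where
  "tensor s Vs = module.span fscale (pure s Vs ` listset Vs)"

definition map_tensor ::
  "('k::field \<Rightarrow> 'v::plus \<Rightarrow> 'v) \<Rightarrow> 'v set list \<Rightarrow> ('u \<Rightarrow> 'v) list \<Rightarrow> ('k, 'u) tensor \<Rightarrow> ('k, 'v) tensor"
  where
  "map_tensor s Vs Fs \<zeta> =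
     (\<lambda>\<phi>. if multilinear_on s Vs \<phi> then \<zeta> (\<lambda>vs. \<phi> (map2 (\<lambda>F v. F v) Fs vs)) else 0)"

text \<open>
  Place permutation \<open>v\<^sub>0 \<otimes> \<dots> \<otimes> v\<^sub>p\<^sub>-\<^sub>1 \<mapsto> v\<^bsub>\<rho> 0\<^esub> \<otimes> \<dots> \<otimes> v\<^bsub>\<rho> (p-1)\<^esub>\<close>, without sign; \<open>Vs\<close> is the list of target
  spaces. This is a right action.
\<close>

definition perm_tensor ::
  "('k::field \<Rightarrow> 'v::plus \<Rightarrow> 'v) \<Rightarrow> 'v set list \<Rightarrow> (nat \<Rightarrow> nat) \<Rightarrow> ('k, 'v) tensor \<Rightarrow> ('k, 'v) tensor" where
  "perm_tensor s Vs \<rho> \<zeta> =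
     (\<lambda>\<phi>. if multilinear_on s Vs \<phi> then \<zeta> (\<lambda>vs. \<phi> (permute_list \<rho> vs)) else 0)"

text \<open>The Koszul sign of that permutation when the \<open>i\<close>-th factor has degree \<open>ds ! i\<close>.\<close>

definition koszul_sign :: "(nat \<Rightarrow> nat) \<Rightarrow> nat list \<Rightarrow> 'k::field" where
  "koszul_sign \<rho> ds =
     (\<Prod>(i, j)\<in>{(i, j). i < j \<and> j < length ds \<and> \<rho> j < \<rho> i}. (-1) ^ (ds ! \<rho> i * ds ! \<rho> j))"


section \<open>Symmetric and bisymmetric sequences\<close>

text \<open>
  The group \<open>\<SS>\<^sub>n\<close> consists of the permutations of \<open>{..<n}\<close>. The last numerical argument of a piece
  or of an action is the homological degree.
\<close>

record 'v symmetric_seq =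
  spiece :: "nat \<Rightarrow> nat \<Rightarrow> 'v set"
  sact :: "nat \<Rightarrow> nat \<Rightarrow> (nat \<Rightarrow> nat) \<Rightarrow> 'v \<Rightarrow> 'v"

record 'v bisymmetric_seq =
  bpiece :: "nat \<Rightarrow> nat \<Rightarrow> nat \<Rightarrow> 'v set"
  bact :: "nat \<Rightarrow> nat \<Rightarrow> nat \<Rightarrow> (nat \<Rightarrow> nat) \<Rightarrow> (nat \<Rightarrow> nat) \<Rightarrow> 'v \<Rightarrow> 'v"

locale symmetric_sequence = vector_space s
  for s :: "'k::field \<Rightarrow> 'v::ab_group_add \<Rightarrow> 'v" +
  fixes N :: "'v symmetric_seq"
  assumes subspace_piece: "subspace (spiece N n d)"
    and linear_act: "\<tau> permutes {..<n} \<Longrightarrow> linear_on s s (spiece N n d) (sact N n d \<tau>)"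
    and act_closed: "\<tau> permutes {..<n} \<Longrightarrow> v \<in> spiece N n d \<Longrightarrow> sact N n d \<tau> v \<in> spiece N n d"
    and act_id: "v \<in> spiece N n d \<Longrightarrow> sact N n d id v = v"
    and act_comp: "\<tau> permutes {..<n} \<Longrightarrow> \<tau>' permutes {..<n} \<Longrightarrow> v \<in> spiece N n d \<Longrightarrow>
      sact N n d (\<tau> \<circ> \<tau>') v = sact N n d \<tau>' (sact N n d \<tau> v)"

locale bisymmetric_sequence = vector_space s
  for s :: "'k::field \<Rightarrow> 'v::ab_group_add \<Rightarrow> 'v" +
  fixes M :: "'v bisymmetric_seq"
  assumes subspace_piece: "subspace (bpiece M m n d)"
    and linear_act: "\<sigma> permutes {..<m} \<Longrightarrow> \<tau> permutes {..<n} \<Longrightarrow>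
      linear_on s s (bpiece M m n d) (bact M m n d \<sigma> \<tau>)"
    and act_closed: "\<sigma> permutes {..<m} \<Longrightarrow> \<tau> permutes {..<n} \<Longrightarrow> v \<in> bpiece M m n d \<Longrightarrow>
      bact M m n d \<sigma> \<tau> v \<in> bpiece M m n d"
    and act_id: "v \<in> bpiece M m n d \<Longrightarrow> bact M m n d id id v = v"
    and act_comp: "\<sigma> permutes {..<m} \<Longrightarrow> \<sigma>' permutes {..<m} \<Longrightarrow>
      \<tau> permutes {..<n} \<Longrightarrow> \<tau>' permutes {..<n} \<Longrightarrow> v \<in> bpiece M m n d \<Longrightarrow>
      bact M m n d (\<sigma> \<circ> \<sigma>') (\<tau> \<circ> \<tau>') v = bact M m n d \<sigma>' \<tau>' (bact M m n d \<sigma> \<tau> v)"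

definition symmetric_finite_type ::
  "('k::field \<Rightarrow> 'v::ab_group_add \<Rightarrow> 'v) \<Rightarrow> 'v symmetric_seq \<Rightarrow> bool" where
  "symmetric_finite_type s N \<longleftrightarrow>
     (\<forall>n. (\<forall>d. finite_dim s (spiece N n d)) \<and> finite {d. spiece N n d \<noteq> {0}})"

definition bisymmetric_finite_type ::
  "('k::field \<Rightarrow> 'v::ab_group_add \<Rightarrow> 'v) \<Rightarrow> 'v bisymmetric_seq \<Rightarrow> bool" where
  "bisymmetric_finite_type s M \<longleftrightarrow>
     (\<forall>m n. (\<forall>d. finite_dim s (bpiece M m n d)) \<and> finite {d. bpiece M m n d \<noteq> {0}})"

definition as_bisymmetric :: "'v::zero symmetric_seq \<Rightarrow> 'v bisymmetric_seq" where
  "as_bisymmetric N = \<lparr>bpiece = (\<lambda>m n d. if m = 0 then spiece N n d else {0}),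
                       bact = (\<lambda>m n d \<sigma> \<tau>. sact N n d \<tau>)\<rparr>"


section \<open>Tensor product of bisymmetric sequences\<close>

text \<open>
  The tensor product of a list \<open>Ns\<close> of \<open>p\<close> bisymmetric sequences is, in biarity \<open>(k, l)\<close>, the direct
  sum over \<open>ks\<close>, \<open>ls\<close> with \<open>\<Sum>ks = k\<close>, \<open>\<Sum>ls = l\<close> (and over degrees \<open>ds\<close>) of the induced representations
  of \<open>V = N\<^sub>0(ks\<^sub>0, ls\<^sub>0) \<otimes> \<dots> \<otimes> N\<^sub>p\<^sub>-\<^sub>1(ks\<^sub>p\<^sub>-\<^sub>1, ls\<^sub>p\<^sub>-\<^sub>1)\<close> from \<open>H = \<Prod>\<^sub>i \<SS>\<^bsub>ks i\<^esub> \<times> \<SS>\<^bsub>ls i\<^esub>\<close> to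
  \<open>G = \<SS>\<^sub>k \<times> \<SS>\<^sub>l\<close>. For \<open>p = 2\<close> this is the binary tensor product.

  The group \<open>G\<close> is replaced by the \<open>G\<close>-\<open>H\<close>-biset of pairs \<open>(b, c)\<close> of bijections from the disjoint unions
  of blocks \<open>\<Squnion>\<^sub>i {..<ks\<^sub>i}\<close>, \<open>\<Squnion>\<^sub>i {..<ls\<^sub>i}\<close> to \<open>{..<k}\<close>, \<open>{..<l}\<close>; this embeds \<open>H\<close> without a choice of
  block permutations. \<open>G\<close> being finite, the induced right module \<open>V \<otimes>\<^sub>H \<k>[G]\<close> is
  \<open>{\<xi> : G \<rightarrow> V. \<xi> (g h) = \<xi> g \<cdot> h}\<close> with \<open>(\<xi> \<cdot> g') g = \<xi> (g' g)\<close>: the element \<open>v \<otimes> g\<^sub>0\<close> corresponds to the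
  function supported on \<open>g\<^sub>0\<^sup>-\<^sup>1 H\<close> which takes \<open>g\<^sub>0\<^sup>-\<^sup>1 h\<close> to \<open>v \<cdot> h\<close>.
\<close>

type_synonym labelling = "nat \<times> nat \<Rightarrow> nat"

definition blocks :: "nat list \<Rightarrow> (nat \<times> nat) set" where
  "blocks ks = (SIGMA i:{..<length ks}. {..<ks ! i})"

definition labellings :: "nat list \<Rightarrow> nat \<Rightarrow> labelling set" where
  "labellings ks k = {b \<in> extensional (blocks ks). bij_betw b (blocks ks) {..<k}}"

type_synonym day_index = "nat list \<times> nat list \<times> nat list \<times> labelling \<times> labelling"

definition day_indices :: "nat \<Rightarrow> nat \<Rightarrow> nat \<Rightarrow> day_index set" where
  "day_indices p k l = {(ks, ls, ds, b, c).
     length ks = p \<and> length ls = p \<and> length ds = p \<and> sum_list ks = k \<and> sum_list ls = l \<and>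
     b \<in> labellings ks k \<and> c \<in> labellings ls l}"

definition factors ::
  "'v bisymmetric_seq list \<Rightarrow> nat list \<Rightarrow> nat list \<Rightarrow> nat list \<Rightarrow> 'v set list" where
  "factors Ns ks ls ds =
     map (\<lambda>i. bpiece (Ns ! i) (ks ! i) (ls ! i) (ds ! i)) [0..<length Ns]"

definition factor_actions ::
  "'v bisymmetric_seq list \<Rightarrow> nat list \<Rightarrow> nat list \<Rightarrow> nat list \<Rightarrow>
   (nat \<Rightarrow> nat \<Rightarrow> nat) \<Rightarrow> (nat \<Rightarrow> nat \<Rightarrow> nat) \<Rightarrow> ('v \<Rightarrow> 'v) list" where
  "factor_actions Ns ks ls ds h h' =
     map (\<lambda>i. bact (Ns ! i) (ks ! i) (ls ! i) (ds ! i) (h i) (h' i)) [0..<length Ns]"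

definition block_shuffle :: "nat list \<Rightarrow> labelling \<Rightarrow> (nat \<Rightarrow> nat \<Rightarrow> nat) \<Rightarrow> labelling" where
  "block_shuffle ks b h = (\<lambda>(i, j)\<in>blocks ks. b (i, h i j))"

type_synonym ('k, 'v) day = "day_index \<Rightarrow> ('k, 'v) tensor"

definition bisym_tensor ::
  "('k::field \<Rightarrow> 'v::plus \<Rightarrow> 'v) \<Rightarrow> 'v bisymmetric_seq list \<Rightarrow> ('k, 'v) day bisymmetric_seq" where
  "bisym_tensor s Ns = \<lparr>
     bpiece = (\<lambda>k l d. {\<xi>.
       (\<forall>(ks, ls, ds, b, c)\<in>day_indices (length Ns) k l. sum_list ds = d \<longrightarrow>
          \<xi> (ks, ls, ds, b, c) \<in> tensor s (factors Ns ks ls ds) \<and>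
          (\<forall>h h'. (\<forall>i<length Ns. h i permutes {..<ks ! i} \<and> h' i permutes {..<ls ! i}) \<longrightarrow>
             \<xi> (ks, ls, ds, block_shuffle ks b h, block_shuffle ls c h') =
             map_tensor s (factors Ns ks ls ds) (factor_actions Ns ks ls ds h h')
               (\<xi> (ks, ls, ds, b, c)))) \<and>
       (\<forall>ks ls ds b c.
          (ks, ls, ds, b, c) \<notin> day_indices (length Ns) k l \<or> sum_list ds \<noteq> d \<longrightarrow>
          \<xi> (ks, ls, ds, b, c) = 0)}),
     bact = (\<lambda>k l d \<sigma> \<tau> \<xi>. \<lambda>(ks, ls, ds, b, c).
       if (ks, ls, ds, b, c) \<in> day_indices (length Ns) k l
       then \<xi> (ks, ls, ds, \<lambda>x\<in>blocks ks. \<sigma> (b x), \<lambda>x\<in>blocks ls. \<tau> (c x)) else 0)\<rparr>"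

text \<open>
  Right action, with Koszul signs, of a permutation \<open>\<rho>\<close> of the tensor factors (for \<open>\<rho>\<close> preserving the
  list \<open>Ns\<close>): a tensor \<open>v\<^sub>0 \<otimes> \<dots> \<otimes> v\<^sub>p\<^sub>-\<^sub>1\<close> labelled by \<open>(b, c)\<close> goes to
  \<open>\<plusminus> v\<^bsub>\<rho> 0\<^esub> \<otimes> \<dots> \<otimes> v\<^bsub>\<rho> (p-1)\<^esub>\<close> labelled by \<open>b (\<rho> i, j)\<close>, \<open>c (\<rho> i, j)\<close>.
\<close>

definition permute_factors ::
  "('k::field \<Rightarrow> 'v::plus \<Rightarrow> 'v) \<Rightarrow> 'v bisymmetric_seq list \<Rightarrow> nat \<Rightarrow> nat \<Rightarrow> (nat \<Rightarrow> nat) \<Rightarrow>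
   ('k, 'v) day \<Rightarrow> ('k, 'v) day" where
  "permute_factors s Ns k l \<rho> \<xi> = (\<lambda>(ks', ls', ds', b', c').
     if (ks', ls', ds', b', c') \<in> day_indices (length Ns) k l
     then let \<rho>' = inv_into UNIV \<rho>;
              ks = permute_list \<rho>' ks'; ls = permute_list \<rho>' ls'; ds = permute_list \<rho>' ds';
              b = (\<lambda>(i, j)\<in>blocks ks. b' (\<rho>' i, j)); c = (\<lambda>(i, j)\<in>blocks ls. c' (\<rho>' i, j))
          in fscale (koszul_sign \<rho> ds)
               (perm_tensor s (factors Ns ks' ls' ds') \<rho> (\<xi> (ks, ls, ds, b, c)))
     else 0)"


section \<open>Relative composition product\<close>

text \<open>
  In a relative bisymmetric sequence \<open>(Nb, N)\<close> both entries live in the same ambient vector space; any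
  two ambient spaces embed into their sum.
\<close>

definition rel_factors ::
  "'v::zero bisymmetric_seq \<Rightarrow> 'v symmetric_seq \<Rightarrow> nat \<Rightarrow> nat \<Rightarrow> 'v bisymmetric_seq list" where
  "rel_factors Nb N m n = replicate m Nb @ replicate n (as_bisymmetric N)"

definition block_perm :: "nat \<Rightarrow> (nat \<Rightarrow> nat) \<Rightarrow> (nat \<Rightarrow> nat) \<Rightarrow> nat \<Rightarrow> nat" where
  "block_perm m \<sigma> \<tau> = (\<lambda>i. if i < m then \<sigma> i else m + \<tau> (i - m))"

definition day_scale :: "'k::field \<Rightarrow> ('k, 'v) day \<Rightarrow> ('k, 'v) day" where
  "day_scale = pscale fscale"

text \<open>
  The component at \<open>(m, n, i, j)\<close> of an element of the composition product lies in the tensor product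
  of the degree \<open>i\<close> part of \<open>M(m, n)\<close> and the degree \<open>j\<close> part of \<open>Nb\<^sup>\<otimes>\<^sup>m \<otimes> N\<^sup>\<otimes>\<^sup>n\<close>.
\<close>

type_synonym ('k, 'u, 'v) rel_comp =
  "nat \<times> nat \<times> nat \<times> nat \<Rightarrow> ('k, 'u, ('k, 'v) day) tensor2"

definition rel_comp_scale :: "'k::field \<Rightarrow> ('k, 'u, 'v) rel_comp \<Rightarrow> ('k, 'u, 'v) rel_comp" where
  "rel_comp_scale = pscale fscale"

definition rel_comp_component ::
  "('k::field \<Rightarrow> 'u::plus \<Rightarrow> 'u) \<Rightarrow> 'u bisymmetric_seq \<Rightarrow>
   ('k \<Rightarrow> 'v::{plus,zero} \<Rightarrow> 'v) \<Rightarrow> 'v bisymmetric_seq \<Rightarrow> 'v symmetric_seq \<Rightarrow>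
   nat \<Rightarrow> nat \<Rightarrow> nat \<Rightarrow> nat \<Rightarrow> nat \<Rightarrow> nat \<Rightarrow> ('k, 'u, ('k, 'v) day) tensor2 set" where
  "rel_comp_component sM M sN Nb N k l m n i j =
     (let Y = bpiece (bisym_tensor sN (rel_factors Nb N m n)) k l j in
      {\<zeta> \<in> tensor2 sM (bpiece M m n i) day_scale Y.
         \<forall>\<sigma> \<tau>. \<sigma> permutes {..<m} \<and> \<tau> permutes {..<n} \<longrightarrow>
           map_tensor2 sM (bpiece M m n i) day_scale Y (bact M m n i \<sigma> \<tau>)
             (permute_factors sN (rel_factors Nb N m n) k l (block_perm m \<sigma> \<tau>)) \<zeta> = \<zeta>})"

definition rel_comp ::
  "('k::field \<Rightarrow> 'u::plus \<Rightarrow> 'u) \<Rightarrow> 'u bisymmetric_seq \<Rightarrow>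
   ('k \<Rightarrow> 'v::{plus,zero} \<Rightarrow> 'v) \<Rightarrow> 'v bisymmetric_seq \<Rightarrow> 'v symmetric_seq \<Rightarrow>
   ('k, 'u, 'v) rel_comp bisymmetric_seq" where
  "rel_comp sM M sN Nb N = \<lparr>
     bpiece = (\<lambda>k l d. {\<omega>. finite {q. \<omega> q \<noteq> 0} \<and>
       (\<forall>m n i j. if i + j = d then \<omega> (m, n, i, j) \<in> rel_comp_component sM M sN Nb N k l m n i j
                  else \<omega> (m, n, i, j) = 0)}),
     bact = (\<lambda>k l d \<sigma> \<tau> \<omega>. \<lambda>(m, n, i, j).
       let T = bisym_tensor sN (rel_factors Nb N m n) in
       map_tensor2 sM (bpiece M m n i) day_scale (bpiece T k l j) id (bact T k l j \<sigma> \<tau>)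
         (\<omega> (m, n, i, j)))\<rparr>"


section \<open>Symmetric series\<close>

text \<open>
  The completion of \<open>\<Lambda>\<^sub>x\<^sub>,\<^sub>y\<close> with respect to polynomial degree consists of all power series in
  \<open>x\<^sub>0, x\<^sub>1, \<dots>, y\<^sub>0, y\<^sub>1, \<dots>\<close> invariant under permutations of the \<open>x\<close> and of the \<open>y\<close> variables. A series
  in \<open>\<hbar>\<close> over it is given by its coefficients at \<open>(\<alpha>, \<beta>, d)\<close>, that is, at \<open>x\<^sup>\<alpha> y\<^sup>\<beta> \<hbar>\<^sup>d\<close>.
\<close>

type_synonym 'k series = "(nat \<Rightarrow>\<^sub>0 nat) \<times> (nat \<Rightarrow>\<^sub>0 nat) \<times> nat \<Rightarrow> 'k"

definition mdeg :: "(nat \<Rightarrow>\<^sub>0 nat) \<Rightarrow> nat" where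
  "mdeg \<alpha> = (\<Sum>i\<in>Poly_Mapping.keys \<alpha>. Poly_Mapping.lookup \<alpha> i)"

definition sym_series :: "'k::comm_ring_1 series ring" where
  "sym_series = \<lparr>
     carrier = {f. \<forall>\<pi> \<rho> \<alpha> \<beta> d. bij \<pi> \<and> bij \<rho> \<longrightarrow>
       f (Poly_Mapping.map_key \<pi> \<alpha>, Poly_Mapping.map_key \<rho> \<beta>, d) = f (\<alpha>, \<beta>, d)},
     monoid.mult = (\<lambda>f g \<mu>. \<Sum>(\<nu>, \<kappa>)\<in>{(\<nu>, \<kappa>). \<nu> + \<kappa> = \<mu>}. f \<nu> * g \<kappa>),
     one = (\<lambda>\<mu>. if \<mu> = 0 then 1 else 0),
     zero = (\<lambda>\<mu>. 0),
     add = (\<lambda>f g \<mu>. f \<mu> + g \<mu>)\<rparr>"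

definition hbar_series :: "'k::zero fps \<Rightarrow> 'k series" where
  "hbar_series c = (\<lambda>(\<alpha>, \<beta>, d). if \<alpha> = 0 \<and> \<beta> = 0 then fps_nth c d else 0)"

definition power_sum_x :: "nat \<Rightarrow> 'k::zero_neq_one series" where
  "power_sum_x n = (\<lambda>(\<alpha>, \<beta>, d).
     if (\<exists>i. \<alpha> = Poly_Mapping.single i n) \<and> \<beta> = 0 \<and> d = 0 then 1 else 0)"

definition power_sum_y :: "nat \<Rightarrow> 'k::zero_neq_one series" where
  "power_sum_y n = (\<lambda>(\<alpha>, \<beta>, d).
     if \<alpha> = 0 \<and> (\<exists>j. \<beta> = Poly_Mapping.single j n) \<and> d = 0 then 1 else 0)"

text \<open>The substitution taking \<open>x\<^sub>i\<close>, \<open>y\<^sub>j\<close>, \<open>\<hbar>\<close> to \<open>x\<^sub>i\<^sup>n\<close>, \<open>y\<^sub>j\<^sup>n\<close>, \<open>\<hbar>\<^sup>n\<close>, for \<open>n \<ge> 1\<close>.\<close>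

definition power_subst :: "nat \<Rightarrow> 'k::zero series \<Rightarrow> 'k series" where
  "power_subst n g = (\<lambda>(\<alpha>, \<beta>, d).
     if (\<forall>i. n dvd Poly_Mapping.lookup \<alpha> i) \<and> (\<forall>j. n dvd Poly_Mapping.lookup \<beta> j) \<and> n dvd d
     then g (Poly_Mapping.map (\<lambda>e. e div n) \<alpha>, Poly_Mapping.map (\<lambda>e. e div n) \<beta>, d div n)
     else 0)"

text \<open>
  Continuity, for additive maps, with respect to the filtration by the total degree in \<open>x\<close>, \<open>y\<close>, \<open>\<hbar>\<close>.
\<close>

definition series_order_ge :: "nat \<Rightarrow> 'k::zero series \<Rightarrow> bool" where
  "series_order_ge K f \<longleftrightarrow> (\<forall>\<alpha> \<beta> d. mdeg \<alpha> + mdeg \<beta> + d < K \<longrightarrow> f (\<alpha>, \<beta>, d) = 0)"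

definition series_continuous :: "('k::comm_ring_1 series \<Rightarrow> 'k series) \<Rightarrow> bool" where
  "series_continuous \<Phi> \<longleftrightarrow>
     (\<forall>L. \<exists>K. \<forall>f\<in>carrier sym_series. series_order_ge K f \<longrightarrow> series_order_ge L (\<Phi> f))"

definition is_rel_plethysm ::
  "'k::comm_ring_1 series \<Rightarrow> 'k series \<Rightarrow> ('k series \<Rightarrow> 'k series) \<Rightarrow> bool" where
  "is_rel_plethysm gb g \<Phi> \<longleftrightarrow>
     \<Phi> \<in> ring_hom sym_series sym_series \<and>
     series_continuous \<Phi> \<and>
     (\<forall>c. \<forall>f\<in>carrier sym_series.
        \<Phi> (hbar_series c \<otimes>\<^bsub>sym_series\<^esub> f) = hbar_series c \<otimes>\<^bsub>sym_series\<^esub> \<Phi> f) \<and>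
     (\<forall>n\<ge>1. \<Phi> (power_sum_x n) = power_subst n gb) \<and>
     (\<forall>n\<ge>1. \<Phi> (power_sum_y n) = power_subst n g)"

definition rel_plethysm :: "'k::comm_ring_1 series \<Rightarrow> 'k series \<Rightarrow> 'k series \<Rightarrow> 'k series" where
  "rel_plethysm f gb g = (THE h. \<exists>\<Phi>. is_rel_plethysm gb g \<Phi> \<and> h = \<Phi> f)"


section \<open>Characters\<close>

definition coord_space :: "nat \<Rightarrow> (nat \<Rightarrow> 'k::zero) set" where
  "coord_space r = {v. \<forall>i\<ge>r. v i = 0}"

definition diag :: "(nat \<Rightarrow> 'k::times) \<Rightarrow> (nat \<Rightarrow> 'k) \<Rightarrow> nat \<Rightarrow> 'k" where
  "diag a v = (\<lambda>i. a i * v i)"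

definition tpow :: "nat \<Rightarrow> nat \<Rightarrow> ('k::field, nat \<Rightarrow> 'k) tensor set" where
  "tpow r m = tensor fscale (replicate m (coord_space r))"

definition tpow_perm ::
  "nat \<Rightarrow> nat \<Rightarrow> (nat \<Rightarrow> nat) \<Rightarrow> ('k::field, nat \<Rightarrow> 'k) tensor \<Rightarrow> ('k, nat \<Rightarrow> 'k) tensor" where
  "tpow_perm r m \<sigma> = perm_tensor fscale (replicate m (coord_space r)) \<sigma>"

definition tpow_diag ::
  "nat \<Rightarrow> nat \<Rightarrow> (nat \<Rightarrow> 'k::field) \<Rightarrow> ('k, nat \<Rightarrow> 'k) tensor \<Rightarrow> ('k, nat \<Rightarrow> 'k) tensor" where
  "tpow_diag r m a = map_tensor fscale (replicate m (coord_space r)) (replicate m (diag a))"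

text \<open>
  The trace of the endomorphism induced by \<open>diag(a\<^sub>0, \<dots>, a\<^sub>r\<^sub>-\<^sub>1)\<close> and \<open>diag(b\<^sub>0, \<dots>, b\<^sub>q\<^sub>-\<^sub>1)\<close> on the degree
  \<open>d\<close> part of the coinvariants \<open>(M(m, n) \<otimes> V\<^sup>\<otimes>\<^sup>m \<otimes> W\<^sup>\<otimes>\<^sup>n)\<^bsub>\<SS>\<^sub>m \<times> \<SS>\<^sub>n\<^esub>\<close>, where \<open>V = \<k>\<^sup>r\<close>, \<open>W = \<k>\<^sup>q\<close>.
\<close>

definition bisym_schur_trace ::
  "('k::field \<Rightarrow> 'v::ab_group_add \<Rightarrow> 'v) \<Rightarrow> 'v bisymmetric_seq \<Rightarrow> nat \<Rightarrow> nat \<Rightarrow> nat \<Rightarrow>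
   nat \<Rightarrow> nat \<Rightarrow> (nat \<Rightarrow> 'k) \<Rightarrow> (nat \<Rightarrow> 'k) \<Rightarrow> 'k" where
  "bisym_schur_trace s M m n d r q a b =
     (let P = bpiece M m n d;
          Q = tensor2 fscale (tpow r m) fscale (tpow q n);
          X = tensor2 s P fscale Q;
          act = (\<lambda>\<sigma> \<tau>. map_tensor2 s P fscale Q (bact M m n d \<sigma> \<tau>)
                  (map_tensor2 fscale (tpow r m) fscale (tpow q n) (tpow_perm r m \<sigma>) (tpow_perm q n \<tau>)));
          U = module.span fscale
                {act \<sigma> \<tau> x - x |\<sigma> \<tau> x. \<sigma> permutes {..<m} \<and> \<tau> permutes {..<n} \<and> x \<in> X};
          D = map_tensor2 s P fscale Q id
                (map_tensor2 fscale (tpow r m) fscale (tpow q n) (tpow_diag r m a) (tpow_diag q n b))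
      in quotient_trace fscale X U D)"

definition sym_schur_trace ::
  "('k::field \<Rightarrow> 'v::ab_group_add \<Rightarrow> 'v) \<Rightarrow> 'v symmetric_seq \<Rightarrow> nat \<Rightarrow> nat \<Rightarrow>
   nat \<Rightarrow> (nat \<Rightarrow> 'k) \<Rightarrow> 'k" where
  "sym_schur_trace s N n d q b =
     (let P = spiece N n d;
          X = tensor2 s P fscale (tpow q n);
          act = (\<lambda>\<tau>. map_tensor2 s P fscale (tpow q n) (sact N n d \<tau>) (tpow_perm q n \<tau>));
          U = module.span fscale {act \<tau> x - x |\<tau> x. \<tau> permutes {..<n} \<and> x \<in> X};
          D = map_tensor2 s P fscale (tpow q n) id (tpow_diag q n b)
      in quotient_trace fscale X U D)"

definition monomials :: "nat \<Rightarrow> nat \<Rightarrow> (nat \<Rightarrow>\<^sub>0 nat) set" where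
  "monomials r m = {\<alpha>. Poly_Mapping.keys \<alpha> \<subseteq> {..<r} \<and> mdeg \<alpha> = m}"

definition monomial_value :: "nat \<Rightarrow> (nat \<Rightarrow>\<^sub>0 nat) \<Rightarrow> (nat \<Rightarrow> 'k::comm_monoid_mult) \<Rightarrow> 'k" where
  "monomial_value r \<alpha> a = (\<Prod>i<r. a i ^ Poly_Mapping.lookup \<alpha> i)"

text \<open>
  The base field being infinite, polynomials in \<open>x\<^sub>0, \<dots>, x\<^sub>r\<^sub>-\<^sub>1, y\<^sub>0, \<dots>, y\<^sub>q\<^sub>-\<^sub>1\<close> are identified with the functions they
  define at the points \<open>(a, b)\<close> of \<open>\<k>\<^sup>r \<times> \<k>\<^sup>q\<close>. The biarity \<open>(m, n)\<close> summand of the Schur functor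
  contributes the part of bidegree \<open>(m, n)\<close> in \<open>(x, y)\<close>, and \<open>(-1)\<^sup>d\<close> comes from the power \<open>(-\<hbar>)\<^sup>d\<close> in the graded trace.
\<close>

definition is_bisym_char ::
  "('k::field \<Rightarrow> 'v::ab_group_add \<Rightarrow> 'v) \<Rightarrow> 'v bisymmetric_seq \<Rightarrow> 'k series \<Rightarrow> bool" where
  "is_bisym_char s M f \<longleftrightarrow> f \<in> carrier sym_series \<and>
     (\<forall>r\<ge>1. \<forall>q\<ge>1. \<forall>m n d a b.
        (\<Sum>\<alpha>\<in>monomials r m. \<Sum>\<beta>\<in>monomials q n.
           f (\<alpha>, \<beta>, d) * monomial_value r \<alpha> a * monomial_value q \<beta> b) =
        (-1) ^ d * bisym_schur_trace s M m n d r q a b)"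

definition bisym_char ::
  "('k::field \<Rightarrow> 'v::ab_group_add \<Rightarrow> 'v) \<Rightarrow> 'v bisymmetric_seq \<Rightarrow> 'k series" where
  "bisym_char s M = (THE f. is_bisym_char s M f)"

definition is_sym_char ::
  "('k::field \<Rightarrow> 'v::ab_group_add \<Rightarrow> 'v) \<Rightarrow> 'v symmetric_seq \<Rightarrow> 'k series \<Rightarrow> bool" where
  "is_sym_char s N f \<longleftrightarrow> f \<in> carrier sym_series \<and>
     (\<forall>\<alpha> \<beta> d. \<alpha> \<noteq> 0 \<longrightarrow> f (\<alpha>, \<beta>, d) = 0) \<and>
     (\<forall>q\<ge>1. \<forall>n d b.
        (\<Sum>\<beta>\<in>monomials q n. f (0, \<beta>, d) * monomial_value q \<beta> b) =
        (-1) ^ d * sym_schur_trace s N n d q b)"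

definition sym_char ::
  "('k::field \<Rightarrow> 'v::ab_group_add \<Rightarrow> 'v) \<Rightarrow> 'v symmetric_seq \<Rightarrow> 'k series" where
  "sym_char s N = (THE f. is_sym_char s N f)"

end

theory Submission
  imports Defs
begin

text \<open>
  Both sides are symmetric series, and a symmetric series is determined by its values at all points \<open>(a, b)\<close> with
  finitely many coordinates (\<open>ev_injective\<close>: distinct monomials are linearly independent functions). At such a
  point both sides turn into the same sum over pairs of permutations.

  On the right, the character of a sequence is written in power sums by Frobenius' formula
  (\<open>is_bisym_char_frobenius\<close>): a pair \<open>(sigma, tau)\<close> of permutations contributes its trace on \<open>M(m, n)\<close> times the product of the power
  sums indexed by the cycle lengths of \<open>sigma\<close> (in \<open>x\<close>) and \<open>tau\<close> (in \<open>y\<close>), divided by \<open>m! n!\<close>. Over a field of characteristic zero the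
  products of power sums are a topological basis of the symmetric series, since they are triangular with
  respect to the monomial symmetric series (\<open>ps_prod_support\<close>). Hence the relative plethysm exists, is
  unique, and replaces the power sums \<open>p\<^sub>c(x)\<close> and \<open>p\<^sub>c(y)\<close> by the \<open>c\<close>-th Adams operations of the two inner characters
  (\<open>rel_plethysm_subst\<close>).

  On the left, the trace on the invariants of \<open>M(m, n) \<otimes> Nb\<^sup>\<otimes>\<^sup>m \<otimes> N\<^sup>\<otimes>\<^sup>n\<close> is the average over \<open>(sigma, tau)\<close> of
  the trace on \<open>M(m, n)\<close> times the trace of the place permutation, with Koszul signs, on the tensor product
  (\<open>has_trace_invariants\<close>, \<open>has_trace_component\<close>). It remains to see that the latter is a product over the cycles, a
  cycle of length \<open>c\<close> contributing the \<open>c\<close>-th Adams operation of the inner character.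

  For this, the Schur functor of a sequence is described by a matrix indexed by an alphabet of letters, that is,
  basis vectors decorated by words in the coordinates. Its entries are those of the averaging projector,
  weighted by the point. The trace of a permutation on the tensor product is a sum over words in these letters
  (\<open>day_trace_words\<close>); the labellings that define the tensor product are permuted freely by the symmetric group, and
  the group average absorbs them. The sum over words factors over cycles because the projector is idempotent and
  commutes with the weights, so that the letters along a cycle can be summed out one at a time
  (\<open>sum_over_cycles\<close>); each such step removes one inversion pattern and one sign \<open>(-1)\<^sup>d\<close>, and the signs cancel
  except for one factor \<open>(-1)\<^sup>d\<close> per cycle. What remains for a cycle of length \<open>c\<close> is the supertrace of the
  projector at the point \<open>(a\<^sup>c, b\<^sup>c)\<close>, with the degrees multiplied by \<open>c\<close> (\<open>letter_cycle_ev\<close>). This is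
  exactly the Adams operation.
\<close>

abbreviation "lookup == Poly_Mapping.lookup"
abbreviation "keys == Poly_Mapping.keys"
abbreviation "single == Poly_Mapping.single"
abbreviation "map_key == Poly_Mapping.map_key"

section \<open>Traces of finite-rank operators\<close>

abbreviation subsp :: "('k::field => 'v::ab_group_add => 'v) => 'v set => bool" where
 "subsp s X \<equiv> vector_space s & module.subspace s X"

definition lin_maps ::
 "('k => 'v => 'v) => 'v::plus set => ('k => 'w => 'w) => 'w::plus set => ('v => 'w) set" where
 "lin_maps s X t Y = {f. linear_on s t X f & (\<forall>x\<in>X. f x \<in> Y)}"

lemma vector_space_mult: "vector_space ((*) :: 'k::field => 'k => 'k)"
 by unfold_locales (auto simp: algebra_simps)

lemma vector_space_pscale: "vector_space s ==> vector_space (pscale s)"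
 unfolding vector_space_def pscale_def by (auto simp: fun_eq_iff)

lemma vector_space_fscale: "vector_space (fscale :: 'k::field => ('i => 'k) => 'i => 'k)"
 by (rule vector_space_pscale[OF vector_space_mult])

lemma subsp_module: "subsp s X ==> module s"
 by (simp add: vector_space_def module_def)

lemma vs_module: "vector_space s ==> module s"
 by (simp add: vector_space_def module_def)

lemma subsp_0: "subsp s X ==> 0 \<in> X"
 using module.subspace_0[OF subsp_module] by blast

lemma subsp_add: "subsp s X ==> x \<in> X ==> y \<in> X ==> x + y \<in> X"
 using module.subspace_add[OF subsp_module] by blast

lemma subsp_diff: "subsp s X ==> x \<in> X ==> y \<in> X ==> x - y \<in> X"
 using module.subspace_diff[OF subsp_module] by blast

lemma subsp_scale: "subsp s X ==> x \<in> X ==> s c x \<in> X"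
 using module.subspace_scale[OF subsp_module] by blast

lemma subsp_sum: "subsp s X ==> (!!i. i \<in> I ==> f i \<in> X) ==> sum f I \<in> X"
 using module.subspace_sum[OF subsp_module] by blast

lemma linear_on_0:
 assumes "subsp s X" "vector_space t" "linear_on s t X f"
 shows "f 0 = (0::'w::ab_group_add)"
proof -
 have "f (s 0 0) = t 0 (f 0)" using assms subsp_0[OF assms(1)] by (simp add: linear_on_def)
 then show ?thesis
  using assms by (simp add: module.scale_zero_left[OF vs_module] module.scale_zero_right[OF vs_module])
qed

lemma linear_on_sum:
 assumes X: "subsp s X" and t: "vector_space t" and f: "linear_on s t X (f :: _ => 'w::ab_group_add)"
  and g: "!!i. i \<in> I ==> g i \<in> X"
 shows "f (\<Sum>i\<in>I. g i) = (\<Sum>i\<in>I. f (g i))"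
 using g
proof (induction I rule: infinite_finite_induct)
 case (insert i I)
 have "f (g i + (\<Sum>i\<in>I. g i)) = f (g i) + f (\<Sum>i\<in>I. g i)"
  using f insert.prems subsp_sum[OF X, of I g] unfolding linear_on_def by blast
 with insert show ?case by simp
qed (use linear_on_0[OF X t f] in auto)

lemma linear_on_lincomb:
 assumes X: "subsp s X" and t: "vector_space t" and f: "linear_on s t X (f :: _ => 'w::ab_group_add)"
  and g: "!!i. i \<in> I ==> g i \<in> X"
 shows "f (\<Sum>i\<in>I. s (c i) (g i)) = (\<Sum>i\<in>I. t (c i) (f (g i)))"
 using linear_on_sum[OF X t f, of I "%i. s (c i) (g i)"] g f subsp_scale[OF X]
 by (auto simp: linear_on_def intro!: sum.cong)

lemma linear_on_diff:
 assumes X: "subsp s X" and t: "vector_space t" and f: "linear_on s t X (f :: _ => 'w::ab_group_add)"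
  and "x \<in> X" "y \<in> X"
 shows "f (x - y) = f x - f y"
proof -
 have "f ((x - y) + y) = f (x - y) + f y"
  using assms subsp_diff[OF X] unfolding linear_on_def by blast
 then show ?thesis by (simp add: algebra_simps)
qed

lemma lin_mapsD:
 assumes "f \<in> lin_maps s X t Y"
 shows "linear_on s t X f" "x \<in> X ==> f x \<in> Y"
 using assms by (auto simp: lin_maps_def)

lemma lin_mapsI:
 assumes "linear_on s t X f" "!!x. x \<in> X ==> f x \<in> Y"
 shows "f \<in> lin_maps s X t Y"
 using assms by (auto simp: lin_maps_def)

lemma lin_maps_id: "id \<in> lin_maps s X s X" "(%x. x) \<in> lin_maps s X s X"
 by (auto simp: lin_maps_def linear_on_def)

lemma lin_maps_comp:
 assumes "f \<in> lin_maps s X t Y" "g \<in> lin_maps t Y u Z"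
 shows "(%x. g (f x)) \<in> lin_maps s X u Z"
 using assms by (auto simp: lin_maps_def linear_on_def)

lemma linear_on_comp:
 assumes "f \<in> lin_maps s X t Y" "linear_on t u Y g"
 shows "linear_on s u X (%x. g (f x))"
 using assms by (auto simp: lin_maps_def linear_on_def)

lemma lin_maps_sum:
 assumes "subsp t Y" "!!i. i \<in> I ==> f i \<in> lin_maps s X t Y"
 shows "(%x. \<Sum>i\<in>I. f i x) \<in> lin_maps s X t Y"
 using assms
 by (auto simp: lin_maps_def linear_on_def sum.distrib module.scale_sum_right[OF subsp_module]
  intro!: subsp_sum[OF assms(1)])

lemma lin_maps_scale:
 assumes "subsp t Y" "f \<in> lin_maps s X t Y"
 shows "(%x. t c (f x)) \<in> lin_maps s X t Y"
 using assms module.scale_right_distrib[OF subsp_module[OF assms(1)]]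
  module.scale_left_commute[OF subsp_module[OF assms(1)]]
 by (auto simp: lin_maps_def linear_on_def subsp_scale)

lemma lin_maps_eq_on_span:
 assumes s: "vector_space s" and t: "vector_space (t :: 'k::field => 'w::ab_group_add => 'w)"
  and f: "linear_on s t (module.span s G) f" and g: "linear_on s t (module.span s G) g"
  and eq: "!!x. x \<in> G ==> f x = g x" and x: "x \<in> module.span s G"
 shows "f x = g x"
proof -
 interpret vector_space s by fact
 interpret t: vector_space t by fact
 have X: "subsp s (span G)" using s by simp
 have "span G \<subseteq> {x \<in> span G. f x = g x}"
 proof (rule span_minimal)
  show "G \<subseteq> {x \<in> span G. f x = g x}" using eq by (auto intro: span_base)
  show "subspace {x \<in> span G. f x = g x}"
   using f g linear_on_0[OF X t f] linear_on_0[OF X t g]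
   by (intro subspaceI) (auto simp: linear_on_def intro: span_zero span_add span_scale)
 qed
 with x show ?thesis by blast
qed

definition has_trace ::
 "('k::field => 'v::ab_group_add => 'v) => 'v set => ('v => 'v) => 'k => bool" where
 "has_trace s X T t \<longleftrightarrow> (\<exists>(n::nat) phi v.
   (\<forall>i<n. linear_on s (*) X (phi i) & v i \<in> X) &
   (\<forall>x\<in>X. T x = (\<Sum>i<n. s (phi i x) (v i))) & t = (\<Sum>i<n. phi i (v i)))"

lemma has_traceI:
 assumes "finite I" "!!i. i \<in> I ==> linear_on s (*) X (phi i)" "!!i. i \<in> I ==> v i \<in> X"
  "!!x. x \<in> X ==> T x = (\<Sum>i\<in>I. s (phi i x) (v i))" "t = (\<Sum>i\<in>I. phi i (v i))"
 shows "has_trace s X T t"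
proof -
 obtain h where h: "bij_betw h {..<card I} I"
  using ex_bij_betw_nat_finite[OF assms(1)] by (auto simp: atLeast0LessThan)
 have *: "(\<Sum>i\<in>I. s (phi i x) (v i)) = (\<Sum>i<card I. s (phi (h i) x) (v (h i)))" for x
  using sum.reindex_bij_betw[OF h, of "%i. s (phi i x) (v i)"] by simp
 have **: "(\<Sum>i\<in>I. phi i (v i)) = (\<Sum>i<card I. phi (h i) (v (h i)))"
  using sum.reindex_bij_betw[OF h, of "%i. phi i (v i)"] by simp
 have "h i \<in> I" if "i < card I" for i using h that by (auto simp: bij_betw_def)
 then show ?thesis
  unfolding has_trace_def using assms
  by (intro exI[of _ "card I"] exI[of _ "%i. phi (h i)"] exI[of _ "%i. v (h i)"]) (auto simp: * **)
qed

lemma has_traceE: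
 assumes "has_trace s X T t"
 obtains n :: nat and phi v where "!!i. i < n ==> linear_on s (*) X (phi i)" "!!i. i < n ==> v i \<in> X"
  "!!x. x \<in> X ==> T x = (\<Sum>i<n. s (phi i x) (v i))" "t = (\<Sum>i<n. phi i (v i))"
 using assms unfolding has_trace_def by blast

text \<open>
  Expanding all the vectors of two presentations in a common finite basis turns both values into the
  sum of the diagonal coefficients of the operator in that basis.
\<close>

lemma has_trace_unique:
 assumes X: "subsp s X" and "has_trace s X T t" "has_trace s X T t'"
 shows "t = t'"
proof -
 interpret vector_space s using X by blast
 obtain n phi v where 1: "!!i. i < n ==> linear_on s (*) X (phi i)" "!!i. i < (n::nat) ==> v i \<in> X"
  "!!x. x \<in> X ==> T x = (\<Sum>i<n. s (phi i x) (v i))" "t = (\<Sum>i<n. phi i (v i))"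
  using assms(2) by (rule has_traceE) blast
 obtain m psi w where 2: "!!i. i < m ==> linear_on s (*) X (psi i)" "!!i. i < (m::nat) ==> w i \<in> X"
  "!!x. x \<in> X ==> T x = (\<Sum>i<m. s (psi i x) (w i))" "t' = (\<Sum>i<m. psi i (w i))"
  using assms(3) by (rule has_traceE) blast
 obtain B where B: "B \<subseteq> v ` {..<n} \<union> w ` {..<m}" "independent B" "v ` {..<n} \<union> w ` {..<m} \<subseteq> span B"
  by (rule maximal_independent_subset)
 have fin: "finite B" using B(1) finite_subset by blast
 have BX: "b \<in> X" if "b \<in> B" for b using B(1) that 1(2) 2(2) by auto
 have key: "(\<Sum>i<k. theta i (u i)) = (\<Sum>b\<in>B. representation B (T b) b)"
  if "!!i. i < k ==> linear_on s (*) X (theta i)" "!!i. i < k ==> u i \<in> span B"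
   "!!x. x \<in> X ==> T x = (\<Sum>i<k. s (theta i x) (u i))" for k :: nat and theta u
 proof -
  have "(\<Sum>i<k. theta i (u i)) = (\<Sum>i<k. \<Sum>b\<in>B. representation B (u i) b * theta i b)"
  proof (rule sum.cong[OF refl])
   fix i assume i: "i \<in> {..<k}"
   have "u i = (\<Sum>b\<in>B. s (representation B (u i) b) b)"
    using sum_representation_eq[OF B(2) that(2) fin subset_refl] i by simp
   then show "theta i (u i) = (\<Sum>b\<in>B. representation B (u i) b * theta i b)"
    using linear_on_lincomb[OF X vector_space_mult that(1), of i B "%b. b" "representation B (u i)"] i BX
    by simp
  qed
  also have "... = (\<Sum>b\<in>B. \<Sum>i<k. representation B (u i) b * theta i b)" by (rule sum.swap)
  also have "... = (\<Sum>b\<in>B. representation B (T b) b)"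
  proof (rule sum.cong[OF refl])
   fix b assume b: "b \<in> B"
   have "representation B (T b) b = (\<Sum>i<k. representation B (s (theta i b) (u i)) b)"
    unfolding that(3)[OF BX[OF b]] using that(2)
    by (subst representation_sum[OF B(2)]) (auto simp: span_scale)
   also have "... = (\<Sum>i<k. representation B (u i) b * theta i b)"
    using that(2) by (intro sum.cong refl) (simp add: representation_scale[OF B(2)] mult.commute)
   finally show "(\<Sum>i<k. representation B (u i) b * theta i b) = representation B (T b) b" by simp
  qed
  finally show ?thesis .
 qed
 have "t = (\<Sum>b\<in>B. representation B (T b) b)" unfolding 1(4) by (rule key) (use 1 B in auto)
 moreover have "t' = (\<Sum>b\<in>B. representation B (T b) b)" unfolding 2(4) by (rule key) (use 2 B in auto)
 ultimately show ?thesis by simp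
qed

lemma has_trace_cong:
 assumes "has_trace s X T t" "!!x. x \<in> X ==> T' x = T x"
 shows "has_trace s X T' t"
 using assms unfolding has_trace_def by metis

lemma has_trace_0:
 assumes "!!x. x \<in> X ==> T x = 0"
 shows "has_trace s X T 0"
 using assms by (intro has_traceI[of "{}"]) auto

lemma has_trace_add:
 assumes "has_trace s X T t" "has_trace s X T' t'"
 shows "has_trace s X (%x. T x + T' x) (t + t')"
proof -
 obtain n phi v where 1: "!!i. i < n ==> linear_on s (*) X (phi i)" "!!i. i < (n::nat) ==> v i \<in> X"
  "!!x. x \<in> X ==> T x = (\<Sum>i<n. s (phi i x) (v i))" "t = (\<Sum>i<n. phi i (v i))"
  using assms(1) by (rule has_traceE) blast
 obtain m psi w where 2: "!!i. i < m ==> linear_on s (*) X (psi i)" "!!i. i < (m::nat) ==> w i \<in> X"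
  "!!x. x \<in> X ==> T' x = (\<Sum>i<m. s (psi i x) (w i))" "t' = (\<Sum>i<m. psi i (w i))"
  using assms(2) by (rule has_traceE) blast
 show ?thesis
  by (rule has_traceI[of "{..<n} <+> {..<m}" s X "case_sum phi psi" "case_sum v w"])
   (use 1 2 in \<open>auto simp: sum.Plus\<close>)
qed

lemma has_trace_sum:
 assumes "finite I" "!!i. i \<in> I ==> has_trace s X (T i) (t i)"
 shows "has_trace s X (%x. \<Sum>i\<in>I. T i x) (\<Sum>i\<in>I. t i)"
 using assms by (induction I) (auto intro: has_trace_0 has_trace_add)

lemma has_trace_scale:
 assumes s: "vector_space s" and "has_trace s X T t"
 shows "has_trace s X (%x. s c (T x)) (c * t)"
proof -
 interpret vector_space s by fact
 obtain n phi v where *: "!!i. i < n ==> linear_on s (*) X (phi i)" "!!i. i < (n::nat) ==> v i \<in> X"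
  "!!x. x \<in> X ==> T x = (\<Sum>i<n. s (phi i x) (v i))" "t = (\<Sum>i<n. phi i (v i))"
  using assms(2) by (rule has_traceE) blast
 show ?thesis
  by (rule has_traceI[of "{..<n}" s X "%i x. c * phi i x" v])
   (use * in \<open>auto simp: linear_on_def algebra_simps scale_sum_right sum_distrib_left\<close>)
qed

lemma has_trace_retract:
 assumes X: "subsp s X" and Y: "Y \<subseteq> X" and e: "e \<in> lin_maps s X s Y" and eY: "!!y. y \<in> Y ==> e y = y"
  and T: "!!y. y \<in> Y ==> T y \<in> Y" and tr: "has_trace s X (%x. T (e x)) t"
 shows "has_trace s Y T t"
proof -
 interpret vector_space s using X by blast
 obtain n phi v where *: "!!i. i < n ==> linear_on s (*) X (phi i)" "!!i. i < (n::nat) ==> v i \<in> X"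
  "!!x. x \<in> X ==> T (e x) = (\<Sum>i<n. s (phi i x) (v i))" "t = (\<Sum>i<n. phi i (v i))"
  using tr by (rule has_traceE) blast
 note eD = lin_mapsD[OF e]
 have e': "e \<in> lin_maps s X s X" using e Y by (auto simp: lin_maps_def)
 have "has_trace s X (%x. T (e x)) (\<Sum>i<n. phi i (e (v i)))"
 proof (rule has_traceI[of "{..<n}" s X "%i x. phi i (e x)" v])
  show "T (e x) = (\<Sum>i<n. s (phi i (e x)) (v i))" if "x \<in> X" for x
   using *(3)[of "e x"] eY[of "e x"] eD(2)[OF that] Y by auto
 qed (use * in \<open>auto intro: linear_on_comp[OF e']\<close>)
 then have t: "t = (\<Sum>i<n. phi i (e (v i)))" using has_trace_unique[OF X tr] by blast
 show ?thesis
 proof (rule has_traceI[of "{..<n}" s Y phi "%i. e (v i)"])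
  show "linear_on s (*) Y (phi i)" if "i \<in> {..<n}" for i
   using *(1)[of i] that Y unfolding linear_on_def by blast
  fix y assume y: "y \<in> Y"
  have "T y = e (T (e y))" using y eY T by simp
  also have "T (e y) = (\<Sum>i<n. s (phi i y) (v i))" using * y Y by blast
  also have "e ... = (\<Sum>i<n. s (phi i y) (e (v i)))"
   by (rule linear_on_lincomb[OF X vector_space_axioms eD(1)]) (use * in auto)
  finally show "T y = (\<Sum>i<n. s (phi i y) (e (v i)))" .
 qed (use t * eD in auto)
qed

lemma has_trace_basis:
 assumes X: "subsp s X" and "T \<in> lin_maps s X s X" and "finite B" "B \<subseteq> X"
  "!!b. b \<in> B ==> linear_on s (*) X (beta b)" "!!x. x \<in> X ==> x = (\<Sum>b\<in>B. s (beta b x) b)"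
 shows "has_trace s X T (\<Sum>b\<in>B. beta b (T b))"
proof (rule has_traceI[of B s X "%b x. beta b (T x)" "%b. b"])
 show "T x = (\<Sum>i\<in>B. s (beta i (T x)) i)" if "x \<in> X" for x
  using lin_mapsD(2)[OF assms(2) that] by (rule assms(6))
qed (use assms in \<open>auto intro: linear_on_comp[OF assms(2)]\<close>)

text \<open>
  The quotient by the kernel of an idempotent \<open>e\<close> is the image of \<open>e\<close>; coordinates in a basis of the
  quotient give a presentation of \<open>e \<circ> D\<close>.
\<close>

lemma quotient_trace_idempotent:
 assumes X: "subsp s X" and e: "e \<in> lin_maps s X s X" and ee: "!!x. x \<in> X ==> e (e x) = e x"
  and U: "U = {x\<in>X. e x = 0}" and D: "D \<in> lin_maps s X s X" and DU: "!!x. x \<in> U ==> D x \<in> U"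
  and fin: "has_trace s X (%x. x) t0" and tr: "has_trace s X (%x. e (D x)) t"
 shows "quotient_trace s X U D = t"
proof -
 interpret vector_space s using X by blast
 note vs = vector_space_axioms
 note eD = lin_mapsD[OF e] and DD = lin_mapsD[OF D]
 have UX: "subsp s U"
  using X vs unfolding U subspace_def
  by (auto simp: linear_on_0[OF X vs eD(1)] eD(1)[unfolded linear_on_def])
 have eU: "x - e x \<in> U" if "x \<in> X" for x
  using that by (auto simp: U eD ee linear_on_diff[OF X vs eD(1)] subsp_diff[OF X])
 obtain n phi v where *: "!!i. i < n ==> linear_on s (*) X (phi i)" "!!i. i < (n::nat) ==> v i \<in> X"
  "!!x. x \<in> X ==> x = (\<Sum>i<n. s (phi i x) (v i))"
  using fin by (rule has_traceE) blast
 obtain B where B: "B \<subseteq> (%i. e (v i)) ` {..<n}" "independent B" "(%i. e (v i)) ` {..<n} \<subseteq> span B"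
  by (rule maximal_independent_subset)
 have finB: "finite B" using B(1) finite_subset by blast
 have BX: "b \<in> X" "e b = b" if "b \<in> B" for b using B(1) that * eD ee by auto
 have eB: "e x \<in> span B" if "x \<in> X" for x
 proof -
  have "e x = e (\<Sum>i<n. s (phi i x) (v i))" using *(3)[OF that] by simp
  also have "... = (\<Sum>i<n. s (phi i x) (e (v i)))"
   by (rule linear_on_lincomb[OF X vs eD(1)]) (use * in auto)
  finally show ?thesis using B(3) by (auto intro!: span_sum span_scale)
 qed
 have eBs: "e x = (\<Sum>b\<in>B. s (representation B (e x) b) b)" if "x \<in> X" for x
  using sum_representation_eq[OF B(2) eB[OF that] finB subset_refl] by simp
 have basis: "quotient_basis s X U B"
  unfolding quotient_basis_def
 proof (intro conjI ballI allI impI)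
  show "\<exists>c. x - (\<Sum>b\<in>B. s (c b) b) \<in> U" if "x \<in> X" for x
   using eU[OF that] eBs[OF that] by (intro exI[of _ "%b. representation B (e x) b"]) simp
  fix c b assume c: "(\<Sum>b\<in>B. s (c b) b) \<in> U" and b: "b \<in> B"
  have "e (\<Sum>b\<in>B. s (c b) b) = (\<Sum>b\<in>B. s (c b) (e b))"
   by (rule linear_on_lincomb[OF X vs eD(1)]) (use BX in auto)
  then have "(\<Sum>b\<in>B. s (c b) b) = 0" using c BX by (simp add: U)
  then show "c b = 0" using B(2) finB b by (auto simp: dependent_finite)
 qed (use finB BX in auto)
 have ex: "D b - (\<Sum>b'\<in>B. s (representation B (e (D b)) b') b') \<in> U" if "b \<in> B" for b
  using eU[of "D b"] eBs[of "D b"] DD BX that by simp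
 have uniq: "t' = t" if C: "quotient_basis s X U C"
  and A: "\<forall>b\<in>C. D b - (\<Sum>b'\<in>C. s (A b' b) b') \<in> U" and t': "t' = (\<Sum>b\<in>C. A b b)" for C A t'
 proof -
  have finC: "finite C" and CX: "!!b. b \<in> C ==> b \<in> X"
   and C1: "\<forall>x\<in>X. \<exists>c. x - (\<Sum>b\<in>C. s (c b) b) \<in> U"
   and C2: "!!c. (\<Sum>b\<in>C. s (c b) b) \<in> U ==> \<forall>b\<in>C. c b = 0"
   using C unfolding quotient_basis_def by blast+
  obtain c where c: "!!x. x \<in> X ==> x - (\<Sum>b\<in>C. s (c x b) b) \<in> U" using C1 by metis
  have cu: "c x b = d b" if "x - (\<Sum>b\<in>C. s (d b) b) \<in> U" "x \<in> X" "b \<in> C" for x d b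
  proof -
   have "(x - (\<Sum>b\<in>C. s (d b) b)) - (x - (\<Sum>b\<in>C. s (c x b) b)) \<in> U"
    by (rule subsp_diff[OF UX that(1) c[OF that(2)]])
   also have "(x - (\<Sum>b\<in>C. s (d b) b)) - (x - (\<Sum>b\<in>C. s (c x b) b)) = (\<Sum>b\<in>C. s (c x b - d b) b)"
    by (simp add: scale_left_diff_distrib sum_subtractf)
   finally show ?thesis using C2 that by fastforce
  qed
  have lin: "linear_on s (*) X (%x. c x b)" if b: "b \<in> C" for b
   unfolding linear_on_def
  proof (intro conjI ballI allI)
   fix x y assume xy: "x \<in> X" "y \<in> X"
   have "(x - (\<Sum>b\<in>C. s (c x b) b)) + (y - (\<Sum>b\<in>C. s (c y b) b)) \<in> U"
    by (rule subsp_add[OF UX c[OF xy(1)] c[OF xy(2)]])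
   then have "x + y - (\<Sum>b\<in>C. s (c x b + c y b) b) \<in> U"
    by (simp add: scale_left_distrib sum.distrib algebra_simps)
   then show "c (x + y) b = c x b + c y b" using cu[of "x + y" "%b. c x b + c y b" b] xy b subsp_add[OF X] by simp
  next
   fix a x assume x: "x \<in> X"
   have "s a (x - (\<Sum>b\<in>C. s (c x b) b)) \<in> U"
    by (rule subsp_scale[OF UX c[OF x]])
   then have "s a x - (\<Sum>b\<in>C. s (a * c x b) b) \<in> U"
    by (simp add: scale_right_diff_distrib scale_sum_right)
   then show "c (s a x) b = a * c x b" using cu[of "s a x" "%b. a * c x b" b] x b subsp_scale[OF X] by simp
  qed
  have "has_trace s X (%x. e (D x)) (\<Sum>b\<in>C. c (e (D b)) b)"
  proof (rule has_traceI[of C s X "%b x. c x b" "%b. e (D b)"])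
   fix x assume x: "x \<in> X"
   let ?y = "\<Sum>b\<in>C. s (c x b) b"
   have y: "?y \<in> X" using CX by (auto intro!: subsp_sum[OF X] subsp_scale[OF X])
   have "D (x - ?y) \<in> U" using c[OF x] DU by blast
   then have "e (D x - D ?y) = 0" using linear_on_diff[OF X vs DD(1) x y] by (simp add: U)
   then have "e (D x) = e (D ?y)" using linear_on_diff[OF X vs eD(1)] DD x y by simp
   also have "D ?y = (\<Sum>b\<in>C. s (c x b) (D b))"
    by (rule linear_on_lincomb[OF X vs DD(1)]) (use CX in auto)
   also have "e ... = (\<Sum>b\<in>C. s (c x b) (e (D b)))"
    by (rule linear_on_lincomb[OF X vs eD(1)]) (use CX DD in auto)
   finally show "e (D x) = (\<Sum>b\<in>C. s (c x b) (e (D b)))" .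
  qed (use finC lin CX DD eD in auto)
  then have "t = (\<Sum>b\<in>C. c (e (D b)) b)" using has_trace_unique[OF X tr] by blast
  also have "... = (\<Sum>b\<in>C. A b b)"
  proof (rule sum.cong[OF refl])
   fix b assume b: "b \<in> C"
   let ?z = "\<Sum>b'\<in>C. s (A b' b) b'"
   have "(D b - ?z) - (D b - e (D b)) \<in> U"
    using A b eU[of "D b"] CX DD by (intro subsp_diff[OF UX, of "D b - ?z"]) auto
   then have "e (D b) - ?z \<in> U" by simp
   then show "c (e (D b)) b = A b b" by (rule cu) (use b CX DD eD in auto)
  qed
  finally show ?thesis using t' by simp
 qed
 let ?A = "%b' b. representation B (e (D b)) b'"
 have At: "(\<Sum>b\<in>B. ?A b b) = t"
  using uniq[OF basis, of ?A] ex by blast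
 show ?thesis
  unfolding quotient_trace_def
 proof (rule the_equality)
  show "\<exists>B A. quotient_basis s X U B &
    (\<forall>b\<in>B. D b - (\<Sum>b'\<in>B. s (A b' b) b') \<in> U) & t = (\<Sum>b\<in>B. A b b)"
   using basis ex At
   by (intro exI[of _ B] exI[of _ ?A]) simp
 next
  fix t' assume "\<exists>B A. quotient_basis s X U B &
    (\<forall>b\<in>B. D b - (\<Sum>b'\<in>B. s (A b' b) b') \<in> U) & t' = (\<Sum>b\<in>B. A b b)"
  then obtain C A where "quotient_basis s X U C"
   "\<forall>b\<in>C. D b - (\<Sum>b'\<in>C. s (A b' b) b') \<in> U" "t' = (\<Sum>b\<in>C. A b b)"
   by (elim exE conjE)
  then show "t' = t" by (rule uniq)
 qed
qed

lemma averaging_lin_maps: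
 assumes X: "subsp s X" and act: "!!g. g \<in> G ==> act g \<in> lin_maps s X s X"
 shows "(%x. s c (\<Sum>g\<in>G. act g x)) \<in> lin_maps s X s X"
 using act by (intro lin_maps_scale[OF X] lin_maps_sum[OF X])

lemma quotient_trace_coinvariants:
 assumes X: "subsp s X" and G: "finite G" "of_nat (card G) ~= (0::'k::field)"
  and act: "!!g. g \<in> G ==> act g \<in> lin_maps s X s X"
  and mult: "!!g x. g \<in> G ==> x \<in> X ==> (\<Sum>h\<in>G. act h (act g x)) = (\<Sum>h\<in>G. act h x)"
  and D: "D \<in> lin_maps s X s X" and comm: "!!g x. g \<in> G ==> x \<in> X ==> act g (D x) = D (act g x)"
  and fin: "has_trace s X (%x. x) t0"
  and tr: "!!g. g \<in> G ==> has_trace s X (%x. act g (D x)) (chi g)"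
  and U: "U = module.span s {act g x - x |g x. g \<in> G & x \<in> X}"
 shows "quotient_trace s X U D = (1 / of_nat (card G)) * (\<Sum>g\<in>G. chi g :: 'k)"
proof -
 interpret vector_space s using X by blast
 note vs = vector_space_axioms
 let ?c = "1 / of_nat (card G) :: 'k"
 define e where "e = (%x. s ?c (\<Sum>g\<in>G. act g x))"
 have e: "e \<in> lin_maps s X s X" unfolding e_def by (rule averaging_lin_maps[OF X act])
 note eD = lin_mapsD[OF e] and DD = lin_mapsD[OF D]
 have eact: "e (act g x) = e x" if "g \<in> G" "x \<in> X" for g x
  using mult that by (simp add: e_def)
 have actX: "act g x \<in> X" if "g \<in> G" "x \<in> X" for g x using lin_mapsD(2)[OF act] that by blast
 have const: "s ?c (\<Sum>g\<in>G. y) = y" for y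
  using G by (simp add: sum_constant_scale scale_scale)
 have ee: "e (e x) = e x" if "x \<in> X" for x
 proof -
  have "e (e x) = s ?c (e (\<Sum>g\<in>G. act g x))"
   using eD(1) that actX e_def by (simp add: linear_on_def subsp_sum[OF X])
  also have "e (\<Sum>g\<in>G. act g x) = (\<Sum>g\<in>G. e (act g x))"
   by (rule linear_on_sum[OF X vs eD(1)]) (use actX that in auto)
  also have "... = (\<Sum>g\<in>G. e x)" using eact that by simp
  finally show ?thesis by (simp only: const)
 qed
 have Ue: "U = {x\<in>X. e x = 0}"
 proof (intro equalityI subsetI)
  have "module.span s {act g x - x |g x. g \<in> G & x \<in> X} \<subseteq> {x\<in>X. e x = 0}"
  proof (rule span_minimal)
   show "{act g x - x |g x. g \<in> G & x \<in> X} \<subseteq> {x \<in> X. e x = 0}"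
    using actX by (auto simp: subsp_diff[OF X] linear_on_diff[OF X vs eD(1)] eact)
   show "subspace {x \<in> X. e x = 0}"
    using X unfolding subspace_def
    by (auto simp: linear_on_0[OF X vs eD(1)] eD(1)[unfolded linear_on_def])
  qed
  then show "x \<in> {x\<in>X. e x = 0}" if "x \<in> U" for x using that unfolding U by blast
 next
  fix x assume x: "x \<in> {x\<in>X. e x = 0}"
  have "s (- ?c) (\<Sum>g\<in>G. act g x - x) \<in> U"
   unfolding U using x by (intro span_scale span_sum span_base) blast
  also have "s (- ?c) (\<Sum>g\<in>G. act g x - x) = s ?c (\<Sum>g\<in>G. x) - e x"
   by (simp add: e_def sum_subtractf scale_right_diff_distrib)
  also have "... = x" using x by (simp only: const) simp
  finally show "x \<in> U" .
 qed
 have eDD: "e (D x) = D (e x)" if "x \<in> X" for x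
 proof -
  have "D (e x) = s ?c (D (\<Sum>g\<in>G. act g x))"
   unfolding e_def using DD(1) that actX by (simp add: linear_on_def subsp_sum[OF X])
  also have "D (\<Sum>g\<in>G. act g x) = (\<Sum>g\<in>G. D (act g x))"
   by (rule linear_on_sum[OF X vs DD(1)]) (use actX that in auto)
  also have "... = (\<Sum>g\<in>G. act g (D x))" using comm that by simp
  finally show ?thesis by (simp add: e_def)
 qed
 have "has_trace s X (%x. e (D x)) (?c * (\<Sum>g\<in>G. chi g))"
  unfolding e_def by (intro has_trace_scale[OF vs] has_trace_sum G tr)
 moreover have "D x \<in> U" if "x \<in> U" for x
  using that eDD DD linear_on_0[OF X vs DD(1)] unfolding Ue by auto
 ultimately show ?thesis by (intro quotient_trace_idempotent[OF X e ee Ue D _ fin]) auto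
qed

lemma has_trace_invariants:
 assumes X: "subsp s X" and G: "finite G" "of_nat (card G) ~= (0::'k::field)"
  and act: "!!g. g \<in> G ==> act g \<in> lin_maps s X s X"
  and mult: "!!g x. g \<in> G ==> x \<in> X ==> (\<Sum>h\<in>G. act g (act h x)) = (\<Sum>h\<in>G. act h x)"
  and T: "T \<in> lin_maps s X s X" and comm: "!!g x. g \<in> G ==> x \<in> X ==> act g (T x) = T (act g x)"
  and tr: "!!g. g \<in> G ==> has_trace s X (%x. T (act g x)) (chi g)"
 shows "has_trace s {x\<in>X. \<forall>g\<in>G. act g x = x} T ((1 / of_nat (card G)) * (\<Sum>g\<in>G. chi g :: 'k))"
proof -
 interpret vector_space s using X by blast
 note vs = vector_space_axioms
 let ?c = "1 / of_nat (card G) :: 'k"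
 define e where "e = (%x. s ?c (\<Sum>g\<in>G. act g x))"
 have e: "e \<in> lin_maps s X s X" unfolding e_def by (rule averaging_lin_maps[OF X act])
 note eD = lin_mapsD[OF e] and TD = lin_mapsD[OF T]
 have actX: "act g x \<in> X" if "g \<in> G" "x \<in> X" for g x using lin_mapsD(2)[OF act] that by blast
 have inv: "act g (e x) = e x" if "g \<in> G" "x \<in> X" for g x
 proof -
  note gD = lin_mapsD(1)[OF act[OF that(1)]]
  have "act g (e x) = s ?c (act g (\<Sum>h\<in>G. act h x))"
   unfolding e_def using gD that actX by (simp add: linear_on_def subsp_sum[OF X])
  also have "act g (\<Sum>h\<in>G. act h x) = (\<Sum>h\<in>G. act g (act h x))"
   by (rule linear_on_sum[OF X vs gD]) (use actX that in auto)
  finally show ?thesis using mult that by (simp add: e_def)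
 qed
 have fixed: "e x = x" if "x \<in> X" "\<forall>g\<in>G. act g x = x" for x
  using that G by (simp add: e_def sum_constant_scale scale_scale)
 show ?thesis
 proof (rule has_trace_retract[OF X, where e = e])
  show "e \<in> lin_maps s X s {x \<in> X. \<forall>g\<in>G. act g x = x}"
   using eD inv by (auto simp: lin_maps_def)
  have "T (e x) = s ?c (\<Sum>g\<in>G. T (act g x))" if "x \<in> X" for x
  proof -
   have "T (e x) = s ?c (T (\<Sum>g\<in>G. act g x))"
    unfolding e_def using TD(1) that actX by (simp add: linear_on_def subsp_sum[OF X])
   also have "T (\<Sum>g\<in>G. act g x) = (\<Sum>g\<in>G. T (act g x))"
    by (rule linear_on_sum[OF X vs TD(1)]) (use actX that in auto)
   finally show ?thesis .
  qed
  moreover have "has_trace s X (%x. s ?c (\<Sum>g\<in>G. T (act g x))) (?c * (\<Sum>g\<in>G. chi g))"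
   by (intro has_trace_scale[OF vs] has_trace_sum G tr)
  ultimately show "has_trace s X (%x. T (e x)) (?c * (\<Sum>g\<in>G. chi g))"
   by (rule has_trace_cong[rotated])
 qed (use TD comm fixed in auto)
qed

section \<open>Operators on tensor products and their traces\<close>

lemma sum_PiE_insert:
 assumes "x \<notin> S"
 shows "(\<Sum>f\<in>Pi\<^sub>E (insert x S) T. F f) = (\<Sum>y\<in>T x. \<Sum>f\<in>Pi\<^sub>E S T. F (f(x := y)))"
 unfolding PiE_insert_eq sum.cartesian_product
 by (subst sum.reindex[OF inj_combinator[OF assms]]) (auto intro!: sum.cong)

lemma sum_apply: "(\<Sum>i\<in>I. f i) x = (\<Sum>i\<in>I. f i x)"
 by (induction I rule: infinite_finite_induct) auto

lemma subsp_tensor2: "subsp fscale (tensor2 s A t B)"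
 unfolding tensor2_def
 using vector_space_fscale module.subspace_span[OF vs_module[OF vector_space_fscale]] by blast

lemma pure2_in: "x \<in> A ==> y \<in> B ==> pure2 s A t B x y \<in> tensor2 s A t B"
 unfolding tensor2_def by (intro module.span_base[OF vs_module[OF vector_space_fscale]]) blast

lemma bilinear_on_comp:
 assumes "F \<in> lin_maps s0 A0 s A" "G \<in> lin_maps t0 B0 t B" "bilinear_on s A t B phi"
 shows "bilinear_on s0 A0 t0 B0 (%x y. phi (F x) (G y))"
 using assms unfolding bilinear_on_def lin_maps_def linear_on_def by auto

lemma bilinear_on_mult:
 assumes "linear_on s (*) A phi" "linear_on t (*) B psi"
 shows "bilinear_on s A t B (%x y. phi x * psi y)"
 using assms unfolding bilinear_on_def linear_on_def by (auto simp: algebra_simps)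

lemma map_tensor2_pure:
 assumes "F \<in> lin_maps s0 A0 s A" "G \<in> lin_maps t0 B0 t B"
 shows "map_tensor2 s A t B F G (pure2 s0 A0 t0 B0 x y) = pure2 s A t B (F x) (G y)"
 by (rule ext) (simp add: map_tensor2_def pure2_def bilinear_on_comp[OF assms])

lemma linear_on_map_tensor2: "linear_on fscale fscale X (map_tensor2 s A t B F G)"
 by (auto simp: linear_on_def map_tensor2_def pscale_def fun_eq_iff)

lemma linear_on_eval: "linear_on fscale (*) X (%zeta. zeta phi)"
 by (auto simp: linear_on_def pscale_def)

lemma tensor2_linear_eq:
 assumes "vector_space r" "linear_on fscale r (tensor2 s A t B) f" "linear_on fscale r (tensor2 s A t B) g"
  "!!x y. x \<in> A ==> y \<in> B ==> f (pure2 s A t B x y) = g (pure2 s A t B x y)"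
  "zeta \<in> tensor2 s A t B"
 shows "f zeta = g zeta"
 using lin_maps_eq_on_span[OF vector_space_fscale assms(1-3)[unfolded tensor2_def] _
   assms(5)[unfolded tensor2_def]] assms(4) by blast

lemma map_tensor2_lin_maps:
 assumes "F \<in> lin_maps s0 A0 s A" "G \<in> lin_maps t0 B0 t B"
 shows "map_tensor2 s A t B F G \<in> lin_maps fscale (tensor2 s0 A0 t0 B0) fscale (tensor2 s A t B)"
proof (rule lin_mapsI[OF linear_on_map_tensor2])
 fix zeta assume z: "zeta \<in> tensor2 s0 A0 t0 B0"
 have "tensor2 s0 A0 t0 B0 \<subseteq> {zeta. map_tensor2 s A t B F G zeta \<in> tensor2 s A t B}"
  unfolding tensor2_def[of s0]
 proof (rule module.span_minimal[OF vs_module[OF vector_space_fscale]])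
  show "{pure2 s0 A0 t0 B0 x y |x y. x \<in> A0 & y \<in> B0} \<subseteq> {zeta. map_tensor2 s A t B F G zeta \<in> tensor2 s A t B}"
   using lin_mapsD(2)[OF assms(1)] lin_mapsD(2)[OF assms(2)]
   by (auto simp: map_tensor2_pure[OF assms] pure2_in)
  have "map_tensor2 s A t B F G (zeta + xi) = map_tensor2 s A t B F G zeta + map_tensor2 s A t B F G xi"
   "map_tensor2 s A t B F G (fscale c zeta) = fscale c (map_tensor2 s A t B F G zeta)" for zeta xi c
   using linear_on_map_tensor2[of UNIV s A t B F G] by (auto simp: linear_on_def)
  moreover have "map_tensor2 s A t B F G 0 = 0" by (auto simp: map_tensor2_def fun_eq_iff)
  ultimately show "module.subspace fscale {zeta. map_tensor2 s A t B F G zeta \<in> tensor2 s A t B}"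
   unfolding module.subspace_def[OF vs_module[OF vector_space_fscale]]
   by (auto simp: subsp_add[OF subsp_tensor2] subsp_scale[OF subsp_tensor2] subsp_0[OF subsp_tensor2])
 qed
 with z show "map_tensor2 s A t B F G zeta \<in> tensor2 s A t B" by blast
qed

lemma map_tensor2_comp:
 assumes "F' \<in> lin_maps s A s' A'" "G' \<in> lin_maps t B t' B'"
 shows "map_tensor2 s' A' t' B' F' G' (map_tensor2 s A t B F G zeta) =
  map_tensor2 s' A' t' B' (%x. F' (F x)) (%y. G' (G y)) zeta"
 by (rule ext) (simp add: map_tensor2_def bilinear_on_comp[OF assms])

lemma map_tensor2_cong:
 assumes F: "F \<in> lin_maps s0 A0 s A" "G \<in> lin_maps t0 B0 t B"
  and F': "F' \<in> lin_maps s0 A0 s A" "G' \<in> lin_maps t0 B0 t B"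
  and eq: "!!x. x \<in> A0 ==> F x = F' x" "!!y. y \<in> B0 ==> G y = G' y"
  and z: "zeta \<in> tensor2 s0 A0 t0 B0"
 shows "map_tensor2 s A t B F G zeta = map_tensor2 s A t B F' G' zeta"
 by (rule tensor2_linear_eq[OF vector_space_fscale linear_on_map_tensor2 linear_on_map_tensor2 _ z])
  (simp add: map_tensor2_pure[OF F] map_tensor2_pure[OF F'] eq)

lemma map_tensor2_id:
 assumes "zeta \<in> tensor2 s A t B"
 shows "map_tensor2 s A t B (%x. x) (%y. y) zeta = zeta"
 using tensor2_linear_eq[OF vector_space_fscale linear_on_map_tensor2 lin_mapsD(1)[OF lin_maps_id(2)] _ assms]
  map_tensor2_pure[OF lin_maps_id(2) lin_maps_id(2)] by fastforce

lemma has_trace_tensor2: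
 assumes A: "subsp s A" and B: "subsp t B"
  and F: "F \<in> lin_maps s A s A" "has_trace s A F a" and G: "G \<in> lin_maps t B t B" "has_trace t B G b"
 shows "has_trace fscale (tensor2 s A t B) (map_tensor2 s A t B F G) (a * b)"
proof -
 obtain n phi v where 1: "!!i. i < n ==> linear_on s (*) A (phi i)" "!!i. i < (n::nat) ==> v i \<in> A"
  "!!x. x \<in> A ==> F x = (\<Sum>i<n. s (phi i x) (v i))" "a = (\<Sum>i<n. phi i (v i))"
  using F(2) by (rule has_traceE) blast
 obtain m psi w where 2: "!!i. i < m ==> linear_on t (*) B (psi i)" "!!i. i < (m::nat) ==> w i \<in> B"
  "!!x. x \<in> B ==> G x = (\<Sum>i<m. t (psi i x) (w i))" "b = (\<Sum>i<m. psi i (w i))"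
  using G(2) by (rule has_traceE) blast
 let ?theta = "%(i, j) zeta. zeta (%x y. phi i x * psi j y)"
 let ?I = "{..<n} \<times> {..<m}"
 let ?p = "%(i, j). pure2 s A t B (v i) (w j)"
 have bil: "bilinear_on s A t B (%x y. phi i x * psi j y)" if "i < n" "j < m" for i j
  using that 1 2 by (intro bilinear_on_mult) auto
 show ?thesis
 proof (rule has_traceI[of ?I fscale _ ?theta ?p])
  fix zeta assume z: "zeta \<in> tensor2 s A t B"
  show "map_tensor2 s A t B F G zeta = (\<Sum>i\<in>?I. fscale (?theta i zeta) (?p i))"
  proof (rule tensor2_linear_eq[OF vector_space_fscale linear_on_map_tensor2 _ _ z])
   show "linear_on fscale fscale (tensor2 s A t B) (%zeta. \<Sum>i\<in>?I. fscale (?theta i zeta) (?p i))"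
    by (auto simp: linear_on_def fun_eq_iff sum_apply pscale_def algebra_simps sum.distrib sum_distrib_left
      split_def intro!: sum.cong)
   fix x y assume xy: "x \<in> A" "y \<in> B"
   show "map_tensor2 s A t B F G (pure2 s A t B x y) = (\<Sum>i\<in>?I. fscale (?theta i (pure2 s A t B x y)) (?p i))"
   proof (rule ext)
    fix f :: "'b => 'c => 'a"
    show "map_tensor2 s A t B F G (pure2 s A t B x y) f =
     (\<Sum>i\<in>?I. fscale (?theta i (pure2 s A t B x y)) (?p i)) f"
    proof (cases "bilinear_on s A t B f")
     case False
     then show ?thesis by (simp add: map_tensor2_def sum_apply pscale_def pure2_def split_def)
    next
     case True
     have "f (F x) (G y) = f (\<Sum>i<n. s (phi i x) (v i)) (\<Sum>j<m. t (psi j y) (w j))"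
      using 1 2 xy by simp
     also have "... = (\<Sum>i<n. phi i x * f (v i) (\<Sum>j<m. t (psi j y) (w j)))"
      by (rule linear_on_lincomb[OF A vector_space_mult])
       (use True 1 2 in \<open>auto simp: bilinear_on_def intro!: subsp_sum[OF B] subsp_scale[OF B]\<close>)
     also have "... = (\<Sum>i<n. phi i x * (\<Sum>j<m. psi j y * f (v i) (w j)))"
     proof (rule sum.cong[OF refl])
      fix i assume i: "i \<in> {..<n}"
      show "phi i x * f (v i) (\<Sum>j<m. t (psi j y) (w j)) = phi i x * (\<Sum>j<m. psi j y * f (v i) (w j))"
       using i True 1 2
       by (subst linear_on_lincomb[OF B vector_space_mult, of "f (v i)"]) (auto simp: bilinear_on_def)
     qed
     also have "... = (\<Sum>i\<in>?I. fscale (?theta i (pure2 s A t B x y)) (?p i)) f"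
      unfolding sum_apply sum_distrib_left sum.cartesian_product
      using True bil by (intro sum.cong) (auto simp: pscale_def pure2_def mult.assoc)
     also have "f (F x) (G y) = map_tensor2 s A t B F G (pure2 s A t B x y) f"
      using True by (simp only: map_tensor2_pure[OF F(1) G(1)]) (simp add: pure2_def)
     finally show ?thesis .
    qed
   qed
  qed
 next
  show "a * b = (\<Sum>i\<in>?I. ?theta i (?p i))"
   unfolding 1(4) 2(4) sum_product sum.cartesian_product
   using bil by (intro sum.cong) (auto simp: pure2_def)
 qed (use 1 2 in \<open>auto simp: pure2_in linear_on_eval\<close>)
qed

text \<open>Tensors over lists of spaces: operators permuting the factors and acting on each of them.\<close>

lemma listset_iff: "vs \<in> listset Vs \<longleftrightarrow> length vs = length Vs & (\<forall>i<length Vs. vs ! i \<in> Vs ! i)"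
proof (induction Vs arbitrary: vs)
 case (Cons V Vs)
 show ?case
  by (cases vs) (auto simp: set_Cons_def Cons.IH nth_Cons less_Suc_eq_0_disj split: nat.splits)
qed auto

definition place_map :: "nat => (nat => nat) => (nat => 'u => 'v) => 'u list => 'v list" where
 "place_map p \<pi> F vs = map (%i. F i (vs ! \<pi> i)) [0..<p]"

definition tensor_op ::
 "('k::field => 'v::plus => 'v) => 'v set list => ('u list => 'v list) => ('k, 'u) tensor => ('k, 'v) tensor" where
 "tensor_op s Ws f zeta = (%phi. if multilinear_on s Ws phi then zeta (%vs. phi (f vs)) else 0)"

lemma map_tensor_eq: "map_tensor s Ws Fs = tensor_op s Ws (map2 (%F v. F v) Fs)"
 by (simp add: map_tensor_def tensor_op_def fun_eq_iff)

lemma perm_tensor_eq: "perm_tensor s Ws rho = tensor_op s Ws (permute_list rho)"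
 by (simp add: perm_tensor_def tensor_op_def fun_eq_iff)

lemma subsp_tensor: "subsp fscale (tensor s Vs)"
 unfolding tensor_def
 using vector_space_fscale module.subspace_span[OF vs_module[OF vector_space_fscale]] by blast

lemma pure_in: "vs \<in> listset Vs ==> pure s Vs vs \<in> tensor s Vs"
 unfolding tensor_def by (intro module.span_base[OF vs_module[OF vector_space_fscale]]) blast

lemma linear_on_tensor_op: "linear_on fscale fscale X (tensor_op s Vs f)"
 by (auto simp: linear_on_def tensor_op_def pscale_def fun_eq_iff)

lemma tensor_linear_eq:
 assumes "vector_space r" "linear_on fscale r (tensor s Vs) f" "linear_on fscale r (tensor s Vs) g"
  "!!vs. vs \<in> listset Vs ==> f (pure s Vs vs) = g (pure s Vs vs)" "zeta \<in> tensor s Vs"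
 shows "f zeta = g zeta"
 using lin_maps_eq_on_span[OF vector_space_fscale assms(1-3)[unfolded tensor_def] _
   assms(5)[unfolded tensor_def]] assms(4) by blast

text \<open>
  What makes an operation on lists act on tensors: pulling back along it preserves multilinearity.
\<close>

definition multi_maps ::
 "('k::field => 'v::plus => 'v) => 'v set list => 'v set list => ('v list => 'v list) set" where
 "multi_maps s Vs Ws = {f. (\<forall>vs\<in>listset Vs. f vs \<in> listset Ws) &
   (\<forall>phi. multilinear_on s Ws phi --> multilinear_on s Vs (%vs. phi (f vs)))}"

lemma multi_maps_place:
 assumes \<pi>: "\<pi> permutes {..<p}" and len: "length Vs = p" "length Ws = p"
  and V: "!!i. i < p ==> subsp s (Vs ! i)"
  and F: "!!i. i < p ==> F i \<in> lin_maps s (Vs ! \<pi> i) s (Ws ! i)"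
  and f: "!!vs. length vs = p ==> f vs = place_map p \<pi> F vs"
 shows "f \<in> multi_maps s Vs Ws"
 unfolding multi_maps_def
proof (intro CollectI conjI ballI allI impI)
 have \<pi>p: "\<pi> i < p" if "i < p" for i using permutes_in_image[OF \<pi>, of i] that by simp
 show fW: "f vs \<in> listset Ws" if "vs \<in> listset Vs" for vs
  using that lin_mapsD(2)[OF F] \<pi>p len f[of vs] by (auto simp: listset_iff place_map_def)
 fix phi assume phi: "multilinear_on s Ws phi"
 show "multilinear_on s Vs (%vs. phi (f vs))"
  unfolding multilinear_on_def
 proof (intro ballI allI impI)
  fix vs i assume vs: "vs \<in> listset Vs" and i: "i < length Vs"
  let ?j = "inv_into UNIV \<pi> i"
  have j: "?j < p" and ji: "\<pi> ?j = i"
   using permutes_in_image[OF permutes_inv[OF \<pi>], of i] i len permutes_inverses[OF \<pi>] by auto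
  have upd: "f (vs[i := x]) = (f vs)[?j := F ?j x]" for x
  proof (rule nth_equalityI)
   fix k assume "k < length (f (vs[i := x]))"
   then have k: "k < p" using f[of "vs[i := x]"] vs len by (simp add: listset_iff place_map_def)
   have "\<pi> k = i \<longleftrightarrow> k = ?j" using inj_eq[OF permutes_inj[OF \<pi>], of k ?j] ji by simp
   then show "f (vs[i := x]) ! k = (f vs)[?j := F ?j x] ! k"
    using f[of "vs[i := x]"] f[of vs] vs len k i j ji
    by (auto simp: listset_iff place_map_def nth_list_update \<pi>p)
  qed (use vs len in \<open>simp add: f listset_iff place_map_def\<close>)
  have "linear_on s (*) (Ws ! ?j) (%x. phi ((f vs)[?j := x]))"
   using phi fW[OF vs] j len by (simp add: multilinear_on_def)
  from linear_on_comp[OF F[OF j] this]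
  show "linear_on s (*) (Vs ! i) (%x. phi (f (vs[i := x])))"
   unfolding upd ji .
 qed
qed

lemma tensor_op_pure:
 assumes "f \<in> multi_maps s Vs Ws"
 shows "tensor_op s Ws f (pure s Vs vs) = pure s Ws (f vs)"
 using assms by (auto simp: tensor_op_def pure_def fun_eq_iff multi_maps_def)

lemma tensor_op_comp:
 assumes "g \<in> multi_maps s Ws Us"
 shows "tensor_op s Us g (tensor_op s Ws f zeta) = tensor_op s Us (%vs. g (f vs)) zeta"
 using assms by (auto simp: tensor_op_def fun_eq_iff multi_maps_def)

lemma tensor_op_lin_maps:
 assumes f: "f \<in> multi_maps s Vs Ws"
 shows "tensor_op s Ws f \<in> lin_maps fscale (tensor s Vs) fscale (tensor s Ws)"
proof (rule lin_mapsI[OF linear_on_tensor_op])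
 fix zeta assume z: "zeta \<in> tensor s Vs"
 have "tensor s Vs \<subseteq> {zeta. tensor_op s Ws f zeta \<in> tensor s Ws}"
  unfolding tensor_def[of s Vs]
 proof (rule module.span_minimal[OF vs_module[OF vector_space_fscale]])
  show "pure s Vs ` listset Vs \<subseteq> {zeta. tensor_op s Ws f zeta \<in> tensor s Ws}"
  proof safe
   fix vs assume "vs \<in> listset Vs"
   then have "f vs \<in> listset Ws" using f by (simp add: multi_maps_def)
   then show "tensor_op s Ws f (pure s Vs vs) \<in> tensor s Ws"
    unfolding tensor_op_pure[OF f] by (rule pure_in)
  qed
  have "tensor_op s Ws f (zeta + xi) = tensor_op s Ws f zeta + tensor_op s Ws f xi"
   "tensor_op s Ws f (fscale c zeta) = fscale c (tensor_op s Ws f zeta)" for zeta xi c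
   using linear_on_tensor_op[of UNIV s Ws f] by (auto simp: linear_on_def)
  moreover have "tensor_op s Ws f 0 = 0" by (auto simp: tensor_op_def fun_eq_iff)
  ultimately show "module.subspace fscale {zeta. tensor_op s Ws f zeta \<in> tensor s Ws}"
   unfolding module.subspace_def[OF vs_module[OF vector_space_fscale]]
   by (auto simp: subsp_add[OF subsp_tensor] subsp_scale[OF subsp_tensor] subsp_0[OF subsp_tensor])
 qed
 with z show "tensor_op s Ws f zeta \<in> tensor s Ws" by blast
qed

lemma tensor_op_cong:
 assumes "f \<in> multi_maps s Vs Ws" "g \<in> multi_maps s Vs Ws"
  "!!vs. vs \<in> listset Vs ==> f vs = g vs" "zeta \<in> tensor s Vs"
 shows "tensor_op s Ws f zeta = tensor_op s Ws g zeta"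
 by (rule tensor_linear_eq[OF vector_space_fscale linear_on_tensor_op linear_on_tensor_op _ assms(4)])
  (use assms in \<open>simp add: tensor_op_pure\<close>)

lemma tensor_op_id:
 assumes "f \<in> multi_maps s Vs Vs" "!!vs. vs \<in> listset Vs ==> f vs = vs" "zeta \<in> tensor s Vs"
 shows "tensor_op s Vs f zeta = zeta"
 by (rule tensor_linear_eq[OF vector_space_fscale linear_on_tensor_op lin_mapsD(1)[OF lin_maps_id(2)] _ assms(3)])
  (use assms in \<open>simp add: tensor_op_pure\<close>)

lemma multilinear_expand:
 assumes Vs: "length Vs = p" "!!i. i < p ==> subsp s (Vs ! i)"
  and phi: "multilinear_on s Vs phi" and w: "!!i j. i < p ==> j \<in> J i ==> w i j \<in> Vs ! i"
  and x: "!!i. i < p ==> x i \<in> Vs ! i" and "q \<le> p"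
 shows "phi (map (%i. if i < q then \<Sum>j\<in>J i. s (c i j) (w i j) else x i) [0..<p]) =
  (\<Sum>j\<in>Pi\<^sub>E {..<q} J. (\<Prod>i<q. c i (j i)) * phi (map (%i. if i < q then w i (j i) else x i) [0..<p]))"
 using \<open>q \<le> p\<close> x
proof (induction q arbitrary: x)
 case (Suc q)
 let ?S = "%i. \<Sum>j\<in>J i. s (c i j) (w i j)"
 have S: "?S i \<in> Vs ! i" if "i < p" for i
  using that w Vs by (auto intro!: subsp_sum[OF Vs(2)] subsp_scale[OF Vs(2)])
 let ?L = "%j. map (%i. if i < q then w i (j i) else x i) [0..<p]"
 have "phi (map (%i. if i < Suc q then ?S i else x i) [0..<p]) =
  phi (map (%i. if i < q then ?S i else (x(q := ?S q)) i) [0..<p])"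
  by (intro arg_cong[of _ _ phi]) (auto simp: less_Suc_eq)
 also have "... = (\<Sum>j\<in>Pi\<^sub>E {..<q} J. (\<Prod>i<q. c i (j i)) *
   phi (map (%i. if i < q then w i (j i) else (x(q := ?S q)) i) [0..<p]))"
  using Suc.prems S by (intro Suc.IH) auto
 also have "... = (\<Sum>j\<in>Pi\<^sub>E {..<q} J. (\<Prod>i<q. c i (j i)) * (\<Sum>k\<in>J q. c q k * phi ((?L j)[q := w q k])))"
 proof (rule sum.cong[OF refl])
  fix j assume j: "j \<in> Pi\<^sub>E {..<q} J"
  have "map (%i. if i < q then w i (j i) else (x(q := ?S q)) i) [0..<p] = (?L j)[q := ?S q]"
   using Suc.prems by (auto intro!: nth_equalityI simp: nth_list_update)
  moreover have "?L j \<in> listset Vs"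
   using Suc.prems w j Vs by (auto simp: listset_iff PiE_iff)
  then have "linear_on s (*) (Vs ! q) (%y. phi ((?L j)[q := y]))"
   using phi Suc.prems Vs unfolding multilinear_on_def by auto
  then have "phi ((?L j)[q := ?S q]) = (\<Sum>k\<in>J q. c q k * phi ((?L j)[q := w q k]))"
   using Suc.prems w by (intro linear_on_lincomb[OF Vs(2) vector_space_mult]) auto
  ultimately show "(\<Prod>i<q. c i (j i)) *
   phi (map (%i. if i < q then w i (j i) else (x(q := ?S q)) i) [0..<p]) =
   (\<Prod>i<q. c i (j i)) * (\<Sum>k\<in>J q. c q k * phi ((?L j)[q := w q k]))" by simp
 qed
 also have "... = (\<Sum>k\<in>J q. \<Sum>j\<in>Pi\<^sub>E {..<q} J. (\<Prod>i<q. c i (j i)) * (c q k * phi ((?L j)[q := w q k])))"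
  by (subst sum.swap) (simp add: sum_distrib_left)
 also have "... = (\<Sum>j\<in>Pi\<^sub>E {..<Suc q} J. (\<Prod>i<Suc q. c i (j i)) *
   phi (map (%i. if i < Suc q then w i (j i) else x i) [0..<p]))"
  unfolding lessThan_Suc
 proof (subst sum_PiE_insert, simp, intro sum.cong refl)
  fix k j
  have "(?L j)[q := w q k] = map (%i. if i < Suc q then w i ((j(q := k)) i) else x i) [0..<p]"
   using Suc.prems by (auto intro!: nth_equalityI simp: nth_list_update less_Suc_eq)
  then show "(\<Prod>i<q. c i (j i)) * (c q k * phi ((?L j)[q := w q k])) =
   (\<Prod>i\<in>insert q {..<q}. c i ((j(q := k)) i)) *
    phi (map (%i. if i < Suc q then w i ((j(q := k)) i) else x i) [0..<p])"
   by (simp add: mult.assoc mult.left_commute)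
 qed
 finally show ?case .
qed auto

lemma multilinear_on_prod:
 assumes "\<pi> permutes {..<p}" "length Vs = p"
  "!!i. i < p ==> linear_on s (*) (Vs ! \<pi> i) (theta i)"
 shows "multilinear_on s Vs (%vs. \<Prod>i<p. theta i (vs ! \<pi> i))"
 unfolding multilinear_on_def
proof (intro ballI allI impI)
 fix vs i assume vs: "vs \<in> listset Vs" and i: "i < length Vs"
 let ?j = "inv_into UNIV \<pi> i"
 have \<pi>p: "\<pi> k < p" if "k < p" for k using permutes_in_image[OF assms(1), of k] that by simp
 have j: "?j < p" and ji: "\<pi> ?j = i"
  using permutes_in_image[OF permutes_inv[OF assms(1)], of i] i assms(2) permutes_inverses[OF assms(1)] by auto
 have neq: "\<pi> k ~= i" if "k ~= ?j" for k
  using inj_eq[OF permutes_inj[OF assms(1)], of k ?j] ji that by simp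
 have upd: "vs[i := x] ! \<pi> k = vs ! \<pi> k" if "k ~= ?j" for k x
  using neq[OF that] by (simp add: nth_list_update_neq)
 have "(\<Prod>k<p. theta k (vs[i := x] ! \<pi> k)) = theta ?j x * (\<Prod>k\<in>{..<p} - {?j}. theta k (vs ! \<pi> k))" for x
  using j ji i vs assms(2) upd
  by (subst prod.remove[of _ ?j]) (auto simp: listset_iff intro!: prod.cong)
 then show "linear_on s (*) (Vs ! i) (%x. \<Prod>k<p. theta k (vs[i := x] ! \<pi> k))"
  using assms(3)[OF j] by (auto simp: linear_on_def ji algebra_simps)
qed

lemma has_trace_tensor_op:
 assumes \<pi>: "\<pi> permutes {..<p}" and Vs: "length Vs = p" "!!i. i < p ==> subsp s (Vs ! i)"
  and F: "!!i. i < p ==> F i \<in> lin_maps s (Vs ! \<pi> i) s (Vs ! i)"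
  and f: "!!vs. length vs = p ==> f vs = place_map p \<pi> F vs"
  and J: "!!i. i < p ==> finite (J i)" and w: "!!i j. i < p ==> j \<in> J i ==> w i j \<in> Vs ! i"
  and theta: "!!i j. i < p ==> j \<in> J i ==> linear_on s (*) (Vs ! \<pi> i) (theta i j)"
  and eq: "!!i x. i < p ==> x \<in> Vs ! \<pi> i ==> F i x = (\<Sum>j\<in>J i. s (theta i j x) (w i j))"
 shows "has_trace fscale (tensor s Vs) (tensor_op s Vs f)
  (\<Sum>j\<in>Pi\<^sub>E {..<p} J. \<Prod>i<p. theta i (j i) (w (\<pi> i) (j (\<pi> i))))"
proof -
 have fm: "f \<in> multi_maps s Vs Vs" by (rule multi_maps_place[OF \<pi> Vs(1) Vs(1) Vs(2) F f])
 have \<pi>p: "\<pi> i < p" if "i < p" for i using permutes_in_image[OF \<pi>, of i] that by simp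
 let ?I = "Pi\<^sub>E {..<p} J"
 let ?\<Theta> = "%j (zeta :: ('a list => 'b) => 'b). zeta (%vs. \<Prod>i<p. theta i (j i) (vs ! \<pi> i))"
 let ?W = "%j. map (%i. w i (j i)) [0..<p]"
 have W: "?W j \<in> listset Vs" if "j \<in> ?I" for j
  using that w Vs by (auto simp: listset_iff PiE_iff)
 have ml: "multilinear_on s Vs (%vs. \<Prod>i<p. theta i (j i) (vs ! \<pi> i))" if "j \<in> ?I" for j
  using that theta by (intro multilinear_on_prod[OF \<pi> Vs(1)]) (auto simp: PiE_iff)
 show ?thesis
 proof (rule has_traceI[of ?I fscale _ ?\<Theta> "%j. pure s Vs (?W j)"])
  fix zeta assume z: "zeta \<in> tensor s Vs"
  show "tensor_op s Vs f zeta = (\<Sum>j\<in>?I. fscale (?\<Theta> j zeta) (pure s Vs (?W j)))"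
  proof (rule tensor_linear_eq[OF vector_space_fscale linear_on_tensor_op _ _ z])
   show "linear_on fscale fscale (tensor s Vs) (%zeta. \<Sum>j\<in>?I. fscale (?\<Theta> j zeta) (pure s Vs (?W j)))"
    by (auto simp: linear_on_def fun_eq_iff sum_apply pscale_def algebra_simps sum.distrib sum_distrib_left
      intro!: sum.cong)
   fix vs assume vs: "vs \<in> listset Vs"
   show "tensor_op s Vs f (pure s Vs vs) = (\<Sum>j\<in>?I. fscale (?\<Theta> j (pure s Vs vs)) (pure s Vs (?W j)))"
   proof (rule ext)
    fix phi :: "'a list => 'b"
    show "tensor_op s Vs f (pure s Vs vs) phi =
     (\<Sum>j\<in>?I. fscale (?\<Theta> j (pure s Vs vs)) (pure s Vs (?W j))) phi"
    proof (cases "multilinear_on s Vs phi")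
     case False
     then show ?thesis by (simp add: tensor_op_def sum_apply pscale_def pure_def)
    next
     case True
     have "f vs = map (%i. if i < p then \<Sum>j\<in>J i. s (theta i j (vs ! \<pi> i)) (w i j) else 0) [0..<p]"
      using f[of vs] vs Vs eq \<pi>p by (auto simp: place_map_def listset_iff)
     moreover have "phi ... = (\<Sum>j\<in>?I. (\<Prod>i<p. theta i (j i) (vs ! \<pi> i)) *
       phi (map (%i. if i < p then w i (j i) else 0) [0..<p]))"
      by (rule multilinear_expand[OF Vs True w]) (use subsp_0[OF Vs(2)] in auto)
     moreover have "map (%i. if i < p then w i (j i) else 0) [0..<p] = ?W j" for j by auto
     ultimately have "phi (f vs) = (\<Sum>j\<in>?I. (\<Prod>i<p. theta i (j i) (vs ! \<pi> i)) * phi (?W j))" by simp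
     also have "... = (\<Sum>j\<in>?I. fscale (?\<Theta> j (pure s Vs vs)) (pure s Vs (?W j))) phi"
      unfolding sum_apply using True ml by (intro sum.cong) (auto simp: pscale_def pure_def)
     finally show ?thesis
      using True by (simp only: tensor_op_pure[OF fm]) (simp add: pure_def)
    qed
   qed
  qed
 next
  show "(\<Sum>j\<in>?I. \<Prod>i<p. theta i (j i) (w (\<pi> i) (j (\<pi> i)))) = (\<Sum>j\<in>?I. ?\<Theta> j (pure s Vs (?W j)))"
   using ml \<pi>p by (auto simp: pure_def intro!: sum.cong prod.cong)
 qed (use J W in \<open>auto intro: pure_in linear_on_eval finite_PiE\<close>)
qed

section \<open>Characters as averages of traces\<close>

text \<open>Coinvariants of a tensor product of two representations of a finite group.\<close>

lemma quotient_trace_tensor_coinvariants: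
 fixes s :: "'k::field => 'u::ab_group_add => 'u" and t :: "'k => 'w::ab_group_add => 'w"
 assumes P: "subsp s P" and Q: "subsp t Q" and G: "finite G" "of_nat (card G) ~= (0::'k)"
  and alpha: "!!g. g \<in> G ==> alpha g \<in> lin_maps s P s P" and beta: "!!g. g \<in> G ==> beta g \<in> lin_maps t Q t Q"
  and \<delta>: "\<delta> \<in> lin_maps t Q t Q"
  and mul: "!!g. g \<in> G ==> bij_betw (mul g) G G"
  and alphaalpha: "!!g h x. g \<in> G ==> h \<in> G ==> x \<in> P ==> alpha h (alpha g x) = alpha (mul g h) x"
  and betabeta: "!!g h x. g \<in> G ==> h \<in> G ==> x \<in> Q ==> beta h (beta g x) = beta (mul g h) x"
  and beta\<delta>: "!!g x. g \<in> G ==> x \<in> Q ==> beta g (\<delta> x) = \<delta> (beta g x)"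
  and chi: "!!g. g \<in> G ==> has_trace s P (alpha g) (chi g)"
  and psi: "!!g. g \<in> G ==> has_trace t Q (%x. beta g (\<delta> x)) (psi g)"
  and fin: "has_trace s P (%x. x) p" "has_trace t Q (%x. x) q"
 shows "quotient_trace fscale (tensor2 s P t Q)
  (module.span fscale {map_tensor2 s P t Q (alpha g) (beta g) x - x |g x. g \<in> G & x \<in> tensor2 s P t Q})
  (map_tensor2 s P t Q id \<delta>) = (1 / of_nat (card G)) * (\<Sum>g\<in>G. chi g * psi g)"
proof (rule quotient_trace_coinvariants[OF subsp_tensor2 G, where act = "%g. map_tensor2 s P t Q (alpha g) (beta g)"])
 note comp = map_tensor2_comp[of _ s P s P _ t Q t Q]
 show "map_tensor2 s P t Q (alpha g) (beta g) \<in> lin_maps fscale (tensor2 s P t Q) fscale (tensor2 s P t Q)"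
  if "g \<in> G" for g using that by (intro map_tensor2_lin_maps alpha beta)
 show "map_tensor2 s P t Q id \<delta> \<in> lin_maps fscale (tensor2 s P t Q) fscale (tensor2 s P t Q)"
  by (intro map_tensor2_lin_maps lin_maps_id \<delta>)
 have mulG: "mul g h \<in> G" if "g \<in> G" "h \<in> G" for g h using mul[OF that(1)] that(2) by (auto simp: bij_betw_def)
 fix g x assume g: "g \<in> G" and x: "x \<in> tensor2 s P t Q"
 have "map_tensor2 s P t Q (alpha h) (beta h) (map_tensor2 s P t Q (alpha g) (beta g) x) =
   map_tensor2 s P t Q (alpha (mul g h)) (beta (mul g h)) x" if h: "h \<in> G" for h
  unfolding comp[OF alpha[OF h] beta[OF h]]
  by (rule map_tensor2_cong[OF lin_maps_comp[OF alpha[OF g] alpha[OF h]] lin_maps_comp[OF beta[OF g] beta[OF h]]])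
   (use alpha beta mulG alphaalpha betabeta g h x in auto)
 then show "(\<Sum>h\<in>G. map_tensor2 s P t Q (alpha h) (beta h) (map_tensor2 s P t Q (alpha g) (beta g) x)) =
   (\<Sum>h\<in>G. map_tensor2 s P t Q (alpha h) (beta h) x)"
  using sum.reindex_bij_betw[OF mul[OF g], of "%h. map_tensor2 s P t Q (alpha h) (beta h) x"] by simp
 show "map_tensor2 s P t Q (alpha g) (beta g) (map_tensor2 s P t Q id \<delta> x) =
   map_tensor2 s P t Q id \<delta> (map_tensor2 s P t Q (alpha g) (beta g) x)"
  unfolding comp[OF alpha[OF g] beta[OF g]] comp[OF lin_maps_id(1) \<delta>]
  by (rule map_tensor2_cong[OF lin_maps_comp[OF lin_maps_id(1) alpha[OF g]] lin_maps_comp[OF \<delta> beta[OF g]]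
     lin_maps_comp[OF alpha[OF g] lin_maps_id(1)] lin_maps_comp[OF beta[OF g] \<delta>]])
   (use beta\<delta> g x in auto)
next
 show "has_trace fscale (tensor2 s P t Q) (%x. x) (p * q)"
  using has_trace_tensor2[OF P Q lin_maps_id(2) fin(1) lin_maps_id(2) fin(2)]
  by (rule has_trace_cong) (simp add: map_tensor2_id)
 fix g assume g: "g \<in> G"
 have alpha': "(%x. alpha g (id x)) \<in> lin_maps s P s P" using alpha[OF g] by simp
 have chi': "has_trace s P (%x. alpha g (id x)) (chi g)" using chi[OF g] by simp
 show "has_trace fscale (tensor2 s P t Q)
   (%x. map_tensor2 s P t Q (alpha g) (beta g) (map_tensor2 s P t Q id \<delta> x)) (chi g * psi g)"
  unfolding map_tensor2_comp[OF alpha[OF g] beta[OF g]]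
  by (rule has_trace_tensor2[OF P Q alpha' chi' lin_maps_comp[OF \<delta> beta[OF g]] psi[OF g]])
qed auto

text \<open>
  The trace of \<open>sigma\<close> times a diagonal operator on \<open>(\<k>\<^sup>r)\<^sup>\<otimes>\<^sup>m\<close>: only the basis tensors fixed by \<open>sigma\<close> contribute.
\<close>

definition fixed_word_sum :: "nat => nat => (nat => nat) => (nat => 'k::comm_semiring_1) => 'k" where
 "fixed_word_sum m r sigma a =
   (\<Sum>w\<in>{..<m} \<rightarrow>\<^sub>E {..<r}. if \<forall>i<m. w (sigma i) = w i then \<Prod>i<m. a (w i) else 0)"

lemma subsp_coord_space: "subsp fscale (coord_space r :: (nat => 'k::field) set)"
 using vector_space_fscale
 by (auto simp: module.subspace_def[OF vs_module[OF vector_space_fscale]] coord_space_def pscale_def)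

lemma diag_lin_maps: "diag (a :: nat => 'k::field) \<in> lin_maps fscale (coord_space r) fscale (coord_space r)"
 by (auto simp: lin_maps_def linear_on_def diag_def coord_space_def pscale_def fun_eq_iff algebra_simps)

lemma prod_if_0:
 "finite I ==> (\<Prod>i\<in>I. if P i then f i else (0::'a::comm_semiring_1)) = (if \<forall>i\<in>I. P i then \<Prod>i\<in>I. f i else 0)"
 by (induction I rule: finite_induct) auto

lemma permute_map2_place:
 assumes "sigma permutes {..<m}" "length vs = m"
 shows "permute_list sigma (map2 (%F v. F v) (replicate m F) vs) = place_map m sigma (%_. F) vs"
 using assms permutes_in_image[OF assms(1)]
 by (auto simp: place_map_def permute_list_def)

lemma map2_place:
 assumes "length vs = m"
 shows "map2 (%F v. F v) (replicate m F) vs = place_map m id (%_. F) vs"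
 using assms by (auto simp: place_map_def intro!: nth_equalityI)

lemma permute_list_place: "length vs = m ==> permute_list sigma vs = place_map m sigma (%_ x. x) vs"
 by (simp add: place_map_def permute_list_def)

context
 fixes r m :: nat
begin

private abbreviation "Vs \<equiv> replicate m (coord_space r :: (nat => 'k::field) set)"

private lemma Vs: "length Vs = m" "i < m ==> subsp fscale (Vs ! i)"
 using subsp_coord_space by auto

private lemma Vs_perm: "sigma permutes {..<m} ==> i < m ==> Vs ! sigma i = coord_space r"
 using permutes_in_image[of sigma "{..<m}" i] by simp

private lemma perm_multi: "sigma permutes {..<m} ==> permute_list sigma \<in> multi_maps fscale Vs (Vs :: (nat => 'k::field) set list)"
 by (rule multi_maps_place[where F = "%_ x. x" and p = m and \<pi> = sigma])
  (use subsp_coord_space in \<open>auto simp: Vs_perm lin_maps_id permute_list_place\<close>)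

private lemma diag_multi: "map2 (%F v. F v) (replicate m (diag a)) \<in> multi_maps fscale Vs (Vs :: (nat => 'k::field) set list)"
 by (rule multi_maps_place[where F = "%_. diag a" and p = m and \<pi> = id])
  (use subsp_coord_space in \<open>auto simp: diag_lin_maps map2_place permutes_id\<close>)

lemma subsp_tpow: "subsp fscale (tpow r m)"
 unfolding tpow_def by (rule subsp_tensor)

lemma tpow_perm_lin_maps: "sigma permutes {..<m} ==> tpow_perm r m sigma \<in> lin_maps fscale (tpow r m) fscale (tpow r m)"
 unfolding tpow_perm_def tpow_def perm_tensor_eq by (intro tensor_op_lin_maps perm_multi)

lemma tpow_diag_lin_maps: "tpow_diag r m a \<in> lin_maps fscale (tpow r m) fscale (tpow r m)"
 unfolding tpow_diag_def tpow_def map_tensor_eq by (intro tensor_op_lin_maps diag_multi)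

lemma tpow_perm_comp:
 assumes "sigma permutes {..<m}" "tau permutes {..<m}" "zeta \<in> tpow r m"
 shows "tpow_perm r m tau (tpow_perm r m sigma zeta) = tpow_perm r m (sigma \<circ> tau) zeta"
proof -
 have c: "sigma \<circ> tau permutes {..<m}" using assms by (simp add: permutes_compose)
 have eq: "permute_list tau (permute_list sigma vs) = permute_list (sigma \<circ> tau) vs" if "vs \<in> listset Vs"
  for vs :: "(nat => 'a) list"
  using permute_list_compose[of tau vs sigma] assms(2) that by (simp add: listset_iff)
 have "(%vs. permute_list tau (permute_list sigma vs)) \<in> multi_maps fscale Vs (Vs :: (nat => 'a) set list)"
  using perm_multi[OF assms(1)] perm_multi[OF assms(2)] by (auto simp: multi_maps_def)
 from tensor_op_cong[OF this perm_multi[OF c] eq assms(3)[unfolded tpow_def]]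
 show ?thesis
  unfolding tpow_perm_def perm_tensor_eq tensor_op_comp[OF perm_multi[OF assms(2)]] by simp
qed

lemma tpow_perm_diag:
 assumes "sigma permutes {..<m}" "zeta \<in> tpow r m"
 shows "tpow_perm r m sigma (tpow_diag r m a zeta) = tpow_diag r m a (tpow_perm r m sigma zeta)"
proof -
 let ?d = "map2 (%F v. F v) (replicate m (diag a))"
 have eq: "permute_list sigma (?d vs) = ?d (permute_list sigma vs)" if "vs \<in> listset Vs"
  for vs :: "(nat => 'a) list"
  using that assms permutes_in_image[OF assms(1)]
  by (auto simp: listset_iff permute_list_def intro!: nth_equalityI)
 have 1: "(%vs. permute_list sigma (?d vs)) \<in> multi_maps fscale Vs Vs"
  and 2: "(%vs. ?d (permute_list sigma vs)) \<in> multi_maps fscale Vs Vs"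
  using perm_multi[OF assms(1)] diag_multi[of a] by (auto simp: multi_maps_def)
 from tensor_op_cong[OF 1 2 eq assms(2)[unfolded tpow_def]]
 show ?thesis
  unfolding tpow_perm_def tpow_diag_def perm_tensor_eq map_tensor_eq
   tensor_op_comp[OF perm_multi[OF assms(1)]] tensor_op_comp[OF diag_multi] by simp
qed

lemma has_trace_tpow:
 assumes "sigma permutes {..<m}"
 shows "has_trace fscale (tpow r m) (%zeta. tpow_perm r m sigma (tpow_diag r m a zeta)) (fixed_word_sum m r sigma a)"
proof -
 let ?d = "map2 (%F v. F v) (replicate m (diag a))"
 let ?w = "%j. (%k. if k = j then 1 else 0) :: nat => 'a"
 have expand: "diag a x = (\<Sum>j<r. fscale (a j * x j) (?w j))" if "x \<in> coord_space r" for x :: "nat => 'a"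
 proof
  fix k
  have "(\<Sum>j<r. a j * x j * (if k = j then 1 else 0)) = (if k < r then a k * x k else 0)"
   by (simp add: sum.delta if_distrib[of "%c. _ * c"] cong: if_cong)
  then show "diag a x k = (\<Sum>j<r. fscale (a j * x j) (?w j)) k"
   using that by (simp add: sum_apply pscale_def diag_def coord_space_def)
 qed
 have "has_trace fscale (tensor fscale Vs) (tensor_op fscale Vs (%vs. permute_list sigma (?d vs)))
  (\<Sum>j\<in>{..<m} \<rightarrow>\<^sub>E {..<r}. \<Prod>i<m. a (j i) * ?w (j (sigma i)) (j i))"
 proof (rule has_trace_tensor_op[OF assms Vs, where F = "%_. diag a" and J = "%_. {..<r}" and w = "%_ j. ?w j"
    and theta = "%_ j x. a j * x j"])
  show "diag a \<in> lin_maps fscale (Vs ! sigma i) fscale (Vs ! i)" if "i < m" for i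
   using that by (simp add: Vs_perm[OF assms] diag_lin_maps)
  show "diag a x = (\<Sum>j<r. fscale (a j * x j) (?w j))" if "i < m" "x \<in> Vs ! sigma i" for i x
   using that expand by (simp add: Vs_perm[OF assms])
 qed (auto simp: permute_map2_place[OF assms] coord_space_def linear_on_def pscale_def algebra_simps)
 moreover have "(\<Sum>j\<in>{..<m} \<rightarrow>\<^sub>E {..<r}. \<Prod>i<m. a (j i) * ?w (j (sigma i)) (j i)) = fixed_word_sum m r sigma a"
  unfolding fixed_word_sum_def
  by (intro sum.cong refl) (auto simp: prod_if_0 if_distrib[of "%c. _ * c"] cong: if_cong)
 ultimately show ?thesis
  unfolding tpow_def tpow_perm_def tpow_diag_def perm_tensor_eq map_tensor_eq
   tensor_op_comp[OF perm_multi[OF assms]] by simp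
qed

lemma has_trace_tpow_id: "\<exists>t. has_trace fscale (tpow r m :: ('k::field, nat => 'k) tensor set) (%x. x) t"
proof -
 have 1: "tpow_perm r m id zeta = zeta" if "zeta \<in> tpow r m" for zeta :: "('k, nat => 'k) tensor"
  using that unfolding tpow_perm_def tpow_def perm_tensor_eq
  by (intro tensor_op_id perm_multi permutes_id) auto
 have 2: "tpow_diag r m (%_. 1) zeta = zeta" if "zeta \<in> tpow r m" for zeta :: "('k, nat => 'k) tensor"
  using that unfolding tpow_diag_def tpow_def map_tensor_eq
  by (intro tensor_op_id diag_multi) (auto simp: listset_iff diag_def intro!: nth_equalityI)
 show ?thesis
  using has_trace_tpow[OF permutes_id, of "%_. 1 :: 'k"]
  by (intro exI, rule has_trace_cong) (simp_all add: 1 2)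
qed

end

definition perms :: "nat => (nat => nat) set" where
 "perms n = {sigma. sigma permutes {..<n}}"

lemma perms_iff: "sigma \<in> perms n \<longleftrightarrow> sigma permutes {..<n}"
 by (simp add: perms_def)

lemma finite_perms [simp]: "finite (perms n)"
 by (simp add: perms_def finite_permutations)

lemma card_perms [simp]: "card (perms n) = fact n"
 unfolding perms_def by (rule card_permutations) auto

lemma bij_perms_comp: "sigma \<in> perms n ==> bij_betw (%tau. sigma \<circ> tau) (perms n) (perms n)"
 unfolding perms_def bij_betw_def
 by (auto simp: inj_on_def permutes_compose image_iff fun_eq_iff permutes_inverses
   dest: permutes_inj intro!: exI[of _ "inv_into UNIV sigma \<circ> _"] permutes_compose permutes_inv)

lemma bij_perms_pair:
 "g \<in> perms m \<times> perms n ==> bij_betw (%h. (fst g \<circ> fst h, snd g \<circ> snd h)) (perms m \<times> perms n) (perms m \<times> perms n)"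
 using bij_betw_map_prod[OF bij_perms_comp[of "fst g" m] bij_perms_comp[of "snd g" n]]
 by (auto simp: map_prod_def split_def)

lemma bisym_schur_trace_eq:
 fixes s :: "'k::field_char_0 => 'v::ab_group_add => 'v"
 assumes M: "bisymmetric_sequence s M"
  and chi: "!!sigma tau. sigma permutes {..<m} ==> tau permutes {..<n} ==>
   has_trace s (bpiece M m n d) (bact M m n d sigma tau) (chi sigma tau)"
 shows "bisym_schur_trace s M m n d r q a b = (1 / (fact m * fact n)) *
  (\<Sum>sigma\<in>perms m. \<Sum>tau\<in>perms n. chi sigma tau * (fixed_word_sum m r sigma a * fixed_word_sum n q tau b))"
proof -
 interpret bisymmetric_sequence s M by fact
 let ?P = "bpiece M m n d"
 let ?R = "tpow r m :: ('k, nat => 'k) tensor set" and ?S = "tpow q n :: ('k, nat => 'k) tensor set"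
 let ?Q = "tensor2 fscale ?R fscale ?S"
 let ?G = "perms m \<times> perms n"
 let ?alpha = "%g. bact M m n d (fst g) (snd g)"
 let ?beta = "%g. map_tensor2 fscale ?R fscale ?S (tpow_perm r m (fst g)) (tpow_perm q n (snd g))"
 let ?\<delta> = "map_tensor2 fscale ?R fscale ?S (tpow_diag r m a) (tpow_diag q n b)"
 let ?mul = "%g h. (fst g \<circ> fst h, snd g \<circ> snd h)"
 note comp = map_tensor2_comp[of _ fscale ?R fscale ?R _ fscale ?S fscale ?S]
 have P: "subsp s ?P" using subspace_piece vector_space_axioms by blast
 have lp: "tpow_perm r m (fst g) \<in> lin_maps fscale ?R fscale ?R"
  "tpow_perm q n (snd g) \<in> lin_maps fscale ?S fscale ?S" if "g \<in> ?G" for g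
  using that by (auto simp: perms_iff intro: tpow_perm_lin_maps)
 note ld = tpow_diag_lin_maps[of r m a] tpow_diag_lin_maps[of q n b]
 obtain t1 t2 where t: "has_trace fscale ?R (%x. x) t1" "has_trace fscale ?S (%x. x) t2"
  using has_trace_tpow_id by metis
 have "quotient_trace fscale (tensor2 s ?P fscale ?Q)
  (module.span fscale {map_tensor2 s ?P fscale ?Q (?alpha g) (?beta g) x - x |g x. g \<in> ?G & x \<in> tensor2 s ?P fscale ?Q})
  (map_tensor2 s ?P fscale ?Q id ?\<delta>) =
  (1 / of_nat (card ?G)) * (\<Sum>g\<in>?G. chi (fst g) (snd g) * (fixed_word_sum m r (fst g) a * fixed_word_sum n q (snd g) b))"
 proof (rule quotient_trace_tensor_coinvariants[OF P subsp_tensor2, where mul = ?mul])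
  show "?alpha g \<in> lin_maps s ?P s ?P" if "g \<in> ?G" for g
   using that linear_act act_closed by (auto simp: lin_maps_def perms_iff)
  show "?beta g \<in> lin_maps fscale ?Q fscale ?Q" if "g \<in> ?G" for g
   using that by (intro map_tensor2_lin_maps lp)
  show "?\<delta> \<in> lin_maps fscale ?Q fscale ?Q" by (intro map_tensor2_lin_maps ld)
  show "bij_betw (?mul g) ?G ?G" if "g \<in> ?G" for g using that by (rule bij_perms_pair)
  show "?alpha h (?alpha g x) = ?alpha (?mul g h) x" if "g \<in> ?G" "h \<in> ?G" "x \<in> ?P" for g h x
   using that act_comp by (auto simp: perms_iff)
  show "?beta h (?beta g x) = ?beta (?mul g h) x" if "g \<in> ?G" "h \<in> ?G" "x \<in> ?Q" for g h x
  proof -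
   have gh: "?mul g h \<in> ?G" using that by (auto simp: perms_iff permutes_compose)
   show ?thesis
    unfolding comp[OF lp[OF that(2)]]
    by (rule map_tensor2_cong[OF lin_maps_comp[OF lp(1)[OF that(1)] lp(1)[OF that(2)]]
       lin_maps_comp[OF lp(2)[OF that(1)] lp(2)[OF that(2)]] lp[OF gh]])
     (use that in \<open>auto simp: tpow_perm_comp perms_iff\<close>)
  qed
  show "?beta g (?\<delta> x) = ?\<delta> (?beta g x)" if "g \<in> ?G" "x \<in> ?Q" for g x
   unfolding comp[OF lp[OF that(1)]] comp[OF ld]
   by (rule map_tensor2_cong[OF lin_maps_comp[OF ld(1) lp(1)[OF that(1)]] lin_maps_comp[OF ld(2) lp(2)[OF that(1)]]
      lin_maps_comp[OF lp(1)[OF that(1)] ld(1)] lin_maps_comp[OF lp(2)[OF that(1)] ld(2)]])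
    (use that in \<open>auto simp: tpow_perm_diag perms_iff\<close>)
  show "has_trace s ?P (?alpha g) (chi (fst g) (snd g))" if "g \<in> ?G" for g
   using that chi by (auto simp: perms_iff)
  show "has_trace fscale ?Q (%x. ?beta g (?\<delta> x)) (fixed_word_sum m r (fst g) a * fixed_word_sum n q (snd g) b)"
   if "g \<in> ?G" for g
   unfolding comp[OF lp[OF that]]
   by (rule has_trace_tensor2[OF subsp_tpow subsp_tpow lin_maps_comp[OF ld(1) lp(1)[OF that]] _
      lin_maps_comp[OF ld(2) lp(2)[OF that]]])
    (use that in \<open>auto simp: perms_iff intro: has_trace_tpow\<close>)
  show "has_trace s ?P (%x. x) (chi id id)"
   by (rule has_trace_cong[OF chi]) (auto simp: permutes_id act_id)
  show "has_trace fscale ?Q (%x. x) (t1 * t2)"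
   using has_trace_tensor2[OF subsp_tpow subsp_tpow lin_maps_id(2) t(1) lin_maps_id(2) t(2)]
   by (rule has_trace_cong) (simp add: map_tensor2_id)
 qed (auto simp: card_cartesian_product)
 moreover have "{map_tensor2 s ?P fscale ?Q (?alpha g) (?beta g) x - x |g x. g \<in> ?G & x \<in> tensor2 s ?P fscale ?Q} =
  {map_tensor2 s ?P fscale ?Q (bact M m n d sigma tau)
   (map_tensor2 fscale ?R fscale ?S (tpow_perm r m sigma) (tpow_perm q n tau)) x - x |sigma tau x.
    sigma permutes {..<m} & tau permutes {..<n} & x \<in> tensor2 s ?P fscale ?Q}"
  by (auto simp: perms_iff)
 ultimately show ?thesis
  unfolding bisym_schur_trace_def Let_def
  by (simp add: card_cartesian_product sum.cartesian_product split_def)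
qed

lemma sym_schur_trace_eq:
 fixes s :: "'k::field_char_0 => 'v::ab_group_add => 'v"
 assumes M: "symmetric_sequence s N"
  and chi: "!!tau. tau permutes {..<n} ==> has_trace s (spiece N n d) (sact N n d tau) (chi tau)"
 shows "sym_schur_trace s N n d q b =
  (1 / fact n) * (\<Sum>tau\<in>perms n. chi tau * fixed_word_sum n q tau b)"
proof -
 interpret symmetric_sequence s N by fact
 let ?P = "spiece N n d" and ?S = "tpow q n :: ('k, nat => 'k) tensor set"
 have P: "subsp s ?P" using subspace_piece vector_space_axioms by blast
 obtain t where t: "has_trace fscale ?S (%x. x) t" using has_trace_tpow_id by metis
 have "quotient_trace fscale (tensor2 s ?P fscale ?S)
  (module.span fscale {map_tensor2 s ?P fscale ?S (sact N n d g) (tpow_perm q n g) x - x |g x.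
    g \<in> perms n & x \<in> tensor2 s ?P fscale ?S})
  (map_tensor2 s ?P fscale ?S id (tpow_diag q n b)) =
  (1 / of_nat (card (perms n))) * (\<Sum>g\<in>perms n. chi g * fixed_word_sum n q g b)"
 proof (rule quotient_trace_tensor_coinvariants[OF P subsp_tpow, where mul = "%g h. g \<circ> h"])
  show "has_trace s ?P (%x. x) (chi id)"
   by (rule has_trace_cong[OF chi]) (auto simp: permutes_id act_id)
  show "sact N n d g \<in> lin_maps s ?P s ?P" if "g \<in> perms n" for g
   using that linear_act act_closed by (auto simp: lin_maps_def perms_iff)
 qed (use t in \<open>auto simp: perms_iff tpow_perm_lin_maps tpow_diag_lin_maps bij_perms_comp tpow_perm_comp
  act_comp tpow_perm_diag chi has_trace_tpow\<close>)
 then show ?thesis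
  unfolding sym_schur_trace_def Let_def by (simp add: perms_iff)
qed

section \<open>Koszul signs\<close>

lemma koszul_sign_pairs:
 "koszul_sign rho ds = (\<Prod>(i, j)\<in>{(i, j). i < j & j < length ds}.
   if rho j < rho i then (-1) ^ (ds ! rho i * ds ! rho j) else 1)"
proof -
 have fin: "finite {(i, j). i < j & j < (n::nat)}" for n
  by (rule finite_subset[of _ "{..<n} \<times> {..<n}"]) auto
 have "{(i, j). i < j & j < length ds & rho j < rho i} =
  {x \<in> {(i, j). i < j & j < length ds}. case x of (i, j) => rho j < rho i}" by auto
 then show ?thesis
  unfolding koszul_sign_def by (simp only: prod.inter_filter[OF fin]) (auto intro!: prod.cong)
qed

text \<open>
  Each unordered pair of positions is inverted by \<open>rho \<circ> rho'\<close> exactly when it is inverted by one of \<open>rho'\<close> and,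
  after moving it by \<open>rho'\<close>, \<open>rho\<close>, but not by both.
\<close>

lemma koszul_sign_comp:
 assumes rho: "rho permutes {..<length ds}" and rho': "rho' permutes {..<length ds}"
 shows "koszul_sign (rho \<circ> rho') ds = (koszul_sign rho ds * koszul_sign rho' (permute_list rho ds) :: 'k::field)"
proof -
 let ?n = "length ds"
 let ?P = "{(i, j). i < j & j < ?n}"
 define s where "s i j = ((-1) ^ (ds ! i * ds ! j) :: 'k)" for i j
 have s: "s i j = s j i" "s i j * s i j = 1" for i j
  by (auto simp: s_def mult.commute simp flip: power_add mult_2)
 let ?f = "%(i, j). (min (rho' i) (rho' j), max (rho' i) (rho' j))"
 have lt: "rho i < ?n" "rho' i < ?n" if "i < ?n" for i
  using permutes_in_image[OF rho, of i] permutes_in_image[OF rho', of i] that by auto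
 have inj: "rho i = rho j \<longleftrightarrow> i = j" "rho' i = rho' j \<longleftrightarrow> i = j" for i j
  using inj_eq[OF permutes_inj[OF rho]] inj_eq[OF permutes_inj[OF rho']] by auto
 have fin: "finite ?P" by (rule finite_subset[of _ "{..<?n} \<times> {..<?n}"]) auto
 have injf: "inj_on ?f ?P"
 proof (rule inj_onI)
  fix x y assume "x \<in> ?P" "y \<in> ?P" "?f x = ?f y"
  then show "x = y"
   using inj(2) by (auto simp: min_def max_def split: if_splits)
 qed
 have fP: "?f ` ?P \<subseteq> ?P"
 proof
  fix x assume "x \<in> ?f ` ?P"
  then obtain i j where ij: "i < j" "j < ?n" and x: "x = ?f (i, j)" by auto
  then have "rho' i ~= rho' j" "rho' i < ?n" "rho' j < ?n" using inj(2)[of i j] lt(2)[of i] lt(2)[of j] by auto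
  then show "x \<in> ?P" by (auto simp: x min_def max_def)
 qed
 have imf: "?f ` ?P = ?P" by (rule endo_inj_surj[OF fin fP injf])
 have "koszul_sign rho ds = (\<Prod>(i, j)\<in>?P. if rho j < rho i then s (rho i) (rho j) else 1)"
  unfolding koszul_sign_pairs by (intro prod.cong) (auto simp: s_def)
 also have "... = (\<Prod>(i, j)\<in>?f ` ?P. if rho j < rho i then s (rho i) (rho j) else 1)" by (simp only: imf)
 also have "... = (\<Prod>(i, j)\<in>?P. if rho' i < rho' j then (if rho (rho' j) < rho (rho' i) then s (rho (rho' i)) (rho (rho' j)) else 1)
   else (if rho (rho' i) < rho (rho' j) then s (rho (rho' i)) (rho (rho' j)) else 1))"
  unfolding prod.reindex[OF injf] using s(1) by (intro prod.cong) (auto simp: min_def max_def)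
 finally have 1: "koszul_sign rho ds = ..." .
 have 2: "koszul_sign rho' (permute_list rho ds) =
  (\<Prod>(i, j)\<in>?P. if rho' j < rho' i then s (rho (rho' i)) (rho (rho' j)) else 1)"
  unfolding koszul_sign_pairs
  by (intro prod.cong) (auto simp: s_def permute_list_nth[OF rho] lt(2))
 have "koszul_sign rho ds * koszul_sign rho' (permute_list rho ds) =
  (\<Prod>(i, j)\<in>?P. if rho (rho' j) < rho (rho' i) then s (rho (rho' i)) (rho (rho' j)) else 1)"
  unfolding 1 2 prod.distrib[symmetric]
 proof (intro prod.cong refl, clarify)
  fix i j :: nat assume "i < j"
  then have "rho' i ~= rho' j" "rho (rho' i) ~= rho (rho' j)" using inj by auto
  then show "(if rho' i < rho' j then (if rho (rho' j) < rho (rho' i) then s (rho (rho' i)) (rho (rho' j)) else 1)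
    else (if rho (rho' i) < rho (rho' j) then s (rho (rho' i)) (rho (rho' j)) else 1)) *
    (if rho' j < rho' i then s (rho (rho' i)) (rho (rho' j)) else 1) =
    (if rho (rho' j) < rho (rho' i) then s (rho (rho' i)) (rho (rho' j)) else 1)"
   using s(2) by auto
 qed
 also have "... = koszul_sign (rho \<circ> rho') ds"
  unfolding koszul_sign_pairs by (intro prod.cong) (auto simp: s_def)
 finally show ?thesis by simp
qed

section \<open>Tensor products of bisymmetric sequences\<close>

text \<open>The three operations on labels: the group acting on a tensor product, the block permutations, the factors.\<close>

definition act_index :: "(nat => nat) => (nat => nat) => day_index => day_index" where
 "act_index g g' = (%(ks, ls, ds, b, c). (ks, ls, ds, \<lambda>x\<in>blocks ks. g (b x), \<lambda>x\<in>blocks ls. g' (c x)))"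

definition shuffle_index :: "(nat => nat => nat) => (nat => nat => nat) => day_index => day_index" where
 "shuffle_index h h' = (%(ks, ls, ds, b, c). (ks, ls, ds, block_shuffle ks b h, block_shuffle ls c h'))"

definition relabel :: "(nat => nat) => nat list => labelling => labelling" where
 "relabel rho ks b = (\<lambda>(i, j)\<in>blocks (permute_list (inv_into UNIV rho) ks). b (inv_into UNIV rho i, j))"

definition permute_index :: "(nat => nat) => day_index => day_index" where
 "permute_index rho = (%(ks, ls, ds, b, c). let rho' = inv_into UNIV rho in
   (permute_list rho' ks, permute_list rho' ls, permute_list rho' ds, relabel rho ks b, relabel rho ls c))"

definition block_perms :: "nat list => (nat => nat => nat) => bool" where
 "block_perms ks h \<longleftrightarrow> (\<forall>i<length ks. h i permutes {..<ks ! i})"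

lemma blocks_iff: "(i, j) \<in> blocks ks \<longleftrightarrow> i < length ks & j < ks ! i"
 by (auto simp: blocks_def)

lemma block_perms_blocks: "block_perms ks h ==> (i, h i j) \<in> blocks ks \<longleftrightarrow> (i, j) \<in> blocks ks"
 using permutes_in_image[of "h i" "{..<ks ! i}" j] by (auto simp: blocks_iff block_perms_def)

lemma bij_block_perms:
 assumes "block_perms ks h"
 shows "bij_betw (%(i, j). (i, h i j)) (blocks ks) (blocks ks)"
proof (rule bij_betwI[where g = "%(i, j). (i, inv_into UNIV (h i) j)"])
 have inv: "block_perms ks (%i. inv_into UNIV (h i))"
  using assms by (auto simp: block_perms_def permutes_inv)
 show "(%(i, j). (i, h i j)) \<in> blocks ks \<rightarrow> blocks ks"
  using block_perms_blocks[OF assms] by auto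
 show "(%(i, j). (i, inv_into UNIV (h i) j)) \<in> blocks ks \<rightarrow> blocks ks"
  using block_perms_blocks[OF inv] by auto
qed (use assms in \<open>auto simp: blocks_iff block_perms_def permutes_inverses\<close>)

lemma labellings_comp:
 assumes "b \<in> labellings ks k" "bij_betw f (blocks ks') (blocks ks)"
 shows "(\<lambda>x\<in>blocks ks'. b (f x)) \<in> labellings ks' k"
 using bij_betw_trans[OF assms(2), of b "{..<k}"] assms(1)
 by (auto simp: labellings_def comp_def bij_betw_def inj_on_def image_iff)

lemma block_shuffle_eq: "block_shuffle ks b h = (\<lambda>x\<in>blocks ks. b ((%(i, j). (i, h i j)) x))"
 by (auto simp: block_shuffle_def)

lemma block_shuffle_in:
 "b \<in> labellings ks k ==> block_perms ks h ==> block_shuffle ks b h \<in> labellings ks k"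
 unfolding block_shuffle_eq by (rule labellings_comp[OF _ bij_block_perms])

lemma block_shuffle_comp:
 assumes "block_perms ks h'"
 shows "block_shuffle ks (block_shuffle ks b h) h' = block_shuffle ks b (%i. h i \<circ> h' i)"
 using block_perms_blocks[OF assms] by (auto simp: block_shuffle_def fun_eq_iff)

lemma block_shuffle_cong:
 assumes "!!i j. (i, j) \<in> blocks ks ==> h i j = h' i j"
 shows "block_shuffle ks b h = block_shuffle ks b h'"
 using assms by (auto simp: block_shuffle_def fun_eq_iff)

lemma block_shuffle_id: "b \<in> labellings ks k ==> block_shuffle ks b (%i. id) = b"
 by (auto simp: block_shuffle_def labellings_def fun_eq_iff extensional_def)

lemma act_label_in:
 assumes "b \<in> labellings ks k" "g permutes {..<k}"
 shows "(\<lambda>x\<in>blocks ks. g (b x)) \<in> labellings ks k"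
proof -
 have "bij_betw (g \<circ> b) (blocks ks) {..<k}"
  using bij_betw_trans[of b "blocks ks" "{..<k}" g "{..<k}"] assms permutes_imp_bij[OF assms(2)]
  by (simp add: labellings_def)
 then have "bij_betw (\<lambda>x\<in>blocks ks. g (b x)) (blocks ks) {..<k}"
  by (rule bij_betw_cong[THEN iffD1, rotated]) simp
 then show ?thesis by (simp add: labellings_def)
qed

lemma bij_relabel:
 assumes "rho permutes {..<length ks}"
 shows "bij_betw (%(i, j). (inv_into UNIV rho i, j)) (blocks (permute_list (inv_into UNIV rho) ks)) (blocks ks)"
proof (rule bij_betwI[where g = "%(i, j). (rho i, j)"])
 note inv = permutes_inv[OF assms]
 have lt: "inv_into UNIV rho i < length ks \<longleftrightarrow> i < length ks" "rho i < length ks \<longleftrightarrow> i < length ks" for i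
  using permutes_in_image[OF inv, of i] permutes_in_image[OF assms, of i] by auto
 show "(%(i, j). (inv_into UNIV rho i, j)) \<in> blocks (permute_list (inv_into UNIV rho) ks) \<rightarrow> blocks ks"
  by (auto simp: blocks_iff permute_list_nth[OF inv] lt)
 show "(%(i, j). (rho i, j)) \<in> blocks ks \<rightarrow> blocks (permute_list (inv_into UNIV rho) ks)"
  by (auto simp: blocks_iff permute_list_nth[OF inv] permutes_inverses[OF assms] lt)
qed (auto simp: permutes_inverses[OF assms])

lemma relabel_eq: "relabel rho ks b =
 (\<lambda>x\<in>blocks (permute_list (inv_into UNIV rho) ks). b ((%(i, j). (inv_into UNIV rho i, j)) x))"
 by (auto simp: relabel_def)

lemma relabel_in:
 "b \<in> labellings ks k ==> rho permutes {..<length ks} ==>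
  relabel rho ks b \<in> labellings (permute_list (inv_into UNIV rho) ks) k"
 unfolding relabel_eq by (rule labellings_comp[OF _ bij_relabel])

lemma sum_list_permute: "\<pi> permutes {..<length ks} ==> sum_list (permute_list \<pi> ks) = sum_list (ks :: nat list)"
 using mset_permute_list[of \<pi> ks] by (simp flip: sum_mset_sum_list)

definition day_indices_deg :: "nat => nat => nat => nat => day_index set" where
 "day_indices_deg p k l d = {z \<in> day_indices p k l. case z of (ks, ls, ds, b, c) => sum_list ds = d}"

lemma day_indices_deg_iff: "(ks, ls, ds, b, c) \<in> day_indices_deg p k l d \<longleftrightarrow>
 length ks = p & length ls = p & length ds = p & sum_list ks = k & sum_list ls = l & sum_list ds = d &
 b \<in> labellings ks k & c \<in> labellings ls l"
 by (auto simp: day_indices_deg_def day_indices_def)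

lemma finite_lists_sum: "finite {ks :: nat list. length ks = p & sum_list ks = k}"
 by (rule finite_subset[OF _ finite_lists_length_eq[of "{..k}" p]]) (auto dest: member_le_sum_list)

lemma finite_labellings: "finite (labellings ks k)"
proof -
 have "finite (blocks ks)" by (auto simp: blocks_def)
 then have "finite (blocks ks \<rightarrow>\<^sub>E {..<k})" by (intro finite_PiE) auto
 moreover have "labellings ks k \<subseteq> blocks ks \<rightarrow>\<^sub>E {..<k}"
  by (auto simp: labellings_def bij_betw_def PiE_def)
 ultimately show ?thesis by (rule rev_finite_subset)
qed

lemma finite_day_indices_deg: "finite (day_indices_deg p k l d)"
proof -
 let ?L = "%k. {ks :: nat list. length ks = p & sum_list ks = k}"
 have "day_indices_deg p k l d \<subseteq>
   ?L k \<times> ?L l \<times> ?L d \<times> (\<Union>ks\<in>?L k. labellings ks k) \<times> (\<Union>ls\<in>?L l. labellings ls l)"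
  by (auto simp: day_indices_deg_iff)
 then show ?thesis
  by (rule finite_subset)
   (intro finite_UN_I finite_cartesian_product finite_lists_sum finite_labellings)
qed

definition block_perm_set :: "nat list => (nat => nat => nat) set" where
 "block_perm_set ks = Pi\<^sub>E {..<length ks} (%i. perms (ks ! i))"

lemma finite_block_perm_set [simp]: "finite (block_perm_set ks)"
 by (auto simp: block_perm_set_def intro: finite_PiE)

lemma card_block_perm_set: "card (block_perm_set ks) = (\<Prod>i<length ks. fact (ks ! i))"
 unfolding block_perm_set_def by (subst card_PiE) auto

lemma block_perm_set_perms: "h \<in> block_perm_set ks ==> block_perms ks h"
 by (auto simp: block_perm_set_def block_perms_def perms_iff PiE_iff)

lemma bij_block_perm_set:
 assumes "block_perms ks g"
 shows "bij_betw (%h. \<lambda>i\<in>{..<length ks}. h i \<circ> g i) (block_perm_set ks) (block_perm_set ks)"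
proof (rule bij_betwI[where g = "%h. \<lambda>i\<in>{..<length ks}. h i \<circ> inv_into UNIV (g i)"])
 show "(%h. \<lambda>i\<in>{..<length ks}. h i \<circ> g i) \<in> block_perm_set ks \<rightarrow> block_perm_set ks"
  using assms by (auto simp: block_perm_set_def block_perms_def perms_iff PiE_iff permutes_compose)
 show "(%h. \<lambda>i\<in>{..<length ks}. h i \<circ> inv_into UNIV (g i)) \<in> block_perm_set ks \<rightarrow> block_perm_set ks"
  using assms by (auto simp: block_perm_set_def block_perms_def perms_iff PiE_iff permutes_compose permutes_inv)
qed (use assms in \<open>auto simp: block_perm_set_def block_perms_def PiE_iff fun_eq_iff permutes_inverses
  extensional_def perms_iff\<close>)

text \<open>Every labelling is reached, by a given block permutation, from exactly one labelling.\<close>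

lemma shuffle_preimage:
 assumes "block_perms ks h" "b' \<in> labellings ks k"
 shows "\<exists>!b. b \<in> labellings ks k & block_shuffle ks b h = b'"
proof (rule ex1I[of _ "block_shuffle ks b' (%i. inv_into UNIV (h i))"])
 have inv: "block_perms ks (%i. inv_into UNIV (h i))"
  using assms(1) by (auto simp: block_perms_def permutes_inv)
 show "block_shuffle ks b' (%i. inv_into UNIV (h i)) \<in> labellings ks k &
   block_shuffle ks (block_shuffle ks b' (%i. inv_into UNIV (h i))) h = b'"
 proof
  show "block_shuffle ks b' (%i. inv_into UNIV (h i)) \<in> labellings ks k"
   by (rule block_shuffle_in[OF assms(2) inv])
  have "block_shuffle ks b' (%i. inv_into UNIV (h i) \<circ> h i) = block_shuffle ks b' (%i. id)"
   using assms(1) by (intro block_shuffle_cong) (auto simp: block_perms_def blocks_iff permutes_inverses)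
  then show "block_shuffle ks (block_shuffle ks b' (%i. inv_into UNIV (h i))) h = b'"
   unfolding block_shuffle_comp[OF assms(1)] by (simp add: block_shuffle_id[OF assms(2)])
 qed
 fix b assume b: "b \<in> labellings ks k & block_shuffle ks b h = b'"
 have "block_shuffle ks b (%i. h i \<circ> inv_into UNIV (h i)) = block_shuffle ks b (%i. id)"
  using assms(1) by (intro block_shuffle_cong) (auto simp: block_perms_def blocks_iff permutes_inverses)
 then show "b = block_shuffle ks b' (%i. inv_into UNIV (h i))"
  using b block_shuffle_comp[OF inv, of b h] block_shuffle_id[of b ks k] by auto
qed

locale factor_list =
 fixes s :: "'k::field_char_0 => 'v::ab_group_add => 'v" and Ns :: "'v bisymmetric_seq list"
 assumes vs: "vector_space s" and seq: "i < length Ns ==> bisymmetric_sequence s (Ns ! i)"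
begin

abbreviation "p \<equiv> length Ns"

definition spaces :: "day_index => 'v set list" where
 "spaces = (%(ks, ls, ds, b, c). factors Ns ks ls ds)"

definition block_act :: "day_index => (nat => nat => nat) => (nat => nat => nat) => nat => 'v => 'v" where
 "block_act = (%(ks, ls, ds, b, c) h h' i. bact (Ns ! i) (ks ! i) (ls ! i) (ds ! i) (h i) (h' i))"

definition tensor_act ::
 "day_index => (nat => nat => nat) => (nat => nat => nat) => ('k, 'v) tensor => ('k, 'v) tensor" where
 "tensor_act z h h' = tensor_op s (spaces z) (place_map p id (block_act z h h'))"

definition shuffles :: "day_index => (nat => nat => nat) => (nat => nat => nat) => bool" where
 "shuffles = (%(ks, ls, ds, b, c) h h'. block_perms ks h & block_perms ls h')"

definition shuffle_set :: "day_index => ((nat => nat => nat) \<times> (nat => nat => nat)) set" where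
 "shuffle_set = (%(ks, ls, ds, b, c). block_perm_set ks \<times> block_perm_set ls)"

abbreviation "Z k l d \<equiv> day_indices_deg p k l d"
abbreviation "Y k l d \<equiv> bpiece (bisym_tensor s Ns) k l d"

lemma length_spaces [simp]: "length (spaces z) = p"
 by (auto simp: spaces_def factors_def split: prod.splits)

lemma spaces_nth: "i < p ==> spaces (ks, ls, ds, b, c) ! i = bpiece (Ns ! i) (ks ! i) (ls ! i) (ds ! i)"
 by (simp add: spaces_def factors_def)

lemma subsp_spaces: "i < p ==> subsp s (spaces z ! i)"
 using vs bisymmetric_sequence.subspace_piece[OF seq]
 by (cases z) (auto simp: spaces_nth)

lemma shuffle_set_shuffles: "(h, h') \<in> shuffle_set z ==> shuffles z h h'"
 by (auto simp: shuffles_def shuffle_set_def block_perm_set_perms split: prod.splits)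

lemma finite_shuffle_set [simp]: "finite (shuffle_set z)"
 by (auto simp: shuffle_set_def split: prod.splits)

lemma card_shuffle_set: "card (shuffle_set (ks, ls, ds, b, c)) =
 (\<Prod>i<length ks. fact (ks ! i)) * (\<Prod>i<length ls. fact (ls ! i))"
 by (simp add: shuffle_set_def card_cartesian_product card_block_perm_set)

lemma card_shuffle_set_nz: "of_nat (card (shuffle_set z)) ~= (0::'k)"
 by (cases z) (simp add: card_shuffle_set)

lemma block_act_lin_maps:
 assumes "z \<in> Z k l d" "shuffles z h h'" "i < p"
 shows "block_act z h h' i \<in> lin_maps s (spaces z ! i) s (spaces z ! i)"
proof -
 obtain ks ls ds b c where z: "z = (ks, ls, ds, b, c)" by (cases z)
 interpret bisymmetric_sequence s "Ns ! i" by (rule seq[OF assms(3)])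
 show ?thesis
  using assms linear_act act_closed
  by (auto simp: z block_act_def spaces_nth shuffles_def block_perms_def day_indices_deg_iff lin_maps_def)
qed

lemma block_act_multi:
 assumes "z \<in> Z k l d" "shuffles z h h'"
 shows "place_map p id (block_act z h h') \<in> multi_maps s (spaces z) (spaces z)"
 by (rule multi_maps_place[OF permutes_id]) (use assms subsp_spaces block_act_lin_maps in auto)

lemma tensor_act_lin_maps:
 assumes "z \<in> Z k l d" "shuffles z h h'"
 shows "tensor_act z h h' \<in> lin_maps fscale (tensor s (spaces z)) fscale (tensor s (spaces z))"
 unfolding tensor_act_def by (rule tensor_op_lin_maps[OF block_act_multi[OF assms]])

lemma tensor_act_cong:
 assumes "!!i. i < p ==> h i = g i" "!!i. i < p ==> h' i = g' i"
 shows "tensor_act z h h' = tensor_act z g g'"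
 using assms unfolding tensor_act_def
 by (intro arg_cong[of _ _ "tensor_op s _"]) (auto simp: place_map_def block_act_def split: prod.splits)

lemma shuffles_comp:
 "shuffles z h h' ==> shuffles z g g' ==> shuffles z (%i. h i \<circ> g i) (%i. h' i \<circ> g' i)"
 by (auto simp: shuffles_def block_perms_def permutes_compose split: prod.splits)

lemma tensor_act_comp:
 assumes z: "z \<in> Z k l d" and h: "shuffles z h h'" and g: "shuffles z g g'" and zeta: "zeta \<in> tensor s (spaces z)"
 shows "tensor_act z g g' (tensor_act z h h' zeta) = tensor_act z (%i. h i \<circ> g i) (%i. h' i \<circ> g' i) zeta"
proof -
 obtain ks ls ds b c where zz: "z = (ks, ls, ds, b, c)" by (cases z)
 have 1: "(%vs. place_map p id (block_act z g g') (place_map p id (block_act z h h') vs)) \<in>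
   multi_maps s (spaces z) (spaces z)"
  using block_act_multi[OF z h] block_act_multi[OF z g] by (auto simp: multi_maps_def)
 have "place_map p id (block_act z g g') (place_map p id (block_act z h h') us) =
  place_map p id (block_act z (%i. h i \<circ> g i) (%i. h' i \<circ> g' i)) us" if us: "us \<in> listset (spaces z)" for us
 proof (rule nth_equalityI)
  fix i assume "i < length (place_map p id (block_act z g g') (place_map p id (block_act z h h') us))"
  then have i: "i < p" by (simp add: place_map_def)
  interpret bisymmetric_sequence s "Ns ! i" by (rule seq[OF i])
  have "us ! i \<in> bpiece (Ns ! i) (ks ! i) (ls ! i) (ds ! i)"
   using us i by (simp add: zz listset_iff spaces_nth)
  then show "place_map p id (block_act z g g') (place_map p id (block_act z h h') us) ! i =
   place_map p id (block_act z (%i. h i \<circ> g i) (%i. h' i \<circ> g' i)) us ! i"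
   using i z h g by (simp add: zz place_map_def block_act_def shuffles_def block_perms_def day_indices_deg_iff act_comp)
 qed (simp add: place_map_def)
 from tensor_op_cong[OF 1 block_act_multi[OF z shuffles_comp[OF h g]] this zeta]
 show ?thesis
  unfolding tensor_act_def tensor_op_comp[OF block_act_multi[OF z g]] by simp
qed

lemma tensor_act_id:
 assumes z: "z \<in> Z k l d" and zeta: "zeta \<in> tensor s (spaces z)"
 shows "tensor_act z (%i. id) (%i. id) zeta = zeta"
proof -
 obtain ks ls ds b c where zz: "z = (ks, ls, ds, b, c)" by (cases z)
 have sh: "shuffles z (%i. id) (%i. id)"
  by (simp add: zz shuffles_def block_perms_def permutes_id)
 show ?thesis
  unfolding tensor_act_def
 proof (rule tensor_op_id[OF block_act_multi[OF z sh] _ zeta])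
  fix us assume "us \<in> listset (spaces z)"
  then show "place_map p id (block_act z (%i. id) (%i. id)) us = us"
   using bisymmetric_sequence.act_id[OF seq]
   by (auto simp: zz listset_iff spaces_nth place_map_def block_act_def intro!: nth_equalityI)
 qed
qed

lemma shuffle_index_in: "z \<in> Z k l d ==> shuffles z h h' ==> shuffle_index h h' z \<in> Z k l d"
 by (cases z) (auto simp: shuffle_index_def day_indices_deg_iff shuffles_def block_shuffle_in)

lemma act_index_in:
 "z \<in> Z k l d ==> g permutes {..<k} ==> g' permutes {..<l} ==> act_index g g' z \<in> Z k l d"
 by (cases z) (auto simp: act_index_def day_indices_deg_iff act_label_in)

lemma permute_index_in: "z \<in> Z k l d ==> rho permutes {..<p} ==> permute_index rho z \<in> Z k l d"
 by (cases z) (auto simp: permute_index_def Let_def day_indices_deg_iff relabel_in sum_list_permute permutes_inv)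

lemma spaces_shuffle [simp]: "spaces (shuffle_index h h' z) = spaces z"
 "tensor_act (shuffle_index h h' z) = tensor_act z" "shuffles (shuffle_index h h' z) = shuffles z"
 "spaces (act_index g g' z) = spaces z" "tensor_act (act_index g g' z) = tensor_act z"
 "shuffles (act_index g g' z) = shuffles z" "shuffle_set (shuffle_index h h' z) = shuffle_set z"
 by (cases z; simp add: spaces_def shuffle_index_def act_index_def tensor_act_def block_act_def shuffles_def
   shuffle_set_def fun_eq_iff)+

lemma map_tensor_factor_actions:
 "map_tensor s (factors Ns ks ls ds) (factor_actions Ns ks ls ds h h') zeta = tensor_act (ks, ls, ds, b, c) h h' zeta"
 if "zeta \<in> tensor s (spaces (ks, ls, ds, b, c))" "(ks, ls, ds, b, c) \<in> Z k l d" "shuffles (ks, ls, ds, b, c) h h'"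
proof -
 have eq: "map2 (%F v. F v) (factor_actions Ns ks ls ds h h') us =
   place_map p id (block_act (ks, ls, ds, b, c) h h') us" if "length us = p" for us
  using that by (auto simp: place_map_def block_act_def factor_actions_def intro!: nth_equalityI)
 have "map2 (%F v. F v) (factor_actions Ns ks ls ds h h') \<in>
   multi_maps s (spaces (ks, ls, ds, b, c)) (spaces (ks, ls, ds, b, c))"
  by (rule multi_maps_place[OF permutes_id, where p = p and F = "block_act (ks, ls, ds, b, c) h h'"])
   (use that subsp_spaces block_act_lin_maps eq in auto)
 from tensor_op_cong[OF this block_act_multi[OF that(2,3)] _ that(1)]
 show ?thesis
  unfolding map_tensor_eq tensor_act_def using eq by (simp add: spaces_def listset_iff factors_def)
qed

lemma Y_iff: "xi \<in> Y k l d \<longleftrightarrow>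
 (\<forall>z\<in>Z k l d. xi z \<in> tensor s (spaces z) &
   (\<forall>h h'. shuffles z h h' --> xi (shuffle_index h h' z) = tensor_act z h h' (xi z))) &
 (\<forall>z. z \<notin> Z k l d --> xi z = 0)" (is "_ \<longleftrightarrow> ?R")
proof -
 have all: "(\<forall>i<p. h i permutes {..<ks ! i} & h' i permutes {..<ls ! i}) \<longleftrightarrow> shuffles (ks, ls, ds, b, c) h h'"
  if "(ks, ls, ds, b, c) \<in> Z k l d" for ks ls ds b c h h'
  using that by (auto simp: shuffles_def block_perms_def day_indices_deg_iff)
 have Z: "(ks, ls, ds, b, c) \<in> Z k l d \<longleftrightarrow> (ks, ls, ds, b, c) \<in> day_indices p k l & sum_list ds = d" for ks ls ds b c
  by (auto simp: day_indices_deg_def)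
 have "xi \<in> Y k l d \<longleftrightarrow> (\<forall>ks ls ds b c. (ks, ls, ds, b, c) \<in> Z k l d -->
   xi (ks, ls, ds, b, c) \<in> tensor s (factors Ns ks ls ds) &
   (\<forall>h h'. (\<forall>i<p. h i permutes {..<ks ! i} & h' i permutes {..<ls ! i}) -->
       xi (ks, ls, ds, block_shuffle ks b h, block_shuffle ls c h') =
       map_tensor s (factors Ns ks ls ds) (factor_actions Ns ks ls ds h h')
        (xi (ks, ls, ds, b, c)))) &
   (\<forall>ks ls ds b c. (ks, ls, ds, b, c) \<notin> Z k l d --> xi (ks, ls, ds, b, c) = 0)"
  unfolding Z by (auto simp: bisym_tensor_def)
 also have "... \<longleftrightarrow> (\<forall>ks ls ds b c. (ks, ls, ds, b, c) \<in> Z k l d -->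
   xi (ks, ls, ds, b, c) \<in> tensor s (spaces (ks, ls, ds, b, c)) &
   (\<forall>h h'. shuffles (ks, ls, ds, b, c) h h' -->
       xi (shuffle_index h h' (ks, ls, ds, b, c)) = tensor_act (ks, ls, ds, b, c) h h' (xi (ks, ls, ds, b, c)))) &
   (\<forall>ks ls ds b c. (ks, ls, ds, b, c) \<notin> Z k l d --> xi (ks, ls, ds, b, c) = 0)"
 proof (intro conj_cong refl all_cong1 imp_cong)
  fix ks ls ds b c h h' assume z: "(ks, ls, ds, b, c) \<in> Z k l d"
  show "xi (ks, ls, ds, b, c) \<in> tensor s (factors Ns ks ls ds) \<longleftrightarrow>
   xi (ks, ls, ds, b, c) \<in> tensor s (spaces (ks, ls, ds, b, c))" by (simp add: spaces_def)
  show "(\<forall>i<p. h i permutes {..<ks ! i} & h' i permutes {..<ls ! i}) \<longleftrightarrow> shuffles (ks, ls, ds, b, c) h h'"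
   by (rule all[OF z])
  assume "xi (ks, ls, ds, b, c) \<in> tensor s (spaces (ks, ls, ds, b, c))" "shuffles (ks, ls, ds, b, c) h h'"
  then show "xi (ks, ls, ds, block_shuffle ks b h, block_shuffle ls c h') =
       map_tensor s (factors Ns ks ls ds) (factor_actions Ns ks ls ds h h') (xi (ks, ls, ds, b, c)) \<longleftrightarrow>
     xi (shuffle_index h h' (ks, ls, ds, b, c)) = tensor_act (ks, ls, ds, b, c) h h' (xi (ks, ls, ds, b, c))"
   using map_tensor_factor_actions[OF _ z] by (simp add: shuffle_index_def)
 qed
 also have "... \<longleftrightarrow> ?R" by (simp only: Ball_def split_paired_All)
 finally show ?thesis .
qed

lemma YD:
 assumes "xi \<in> Y k l d"
 shows "z \<in> Z k l d ==> xi z \<in> tensor s (spaces z)"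
  "z \<in> Z k l d ==> shuffles z h h' ==> xi (shuffle_index h h' z) = tensor_act z h h' (xi z)"
  "z \<notin> Z k l d ==> xi z = 0"
 using assms unfolding Y_iff by blast+

lemma vs_day_scale: "vector_space (day_scale :: 'k => ('k, 'v) day => ('k, 'v) day)"
 using vector_space_pscale[OF vector_space_fscale] by (simp add: day_scale_def[abs_def])

lemma day_scale_apply: "day_scale c xi z = fscale c (xi z)"
 by (simp add: day_scale_def pscale_def)

lemma subsp_Y: "subsp day_scale (Y k l d)"
proof -
 have "tensor_act z h h' 0 = 0" if "z \<in> Z k l d" "shuffles z h h'" for z h h'
  by (rule linear_on_0[OF subsp_tensor vector_space_fscale lin_mapsD(1)[OF tensor_act_lin_maps[OF that]]])
 then have "0 \<in> Y k l d"
  by (auto simp: Y_iff subsp_0[OF subsp_tensor])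
 moreover have "xi + eta \<in> Y k l d" if "xi \<in> Y k l d" "eta \<in> Y k l d" for xi eta
  using YD[OF that(1)] YD[OF that(2)] lin_mapsD(1)[OF tensor_act_lin_maps]
  by (auto simp: Y_iff subsp_add[OF subsp_tensor] linear_on_def)
 moreover have "day_scale c xi \<in> Y k l d" if "xi \<in> Y k l d" for c xi
  using YD[OF that] lin_mapsD(1)[OF tensor_act_lin_maps] module.scale_zero_right[OF vs_module[OF vector_space_fscale]]
  by (auto simp: Y_iff day_scale_apply subsp_scale[OF subsp_tensor] linear_on_def)
 ultimately show ?thesis
  using vs_day_scale by (auto simp: module.subspace_def[OF vs_module[OF vs_day_scale]])
qed

end

context factor_list
begin

subsection \<open>The action of the symmetric groups\<close>

lemma bact_Y:
 assumes "xi \<in> Y k l d"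
 shows "bact (bisym_tensor s Ns) k l d g g' xi z = (if z \<in> Z k l d then xi (act_index g g' z) else 0)"
proof -
 obtain ks ls ds b c where z: "z = (ks, ls, ds, b, c)" by (cases z)
 have "xi (act_index g g' z) = 0" if "z \<in> day_indices p k l" "z \<notin> Z k l d"
  using that by (intro YD(3)[OF assms]) (auto simp: z act_index_def day_indices_deg_iff day_indices_def)
 moreover have "z \<in> day_indices p k l" if "z \<in> Z k l d" using that by (simp add: day_indices_deg_def)
 moreover have "bact (bisym_tensor s Ns) k l d g g' xi z = (if z \<in> day_indices p k l then xi (act_index g g' z) else 0)"
  by (simp add: bisym_tensor_def z act_index_def)
 ultimately show ?thesis by auto
qed

lemma act_shuffle_index:
 assumes "shuffles z h h'"
 shows "act_index g g' (shuffle_index h h' z) = shuffle_index h h' (act_index g g' z)"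
 using assms block_perms_blocks
 by (cases z) (auto simp: act_index_def shuffle_index_def block_shuffle_def shuffles_def fun_eq_iff)

lemma bact_in_Y:
 assumes "g permutes {..<k}" "g' permutes {..<l}" "xi \<in> Y k l d"
 shows "bact (bisym_tensor s Ns) k l d g g' xi \<in> Y k l d"
 unfolding Y_iff bact_Y[OF assms(3)]
proof (intro conjI ballI allI impI)
 fix z assume z: "z \<in> Z k l d"
 note az = act_index_in[OF z assms(1,2)]
 show "(if z \<in> Z k l d then xi (act_index g g' z) else 0) \<in> tensor s (spaces z)"
  using YD(1)[OF assms(3) az] z by simp
 fix h h' assume h: "shuffles z h h'"
 show "(if shuffle_index h h' z \<in> Z k l d then xi (act_index g g' (shuffle_index h h' z)) else 0) =
  tensor_act z h h' (if z \<in> Z k l d then xi (act_index g g' z) else 0)"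
  using YD(2)[OF assms(3) az, of h h'] h z by (simp add: shuffle_index_in act_shuffle_index)
qed simp

lemma bact_lin_maps:
 assumes "g permutes {..<k}" "g' permutes {..<l}"
 shows "bact (bisym_tensor s Ns) k l d g g' \<in> lin_maps day_scale (Y k l d) day_scale (Y k l d)"
proof (rule lin_mapsI)
 show "linear_on day_scale day_scale (Y k l d) (bact (bisym_tensor s Ns) k l d g g')"
  unfolding linear_on_def
  by (auto simp: fun_eq_iff bact_Y subsp_add[OF subsp_Y] subsp_scale[OF subsp_Y] day_scale_apply pscale_def)
qed (use assms bact_in_Y in auto)

lemma act_index_id: "z \<in> Z k l d ==> act_index id id z = z"
 by (cases z) (auto simp: act_index_def day_indices_deg_iff labellings_def fun_eq_iff extensional_def)

lemma bact_id:
 assumes "xi \<in> Y k l d"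
 shows "bact (bisym_tensor s Ns) k l d id id xi = xi"
 using assms YD(3)[OF assms] by (auto simp: fun_eq_iff bact_Y act_index_id)

lemma act_index_comp: "act_index g g' (act_index f f' z) = act_index (g \<circ> f) (g' \<circ> f') z"
 by (cases z) (auto simp: act_index_def fun_eq_iff)

lemma bact_comp:
 assumes "f permutes {..<k}" "f' permutes {..<l}" "g permutes {..<k}" "g' permutes {..<l}" "xi \<in> Y k l d"
 shows "bact (bisym_tensor s Ns) k l d (g \<circ> f) (g' \<circ> f') xi =
  bact (bisym_tensor s Ns) k l d f f' (bact (bisym_tensor s Ns) k l d g g' xi)"
 using assms by (auto simp: fun_eq_iff bact_Y bact_in_Y act_index_in act_index_comp)

subsection \<open>Permutations of the factors\<close>

definition permutes_factors :: "(nat => nat) => bool" where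
 "permutes_factors rho \<longleftrightarrow> rho permutes {..<p} & (\<forall>i<p. Ns ! rho i = Ns ! i)"

definition perm_op :: "(nat => nat) => day_index => ('k, 'v) tensor => ('k, 'v) tensor" where
 "perm_op rho z = tensor_op s (spaces z) (permute_list rho)"

definition index_sign :: "(nat => nat) => day_index => 'k" where
 "index_sign rho = (%(ks, ls, ds, b, c). koszul_sign rho (permute_list (inv_into UNIV rho) ds))"

lemma perm_multi:
 assumes rho: "permutes_factors rho" and z: "z \<in> Z k l d"
 shows "permute_list rho \<in> multi_maps s (spaces (permute_index rho z)) (spaces z)"
proof -
 obtain ks ls ds b c where zz: "z = (ks, ls, ds, b, c)" by (cases z)
 have p: "rho permutes {..<p}" using rho by (simp add: permutes_factors_def)
 note inv = permutes_inv[OF p]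
 have "spaces (permute_index rho z) ! rho i = spaces z ! i" if i: "i < p" for i
 proof -
  have ri: "rho i < p" using permutes_in_image[OF p, of i] i by simp
  have "permute_list (inv_into UNIV rho) xs ! rho i = xs ! i" if "length xs = p" for xs :: "nat list"
   using permute_list_nth[of "inv_into UNIV rho" xs "rho i"] inv ri that by (simp add: permutes_inverses[OF p])
  then show ?thesis
   using i ri z rho by (simp add: zz permute_index_def Let_def spaces_nth day_indices_deg_iff permutes_factors_def)
 qed
 then show ?thesis
  using subsp_spaces
  by (intro multi_maps_place[OF p, where F = "%_ x. x"]) (auto simp: permute_list_place lin_maps_id)
qed

lemma perm_op_lin_maps:
 assumes "permutes_factors rho" "z \<in> Z k l d"
 shows "perm_op rho z \<in> lin_maps fscale (tensor s (spaces (permute_index rho z))) fscale (tensor s (spaces z))"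
 unfolding perm_op_def by (rule tensor_op_lin_maps[OF perm_multi[OF assms]])

lemma perm_op_0: "permutes_factors rho ==> z \<in> Z k l d ==> perm_op rho z 0 = 0"
 by (rule linear_on_0[OF subsp_tensor vector_space_fscale lin_mapsD(1)[OF perm_op_lin_maps]])

lemma permute_factors_Y:
 assumes "xi \<in> Y k l d" "permutes_factors rho"
 shows "permute_factors s Ns k l rho xi z =
  (if z \<in> Z k l d then fscale (index_sign rho z) (perm_op rho z (xi (permute_index rho z))) else 0)"
proof -
 obtain ks ls ds b c where z: "z = (ks, ls, ds, b, c)" by (cases z)
 have p: "rho permutes {..<p}" using assms by (simp add: permutes_factors_def)
 have 1: "z \<in> day_indices p k l" if "z \<in> Z k l d" using that by (simp add: day_indices_deg_def)
 have 2: "permute_factors s Ns k l rho xi z =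
  (if z \<in> day_indices p k l then fscale (index_sign rho z) (perm_op rho z (xi (permute_index rho z))) else 0)"
  unfolding permute_factors_def z permute_index_def relabel_def
  by (simp add: Let_def index_sign_def perm_op_def perm_tensor_eq spaces_def)
 have 3: "xi (permute_index rho z) = 0" if "z \<in> day_indices p k l" "z \<notin> Z k l d"
  using that p by (intro YD(3)[OF assms(1)])
   (auto simp: z permute_index_def Let_def day_indices_deg_iff day_indices_def sum_list_permute permutes_inv)
 have "perm_op rho z 0 = 0" by (simp add: perm_op_def tensor_op_def fun_eq_iff)
 with 1 2 3 show ?thesis by (auto simp: pscale_def)
qed

lemma permute_shuffle_index:
 assumes "permutes_factors rho" "z \<in> Z k l d" "shuffles z h h'"
 shows "permute_index rho (shuffle_index h h' z) =
  shuffle_index (%i. h (inv_into UNIV rho i)) (%i. h' (inv_into UNIV rho i)) (permute_index rho z)"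
  "shuffles (permute_index rho z) (%i. h (inv_into UNIV rho i)) (%i. h' (inv_into UNIV rho i))"
proof -
 obtain ks ls ds b c where z: "z = (ks, ls, ds, b, c)" by (cases z)
 have p: "rho permutes {..<p}" using assms by (simp add: permutes_factors_def)
 note inv = permutes_inv[OF p]
 have len: "length ks = p" "length ls = p" using assms by (auto simp: z day_indices_deg_iff)
 have lt: "inv_into UNIV rho i < p" if "i < p" for i using permutes_in_image[OF inv, of i] that by simp
 have perm: "permute_list (inv_into UNIV rho) xs ! i = xs ! inv_into UNIV rho i" if "length xs = p" "i < p"
  for i and xs :: "nat list" using permute_list_nth[of "inv_into UNIV rho" xs i] inv that by simp
 have bl: "(inv_into UNIV rho i, j) \<in> blocks xs" if "(i, j) \<in> blocks (permute_list (inv_into UNIV rho) xs)" "length xs = p"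
  for i j xs using that lt perm by (auto simp: blocks_iff)
 show sh: "shuffles (permute_index rho z) (%i. h (inv_into UNIV rho i)) (%i. h' (inv_into UNIV rho i))"
  using assms(3) lt len perm by (auto simp: z shuffles_def permute_index_def Let_def block_perms_def)
 have key: "relabel rho xs (block_shuffle xs e f) =
  block_shuffle (permute_list (inv_into UNIV rho) xs) (relabel rho xs e) (%i. f (inv_into UNIV rho i))"
  if "length xs = p" "block_perms xs f" "block_perms (permute_list (inv_into UNIV rho) xs) (%i. f (inv_into UNIV rho i))"
  for xs e f
  using bl[OF _ that(1)] block_perms_blocks[OF that(3)] by (auto simp: relabel_def block_shuffle_def fun_eq_iff)
 show "permute_index rho (shuffle_index h h' z) =
  shuffle_index (%i. h (inv_into UNIV rho i)) (%i. h' (inv_into UNIV rho i)) (permute_index rho z)"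
  using assms(3) sh len
  by (simp add: z permute_index_def shuffle_index_def Let_def shuffles_def key)
qed

lemma perm_op_tensor_act:
 assumes rho: "permutes_factors rho" and z: "z \<in> Z k l d" and h: "shuffles z h h'"
  and zeta: "zeta \<in> tensor s (spaces (permute_index rho z))"
 shows "perm_op rho z (tensor_act (permute_index rho z) (%i. h (inv_into UNIV rho i)) (%i. h' (inv_into UNIV rho i)) zeta) =
  tensor_act z h h' (perm_op rho z zeta)"
proof -
 obtain ks ls ds b c where zz: "z = (ks, ls, ds, b, c)" by (cases z)
 have p: "rho permutes {..<p}" using rho by (simp add: permutes_factors_def)
 note inv = permutes_inv[OF p]
 let ?w = "permute_index rho z"
 let ?g = "%i. h (inv_into UNIV rho i)" and ?g' = "%i. h' (inv_into UNIV rho i)"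
 have w: "?w \<in> Z k l d" using permute_index_in[OF z p] .
 note m1 = block_act_multi[OF w permute_shuffle_index(2)[OF rho z h]] and m2 = perm_multi[OF rho z]
  and m3 = block_act_multi[OF z h]
 have 1: "(%vs. permute_list rho (place_map p id (block_act ?w ?g ?g') vs)) \<in> multi_maps s (spaces ?w) (spaces z)"
  and 2: "(%vs. place_map p id (block_act z h h') (permute_list rho vs)) \<in> multi_maps s (spaces ?w) (spaces z)"
  using m1 m2 m3 by (auto simp: multi_maps_def)
 have 3: "permute_list rho (place_map p id (block_act ?w ?g ?g') us) = place_map p id (block_act z h h') (permute_list rho us)"
  if "us \<in> listset (spaces ?w)" for us
 proof (rule nth_equalityI)
  fix i assume "i < length (permute_list rho (place_map p id (block_act ?w ?g ?g') us))"
  then have i: "i < p" by (simp add: place_map_def)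
  have ri: "rho i < p" using permutes_in_image[OF p, of i] i by simp
  have len: "length us = p" using that by (simp add: listset_iff)
  have "permute_list (inv_into UNIV rho) xs ! rho i = xs ! i" if "length xs = p" for xs :: "nat list"
   using permute_list_nth[of "inv_into UNIV rho" xs "rho i"] inv ri that by (simp add: permutes_inverses[OF p])
  then have "block_act ?w ?g ?g' (rho i) = block_act z h h' i"
   using i z rho by (simp add: zz block_act_def permute_index_def Let_def day_indices_deg_iff
     permutes_inverses[OF p] permutes_factors_def)
  then show "permute_list rho (place_map p id (block_act ?w ?g ?g') us) ! i =
    place_map p id (block_act z h h') (permute_list rho us) ! i"
   using i ri len by (simp add: place_map_def permute_list_nth[of rho] p)
 qed (simp add: place_map_def)
 show ?thesis
  unfolding perm_op_def tensor_act_def tensor_op_comp[OF m2] tensor_op_comp[OF m3]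
  by (rule tensor_op_cong[OF 1 2 3 zeta])
qed

lemma permute_factors_in_Y:
 assumes rho: "permutes_factors rho" and xi: "xi \<in> Y k l d"
 shows "permute_factors s Ns k l rho xi \<in> Y k l d"
 unfolding Y_iff permute_factors_Y[OF xi rho]
proof (intro conjI ballI allI impI)
 fix z assume z: "z \<in> Z k l d"
 have p: "rho permutes {..<p}" using rho by (simp add: permutes_factors_def)
 note w = permute_index_in[OF z p]
 have in1: "perm_op rho z (xi (permute_index rho z)) \<in> tensor s (spaces z)"
  by (rule lin_mapsD(2)[OF perm_op_lin_maps[OF rho z] YD(1)[OF xi w]])
 then show "(if z \<in> Z k l d then fscale (index_sign rho z) (perm_op rho z (xi (permute_index rho z))) else 0)
   \<in> tensor s (spaces z)"
  using z by (simp add: subsp_scale[OF subsp_tensor])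
 fix h h' assume h: "shuffles z h h'"
 have "index_sign rho (shuffle_index h h' z) = index_sign rho z" "perm_op rho (shuffle_index h h' z) = perm_op rho z"
  by (auto simp: index_sign_def shuffle_index_def perm_op_def spaces_def split: prod.splits)
 then show "(if shuffle_index h h' z \<in> Z k l d then fscale (index_sign rho (shuffle_index h h' z))
   (perm_op rho (shuffle_index h h' z) (xi (permute_index rho (shuffle_index h h' z)))) else 0) =
  tensor_act z h h' (if z \<in> Z k l d then fscale (index_sign rho z) (perm_op rho z (xi (permute_index rho z))) else 0)"
  using z shuffle_index_in[OF z h] permute_shuffle_index[OF rho z h] YD(2)[OF xi w] perm_op_tensor_act[OF rho z h YD(1)[OF xi w]]
   lin_mapsD(1)[OF tensor_act_lin_maps[OF z h]] in1
  by (simp add: linear_on_def)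
qed simp

lemma permute_factors_lin_maps:
 assumes rho: "permutes_factors rho"
 shows "permute_factors s Ns k l rho \<in> lin_maps day_scale (Y k l d) day_scale (Y k l d)"
proof (rule lin_mapsI)
 have p: "rho permutes {..<p}" using rho by (simp add: permutes_factors_def)
 note * = lin_mapsD(1)[OF perm_op_lin_maps[OF rho]] YD(1)
 have add: "perm_op rho z (xi (permute_index rho z) + eta (permute_index rho z)) =
   perm_op rho z (xi (permute_index rho z)) + perm_op rho z (eta (permute_index rho z))"
  if "z \<in> Z k l d" "xi \<in> Y k l d" "eta \<in> Y k l d" for z xi eta
  using *(1)[OF that(1)] *(2)[OF that(2) permute_index_in[OF that(1) p]] *(2)[OF that(3) permute_index_in[OF that(1) p]]
  by (simp add: linear_on_def)
 have scale: "perm_op rho z (fscale c (xi (permute_index rho z))) = fscale c (perm_op rho z (xi (permute_index rho z)))"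
  if "z \<in> Z k l d" "xi \<in> Y k l d" for z xi c
  using *(1)[OF that(1)] *(2)[OF that(2) permute_index_in[OF that(1) p]] by (simp add: linear_on_def)
 show "linear_on day_scale day_scale (Y k l d) (permute_factors s Ns k l rho)"
  unfolding linear_on_def
  by (auto simp: fun_eq_iff permute_factors_Y[where d = d, OF _ rho] subsp_add[OF subsp_Y] subsp_scale[OF subsp_Y] day_scale_apply
    add scale) (auto simp: pscale_def algebra_simps)
qed (use permute_factors_in_Y[OF rho] in auto)

lemma permute_index_comp:
 assumes "rho permutes {..<p}" "rho' permutes {..<p}" "z \<in> Z k l d"
 shows "permute_index rho (permute_index rho' z) = permute_index (rho \<circ> rho') z"
proof -
 obtain ks ls ds b c where z: "z = (ks, ls, ds, b, c)" by (cases z)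
 have len: "length ks = p" "length ls = p" "length ds = p" using assms by (auto simp: z day_indices_deg_iff)
 have inv: "inv_into UNIV (rho \<circ> rho') = inv_into UNIV rho' \<circ> inv_into UNIV rho"
  using assms by (intro o_inv_distrib) (auto intro: permutes_bij)
 have pl: "permute_list (inv_into UNIV rho) (permute_list (inv_into UNIV rho') xs) = permute_list (inv_into UNIV (rho \<circ> rho')) xs"
  if "length xs = p" for xs :: "nat list"
  unfolding inv using permutes_inv[OF assms(1)] that by (simp add: permute_list_compose)
 have lt: "inv_into UNIV rho i < p" if "i < p" for i using permutes_in_image[OF permutes_inv[OF assms(1)], of i] that by simp
 have bl: "(inv_into UNIV rho i, j) \<in> blocks (permute_list (inv_into UNIV rho') xs)"
  if "(i, j) \<in> blocks (permute_list (inv_into UNIV (rho \<circ> rho')) xs)" "length xs = p" for i j xs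
  using that lt permute_list_nth[of "inv_into UNIV rho" "permute_list (inv_into UNIV rho') xs" i] permutes_inv[OF assms(1)]
  by (auto simp: blocks_iff pl[symmetric])
 have rel: "relabel rho (permute_list (inv_into UNIV rho') xs) (relabel rho' xs e) = relabel (rho \<circ> rho') xs e"
  if "length xs = p" for xs e
  using bl[OF _ that] unfolding relabel_def pl[OF that] by (auto simp: fun_eq_iff inv)
 show ?thesis by (simp add: z permute_index_def Let_def pl len rel)
qed

lemma permutes_factors_comp: "permutes_factors rho ==> permutes_factors rho' ==> permutes_factors (rho \<circ> rho')"
 using permutes_in_image[of rho' "{..<p}"] by (auto simp: permutes_factors_def permutes_compose)

lemma permute_factors_comp:
 assumes rho: "permutes_factors rho" and rho': "permutes_factors rho'" and xi: "xi \<in> Y k l d"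
 shows "permute_factors s Ns k l rho' (permute_factors s Ns k l rho xi) = permute_factors s Ns k l (rho \<circ> rho') xi"
proof
 fix z
 have p: "rho permutes {..<p}" "rho' permutes {..<p}" using rho rho' by (simp_all add: permutes_factors_def)
 note rhorho' = permutes_factors_comp[OF rho rho']
 show "permute_factors s Ns k l rho' (permute_factors s Ns k l rho xi) z = permute_factors s Ns k l (rho \<circ> rho') xi z"
 proof (cases "z \<in> Z k l d")
  case False
  then show ?thesis
   by (simp add: permute_factors_Y[OF permute_factors_in_Y[OF rho xi] rho'] permute_factors_Y[OF xi rhorho'])
 next
  case z: True
  let ?w = "permute_index rho' z" and ?u = "permute_index (rho \<circ> rho') z"
  obtain ks ls ds b c where zz: "z = (ks, ls, ds, b, c)" by (cases z)
  have len: "length ds = p" using z by (auto simp: zz day_indices_deg_iff)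
  have inv: "inv_into UNIV (rho \<circ> rho') = inv_into UNIV rho' \<circ> inv_into UNIV rho"
   using p by (intro o_inv_distrib) (auto intro: permutes_bij)
  note w = permute_index_in[OF z p(2)]
  have u: "?u = permute_index rho ?w" using permute_index_comp[OF p z] by simp
  have uZ: "?u \<in> Z k l d" unfolding u by (rule permute_index_in[OF w p(1)])
  let ?zeta = "xi ?u"
  have zeta: "?zeta \<in> tensor s (spaces ?u)" by (rule YD(1)[OF xi uZ])
  let ?ds' = "permute_list (inv_into UNIV rho') ds"
  have "permute_list rho (permute_list (inv_into UNIV rho) ?ds') = permute_list (inv_into UNIV rho \<circ> rho) ?ds'"
   using p len by (simp add: permute_list_compose)
  then have "permute_list rho (permute_list (inv_into UNIV rho) ?ds') = ?ds'"
   by (simp add: permutes_inv_o[OF p(1)])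
  then have sgn: "index_sign rho' z * index_sign rho ?w = index_sign (rho \<circ> rho') z"
   using koszul_sign_comp[of rho "permute_list (inv_into UNIV rho) ?ds'" rho', where 'k = 'k] p len permutes_inv[OF p(1)]
   by (simp add: zz index_sign_def permute_index_def Let_def inv permute_list_compose)
  note m1 = perm_multi[OF rho' z] and m2 = perm_multi[OF rho w, folded u]
  have m3: "(%vs. permute_list rho' (permute_list rho vs)) \<in> multi_maps s (spaces ?u) (spaces z)"
   using m1 m2 by (auto simp: multi_maps_def)
  have "perm_op rho' z (perm_op rho ?w ?zeta) = perm_op (rho \<circ> rho') z ?zeta"
   unfolding perm_op_def tensor_op_comp[OF m1]
   by (rule tensor_op_cong[OF m3 perm_multi[OF rhorho' z] _ zeta])
    (use p in \<open>auto simp: listset_iff permute_list_compose\<close>)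
  moreover have "perm_op rho' z (fscale c eta) = fscale c (perm_op rho' z eta)" if "eta \<in> tensor s (spaces ?w)" for c eta
   using lin_mapsD(1)[OF perm_op_lin_maps[OF rho' z]] that by (simp add: linear_on_def)
  moreover have "perm_op rho ?w ?zeta \<in> tensor s (spaces ?w)"
   using lin_mapsD(2)[OF perm_op_lin_maps[OF rho w]] zeta u by simp
  ultimately show ?thesis
   using z w by (simp add: permute_factors_Y[OF permute_factors_in_Y[OF rho xi] rho'] permute_factors_Y[OF xi rhorho']
     permute_factors_Y[OF xi rho] u[symmetric] sgn[symmetric] pscale_def mult.assoc)
 qed
qed

lemma permute_act_index:
 assumes "rho permutes {..<p}" "z \<in> Z k l d"
 shows "permute_index rho (act_index g g' z) = act_index g g' (permute_index rho z)"
proof -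
 obtain ks ls ds b c where z: "z = (ks, ls, ds, b, c)" by (cases z)
 have lt: "inv_into UNIV rho i < p" if "i < p" for i using permutes_in_image[OF permutes_inv[OF assms(1)], of i] that by simp
 have "relabel rho xs (\<lambda>x\<in>blocks xs. f (e x)) = (\<lambda>x\<in>blocks (permute_list (inv_into UNIV rho) xs). f (relabel rho xs e x))"
  if "length xs = p" for xs e f
  using that lt permute_list_nth[of "inv_into UNIV rho" xs] permutes_inv[OF assms(1)]
  by (auto simp: relabel_def fun_eq_iff blocks_iff)
 then show ?thesis
  using assms(2) by (simp add: z act_index_def permute_index_def Let_def day_indices_deg_iff)
qed

lemma bact_permute_factors:
 assumes rho: "permutes_factors rho" and g: "g permutes {..<k}" "g' permutes {..<l}" and xi: "xi \<in> Y k l d"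
 shows "bact (bisym_tensor s Ns) k l d g g' (permute_factors s Ns k l rho xi) =
  permute_factors s Ns k l rho (bact (bisym_tensor s Ns) k l d g g' xi)"
proof
 fix z
 have p: "rho permutes {..<p}" using rho by (simp add: permutes_factors_def)
 have "index_sign rho (act_index g g' z) = index_sign rho z" "perm_op rho (act_index g g' z) = perm_op rho z"
  by (auto simp: index_sign_def act_index_def perm_op_def spaces_def split: prod.splits)
 then show "bact (bisym_tensor s Ns) k l d g g' (permute_factors s Ns k l rho xi) z =
   permute_factors s Ns k l rho (bact (bisym_tensor s Ns) k l d g g' xi) z"
  using permute_index_in[OF _ p] act_index_in[OF _ g]
  by (simp add: bact_Y[OF permute_factors_in_Y[OF rho xi]] permute_factors_Y[OF bact_in_Y[OF g xi] rho]
    permute_factors_Y[OF xi rho] bact_Y[OF xi] permute_act_index[OF p])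
qed

end

subsection \<open>Bases of finite-dimensional pieces\<close>

definition is_basis :: "('k::field => 'v::ab_group_add => 'v) => 'v set => 'v set => ('v => 'v => 'k) => bool" where
 "is_basis s X B beta \<longleftrightarrow> finite B & B \<subseteq> X & (\<forall>e\<in>B. linear_on s (*) X (beta e)) &
   (\<forall>x\<in>X. x = (\<Sum>e\<in>B. s (beta e x) e)) & (\<forall>e\<in>B. \<forall>e'\<in>B. beta e e' = (if e = e' then 1 else 0))"

definition basis_of :: "('k::field => 'v::ab_group_add => 'v) => 'v set => 'v set" where
 "basis_of s X = fst (SOME (B, beta). is_basis s X B beta)"

definition coord_of :: "('k::field => 'v::ab_group_add => 'v) => 'v set => 'v => 'v => 'k" where
 "coord_of s X = snd (SOME (B, beta). is_basis s X B beta)"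

lemma is_basis_of:
 assumes X: "subsp s X" and "finite_dim s X"
 shows "is_basis s X (basis_of s X) (coord_of s X)"
proof -
 interpret vector_space s using X by blast
 obtain S where S: "finite S" "S \<subseteq> X" "X \<subseteq> span S" using assms(2) by (auto simp: finite_dim_def)
 obtain B where B: "B \<subseteq> S" "independent B" "S \<subseteq> span B" by (rule maximal_independent_subset)
 have XB: "X \<subseteq> span B" using S(3) B(3) span_mono[of S "span B"] by (auto simp: span_span)
 have fin: "finite B" using B(1) S(1) finite_subset by blast
 have "is_basis s X B (%e x. representation B x e)"
  unfolding is_basis_def
 proof (intro conjI ballI)
  fix e
  show "linear_on s (*) X (%x. representation B x e)"
   using XB by (auto simp: linear_on_def representation_add[OF B(2)] representation_scale[OF B(2)] subset_iff)
 next
  fix x assume "x \<in> X"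
  then show "x = (\<Sum>e\<in>B. s (representation B x e) e)"
   using sum_representation_eq[OF B(2) _ fin subset_refl, of x] XB by auto
 qed (use fin B S in \<open>auto simp: representation_basis\<close>)
 then have "case (SOME (B, beta). is_basis s X B beta) of (B, beta) => is_basis s X B beta"
  using someI[of "%(B, beta). is_basis s X B beta" "(B, %e x. representation B x e)"] by simp
 then show ?thesis by (simp add: basis_of_def coord_of_def split_def)
qed

context factor_list
begin

subsection \<open>Traces on a tensor product\<close>

text \<open>The equivariant function supported on the orbit of \<open>z\<close> which is built from the tensor \<open>w\<close> at \<open>z\<close>.\<close>

definition orbit_extension :: "day_index => ('k, 'v) tensor => ('k, 'v) day" where
 "orbit_extension z w = (%z'. \<Sum>(h, h')\<in>shuffle_set z. if shuffle_index h h' z = z' then tensor_act z h h' w else 0)"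

lemma shuffle_index_unique:
 assumes "z' \<in> Z k l d" "shuffles z' h h'"
 shows "\<exists>!z. z \<in> Z k l d & shuffle_index h h' z = z'"
proof -
 obtain ks ls ds b' c' where z': "z' = (ks, ls, ds, b', c')" by (cases z')
 have mem: "b' \<in> labellings ks k" "c' \<in> labellings ls l" and h: "block_perms ks h" "block_perms ls h'"
  using assms by (auto simp: z' day_indices_deg_iff shuffles_def)
 obtain b where b: "b \<in> labellings ks k" "block_shuffle ks b h = b'"
  and bu: "!!y. y \<in> labellings ks k ==> block_shuffle ks y h = b' ==> y = b"
  using shuffle_preimage[OF h(1) mem(1)] by blast
 obtain c where c: "c \<in> labellings ls l" "block_shuffle ls c h' = c'"
  and cu: "!!y. y \<in> labellings ls l ==> block_shuffle ls y h' = c' ==> y = c"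
  using shuffle_preimage[OF h(2) mem(2)] by blast
 show ?thesis
 proof (rule ex1I[of _ "(ks, ls, ds, b, c)"])
  show "(ks, ls, ds, b, c) \<in> Z k l d & shuffle_index h h' (ks, ls, ds, b, c) = z'"
   using assms b c by (auto simp: z' day_indices_deg_iff shuffle_index_def)
  fix z assume "z \<in> Z k l d & shuffle_index h h' z = z'"
  then show "z = (ks, ls, ds, b, c)"
   using bu cu by (cases z) (auto simp: z' day_indices_deg_iff shuffle_index_def)
 qed
qed

lemma shuffle_index_comp:
 assumes "shuffles z g g'"
 shows "shuffle_index g g' (shuffle_index h h' z) = shuffle_index (%i. h i \<circ> g i) (%i. h' i \<circ> g' i) z"
 using assms by (cases z) (auto simp: shuffle_index_def shuffles_def block_shuffle_comp)

lemma shuffle_set_cong: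
 assumes "shuffle_index h h' z = z'"
 shows "shuffle_set z = shuffle_set z'" "shuffles z = shuffles z'" "tensor_act z = tensor_act z'" "spaces z = spaces z'"
 unfolding assms[symmetric] by simp_all

lemma orbit_extension_in_Y:
 assumes z: "z \<in> Z k l d" and w: "w \<in> tensor s (spaces z)"
 shows "orbit_extension z w \<in> Y k l d"
 unfolding Y_iff
proof (intro conjI ballI allI impI)
 fix z' assume z': "z' \<in> Z k l d"
 have trm: "(if shuffle_index h h' z = z' then tensor_act z h h' w else 0) \<in> tensor s (spaces z')"
  if "(h, h') \<in> shuffle_set z" for h h'
  using shuffle_set_cong(4)[of h h' z z'] lin_mapsD(2)[OF tensor_act_lin_maps[OF z shuffle_set_shuffles[OF that]] w]
  by (auto simp: subsp_0[OF subsp_tensor])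
 show "orbit_extension z w z' \<in> tensor s (spaces z')"
  unfolding orbit_extension_def using trm by (intro subsp_sum[OF subsp_tensor]) auto
 fix g g' assume g: "shuffles z' g g'"
 note lin = lin_mapsD(1)[OF tensor_act_lin_maps[OF z' g]]
 show "orbit_extension z w (shuffle_index g g' z') = tensor_act z' g g' (orbit_extension z w z')"
 proof (cases "\<exists>(h, h')\<in>shuffle_set z. shuffle_index h h' z = z' \<or> shuffle_index h h' z = shuffle_index g g' z'")
  case False
  then have "orbit_extension z w (shuffle_index g g' z') = 0" "orbit_extension z w z' = 0"
   unfolding orbit_extension_def by (auto intro!: sum.neutral)
  then show ?thesis using linear_on_0[OF subsp_tensor vector_space_fscale lin] by simp
 next
  case True
  then obtain h h' where "shuffle_index h h' z = z' \<or> shuffle_index h h' z = shuffle_index g g' z'" by auto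
  then have eq: "shuffle_set z = shuffle_set z'" "shuffles z = shuffles z'" "tensor_act z = tensor_act z'"
   using shuffle_set_cong(1-3)[of h h' z z'] shuffle_set_cong(1-3)[of h h' z "shuffle_index g g' z'"]
   by (simp_all del: split_paired_All) (metis spaces_shuffle(2,3,7))+
  obtain ks ls ds b c where zz: "z = (ks, ls, ds, b, c)" by (cases z)
  have len: "length ks = p" "length ls = p" using z by (auto simp: zz day_indices_deg_iff)
  have gz: "shuffles z g g'" using g eq by simp
  then have gb: "block_perms ks g" "block_perms ls g'" by (auto simp: zz shuffles_def)
  let ?f = "map_prod (%h. \<lambda>i\<in>{..<length ks}. h i \<circ> g i) (%h. \<lambda>i\<in>{..<length ls}. h i \<circ> g' i)"
  have bij: "bij_betw ?f (shuffle_set z) (shuffle_set z)"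
   unfolding zz shuffle_set_def using bij_betw_map_prod[OF bij_block_perm_set[OF gb(1)] bij_block_perm_set[OF gb(2)]]
   by simp
  have "orbit_extension z w (shuffle_index g g' z') =
   (\<Sum>hh\<in>shuffle_set z. case ?f hh of (h, h') =>
    if shuffle_index h h' z = shuffle_index g g' z' then tensor_act z h h' w else 0)"
   unfolding orbit_extension_def by (rule sum.reindex_bij_betw[OF bij, symmetric])
  also have "... = (\<Sum>(h, h')\<in>shuffle_set z.
    tensor_act z' g g' (if shuffle_index h h' z = z' then tensor_act z h h' w else 0))"
  proof (rule sum.cong[OF refl], clarify)
   fix h h' assume hh: "(h, h') \<in> shuffle_set z"
   let ?h = "\<lambda>i\<in>{..<length ks}. h i \<circ> g i" and ?h' = "\<lambda>i\<in>{..<length ls}. h' i \<circ> g' i"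
   have sh: "shuffles z h h'" using shuffle_set_shuffles[OF hh] .
   have 1: "shuffle_index ?h ?h' z = shuffle_index g g' (shuffle_index h h' z)"
    unfolding shuffle_index_comp[OF gz]
    by (auto simp: zz shuffle_index_def blocks_iff intro!: block_shuffle_cong)
   have "tensor_act z ?h ?h' w = tensor_act z (%i. h i \<circ> g i) (%i. h' i \<circ> g' i) w"
    by (intro fun_cong[OF tensor_act_cong]) (auto simp: len)
   also have "... = tensor_act z g g' (tensor_act z h h' w)"
    by (rule tensor_act_comp[OF z sh gz w, symmetric])
   finally have 2: "tensor_act z ?h ?h' w = tensor_act z' g g' (tensor_act z h h' w)" by (simp add: eq)
   have 3: "shuffle_index g g' (shuffle_index h h' z) = shuffle_index g g' z' \<longleftrightarrow> shuffle_index h h' z = z'"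
    using shuffle_index_unique[OF shuffle_index_in[OF z' g], of g g'] g z' shuffle_index_in[OF z sh] by auto
   show "(case ?f (h, h') of (h, h') =>
     if shuffle_index h h' z = shuffle_index g g' z' then tensor_act z h h' w else 0) =
    tensor_act z' g g' (if shuffle_index h h' z = z' then tensor_act z h h' w else 0)"
    using linear_on_0[OF subsp_tensor vector_space_fscale lin] by (simp add: 1 2 3)
  qed
  also have "... = tensor_act z' g g' (orbit_extension z w z')"
   unfolding orbit_extension_def split_def
   by (rule linear_on_sum[OF subsp_tensor vector_space_fscale lin, symmetric]) (use trm in \<open>auto simp: split_def\<close>)
  finally show ?thesis .
 qed
next
 fix z' assume "z' \<notin> Z k l d"
 then show "orbit_extension z w z' = 0"
  unfolding orbit_extension_def using shuffle_index_in[OF z shuffle_set_shuffles]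
  by (auto intro!: sum.neutral)
qed

lemma orbit_extension_linear:
 assumes z: "z \<in> Z k l d"
 shows "orbit_extension z \<in> lin_maps fscale (tensor s (spaces z)) day_scale (Y k l d)"
proof (rule lin_mapsI)
 have lin: "linear_on fscale fscale (tensor s (spaces z)) (tensor_act z h h')" if "(h, h') \<in> shuffle_set z" for h h'
  using lin_mapsD(1)[OF tensor_act_lin_maps[OF z shuffle_set_shuffles[OF that]]] .
 show "linear_on fscale day_scale (tensor s (spaces z)) (orbit_extension z)"
  unfolding linear_on_def
 proof (intro conjI ballI allI)
  fix x y assume xy: "x \<in> tensor s (spaces z)" "y \<in> tensor s (spaces z)"
  have "orbit_extension z (x + y) z' = orbit_extension z x z' + orbit_extension z y z'" for z'
   using lin xy unfolding orbit_extension_def sum.distrib[symmetric]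
   by (intro sum.cong) (auto simp: linear_on_def)
  then show "orbit_extension z (x + y) = orbit_extension z x + orbit_extension z y" by (simp add: fun_eq_iff)
 next
  fix c x assume x: "x \<in> tensor s (spaces z)"
  have "orbit_extension z (fscale c x) z' = day_scale c (orbit_extension z x) z'" for z'
   using lin x unfolding orbit_extension_def day_scale_apply module.scale_sum_right[OF vs_module[OF vector_space_fscale]]
   by (intro sum.cong) (auto simp: linear_on_def module.scale_zero_right[OF vs_module[OF vector_space_fscale]])
  then show "orbit_extension z (fscale c x) = day_scale c (orbit_extension z x)" by (rule ext)
 qed
qed (rule orbit_extension_in_Y[OF z])

lemma Y_expand:
 assumes xi: "xi \<in> Y k l d"
 shows "xi = (\<Sum>z\<in>Z k l d. day_scale (1 / of_nat (card (shuffle_set z))) (orbit_extension z (xi z)))"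
proof
 fix z'
 show "xi z' = (\<Sum>z\<in>Z k l d. day_scale (1 / of_nat (card (shuffle_set z))) (orbit_extension z (xi z))) z'"
 proof (cases "z' \<in> Z k l d")
  case False
  then have "day_scale (1 / of_nat (card (shuffle_set z))) (orbit_extension z (xi z)) z' = 0" if "z \<in> Z k l d" for z
   using YD(3)[OF orbit_extension_in_Y[OF that YD(1)[OF xi that]] False]
   by (simp add: day_scale_apply module.scale_zero_right[OF vs_module[OF vector_space_fscale]])
  then show ?thesis using YD(3)[OF xi False] by (simp add: sum_apply)
 next
  case z': True
  interpret t: vector_space "fscale :: 'k => ('k, 'v) tensor => _" by (rule vector_space_fscale)
  let ?c = "1 / of_nat (card (shuffle_set z')) :: 'k"
  have "day_scale (1 / of_nat (card (shuffle_set z))) (orbit_extension z (xi z)) z' =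
   (\<Sum>(h, h')\<in>shuffle_set z'. if shuffle_index h h' z = z' then fscale ?c (xi z') else 0)" if z: "z \<in> Z k l d" for z
  proof (cases "shuffle_set z = shuffle_set z'")
   case True
   have "tensor_act z h h' (xi z) = xi z'" if "(h, h') \<in> shuffle_set z" "shuffle_index h h' z = z'" for h h'
    using YD(2)[OF xi z shuffle_set_shuffles[OF that(1)]] that(2) by simp
   then show ?thesis
    unfolding day_scale_apply orbit_extension_def t.scale_sum_right True
    by (intro sum.cong) (auto simp: True)
  next
   case False
   then have "shuffle_index h h' z ~= z'" for h h' using shuffle_set_cong(1)[of h h' z z'] by blast
   then show ?thesis by (simp add: day_scale_apply orbit_extension_def split_def)
  qed
  then have "(\<Sum>z\<in>Z k l d. day_scale (1 / of_nat (card (shuffle_set z))) (orbit_extension z (xi z))) z' =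
   (\<Sum>(h, h')\<in>shuffle_set z'. \<Sum>z\<in>Z k l d. if shuffle_index h h' z = z' then fscale ?c (xi z') else 0)"
   by (simp add: sum_apply split_def sum.swap[of _ "Z k l d"])
  also have "... = (\<Sum>hh\<in>shuffle_set z'. fscale ?c (xi z'))"
  proof (rule sum.cong[OF refl], clarify)
   fix h h' assume "(h, h') \<in> shuffle_set z'"
   then obtain z where z: "z \<in> Z k l d" "shuffle_index h h' z = z'"
    and u: "!!y. y \<in> Z k l d ==> shuffle_index h h' y = z' ==> y = z"
    using shuffle_index_unique[OF z' shuffle_set_shuffles] by blast
   have "(\<Sum>y\<in>Z k l d. if shuffle_index h h' y = z' then fscale ?c (xi z') else 0) =
    (\<Sum>y\<in>Z k l d. if y = z then fscale ?c (xi z') else 0)"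
   proof (rule sum.cong[OF refl])
    fix y assume "y \<in> Z k l d"
    then have "shuffle_index h h' y = z' \<longleftrightarrow> y = z" using z(2) u[of y] by blast
    then show "(if shuffle_index h h' y = z' then fscale ?c (xi z') else 0) =
     (if y = z then fscale ?c (xi z') else 0)" by simp
   qed
   also have "... = fscale ?c (xi z')" using z(1) by (simp add: finite_day_indices_deg)
   finally show "(\<Sum>y\<in>Z k l d. if shuffle_index h h' y = z' then fscale ?c (xi z') else 0) = fscale ?c (xi z')" .
  qed
  also have "... = xi z'"
   using card_shuffle_set_nz[of z'] by (intro ext) (simp add: sum_apply pscale_def)
  finally show ?thesis by simp
 qed
qed

lemma has_trace_Y:
 assumes T: "T \<in> lin_maps day_scale (Y k l d) day_scale (Y k l d)"
  and fin: "!!z. z \<in> Z k l d ==> \<exists>t. has_trace fscale (tensor s (spaces z)) (%x. x) t"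
  and tr: "!!z. z \<in> Z k l d ==> has_trace fscale (tensor s (spaces z)) (%w. T (orbit_extension z w) z) (t z)"
 shows "has_trace day_scale (Y k l d) T (\<Sum>z\<in>Z k l d. (1 / of_nat (card (shuffle_set z))) * t z)"
proof -
 interpret D: vector_space "day_scale :: 'k => ('k, 'v) day => _" by (rule vs_day_scale)
 have lin0: "(%w. T (orbit_extension z w)) \<in> lin_maps fscale (tensor s (spaces z)) day_scale (Y k l d)"
  if "z \<in> Z k l d" for z by (rule lin_maps_comp[OF orbit_extension_linear[OF that] T])
 have ev: "(%xi. xi z) \<in> lin_maps day_scale (Y k l d) fscale (tensor s (spaces z))" if "z \<in> Z k l d" for z
  using YD(1) that by (auto simp: lin_maps_def linear_on_def day_scale_apply)
 have piece: "has_trace day_scale (Y k l d) (%xi. day_scale (1 / of_nat (card (shuffle_set z)))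
   (T (orbit_extension z (xi z)))) (1 / of_nat (card (shuffle_set z)) * t z)" if z: "z \<in> Z k l d" for z
 proof -
  obtain t0 where "has_trace fscale (tensor s (spaces z)) (%x. x) t0" using fin[OF z] by blast
  then obtain n phi v where *: "!!i. i < n ==> linear_on fscale (*) (tensor s (spaces z)) (phi i)"
   "!!i. i < (n::nat) ==> v i \<in> tensor s (spaces z)"
   "!!x. x \<in> tensor s (spaces z) ==> x = (\<Sum>i<n. fscale (phi i x) (v i))"
   by (rule has_traceE) blast
  have exp: "T (orbit_extension z w) = (\<Sum>i<n. day_scale (phi i w) (T (orbit_extension z (v i))))"
   if "w \<in> tensor s (spaces z)" for w
   using linear_on_lincomb[OF subsp_tensor D.vector_space_axioms lin_mapsD(1)[OF lin0[OF z]], of "{..<n}" v "%i. phi i w"]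
    * that by simp
  have "has_trace fscale (tensor s (spaces z)) (%w. T (orbit_extension z w) z)
    (\<Sum>i<n. phi i (T (orbit_extension z (v i)) z))"
  proof (rule has_traceI[of "{..<n}" _ _ phi])
   show "T (orbit_extension z (v i)) z \<in> tensor s (spaces z)" if "i \<in> {..<n}" for i
    using lin_mapsD(2)[OF lin0[OF z] *(2)] that by (intro YD(1)[OF _ z]) auto
   show "T (orbit_extension z w) z = (\<Sum>i<n. fscale (phi i w) (T (orbit_extension z (v i)) z))"
    if "w \<in> tensor s (spaces z)" for w
    unfolding exp[OF that] sum_apply day_scale_apply ..
  qed (use *(1) in auto)
  then have t: "t z = (\<Sum>i<n. phi i (T (orbit_extension z (v i)) z))"
   using has_trace_unique[OF subsp_tensor tr[OF z]] by blast
  have "has_trace day_scale (Y k l d) (%xi. T (orbit_extension z (xi z))) (t z)"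
   unfolding t
  proof (rule has_traceI[of "{..<n}" _ _ "%i xi. phi i (xi z)"])
   show "linear_on day_scale (*) (Y k l d) (%xi. phi i (xi z))" if "i \<in> {..<n}" for i
    using that * by (intro linear_on_comp[OF ev[OF z]]) auto
   show "T (orbit_extension z (v i)) \<in> Y k l d" if "i \<in> {..<n}" for i
    using lin_mapsD(2)[OF lin0[OF z] *(2)] that by auto
   show "T (orbit_extension z (xi z)) = (\<Sum>i<n. day_scale (phi i (xi z)) (T (orbit_extension z (v i))))"
    if "xi \<in> Y k l d" for xi by (rule exp[OF YD(1)[OF that z]])
  qed auto
  then show ?thesis by (rule has_trace_scale[OF D.vector_space_axioms])
 qed
 have "has_trace day_scale (Y k l d) (%xi. \<Sum>z\<in>Z k l d. day_scale (1 / of_nat (card (shuffle_set z)))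
   (T (orbit_extension z (xi z)))) (\<Sum>z\<in>Z k l d. (1 / of_nat (card (shuffle_set z))) * t z)"
  by (rule has_trace_sum[OF finite_day_indices_deg piece])
 moreover have "T xi = (\<Sum>z\<in>Z k l d. day_scale (1 / of_nat (card (shuffle_set z))) (T (orbit_extension z (xi z))))"
  if "xi \<in> Y k l d" for xi
  using linear_on_lincomb[OF subsp_Y D.vector_space_axioms lin_mapsD(1)[OF T], of "Z k l d"
    "%z. orbit_extension z (xi z)" "%z. 1 / of_nat (card (shuffle_set z))"] Y_expand[OF that]
   orbit_extension_in_Y[OF _ YD(1)[OF that]] by simp
 ultimately show ?thesis by (rule has_trace_cong)
qed

definition fin_pieces :: bool where
 "fin_pieces \<longleftrightarrow> (\<forall>i<p. \<forall>k l d. finite_dim s (bpiece (Ns ! i) k l d))"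

lemma is_basis_spaces:
 assumes "fin_pieces" "i < p"
 shows "is_basis s (spaces z ! i) (basis_of s (spaces z ! i)) (coord_of s (spaces z ! i))"
proof (rule is_basis_of[OF subsp_spaces[OF assms(2)]])
 obtain ks ls ds b c where "z = (ks, ls, ds, b, c)" by (cases z)
 then show "finite_dim s (spaces z ! i)" using assms by (simp add: fin_pieces_def spaces_nth)
qed

definition block_trace :: "(nat => nat) => day_index => (nat => nat => nat) => (nat => nat => nat) => 'k" where
 "block_trace rho z h h' = (\<Sum>e\<in>Pi\<^sub>E {..<p} (%i. basis_of s (spaces z ! i)).
   \<Prod>i<p. coord_of s (spaces z ! i) (e i) (block_act z h h' (rho i) (e (rho i))))"

lemma has_trace_perm_act:
 assumes fin: fin_pieces and rho: "permutes_factors rho" and z: "z \<in> Z k l d" and h: "shuffles z h h'"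
  and sp: "spaces (permute_index rho z) = spaces z"
 shows "has_trace fscale (tensor s (spaces z)) (%w. perm_op rho z (tensor_act z h h' w)) (block_trace rho z h h')"
proof -
 have p: "rho permutes {..<p}" using rho by (simp add: permutes_factors_def)
 have ri: "rho i < p" if "i < p" for i using permutes_in_image[OF p, of i] that by simp
 obtain ks ls ds b c where zz: "z = (ks, ls, ds, b, c)" by (cases z)
 have spr: "spaces z ! rho i = spaces z ! i" if i: "i < p" for i
 proof -
  have "permute_list (inv_into UNIV rho) xs ! rho i = xs ! i" if "length xs = p" for xs :: "nat list"
   using permute_list_nth[of "inv_into UNIV rho" xs "rho i"] permutes_inv[OF p] ri[OF i] that
   by (simp add: permutes_inverses[OF p])
  then have "spaces (permute_index rho z) ! rho i = spaces z ! i"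
   using i ri z rho by (simp add: zz permute_index_def Let_def spaces_nth day_indices_deg_iff permutes_factors_def)
  then show ?thesis by (simp add: sp)
 qed
 have m: "permute_list rho \<in> multi_maps s (spaces z) (spaces z)" using perm_multi[OF rho z] sp by simp
 let ?f = "%vs. permute_list rho (place_map p id (block_act z h h') vs)"
 note basis = is_basis_spaces[OF fin, of _ z, unfolded is_basis_def]
 have act: "block_act z h h' (rho i) \<in> lin_maps s (spaces z ! rho i) s (spaces z ! i)" if "i < p" for i
  using block_act_lin_maps[OF z h ri[OF that]] spr[OF that] by simp
 have "has_trace fscale (tensor s (spaces z)) (tensor_op s (spaces z) ?f) (block_trace rho z h h')"
  unfolding block_trace_def
 proof (rule has_trace_tensor_op[OF p length_spaces subsp_spaces, where w = "%_ e. e" and J = "%i. basis_of s (spaces z ! i)"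
    and theta = "%i e x. coord_of s (spaces z ! i) e (block_act z h h' (rho i) x)" and F = "%i. block_act z h h' (rho i)"])
  show "?f us = place_map p rho (%i. block_act z h h' (rho i)) us" if "length us = p" for us
   using that ri by (auto simp: place_map_def permute_list_def)
  show "linear_on s (*) (spaces z ! rho i) (%x. coord_of s (spaces z ! i) e (block_act z h h' (rho i) x))"
   if "i < p" "e \<in> basis_of s (spaces z ! i)" for i e
   using that basis[of i] by (intro linear_on_comp[OF act]) auto
  show "block_act z h h' (rho i) x = (\<Sum>e\<in>basis_of s (spaces z ! i). s (coord_of s (spaces z ! i) e (block_act z h h' (rho i) x)) e)"
   if "i < p" "x \<in> spaces z ! rho i" for i x
   using basis[OF that(1)] lin_mapsD(2)[OF act[OF that(1)] that(2)] by blast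
  show "e \<in> spaces z ! i" if "i < p" "e \<in> basis_of s (spaces z ! i)" for i e
   using that basis[OF that(1)] by blast
  show "finite (basis_of s (spaces z ! i))" if "i < p" for i using basis[OF that] by blast
 qed (use act in auto)
 then show ?thesis
  unfolding perm_op_def tensor_act_def tensor_op_comp[OF m] .
qed

lemma permutes_factors_id: "permutes_factors id"
 by (simp add: permutes_factors_def permutes_id)

lemma fin_tensor:
 assumes fin: fin_pieces and z: "z \<in> Z k l d"
 shows "\<exists>t. has_trace fscale (tensor s (spaces z)) (%x. x) t"
proof -
 obtain ks ls ds b c where zz: "z = (ks, ls, ds, b, c)" by (cases z)
 have sh: "shuffles z (%_. id) (%_. id)" by (simp add: zz shuffles_def block_perms_def permutes_id)
 have sp: "spaces (permute_index id z) = spaces z"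
  by (simp add: zz permute_index_def Let_def spaces_def)
 have "perm_op id z w = w" if "w \<in> tensor s (spaces z)" for w
  using perm_multi[OF permutes_factors_id z] that sp unfolding perm_op_def by (intro tensor_op_id) auto
 then have "perm_op id z (tensor_act z (%_. id) (%_. id) w) = w" if "w \<in> tensor s (spaces z)" for w
  using tensor_act_id[OF z that] that by simp
 then show ?thesis
  using has_trace_cong[OF has_trace_perm_act[OF fin permutes_factors_id z sh sp], of "%x. x"] by auto
qed

lemma has_trace_day:
 assumes fin: fin_pieces and rho: "permutes_factors rho" and g: "g permutes {..<k}" "g' permutes {..<l}"
 shows "has_trace day_scale (Y k l d) (%xi. bact (bisym_tensor s Ns) k l d g g' (permute_factors s Ns k l rho xi))
  (\<Sum>z\<in>Z k l d. (1 / of_nat (card (shuffle_set z))) * (index_sign rho z *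
   (\<Sum>(h, h')\<in>shuffle_set z.
    if shuffle_index h h' z = permute_index rho (act_index g g' z) then block_trace rho z h h' else 0)))"
proof (rule has_trace_Y[OF lin_maps_comp[OF permute_factors_lin_maps[OF rho] bact_lin_maps[OF g]] fin_tensor[OF fin]])
 fix z assume z: "z \<in> Z k l d"
 have p: "rho permutes {..<p}" using rho by (simp add: permutes_factors_def)
 note az = act_index_in[OF z g]
 let ?u = "permute_index rho (act_index g g' z)"
 have inv: "index_sign rho (act_index g g' z) = index_sign rho z" "perm_op rho (act_index g g' z) = perm_op rho z"
  by (auto simp: index_sign_def act_index_def perm_op_def spaces_def split: prod.splits)
 have u: "?u = act_index g g' (permute_index rho z)" by (rule permute_act_index[OF p z])
 have eq: "bact (bisym_tensor s Ns) k l d g g' (permute_factors s Ns k l rho (orbit_extension z w)) z =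
   (fscale (index_sign rho z) (\<Sum>(h, h')\<in>shuffle_set z. if shuffle_index h h' z = ?u
    then perm_op rho z (tensor_act z h h' w) else 0))" if w: "w \<in> tensor s (spaces z)" for w
 proof -
  note oY = orbit_extension_in_Y[OF z w]
  have "bact (bisym_tensor s Ns) k l d g g' (permute_factors s Ns k l rho (orbit_extension z w)) z =
   fscale (index_sign rho z) (perm_op rho z (orbit_extension z w ?u))"
   using z az by (simp add: bact_Y[OF permute_factors_in_Y[OF rho oY]] permute_factors_Y[OF oY rho] inv)
  also have "perm_op rho z (orbit_extension z w ?u) =
   (\<Sum>hh\<in>shuffle_set z. perm_op rho z (case hh of (h, h') => if shuffle_index h h' z = ?u then tensor_act z h h' w else 0))"
   unfolding orbit_extension_def
  proof (rule linear_on_sum[OF subsp_tensor vector_space_fscale lin_mapsD(1)[OF perm_op_lin_maps[OF rho z]]], clarify)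
   fix h h' assume hh: "(h, h') \<in> shuffle_set z"
   have "spaces z = spaces (permute_index rho z)" if "shuffle_index h h' z = ?u"
    using shuffle_set_cong(4)[OF that] by (simp add: u)
   then show "(if shuffle_index h h' z = ?u then tensor_act z h h' w else 0) \<in> tensor s (spaces (permute_index rho z))"
    using lin_mapsD(2)[OF tensor_act_lin_maps[OF z shuffle_set_shuffles[OF hh]] w]
    by (auto simp: subsp_0[OF subsp_tensor])
  qed
  also have "... = (\<Sum>(h, h')\<in>shuffle_set z. if shuffle_index h h' z = ?u
    then perm_op rho z (tensor_act z h h' w) else 0)"
   using perm_op_0[OF rho z] by (intro sum.cong) auto
  finally show ?thesis .
 qed
 have tr: "has_trace fscale (tensor s (spaces z))
   (%w. case hh of (h, h') => if shuffle_index h h' z = ?u then perm_op rho z (tensor_act z h h' w) else 0)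
   (case hh of (h, h') => if shuffle_index h h' z = ?u then block_trace rho z h h' else 0)"
  if hh: "hh \<in> shuffle_set z" for hh
 proof -
  obtain h h' where hh': "hh = (h, h')" by (cases hh)
  show ?thesis
  proof (cases "shuffle_index h h' z = ?u")
   case True
   have "spaces (permute_index rho z) = spaces z" using shuffle_set_cong(4)[OF True] by (simp add: u)
   then show ?thesis
    using has_trace_perm_act[OF fin rho z shuffle_set_shuffles[OF hh[unfolded hh']]] True by (simp add: hh')
  qed (simp add: hh' has_trace_0)
 qed
 have "has_trace fscale (tensor s (spaces z))
   (%w. fscale (index_sign rho z) (\<Sum>(h, h')\<in>shuffle_set z. if shuffle_index h h' z = ?u
    then perm_op rho z (tensor_act z h h' w) else 0))
   (index_sign rho z * (\<Sum>(h, h')\<in>shuffle_set z. if shuffle_index h h' z = ?u then block_trace rho z h h' else 0))"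
  by (intro has_trace_scale[OF vector_space_fscale] has_trace_sum finite_shuffle_set tr)
 then show "has_trace fscale (tensor s (spaces z))
   (%w. bact (bisym_tensor s Ns) k l d g g' (permute_factors s Ns k l rho (orbit_extension z w)) z)
   (index_sign rho z * (\<Sum>(h, h')\<in>shuffle_set z. if shuffle_index h h' z = ?u then block_trace rho z h h' else 0))"
  by (rule has_trace_cong) (rule eq)
qed

end

section \<open>Traces of block permutations as sums over words\<close>

lemma card_blocks: "card (blocks ks) = sum_list ks"
 by (simp add: blocks_def sum_list_sum_nth atLeast0LessThan)

text \<open>The group \<open>\<SS>\<^sub>k\<close> acts simply transitively on the labellings.\<close>

lemma labellings_torsor:
 assumes "b \<in> labellings ks k" "b' \<in> labellings ks k"
 shows "\<exists>!g. g \<in> perms k & (\<lambda>x\<in>blocks ks. g (b x)) = b'"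
proof -
 have bij: "bij_betw b (blocks ks) {..<k}" "bij_betw b' (blocks ks) {..<k}"
  and ext: "b' \<in> extensional (blocks ks)" using assms by (auto simp: labellings_def)
 let ?c = "inv_into (blocks ks) b"
 define g where "g y = (if y < k then b' (?c y) else y)" for y
 have "bij_betw (b' \<circ> ?c) {..<k} {..<k}"
  by (rule bij_betw_trans[OF bij_betw_inv_into[OF bij(1)] bij(2)])
 then have "bij_betw g {..<k} {..<k}" by (rule bij_betw_cong[THEN iffD1, rotated]) (simp add: g_def)
 then have g: "g permutes {..<k}" by (rule bij_imp_permutes) (simp add: g_def)
 have lt: "b x < k" if "x \<in> blocks ks" for x using bij(1) that by (auto simp: bij_betw_def)
 have gb: "(\<lambda>x\<in>blocks ks. g (b x)) = b'"
  using ext lt bij_betw_inv_into_left[OF bij(1)] by (auto simp: g_def fun_eq_iff extensional_def)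
 show ?thesis
 proof (rule ex1I[of _ g])
  show "g \<in> perms k & (\<lambda>x\<in>blocks ks. g (b x)) = b'" using g gb by (simp add: perms_iff)
  fix f assume f: "f \<in> perms k & (\<lambda>x\<in>blocks ks. f (b x)) = b'"
  show "f = g"
  proof
   fix y
   show "f y = g y"
   proof (cases "y < k")
    case True
    then have "y \<in> b ` blocks ks" using bij(1) by (simp add: bij_betw_def)
    then obtain x where x: "x \<in> blocks ks" "y = b x" by blast
    then have "f (b x) = b' x" using f by (metis restrict_apply')
    then show ?thesis using x True bij_betw_inv_into_left[OF bij(1)] by (simp add: g_def)
   next
    case False
    then show ?thesis using f permutes_not_in[of f "{..<k}" y] by (simp add: g_def perms_iff)
   qed
  qed
 qed
qed

lemma card_labellings:
 assumes "sum_list ks = k"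
 shows "card (labellings ks k) = fact k"
proof -
 have "finite (blocks ks)" by (auto simp: blocks_def)
 then obtain f where "bij_betw f (blocks ks) {..<k}"
  using finite_same_card_bij[of "blocks ks" "{..<k}"] card_blocks[of ks] assms by auto
 then have "bij_betw (restrict f (blocks ks)) (blocks ks) {..<k}"
  by (rule bij_betw_cong[THEN iffD1, rotated]) simp
 then have b: "restrict f (blocks ks) \<in> labellings ks k" by (simp add: labellings_def)
 let ?b = "restrict f (blocks ks)"
 have "bij_betw (%g. \<lambda>x\<in>blocks ks. g (?b x)) (perms k) (labellings ks k)"
  unfolding bij_betw_def
 proof
  have in_l: "(\<lambda>x\<in>blocks ks. g (?b x)) \<in> labellings ks k" if "g \<in> perms k" for g
   using act_label_in[OF b] that by (simp add: perms_iff)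
  show "inj_on (%g. \<lambda>x\<in>blocks ks. g (?b x)) (perms k)"
   using labellings_torsor[OF b in_l] by (intro inj_onI) blast
  show "(%g. \<lambda>x\<in>blocks ks. g (?b x)) ` perms k = labellings ks k"
   using in_l labellings_torsor[OF b] by blast
 qed
 then show ?thesis using bij_betw_same_card by fastforce
qed

lemma sum_words_blocks:
 assumes b: "b \<in> labellings ks k"
 shows "(\<Sum>w\<in>{..<k} \<rightarrow>\<^sub>E {..<r::nat}. F w) =
  (\<Sum>u\<in>Pi\<^sub>E {..<length ks} (%i. {..<ks ! i} \<rightarrow>\<^sub>E {..<r}).
    F (\<lambda>y\<in>{..<k}. case inv_into (blocks ks) b y of (i, j) => u i j))"
proof -
 have bij: "bij_betw b (blocks ks) {..<k}" using b by (simp add: labellings_def)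
 let ?c = "inv_into (blocks ks) b"
 have c: "?c y \<in> blocks ks" "b (?c y) = y" if "y < k" for y
  using bij_betwE[OF bij_betw_inv_into[OF bij]] bij_betw_inv_into_right[OF bij] that by auto
 have lt: "b x < k" "?c (b x) = x" if "x \<in> blocks ks" for x
  using bij_betwE[OF bij] bij_betw_inv_into_left[OF bij] that by auto
 show ?thesis
 proof (rule sum.reindex_bij_witness[where i = "%u. \<lambda>y\<in>{..<k}. case ?c y of (i, j) => u i j"
    and j = "%w. \<lambda>i\<in>{..<length ks}. \<lambda>j\<in>{..<ks ! i}. w (b (i, j))"])
  fix w assume w: "w \<in> {..<k} \<rightarrow>\<^sub>E {..<r}"
  show "(\<lambda>y\<in>{..<k}. case ?c y of (i, j) => (\<lambda>i\<in>{..<length ks}. \<lambda>j\<in>{..<ks ! i}. w (b (i, j))) i j) = w"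
  proof
   fix y
   show "(\<lambda>y\<in>{..<k}. case ?c y of (i, j) => (\<lambda>i\<in>{..<length ks}. \<lambda>j\<in>{..<ks ! i}. w (b (i, j))) i j) y = w y"
   proof (cases "y < k")
    case True
    then show ?thesis using c[OF True] by (cases "?c y") (auto simp: blocks_iff)
   next
    case False
    then show ?thesis using w by (simp add: PiE_def extensional_def)
   qed
  qed
  then show "F (\<lambda>y\<in>{..<k}. case ?c y of (i, j) => (\<lambda>i\<in>{..<length ks}. \<lambda>j\<in>{..<ks ! i}. w (b (i, j))) i j) = F w"
   by simp
  show "(\<lambda>i\<in>{..<length ks}. \<lambda>j\<in>{..<ks ! i}. w (b (i, j))) \<in> Pi\<^sub>E {..<length ks} (%i. {..<ks ! i} \<rightarrow>\<^sub>E {..<r})"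
   using w lt(1) by (auto simp: PiE_iff blocks_iff)
 next
  fix u assume u: "u \<in> Pi\<^sub>E {..<length ks} (%i. {..<ks ! i} \<rightarrow>\<^sub>E {..<r})"
  show "(\<lambda>i\<in>{..<length ks}. \<lambda>j\<in>{..<ks ! i}. (\<lambda>y\<in>{..<k}. case ?c y of (i, j) => u i j) (b (i, j))) = u"
  proof (intro ext)
   fix i j
   show "(\<lambda>i\<in>{..<length ks}. \<lambda>j\<in>{..<ks ! i}. (\<lambda>y\<in>{..<k}. case ?c y of (i, j) => u i j) (b (i, j))) i j = u i j"
    using u lt[of "(i, j)"] by (auto simp: PiE_iff extensional_def blocks_iff)
  qed
  show "(\<lambda>y\<in>{..<k}. case ?c y of (i, j) => u i j) \<in> {..<k} \<rightarrow>\<^sub>E {..<r}"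
  proof (rule PiE_I)
   fix y assume "y \<in> {..<k}"
   then show "(\<lambda>y\<in>{..<k}. case ?c y of (i, j) => u i j) y \<in> {..<r}"
    using c[of y] u by (cases "?c y") (auto simp: PiE_iff blocks_iff)
  qed simp
 qed
qed

text \<open>
  Given a labelling \<open>b\<close>, a block permutation \<open>rho\<close> and permutations \<open>h\<close> inside the blocks, a unique \<open>g\<close> is
  compatible with them; cut into blocks, the words fixed by \<open>g\<close> are the families of words with
  \<open>u\<^sub>i = u\<^bsub>rho i\<^esub> \<circ> h\<^bsub>rho i\<^esub>\<close>.
\<close>

lemma sum_fixed_word_sum:
 assumes rho: "rho permutes {..<length ks}" and inv: "!!i. i < length ks ==> ks ! rho i = ks ! i"
  and b: "b \<in> labellings ks k" and h: "block_perms ks h"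
 shows "(\<Sum>g\<in>perms k. if relabel rho ks (\<lambda>x\<in>blocks ks. g (b x)) = block_shuffle ks b h
   then fixed_word_sum k r g a else 0) =
  (\<Sum>u\<in>Pi\<^sub>E {..<length ks} (%i. {..<ks ! i} \<rightarrow>\<^sub>E {..<r}). \<Prod>i<length ks.
   if \<forall>j<ks ! i. u i j = u (rho i) (h (rho i) j) then \<Prod>j<ks ! i. a (u (rho i) j) else (0::'k::comm_semiring_1))"
proof -
 let ?n = "length ks" and ?rho' = "inv_into UNIV rho" and ?c = "inv_into (blocks ks) b"
 note invrho = permutes_inv[OF rho]
 have lt: "rho i < ?n" "?rho' i < ?n" if "i < ?n" for i
  using permutes_in_image[OF rho, of i] permutes_in_image[OF invrho, of i] that by auto
 have inv': "ks ! ?rho' i = ks ! i" if "i < ?n" for i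
  using inv[OF lt(2)[OF that]] by (simp add: permutes_inverses[OF rho])
 have pl: "permute_list ?rho' ks = ks"
  using inv' by (intro nth_equalityI) (auto simp: permute_list_nth[OF invrho])
 have bij: "bij_betw b (blocks ks) {..<k}" using b by (simp add: labellings_def)
 have rel: "relabel rho ks b \<in> labellings ks k" using relabel_in[OF b rho] pl by simp
 have blk: "(?rho' i, j) \<in> blocks ks" if "(i, j) \<in> blocks ks" for i j
  using that lt inv' by (auto simp: blocks_iff)
 have releq: "relabel rho ks (\<lambda>x\<in>blocks ks. g (b x)) = (\<lambda>x\<in>blocks ks. g (relabel rho ks b x))" for g
  using blk by (auto simp: relabel_def pl fun_eq_iff)
 obtain g0 where g0: "g0 \<in> perms k" "(\<lambda>x\<in>blocks ks. g0 (relabel rho ks b x)) = block_shuffle ks b h"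
  and uniq: "!!g. g \<in> perms k ==> (\<lambda>x\<in>blocks ks. g (relabel rho ks b x)) = block_shuffle ks b h ==> g = g0"
  using labellings_torsor[OF rel block_shuffle_in[OF b h]] by blast
 have "(\<Sum>g\<in>perms k. if relabel rho ks (\<lambda>x\<in>blocks ks. g (b x)) = block_shuffle ks b h
   then fixed_word_sum k r g a else 0) = (\<Sum>g\<in>perms k. if g = g0 then fixed_word_sum k r g0 a else 0)"
 proof (rule sum.cong[OF refl])
  fix g assume "g \<in> perms k"
  then have "relabel rho ks (\<lambda>x\<in>blocks ks. g (b x)) = block_shuffle ks b h \<longleftrightarrow> g = g0"
   unfolding releq using uniq g0 by blast
  then show "(if relabel rho ks (\<lambda>x\<in>blocks ks. g (b x)) = block_shuffle ks b h
   then fixed_word_sum k r g a else 0) = (if g = g0 then fixed_word_sum k r g0 a else 0)" by simp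
 qed
 also have "... = fixed_word_sum k r g0 a" using g0(1) by simp
 also have "... = (\<Sum>u\<in>Pi\<^sub>E {..<?n} (%i. {..<ks ! i} \<rightarrow>\<^sub>E {..<r}). \<Prod>i<?n.
   if \<forall>j<ks ! i. u i j = u (rho i) (h (rho i) j) then \<Prod>j<ks ! i. a (u (rho i) j) else 0)"
  unfolding fixed_word_sum_def sum_words_blocks[OF b]
 proof (rule sum.cong[OF refl])
  fix u assume u: "u \<in> Pi\<^sub>E {..<?n} (%i. {..<ks ! i} \<rightarrow>\<^sub>E {..<r})"
  define W where "W = (\<lambda>y\<in>{..<k}. case ?c y of (i, j) => u i j)"
  have w: "W (b (i, j)) = u i j" "b (i, j) < k" if "(i, j) \<in> blocks ks" for i j
   using bij_betwE[OF bij] bij_betw_inv_into_left[OF bij that] that by (auto simp: W_def)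
  have g0b: "g0 (b (?rho' i, j)) = b (i, h i j)" if "(i, j) \<in> blocks ks" for i j
   using fun_cong[OF g0(2), of "(i, j)"] that by (simp add: relabel_def pl block_shuffle_def)
  have "(\<forall>y<k. W (g0 y) = W y) \<longleftrightarrow> (\<forall>(i, j)\<in>blocks ks. W (g0 (b (?rho' i, j))) = W (b (?rho' i, j)))"
  proof -
   have "bij_betw (relabel rho ks b) (blocks ks) {..<k}" using rel by (simp add: labellings_def)
   then have "{..<k} = relabel rho ks b ` blocks ks" by (simp add: bij_betw_def)
   then have "(\<forall>y\<in>{..<k}. P y) \<longleftrightarrow> (\<forall>x\<in>blocks ks. P (relabel rho ks b x))" for P
    by simp
   from this[of "%y. W (g0 y) = W y"]
   show ?thesis by (auto simp: relabel_def pl)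
  qed
  also have "... \<longleftrightarrow> (\<forall>(i, j)\<in>blocks ks. u i (h i j) = u (?rho' i) j)"
   using g0b w blk block_perms_blocks[OF h] by (intro ball_cong refl) auto
  also have "... \<longleftrightarrow> (\<forall>i<?n. \<forall>j<ks ! i. u i j = u (rho i) (h (rho i) j))"
  proof (intro iffI allI impI)
   fix i j assume *: "\<forall>(i, j)\<in>blocks ks. u i (h i j) = u (?rho' i) j" "i < ?n" "j < ks ! i"
   then have "(rho i, j) \<in> blocks ks" using lt inv by (simp add: blocks_iff)
   with *(1) show "u i j = u (rho i) (h (rho i) j)" by (auto simp: permutes_inverses[OF rho])
  next
   assume *: "\<forall>i<?n. \<forall>j<ks ! i. u i j = u (rho i) (h (rho i) j)"
   show "\<forall>(i, j)\<in>blocks ks. u i (h i j) = u (?rho' i) j"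
   proof clarify
    fix i j assume "(i, j) \<in> blocks ks"
    then have "?rho' i < ?n" "j < ks ! ?rho' i" using lt inv' by (auto simp: blocks_iff)
    with * show "u i (h i j) = u (?rho' i) j" by (simp add: permutes_inverses[OF rho])
   qed
  qed
  finally have cond: "(\<forall>y<k. W (g0 y) = W y) \<longleftrightarrow> (\<forall>i<?n. \<forall>j<ks ! i. u i j = u (rho i) (h (rho i) j))" .
  have "(\<Prod>y<k. a (W y)) = (\<Prod>x\<in>blocks ks. a (W (b x)))"
   by (rule prod.reindex_bij_betw[OF bij, symmetric])
  also have "... = (\<Prod>(i, j)\<in>blocks ks. a (u i j))"
   using w(1) by (intro prod.cong refl) auto
  also have "... = (\<Prod>i<?n. \<Prod>j<ks ! i. a (u i j))"
   unfolding blocks_def by (subst prod.Sigma) auto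
  also have "... = (\<Prod>i<?n. \<Prod>j<ks ! rho i. a (u (rho i) j))"
   by (rule prod.reindex_bij_betw[OF permutes_imp_bij[OF rho], symmetric])
  also have "... = (\<Prod>i<?n. \<Prod>j<ks ! i. a (u (rho i) j))" using inv by (intro prod.cong) auto
  finally have pr: "(\<Prod>y<k. a (W y)) = (\<Prod>i<?n. \<Prod>j<ks ! i. a (u (rho i) j))" .
  show "(if \<forall>y<k. (\<lambda>y\<in>{..<k}. case ?c y of (i, j) => u i j) (g0 y) = (\<lambda>y\<in>{..<k}. case ?c y of (i, j) => u i j) y
    then \<Prod>y<k. a ((\<lambda>y\<in>{..<k}. case ?c y of (i, j) => u i j) y) else 0) =
   (\<Prod>i<?n. if \<forall>j<ks ! i. u i j = u (rho i) (h (rho i) j) then \<Prod>j<ks ! i. a (u (rho i) j) else 0)"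
   unfolding W_def[symmetric] cond pr by (subst prod_if_0) auto
 qed
 finally show ?thesis .
qed

type_synonym 'v letter = "(nat \<times> nat \<times> nat) \<times> 'v \<times> (nat => nat) \<times> (nat => nat)"

definition alphabet ::
 "('k::field => 'v::ab_group_add => 'v) => 'v bisymmetric_seq => nat => nat => (nat \<times> nat \<times> nat) set => 'v letter set" where
 "alphabet s N r q K = (SIGMA (k, l, d):K. basis_of s (bpiece N k l d) \<times> ({..<k} \<rightarrow>\<^sub>E {..<r}) \<times> ({..<l} \<rightarrow>\<^sub>E {..<q}))"

definition letter_weight :: "(nat => 'k::comm_monoid_mult) => (nat => 'k) => 'v letter => 'k" where
 "letter_weight a b = (%((k, l, d), e, u, v). (\<Prod>j<k. a (u j)) * (\<Prod>j<l. b (v j)))"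

text \<open>
  The matrix of the averaging projector onto the \<open>\<SS>\<^sub>k \<times> \<SS>\<^sub>l\<close>-invariants of \<open>N(k, l)\<^sub>d \<otimes> V\<^sup>\<otimes>\<^sup>k \<otimes> W\<^sup>\<otimes>\<^sup>l\<close>, all
  \<open>k\<close>, \<open>l\<close>, \<open>d\<close> taken together.
\<close>

definition letter_proj ::
 "('k::field_char_0 => 'v::ab_group_add => 'v) => 'v bisymmetric_seq => 'v letter => 'v letter => 'k" where
 "letter_proj s N = (%((k, l, d), e, u, v) (t', e', u', v'). if (k, l, d) = t' then
   (1 / (fact k * fact l)) * (\<Sum>h\<in>perms k. \<Sum>h'\<in>perms l.
    coord_of s (bpiece N k l d) e (bact N k l d h h' e') *
    (if \<forall>j<k. u j = u' (h j) then 1 else 0) * (if \<forall>j<l. v j = v' (h' j) then 1 else 0)) else 0)"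

lemma bij_PiE_permute:
 assumes rho: "rho permutes {..<p::nat}" and U: "!!i. i < p ==> U (rho i) = U i"
 shows "bij_betw (%h. \<lambda>i\<in>{..<p}. h (rho i)) (Pi\<^sub>E {..<p} U) (Pi\<^sub>E {..<p} U)"
proof (rule bij_betwI[where g = "%h. \<lambda>i\<in>{..<p}. h (inv_into UNIV rho i)"])
 have lt: "rho i < p" "inv_into UNIV rho i < p" if "i < p" for i
  using permutes_in_image[OF rho, of i] permutes_in_image[OF permutes_inv[OF rho], of i] that by auto
 have U': "U (inv_into UNIV rho i) = U i" if "i < p" for i
  using U[OF lt(2)[OF that]] by (simp add: permutes_inverses[OF rho])
 show "(%h. \<lambda>i\<in>{..<p}. h (inv_into UNIV rho i)) \<in> Pi\<^sub>E {..<p} U \<rightarrow> Pi\<^sub>E {..<p} U"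
 proof
  fix h assume h: "h \<in> Pi\<^sub>E {..<p} U"
  have "h (inv_into UNIV rho i) \<in> U i" if "i < p" for i using h lt(2)[OF that] U'[OF that] by (metis PiE_mem lessThan_iff)
  then show "(\<lambda>i\<in>{..<p}. h (inv_into UNIV rho i)) \<in> Pi\<^sub>E {..<p} U" by auto
 qed
 show "(%h. \<lambda>i\<in>{..<p}. h (rho i)) \<in> Pi\<^sub>E {..<p} U \<rightarrow> Pi\<^sub>E {..<p} U"
 proof
  fix h assume h: "h \<in> Pi\<^sub>E {..<p} U"
  have "h (rho i) \<in> U i" if "i < p" for i using h lt(1)[OF that] U[OF that] by (metis PiE_mem lessThan_iff)
  then show "(\<lambda>i\<in>{..<p}. h (rho i)) \<in> Pi\<^sub>E {..<p} U" by auto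
 qed
 fix h assume "h \<in> Pi\<^sub>E {..<p} U"
 then show "(\<lambda>i\<in>{..<p}. (\<lambda>i\<in>{..<p}. h (rho i)) (inv_into UNIV rho i)) = h"
  "(\<lambda>i\<in>{..<p}. (\<lambda>i\<in>{..<p}. h (inv_into UNIV rho i)) (rho i)) = h"
  by (auto simp: PiE_iff extensional_def fun_eq_iff lt permutes_inverses[OF rho])
qed

lemma sum_perm_families:
 assumes "rho permutes {..<p::nat}" "!!i. i < p ==> T (rho i) = T i"
  "!!i. i < p ==> finite (T i)" "!!i. i < p ==> finite (T' i)" "!!i. i < p ==> T' (rho i) = T' i"
 shows "(\<Sum>h\<in>Pi\<^sub>E {..<p} T. \<Sum>h'\<in>Pi\<^sub>E {..<p} T'. \<Prod>i<p. X i (h (rho i)) (h' (rho i))) =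
  (\<Prod>i<p. \<Sum>x\<in>T i. \<Sum>y\<in>T' i. (X i x y :: 'a::comm_semiring_1))"
proof -
 note bij = bij_PiE_permute[OF assms(1)]
 let ?H = "%h. \<lambda>i\<in>{..<p}. h (rho i)"
 have "(\<Sum>h\<in>Pi\<^sub>E {..<p} T. \<Sum>h'\<in>Pi\<^sub>E {..<p} T'. \<Prod>i<p. X i (h (rho i)) (h' (rho i))) =
  (\<Sum>h\<in>Pi\<^sub>E {..<p} T. \<Sum>h'\<in>Pi\<^sub>E {..<p} T'. \<Prod>i<p. X i (?H h i) (?H h' i))"
  by (intro sum.cong refl prod.cong) auto
 also have "... = (\<Sum>h\<in>Pi\<^sub>E {..<p} T. \<Sum>h'\<in>Pi\<^sub>E {..<p} T'. \<Prod>i<p. X i (?H h i) (h' i))"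
  by (rule sum.cong[OF refl], rule sum.reindex_bij_betw[OF bij[of T', OF assms(5)]])
 also have "... = (\<Sum>h\<in>Pi\<^sub>E {..<p} T. \<Sum>h'\<in>Pi\<^sub>E {..<p} T'. \<Prod>i<p. X i (h i) (h' i))"
  by (rule sum.reindex_bij_betw[OF bij[of T, OF assms(2)]])
 also have "... = (\<Sum>h\<in>Pi\<^sub>E {..<p} T. \<Prod>i<p. \<Sum>y\<in>T' i. X i (h i) y)"
  using assms(4) by (intro sum.cong refl prod_sum_PiE[symmetric]) auto
 also have "... = (\<Prod>i<p. \<Sum>x\<in>T i. \<Sum>y\<in>T' i. X i x y)"
  using assms(3) by (intro prod_sum_PiE[symmetric]) auto
 finally show ?thesis .
qed

definition letter_mat ::
 "('k::field_char_0 => 'v::ab_group_add => 'v) => 'v bisymmetric_seq => (nat => 'k) => (nat => 'k) =>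
  nat => 'v letter => 'v letter => 'k" where
 "letter_mat s N a b n E E' = letter_proj s N E E' * letter_weight a b E' ^ n"

abbreviation letter_deg :: "'v letter => nat" where
 "letter_deg E \<equiv> snd (snd (fst E))"

lemma sum_triple: "(\<Sum>i\<in>I. (f i, g i, h i)) = (sum f I, sum g I, sum h I)"
 by (induction I rule: infinite_finite_induct) (auto simp: zero_prod_def)

lemma mult_if_if:
 "c * ((if P then A else 0) * (if Q then B else 0)) =
  c * (if P then 1 else 0) * (if Q then 1 else 0) * (A * B :: 'a::comm_semiring_1)"
 by (cases P; cases Q) (simp_all add: mult_ac)

lemma sum3_product:
 "sum f A * (sum g B * sum h C) = (\<Sum>(x, y, z)\<in>A \<times> B \<times> C. f x * (g y * h z :: 'a::comm_semiring_0))"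
 by (simp add: sum_product sum.cartesian_product split_def)

context factor_list
begin

definition day_trace :: "(nat => nat) => nat => nat => nat => (nat => nat) => (nat => nat) => 'k" where
 "day_trace rho k l d g g' = (\<Sum>z\<in>Z k l d. (1 / of_nat (card (shuffle_set z))) * (index_sign rho z *
   (\<Sum>(h, h')\<in>shuffle_set z.
    if shuffle_index h h' z = permute_index rho (act_index g g' z) then block_trace rho z h h' else 0)))"

definition word_families :: "nat => nat => nat list \<times> nat list \<times> nat list =>
  ((nat => 'v) \<times> (nat => nat => nat) \<times> (nat => nat => nat)) set" where
 "word_families r q = (%(ks, ls, ds).
   Pi\<^sub>E {..<p} (%i. basis_of s (bpiece (Ns ! i) (ks ! i) (ls ! i) (ds ! i))) \<times>
   Pi\<^sub>E {..<p} (%i. {..<ks ! i} \<rightarrow>\<^sub>E {..<r}) \<times> Pi\<^sub>E {..<p} (%i. {..<ls ! i} \<rightarrow>\<^sub>E {..<q}))"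

definition family_word :: "nat list \<times> nat list \<times> nat list =>
  (nat => 'v) \<times> (nat => nat => nat) \<times> (nat => nat => nat) => nat => 'v letter" where
 "family_word = (%(ks, ls, ds) (e, u, v) i. ((ks ! i, ls ! i, ds ! i), e i, u i, v i))"

definition shapes :: "nat => nat => nat => (nat list \<times> nat list \<times> nat list) set" where
 "shapes k l d = {(ks, ls, ds). length ks = p & length ls = p & length ds = p &
   sum_list ks = k & sum_list ls = l & sum_list ds = d}"

lemma finite_shapes: "finite (shapes k l d)"
proof -
 let ?L = "%k. {ks :: nat list. length ks = p & sum_list ks = k}"
 have "shapes k l d \<subseteq> ?L k \<times> ?L l \<times> ?L d" by (auto simp: shapes_def)
 then show ?thesis by (rule finite_subset) (intro finite_cartesian_product finite_lists_sum)
qed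

lemma finite_basis: "fin_pieces ==> i < p ==> finite (basis_of s (bpiece (Ns ! i) k l d))"
 using is_basis_of[of s "bpiece (Ns ! i) k l d"] vs bisymmetric_sequence.subspace_piece[OF seq]
 by (simp add: fin_pieces_def is_basis_def)

lemma finite_word_families:
 assumes fin_pieces
 shows "finite (word_families r q t)"
proof -
 obtain ks ls ds where t: "t = (ks, ls, ds)" by (cases t)
 show ?thesis
  unfolding t word_families_def case_prod_conv
  by (intro finite_cartesian_product finite_PiE) (auto simp: finite_basis[OF assms])
qed

text \<open>The contribution of one shape, with the sums over the labellings and over \<open>g\<close>, \<open>g'\<close> carried out.\<close>

lemma shape_sum:
 assumes fin: fin_pieces and rho: "permutes_factors rho" and t: "(ks, ls, ds) \<in> shapes k l d"
  and b: "b \<in> labellings ks k" and c: "c \<in> labellings ls l"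
 shows "(\<Sum>g\<in>perms k. \<Sum>g'\<in>perms l. (1 / of_nat (card (shuffle_set (ks, ls, ds, b, c)))) *
   (index_sign rho (ks, ls, ds, b, c) * (\<Sum>(h, h')\<in>shuffle_set (ks, ls, ds, b, c).
    if shuffle_index h h' (ks, ls, ds, b, c) = permute_index rho (act_index g g' (ks, ls, ds, b, c))
    then block_trace rho (ks, ls, ds, b, c) h h' else 0)) *
   (fixed_word_sum k r g a * fixed_word_sum l q g' a')) =
  (\<Sum>w\<in>word_families r q (ks, ls, ds). koszul_sign rho ds *
   (\<Prod>i<p. letter_mat s (Ns ! i) a a' 1 (family_word (ks, ls, ds) w i) (family_word (ks, ls, ds) w (rho i))))"
  (is "?L = ?R")
proof -
 let ?z = "(ks, ls, ds, b, c)"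
 have len: "length ks = p" "length ls = p" "length ds = p" using t by (auto simp: shapes_def)
 have p: "rho permutes {..<p}" and Nr: "!!i. i < p ==> Ns ! rho i = Ns ! i"
  using rho by (auto simp: permutes_factors_def)
 note ip = permutes_inv[OF p]
 have lt: "rho i < p" "inv_into UNIV rho i < p" if "i < p" for i
  using permutes_in_image[OF p, of i] permutes_in_image[OF ip, of i] that by auto
 have pl: "permute_list (inv_into UNIV rho) xs = xs \<longleftrightarrow> (\<forall>i<p. xs ! rho i = xs ! i)"
  if "length xs = p" for xs :: "nat list"
 proof
  assume *: "permute_list (inv_into UNIV rho) xs = xs"
  show "\<forall>i<p. xs ! rho i = xs ! i"
  proof (intro allI impI)
   fix i assume i: "i < p"
   have "permute_list (inv_into UNIV rho) xs ! rho i = xs ! i"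
    using permute_list_nth[of "inv_into UNIV rho" xs "rho i"] ip lt[OF i] that by (simp add: permutes_inverses[OF p])
   then show "xs ! rho i = xs ! i" by (simp add: *)
  qed
 next
  assume *: "\<forall>i<p. xs ! rho i = xs ! i"
  show "permute_list (inv_into UNIV rho) xs = xs"
  proof (rule nth_equalityI)
   fix i assume "i < length (permute_list (inv_into UNIV rho) xs)"
   then have i: "i < p" using that by simp
   then show "permute_list (inv_into UNIV rho) xs ! i = xs ! i"
    using *[rule_format, OF lt(2)[OF i]] permute_list_nth[of "inv_into UNIV rho" xs i] ip that
    by (simp add: permutes_inverses[OF p])
  qed simp
 qed
 let ?inv = "(\<forall>i<p. ks ! rho i = ks ! i) & (\<forall>i<p. ls ! rho i = ls ! i) & (\<forall>i<p. ds ! rho i = ds ! i)"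
 have cond: "shuffle_index h h' ?z = permute_index rho (act_index g g' ?z) \<longleftrightarrow> ?inv &
   relabel rho ks (\<lambda>x\<in>blocks ks. g (b x)) = block_shuffle ks b h &
   relabel rho ls (\<lambda>x\<in>blocks ls. g' (c x)) = block_shuffle ls c h'" for g g' h h'
  using pl[OF len(1)] pl[OF len(2)] pl[OF len(3)]
  by (auto simp: shuffle_index_def permute_index_def act_index_def Let_def)
 show ?thesis
 proof (cases ?inv)
  case False
  have "?R = 0"
  proof (rule sum.neutral, clarify)
   fix e u v assume "(e, u, v) \<in> word_families r q (ks, ls, ds)"
   obtain i where "i < p" "(ks ! i, ls ! i, ds ! i) ~= (ks ! rho i, ls ! rho i, ds ! rho i)" using False by auto
   then have "letter_mat s (Ns ! i) a a' 1 (family_word (ks, ls, ds) (e, u, v) i)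
     (family_word (ks, ls, ds) (e, u, v) (rho i)) = 0"
    by (auto simp: letter_mat_def letter_proj_def family_word_def)
   with \<open>i < p\<close> show "koszul_sign rho ds * (\<Prod>i<p. letter_mat s (Ns ! i) a a' 1 (family_word (ks, ls, ds) (e, u, v) i)
     (family_word (ks, ls, ds) (e, u, v) (rho i))) = 0"
    by (simp add: prod_zero_iff) blast
  qed
  moreover have ncond: "(shuffle_index h h' ?z = permute_index rho (act_index g g' ?z)) = False" for g g' h h'
   using cond False by blast
  have "?L = 0" unfolding ncond by simp
  ultimately show ?thesis by simp
 next
  case inv: True
  let ?W = "%xs h m a. \<Sum>u\<in>Pi\<^sub>E {..<p} (%i. {..<xs ! i} \<rightarrow>\<^sub>E {..<m::nat}). \<Prod>i<p.
   if \<forall>j<xs ! i. u i j = u (rho i) (h (rho i) j) then \<Prod>j<xs ! i. a (u (rho i) j) else (0::'k)"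
  let ?B = "Pi\<^sub>E {..<p} (%i. basis_of s (bpiece (Ns ! i) (ks ! i) (ls ! i) (ds ! i)))"
  let ?c = "1 / of_nat (card (shuffle_set ?z)) :: 'k"
  define X where "X = (%(e, u, v) i x y.
    coord_of s (bpiece (Ns ! i) (ks ! i) (ls ! i) (ds ! i)) (e i) (bact (Ns ! i) (ks ! i) (ls ! i) (ds ! i) x y (e (rho i))) *
    ((if \<forall>j<ks ! i. u i j = u (rho i) (x j) then \<Prod>j<ks ! i. a (u (rho i) j) else 0) *
    (if \<forall>j<ls ! i. v i j = v (rho i) (y j) then \<Prod>j<ls ! i. a' (v (rho i) j) else 0)))"
  have sgn: "index_sign rho ?z = koszul_sign rho ds" using inv pl[OF len(3)] by (simp add: index_sign_def)
  have W1: "(\<Sum>g\<in>perms k. if relabel rho ks (\<lambda>x\<in>blocks ks. g (b x)) = block_shuffle ks b h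
    then fixed_word_sum k r g a else 0) = ?W ks h r a" if "block_perms ks h" for h
   using sum_fixed_word_sum[of rho ks b k h r a] p inv b that len by simp
  have W2: "(\<Sum>g\<in>perms l. if relabel rho ls (\<lambda>x\<in>blocks ls. g (c x)) = block_shuffle ls c h
    then fixed_word_sum l q g a' else 0) = ?W ls h q a'" if "block_perms ls h" for h
   using sum_fixed_word_sum[of rho ls c l h q a'] p inv c that len by simp
  have "?L = (\<Sum>g\<in>perms k. \<Sum>g'\<in>perms l. \<Sum>(h, h')\<in>shuffle_set ?z. ?c * koszul_sign rho ds * block_trace rho ?z h h' *
    ((if relabel rho ks (\<lambda>x\<in>blocks ks. g (b x)) = block_shuffle ks b h then fixed_word_sum k r g a else 0) *
    (if relabel rho ls (\<lambda>x\<in>blocks ls. g' (c x)) = block_shuffle ls c h' then fixed_word_sum l q g' a' else 0)))"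
   unfolding cond sgn sum_distrib_left sum_distrib_right split_def using inv
   by (intro sum.cong refl) (simp add: mult.assoc)
  also have "... = (\<Sum>(h, h')\<in>shuffle_set ?z. ?c * koszul_sign rho ds * block_trace rho ?z h h' *
    ((\<Sum>g\<in>perms k. if relabel rho ks (\<lambda>x\<in>blocks ks. g (b x)) = block_shuffle ks b h then fixed_word_sum k r g a else 0) *
    (\<Sum>g'\<in>perms l. if relabel rho ls (\<lambda>x\<in>blocks ls. g' (c x)) = block_shuffle ls c h' then fixed_word_sum l q g' a' else 0)))"
   unfolding sum_product
   unfolding sum_distrib_left split_def
   by (simp only: sum.swap[of _ "shuffle_set ?z"])
  also have "... = (\<Sum>(h, h')\<in>shuffle_set ?z. ?c * koszul_sign rho ds * block_trace rho ?z h h' * (?W ks h r a * ?W ls h' q a'))"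
  proof (rule sum.cong[OF refl], clarify)
   fix h h' assume "(h, h') \<in> shuffle_set ?z"
   then have "block_perms ks h" "block_perms ls h'" using shuffle_set_shuffles[of h h' ?z] by (auto simp: shuffles_def)
   then show "?c * koszul_sign rho ds * block_trace rho ?z h h' *
    ((\<Sum>g\<in>perms k. if relabel rho ks (\<lambda>x\<in>blocks ks. g (b x)) = block_shuffle ks b h then fixed_word_sum k r g a else 0) *
    (\<Sum>g'\<in>perms l. if relabel rho ls (\<lambda>x\<in>blocks ls. g' (c x)) = block_shuffle ls c h' then fixed_word_sum l q g' a' else 0)) =
    ?c * koszul_sign rho ds * block_trace rho ?z h h' * (?W ks h r a * ?W ls h' q a')"
    by (simp only: W1 W2)
  qed
  also have "... = (\<Sum>(h, h')\<in>shuffle_set ?z. ?c * koszul_sign rho ds *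
    (\<Sum>w\<in>word_families r q (ks, ls, ds). \<Prod>i<p. X w i (h (rho i)) (h' (rho i))))"
  proof (intro sum.cong refl, clarify)
   fix h h'
   have bt: "block_trace rho ?z h h' = (\<Sum>e\<in>?B. \<Prod>i<p. coord_of s (bpiece (Ns ! i) (ks ! i) (ls ! i) (ds ! i)) (e i)
     (bact (Ns ! i) (ks ! i) (ls ! i) (ds ! i) (h (rho i)) (h' (rho i)) (e (rho i))))"
    unfolding block_trace_def using inv Nr
    by (intro sum.cong PiE_cong prod.cong) (auto simp: spaces_nth block_act_def)
   show "?c * koszul_sign rho ds * block_trace rho ?z h h' * (?W ks h r a * ?W ls h' q a') =
    ?c * koszul_sign rho ds * (\<Sum>w\<in>word_families r q (ks, ls, ds). \<Prod>i<p. X w i (h (rho i)) (h' (rho i)))"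
    unfolding mult.assoc bt sum3_product word_families_def X_def
    by (simp add: split_def prod.distrib)
  qed
  also have "... = (\<Sum>w\<in>word_families r q (ks, ls, ds). koszul_sign rho ds *
    (?c * (\<Sum>(h, h')\<in>shuffle_set ?z. \<Prod>i<p. X w i (h (rho i)) (h' (rho i)))))"
   unfolding sum_distrib_left split_def
   by (subst sum.swap) (simp only: mult_ac)
  also have "... = ?R"
  proof (intro sum.cong refl arg_cong2[of _ _ _ _ "(*)"], clarify)
   fix e u v assume "(e, u, v) \<in> word_families r q (ks, ls, ds)"
   let ?w = "(e, u, v)"
   have "(\<Sum>(h, h')\<in>shuffle_set ?z. \<Prod>i<p. X ?w i (h (rho i)) (h' (rho i))) =
    (\<Sum>h\<in>Pi\<^sub>E {..<p} (%i. perms (ks ! i)). \<Sum>h'\<in>Pi\<^sub>E {..<p} (%i. perms (ls ! i)). \<Prod>i<p. X ?w i (h (rho i)) (h' (rho i)))"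
    by (simp add: shuffle_set_def block_perm_set_def len sum.cartesian_product)
   also have "... = (\<Prod>i<p. \<Sum>x\<in>perms (ks ! i). \<Sum>y\<in>perms (ls ! i). X ?w i x y)"
    using inv by (intro sum_perm_families[OF p]) auto
   finally have "?c * (\<Sum>(h, h')\<in>shuffle_set ?z. \<Prod>i<p. X ?w i (h (rho i)) (h' (rho i))) =
    (\<Prod>i<p. (1 / (fact (ks ! i) * fact (ls ! i))) * (\<Sum>x\<in>perms (ks ! i). \<Sum>y\<in>perms (ls ! i). X ?w i x y))"
    by (simp add: card_shuffle_set len prod.distrib prod_dividef)
   also have "... = (\<Prod>i<p. letter_mat s (Ns ! i) a a' 1 (family_word (ks, ls, ds) ?w i) (family_word (ks, ls, ds) ?w (rho i)))"
   proof (rule prod.cong[OF refl])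
    fix i assume "i \<in> {..<p}"
    then have i: "ks ! rho i = ks ! i" "ls ! rho i = ls ! i" "ds ! rho i = ds ! i" using inv by auto
    show "(1 / (fact (ks ! i) * fact (ls ! i))) * (\<Sum>x\<in>perms (ks ! i). \<Sum>y\<in>perms (ls ! i). X ?w i x y) =
     letter_mat s (Ns ! i) a a' 1 (family_word (ks, ls, ds) ?w i) (family_word (ks, ls, ds) ?w (rho i))"
    proof -
     have X: "X ?w i x y =
      coord_of s (bpiece (Ns ! i) (ks ! i) (ls ! i) (ds ! i)) (e i) (bact (Ns ! i) (ks ! i) (ls ! i) (ds ! i) x y (e (rho i))) *
      (if \<forall>j<ks ! i. u i j = u (rho i) (x j) then 1 else 0) * (if \<forall>j<ls ! i. v i j = v (rho i) (y j) then 1 else 0) *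
      ((\<Prod>j<ks ! i. a (u (rho i) j)) * (\<Prod>j<ls ! i. a' (v (rho i) j)))" for x y
      unfolding X_def case_prod_conv by (rule mult_if_if)
     show ?thesis
      unfolding X sum_distrib_right[symmetric]
      by (simp add: letter_mat_def letter_proj_def family_word_def letter_weight_def i)
    qed
   qed
   finally show "?c * (\<Sum>(h, h')\<in>shuffle_set ?z. \<Prod>i<p. X ?w i (h (rho i)) (h' (rho i))) =
    (\<Prod>i<p. letter_mat s (Ns ! i) a a' 1 (family_word (ks, ls, ds) ?w i) (family_word (ks, ls, ds) ?w (rho i)))" .
  qed
  finally show ?thesis .
 qed
qed

lemma sum_shapes:
 assumes fin: fin_pieces
 shows "(\<Sum>E\<in>Pi\<^sub>E {..<p} (%i. alphabet s (Ns ! i) r q ({..k} \<times> {..l} \<times> {..d})).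
   if (\<Sum>i<p. fst (E i)) = (k, l, d) then F (map (%i. letter_deg (E i)) [0..<p]) E else 0) =
  (\<Sum>t\<in>shapes k l d. \<Sum>w\<in>word_families r q t. F (snd (snd t)) (\<lambda>i\<in>{..<p}. family_word t w i))"
proof -
 let ?PE = "Pi\<^sub>E {..<p} (%i. alphabet s (Ns ! i) r q ({..k} \<times> {..l} \<times> {..d}))"
 have finA: "finite (alphabet s (Ns ! i) r q ({..k} \<times> {..l} \<times> {..d}))" if "i < p" for i
 proof -
  have "finite (basis_of s (bpiece (Ns ! i) k' l' d'))" for k' l' d'
   by (rule finite_basis[OF fin that])
  then show ?thesis unfolding alphabet_def by (auto intro!: finite_SigmaI finite_PiE)
 qed
 have "(\<Sum>t\<in>shapes k l d. \<Sum>w\<in>word_families r q t. F (snd (snd t)) (\<lambda>i\<in>{..<p}. family_word t w i)) =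
  (\<Sum>(t, w)\<in>(SIGMA t:shapes k l d. word_families r q t). F (snd (snd t)) (\<lambda>i\<in>{..<p}. family_word t w i))"
  using finite_word_families[OF fin] by (intro sum.Sigma finite_shapes) auto
 also have "... = (\<Sum>E\<in>{E \<in> ?PE. (\<Sum>i<p. fst (E i)) = (k, l, d)}. F (map (%i. letter_deg (E i)) [0..<p]) E)"
 proof (rule sum.reindex_bij_witness[where j = "%(t, w). \<lambda>i\<in>{..<p}. family_word t w i"
    and i = "%E. ((map (%i. fst (fst (E i))) [0..<p], map (%i. fst (snd (fst (E i)))) [0..<p],
     map (%i. letter_deg (E i)) [0..<p]), \<lambda>i\<in>{..<p}. fst (snd (E i)), \<lambda>i\<in>{..<p}. fst (snd (snd (E i))),
     \<lambda>i\<in>{..<p}. snd (snd (snd (E i))))"])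
  fix tw assume "tw \<in> (SIGMA t:shapes k l d. word_families r q t)"
  then obtain ks ls ds e u v where tw: "tw = ((ks, ls, ds), e, u, v)" and t: "(ks, ls, ds) \<in> shapes k l d"
   and w: "(e, u, v) \<in> word_families r q (ks, ls, ds)" by (cases tw) auto
  have len: "length ks = p" "length ls = p" "length ds = p"
   and sums: "sum_list ks = k" "sum_list ls = l" "sum_list ds = d" using t by (auto simp: shapes_def)
  have le: "ks ! i \<le> k" "ls ! i \<le> l" "ds ! i \<le> d" if "i < p" for i
   using that len sums by (auto intro: elem_le_sum_list)
  show "(case tw of (t, w) => \<lambda>i\<in>{..<p}. family_word t w i) \<in> {E \<in> ?PE. (\<Sum>i<p. fst (E i)) = (k, l, d)}"
   using w le sums len
   by (auto simp: tw family_word_def alphabet_def word_families_def PiE_iff sum_triple sum_list_sum_nth atLeast0LessThan)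
  show "((map (%i. fst (fst ((case tw of (t, w) => \<lambda>i\<in>{..<p}. family_word t w i) i))) [0..<p],
    map (%i. fst (snd (fst ((case tw of (t, w) => \<lambda>i\<in>{..<p}. family_word t w i) i)))) [0..<p],
    map (%i. letter_deg ((case tw of (t, w) => \<lambda>i\<in>{..<p}. family_word t w i) i)) [0..<p]),
    \<lambda>i\<in>{..<p}. fst (snd ((case tw of (t, w) => \<lambda>i\<in>{..<p}. family_word t w i) i)),
    \<lambda>i\<in>{..<p}. fst (snd (snd ((case tw of (t, w) => \<lambda>i\<in>{..<p}. family_word t w i) i))),
    \<lambda>i\<in>{..<p}. snd (snd (snd ((case tw of (t, w) => \<lambda>i\<in>{..<p}. family_word t w i) i)))) = tw"
   using w len by (auto simp: tw family_word_def word_families_def PiE_iff fun_eq_iff extensional_def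
     intro!: nth_equalityI)
  have "map (%i. letter_deg ((\<lambda>i\<in>{..<p}. family_word (ks, ls, ds) (e, u, v) i) i)) [0..<p] = ds"
   using len by (auto simp: family_word_def intro!: nth_equalityI)
  then show "F (map (%i. letter_deg ((case tw of (t, w) => \<lambda>i\<in>{..<p}. family_word t w i) i)) [0..<p])
    (case tw of (t, w) => \<lambda>i\<in>{..<p}. family_word t w i) =
   (case tw of (t, w) => F (snd (snd t)) (\<lambda>i\<in>{..<p}. family_word t w i))"
   unfolding tw by simp
 next
  fix E assume "E \<in> {E \<in> ?PE. (\<Sum>i<p. fst (E i)) = (k, l, d)}"
  then have E: "E \<in> ?PE" and sm: "(\<Sum>i<p. (fst (fst (E i)), fst (snd (fst (E i))), letter_deg (E i))) = (k, l, d)"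
   by auto
  note sm' = sm[unfolded sum_triple prod.inject]
  have Ei: "fst (snd (E i)) \<in> basis_of s (bpiece (Ns ! i) (fst (fst (E i))) (fst (snd (fst (E i)))) (letter_deg (E i)))"
   "fst (snd (snd (E i))) \<in> {..<fst (fst (E i))} \<rightarrow>\<^sub>E {..<r}"
   "snd (snd (snd (E i))) \<in> {..<fst (snd (fst (E i)))} \<rightarrow>\<^sub>E {..<q}" if "i < p" for i
  proof -
   have "E i \<in> alphabet s (Ns ! i) r q ({..k} \<times> {..l} \<times> {..d})" using E that by (auto simp: PiE_iff)
   then show "fst (snd (E i)) \<in> basis_of s (bpiece (Ns ! i) (fst (fst (E i))) (fst (snd (fst (E i)))) (letter_deg (E i)))"
    "fst (snd (snd (E i))) \<in> {..<fst (fst (E i))} \<rightarrow>\<^sub>E {..<r}"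
    "snd (snd (snd (E i))) \<in> {..<fst (snd (fst (E i)))} \<rightarrow>\<^sub>E {..<q}"
    by (auto simp: alphabet_def)
  qed
  show "((map (%i. fst (fst (E i))) [0..<p], map (%i. fst (snd (fst (E i)))) [0..<p],
     map (%i. letter_deg (E i)) [0..<p]), \<lambda>i\<in>{..<p}. fst (snd (E i)), \<lambda>i\<in>{..<p}. fst (snd (snd (E i))),
     \<lambda>i\<in>{..<p}. snd (snd (snd (E i)))) \<in> (SIGMA t:shapes k l d. word_families r q t)"
   using sm' Ei by (auto simp: shapes_def word_families_def sum_list_sum_nth atLeast0LessThan)
  show "(case ((map (%i. fst (fst (E i))) [0..<p], map (%i. fst (snd (fst (E i)))) [0..<p],
     map (%i. letter_deg (E i)) [0..<p]), \<lambda>i\<in>{..<p}. fst (snd (E i)), \<lambda>i\<in>{..<p}. fst (snd (snd (E i))),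
     \<lambda>i\<in>{..<p}. snd (snd (snd (E i)))) of (t, w) => \<lambda>i\<in>{..<p}. family_word t w i) = E"
   using E by (auto simp: family_word_def PiE_iff fun_eq_iff extensional_def)
 qed
 also have "... = (\<Sum>E\<in>?PE. if (\<Sum>i<p. fst (E i)) = (k, l, d) then F (map (%i. letter_deg (E i)) [0..<p]) E else 0)"
  by (rule sum.inter_filter) (use finA in \<open>auto intro: finite_PiE\<close>)
 finally show ?thesis by simp
qed

text \<open>
  The character of the tensor product twisted by the block permutation \<open>rho\<close>. It is the trace of \<open>rho\<close>, with
  Koszul signs, on a tensor product of the spaces of coinvariants.
\<close>

theorem day_trace_words:
 assumes fin: fin_pieces and rho: "permutes_factors rho"
 shows "(1 / (fact k * fact l)) * (\<Sum>g\<in>perms k. \<Sum>g'\<in>perms l. day_trace rho k l d g g' *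
   (fixed_word_sum k r g a * fixed_word_sum l q g' a')) =
  (\<Sum>E\<in>Pi\<^sub>E {..<p} (%i. alphabet s (Ns ! i) r q ({..k} \<times> {..l} \<times> {..d})).
   if (\<Sum>i<p. fst (E i)) = (k, l, d) then koszul_sign rho (map (%i. letter_deg (E i)) [0..<p]) *
    (\<Prod>i<p. letter_mat s (Ns ! i) a a' 1 (E i) (E (rho i))) else 0)"
proof -
 have p: "rho permutes {..<p}" using rho by (simp add: permutes_factors_def)
 have lt: "rho i < p" if "i < p" for i using permutes_in_image[OF p, of i] that by auto
 let ?f = "%z g g'. (1 / of_nat (card (shuffle_set z))) * (index_sign rho z * (\<Sum>(h, h')\<in>shuffle_set z.
    if shuffle_index h h' z = permute_index rho (act_index g g' z) then block_trace rho z h h' else 0)) *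
    (fixed_word_sum k r g a * fixed_word_sum l q g' a')"
 let ?R = "%t. \<Sum>w\<in>word_families r q t. koszul_sign rho (snd (snd t)) *
   (\<Prod>i<p. letter_mat s (Ns ! i) a a' 1 (family_word t w i) (family_word t w (rho i)))"
 let ?S = "SIGMA t:shapes k l d. labellings (fst t) k \<times> labellings (fst (snd t)) l"
 have "(\<Sum>g\<in>perms k. \<Sum>g'\<in>perms l. day_trace rho k l d g g' *
   (fixed_word_sum k r g a * fixed_word_sum l q g' a')) = (\<Sum>z\<in>Z k l d. \<Sum>g\<in>perms k. \<Sum>g'\<in>perms l. ?f z g g')"
  unfolding day_trace_def sum_distrib_right
  by (subst (2) sum.swap, subst sum.swap) simp
 also have "... = (\<Sum>(t, b, c)\<in>?S. \<Sum>g\<in>perms k. \<Sum>g'\<in>perms l. ?f (fst t, fst (snd t), snd (snd t), b, c) g g')"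
  by (rule sum.reindex_bij_witness[where i = "%(t, b, c). (fst t, fst (snd t), snd (snd t), b, c)"
     and j = "%(ks, ls, ds, b, c). ((ks, ls, ds), b, c)"])
   (auto simp: day_indices_deg_iff shapes_def cong: if_cong)
 also have "... = (\<Sum>(t, b, c)\<in>?S. ?R t)"
 proof (rule sum.cong[OF refl], clarify)
  fix ks ls ds b c assume "(ks, ls, ds) \<in> shapes k l d" "b \<in> labellings (fst (ks, ls, ds)) k"
   "c \<in> labellings (fst (snd (ks, ls, ds))) l"
  then show "(\<Sum>g\<in>perms k. \<Sum>g'\<in>perms l. ?f (fst (ks, ls, ds), fst (snd (ks, ls, ds)), snd (snd (ks, ls, ds)), b, c) g g') =
   ?R (ks, ls, ds)"
   unfolding fst_conv snd_conv by (intro shape_sum[OF fin rho])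
 qed
 also have "... = (\<Sum>t\<in>shapes k l d. fact k * fact l * ?R t)"
 proof -
  have "(\<Sum>(t, b, c)\<in>?S. ?R t) = (\<Sum>t\<in>shapes k l d. \<Sum>bc\<in>labellings (fst t) k \<times> labellings (fst (snd t)) l. ?R t)"
   by (subst sum.Sigma) (auto simp: finite_shapes finite_labellings split_def)
  also have "... = (\<Sum>t\<in>shapes k l d. fact k * fact l * ?R t)"
   by (intro sum.cong refl) (auto simp: shapes_def card_cartesian_product card_labellings)
  finally show ?thesis .
 qed
 finally have "(1 / (fact k * fact l)) * (\<Sum>g\<in>perms k. \<Sum>g'\<in>perms l. day_trace rho k l d g g' *
   (fixed_word_sum k r g a * fixed_word_sum l q g' a')) = (\<Sum>t\<in>shapes k l d. ?R t)"
  by (simp add: sum_distrib_left[symmetric])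
 also have "... = (\<Sum>t\<in>shapes k l d. \<Sum>w\<in>word_families r q t. koszul_sign rho (snd (snd t)) *
   (\<Prod>i<p. letter_mat s (Ns ! i) a a' 1 ((\<lambda>i\<in>{..<p}. family_word t w i) i) ((\<lambda>i\<in>{..<p}. family_word t w i) (rho i))))"
  using lt by (intro sum.cong refl arg_cong2[of _ _ _ _ "(*)"] prod.cong) auto
 also have "... = (\<Sum>E\<in>Pi\<^sub>E {..<p} (%i. alphabet s (Ns ! i) r q ({..k} \<times> {..l} \<times> {..d})).
   if (\<Sum>i<p. fst (E i)) = (k, l, d) then koszul_sign rho (map (%i. letter_deg (E i)) [0..<p]) *
    (\<Prod>i<p. letter_mat s (Ns ! i) a a' 1 (E i) (E (rho i))) else 0)"
  by (rule sum_shapes[OF fin, symmetric])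
 finally show ?thesis .
qed

end

section \<open>Cycle decomposition\<close>

text \<open>
  The lengths of the cycles of a permutation of \<open>{..<m}\<close>, the point \<open>i\<close> being counted with multiplicity
  \<open>n i\<close>. The recursion removes the last point; unless it is fixed, its multiplicity goes to its predecessor
  in its cycle.
\<close>

primrec cycle_lengths :: "nat => (nat => nat) => (nat => nat) => nat multiset" where
 "cycle_lengths 0 rho n = {#}"
| "cycle_lengths (Suc m) rho n = (if rho m = m then add_mset (n m) (cycle_lengths m rho n)
   else cycle_lengths m (transpose m (rho m) \<circ> rho) (n(inv_into UNIV rho m := n (inv_into UNIV rho m) + n m)))"

lemma permutes_lessThan_Suc:
 assumes "rho permutes {..<Suc m}"
 shows "transpose m (rho m) \<circ> rho permutes {..<m}"
proof -
 show ?thesis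
  using permutes_insert_lemma[of rho m "{..<m}"] assms by (simp add: lessThan_Suc)
qed

lemma permutes_lessThan_fixed:
 assumes "rho permutes {..<Suc m}" "rho m = m"
 shows "rho permutes {..<m}"
 using permutes_lessThan_Suc[OF assms(1)] assms(2) by simp

lemma last_point_facts:
 assumes rho: "rho permutes {..<Suc m}" and "rho m ~= m"
 shows "rho m < m" "inv_into UNIV rho m < m" "rho (inv_into UNIV rho m) = m"
  "!!i. i < m ==> i ~= inv_into UNIV rho m ==> (transpose m (rho m) \<circ> rho) i = rho i & rho i < m & rho i ~= rho m"
  "(transpose m (rho m) \<circ> rho) (inv_into UNIV rho m) = rho m"
proof -
 show "rho m < m" using permutes_in_image[OF rho, of m] assms(2) by simp
 show 1: "rho (inv_into UNIV rho m) = m" by (simp add: permutes_inverses[OF rho])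
 have "inv_into UNIV rho m ~= m" using 1 assms(2) by metis
 then show "inv_into UNIV rho m < m" using permutes_in_image[OF permutes_inv[OF rho], of m] by simp
 show "(transpose m (rho m) \<circ> rho) (inv_into UNIV rho m) = rho m" using 1 by simp
 fix i assume i: "i < m" "i ~= inv_into UNIV rho m"
 have inj: "rho i = rho j \<longleftrightarrow> i = j" for j using inj_eq[OF permutes_inj[OF rho]] by simp
 have "rho i ~= m" using inj[of "inv_into UNIV rho m"] 1 i by simp
 moreover have "rho i < Suc m" using permutes_in_image[OF rho, of i] i by simp
 moreover have "rho i ~= rho m" using inj[of m] i by simp
 ultimately show "(transpose m (rho m) \<circ> rho) i = rho i & rho i < m & rho i ~= rho m"
  by (simp add: transpose_def)
qed

lemma cycle_lengths_pos:
 "rho permutes {..<m} ==> (!!i. i < m ==> 1 \<le> n i) ==> x \<in># cycle_lengths m rho n ==> 1 \<le> x"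
proof (induction m arbitrary: rho n)
 case (Suc m)
 show ?case
 proof (cases "rho m = m")
  case True
  then show ?thesis
   using Suc.IH[OF permutes_lessThan_fixed[OF Suc.prems(1) True], of n] Suc.prems by auto
 next
  case False
  let ?n' = "n(inv_into UNIV rho m := n (inv_into UNIV rho m) + n m)"
  show ?thesis
  proof (rule Suc.IH[OF permutes_lessThan_Suc[OF Suc.prems(1)], of ?n'])
   show "1 \<le> ?n' i" if "i < m" for i using Suc.prems(2)[of i] Suc.prems(2)[of m] that by simp
   show "x \<in># cycle_lengths m (transpose m (rho m) \<circ> rho) ?n'" using Suc.prems(3) False by (simp del: fun_upd_apply)
  qed
 qed
qed simp

lemma sum_cycle_lengths:
 "rho permutes {..<m} ==> sum_mset (cycle_lengths m rho n) = (\<Sum>i<m. n i)"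
proof (induction m arbitrary: rho n)
 case (Suc m)
 show ?case
 proof (cases "rho m = m")
  case True
  then show ?thesis using Suc.IH[OF permutes_lessThan_fixed[OF Suc.prems True]] by simp
 next
  case False
  let ?t = "inv_into UNIV rho m"
  have "(\<Sum>i<m. (n(?t := n ?t + n m)) i) = (\<Sum>i<m. n i + (if i = ?t then n m else 0))"
   by (intro sum.cong) auto
  also have "... = (\<Sum>i<m. n i) + n m"
   using last_point_facts(2)[OF Suc.prems False] by (simp add: sum.distrib)
  finally have "(\<Sum>i<m. (n(?t := n ?t + n m)) i) = (\<Sum>i<m. n i) + n m" .
  moreover have "sum_mset (cycle_lengths m (transpose m (rho m) \<circ> rho) (n(?t := n ?t + n m))) =
    (\<Sum>i<m. (n(?t := n ?t + n m)) i)"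
   by (rule Suc.IH[OF permutes_lessThan_Suc[OF Suc.prems]])
  ultimately show ?thesis using False by (simp only: cycle_lengths.simps if_False sum.lessThan_Suc)
 qed
qed simp

text \<open>The Koszul sign with values in any commutative ring; the degrees are given by a function.\<close>

definition ksgn :: "(nat => nat) => nat => (nat => nat) => 'a::comm_ring_1" where
 "ksgn rho m d = (\<Prod>(i, j)\<in>{(i, j). i < j & j < m}. if rho j < rho i then (-1) ^ (d (rho i) * d (rho j)) else 1)"

lemma finite_pairs: "finite {(i, j). i < j & j < (m::nat)}"
 by (rule finite_subset[of _ "{..<m} \<times> {..<m}"]) auto

definition koszul_exponent :: "(nat => nat) => nat => (nat => nat) => nat" where
 "koszul_exponent rho m d = (\<Sum>(i, j)\<in>{(i, j). i < j & j < m}. if rho j < rho i then d (rho i) * d (rho j) else 0)"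

lemma ksgn_power: "ksgn rho m d = (-1) ^ koszul_exponent rho m d"
 unfolding ksgn_def koszul_exponent_def power_sum by (intro prod.cong) auto

lemma koszul_sign_ksgn:
 assumes "rho permutes {..<m}"
 shows "koszul_sign rho (map d [0..<m]) = ksgn rho m d"
proof -
 have "rho i < m" if "i < m" for i using permutes_in_image[OF assms, of i] that by simp
 then show ?thesis unfolding koszul_sign_pairs ksgn_def by (intro prod.cong) auto
qed

lemma ksgn_cong:
 assumes "rho permutes {..<m}" "!!i. i < m ==> d i = d' i"
 shows "ksgn rho m d = ksgn rho m d'"
proof -
 have "rho i < m" if "i < m" for i using permutes_in_image[OF assms(1), of i] that by simp
 then show ?thesis unfolding ksgn_def by (intro prod.cong) (auto simp: assms(2))
qed

lemma prod_pairs_Suc: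
 "(\<Prod>(i, j)\<in>{(i, j). i < j & j < Suc m}. F i j) =
  (\<Prod>(i, j)\<in>{(i, j). i < j & j < m}. F i j) * (\<Prod>i<m. F i m :: 'a::comm_monoid_mult)"
proof -
 have "{(i, j). i < j & j < Suc m} = {(i, j). i < j & j < m} \<union> (%i. (i, m)) ` {..<m}" by auto
 moreover have "(\<Prod>(i, j)\<in>(%i. (i, m)) ` {..<m}. F i j) = (\<Prod>i<m. F i m)"
  by (subst prod.reindex) (auto simp: inj_on_def)
 ultimately show ?thesis
  using prod.union_disjoint[OF finite_pairs[of m], of "(%i. (i, m)) ` {..<m}" "%(i, j). F i j"] by auto
qed

lemma prod_pairs_point:
 assumes "t < (m::nat)"
 shows "(\<Prod>(i, j)\<in>{(i, j). i < j & j < m}. F i j) =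
  (\<Prod>(i, j)\<in>{(i, j). i < j & j < m & i ~= t & j ~= t}. F i j) *
  (\<Prod>i\<in>{..<m} - {t}. F (min i t) (max i t) :: 'a::comm_monoid_mult)"
proof -
 let ?A = "{(i, j). i < j & j < m & i ~= t & j ~= t}" and ?g = "%i. (min i t, max i t)"
 have un: "{(i, j). i < j & j < m} = ?A \<union> ?g ` ({..<m} - {t})"
 proof (intro equalityI subsetI)
  fix x assume "x \<in> {(i, j). i < j & j < m}"
  then obtain i j where x: "x = (i, j)" "i < j" "j < m" by auto
  have "x \<in> ?g ` ({..<m} - {t})" if "i = t"
   using x that by (intro image_eqI[of _ _ j]) (auto simp: min_def max_def)
  moreover have "x \<in> ?g ` ({..<m} - {t})" if "j = t"
   using x that by (intro image_eqI[of _ _ i]) (auto simp: min_def max_def)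
  moreover have "x \<in> ?A" if "i ~= t" "j ~= t" using x that by simp
  ultimately show "x \<in> ?A \<union> ?g ` ({..<m} - {t})" by blast
 qed (use assms in \<open>auto simp: min_def max_def split: if_splits\<close>)
 have dis: "?A \<inter> ?g ` ({..<m} - {t}) = {}" by (auto simp: min_def max_def split: if_splits)
 have fin: "finite ?A" by (rule finite_subset[OF _ finite_pairs[of m]]) auto
 have inj: "inj_on ?g ({..<m} - {t})" by (auto simp: inj_on_def min_def max_def split: if_splits)
 show ?thesis
  unfolding un using prod.union_disjoint[OF fin _ dis, of "%(i, j). F i j"] prod.reindex[OF inj, of "%(i, j). F i j"]
  by (simp add: split_def)
qed

lemma ksgn_fixed_last:
 assumes "rho permutes {..<m}"
 shows "ksgn rho (Suc m) d = (ksgn rho m d :: 'a::comm_ring_1)"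
proof -
 have "rho i < m" if "i < m" for i using permutes_in_image[OF assms, of i] that by simp
 then have "\<not> rho m < rho i" if "i < m" for i
  using permutes_not_in[OF assms, of m] that less_asym by auto
 then have "(\<Prod>i<m. if rho m < rho i then (- 1) ^ (d (rho i) * d (rho m)) else 1 :: 'a) = 1"
  by (intro prod.neutral) simp
 then show ?thesis unfolding ksgn_def prod_pairs_Suc by simp
qed

text \<open>Removing the last point from its cycle changes the sign by \<open>(-1)\<^sup>d\<close> when that cycle has degree \<open>d\<close>.\<close>

lemma ksgn_remove_last:
 assumes rho: "rho permutes {..<Suc m}" and nf: "rho m ~= m" and inv: "!!i. i < Suc m ==> d (rho i) = d i"
 shows "ksgn rho (Suc m) d = ((-1) ^ d m * ksgn (transpose m (rho m) \<circ> rho) m d :: 'a::comm_ring_1)"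
proof -
 let ?t = "inv_into UNIV rho m" and ?rho' = "transpose m (rho m) \<circ> rho"
 note t = last_point_facts[OF rho nf]
 define sigma where "sigma i j = ((-1) ^ (d i * d j) :: 'a)" for i j
 have sigma: "sigma i j = sigma j i" "sigma i j * sigma i j = 1" for i j
  by (auto simp: sigma_def mult.commute simp flip: power_add mult_2)
 have dt: "d ?t = d m" using inv[of ?t] t by simp
 have odd_sq: "sigma m m = (-1) ^ d m"
  by (cases "even (d m)") (auto simp: sigma_def)
 have inv': "d (?rho' i) = d i" if "i < m" for i
  using that t(4)[of i] t(5) inv[of i] inv[of m] dt by (cases "i = ?t") auto
 have lt: "i < Suc m" if "i < m" for i using that by simp
 let ?C = "\<Prod>(i, j)\<in>{(i, j). i < j & j < m & i ~= ?t & j ~= ?t}. if rho j < rho i then sigma i j else 1"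
 have K: "ksgn rho (Suc m) d = (\<Prod>(i, j)\<in>{(i, j). i < j & j < m}. if rho j < rho i then sigma i j else 1) *
   (\<Prod>i<m. if rho m < rho i then sigma i m else 1)"
  unfolding ksgn_def prod_pairs_Suc
  by (intro arg_cong2[of _ _ _ _ "(*)"] prod.cong) (auto simp: sigma_def inv)
 have 1: "(\<Prod>(i, j)\<in>{(i, j). i < j & j < m}. if rho j < rho i then sigma i j else 1) =
   ?C * (\<Prod>i\<in>{..<m} - {?t}. if i < ?t then 1 else sigma i m)"
  unfolding prod_pairs_point[OF t(2)]
 proof (intro arg_cong2[of _ _ _ _ "(*)"] prod.cong refl)
  fix i assume i: "i \<in> {..<m} - {?t}"
  then show "(if rho (max i ?t) < rho (min i ?t) then sigma (min i ?t) (max i ?t) else 1) = (if i < ?t then 1 else sigma i m)"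
   using t(3) t(4)[of i] sigma(1)[of m i] dt by (auto simp: min_def max_def sigma_def)
 qed
 have 2: "(\<Prod>i<m. if rho m < rho i then sigma i m else 1) =
   (-1) ^ d m * (\<Prod>i\<in>{..<m} - {?t}. if rho m < rho i then sigma i m else 1)"
  using t(1-3) dt odd_sq by (subst prod.remove[of _ ?t]) (auto simp: sigma_def)
 have "ksgn ?rho' m d = (\<Prod>(i, j)\<in>{(i, j). i < j & j < m}. if ?rho' j < ?rho' i then sigma i j else 1)"
  unfolding ksgn_def by (intro prod.cong) (auto simp: sigma_def inv' simp del: o_apply)
 also have "... = ?C * (\<Prod>i\<in>{..<m} - {?t}. (if i < ?t then 1 else sigma i m) * (if rho m < rho i then sigma i m else 1))"
  unfolding prod_pairs_point[OF t(2)]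
 proof (intro arg_cong2[of _ _ _ _ "(*)"])
  show "(\<Prod>(i, j)\<in>{(i, j). i < j & j < m & i ~= ?t & j ~= ?t}. if ?rho' j < ?rho' i then sigma i j else 1) = ?C"
   using t(4) by (intro prod.cong) (auto simp del: o_apply)
  show "(\<Prod>i\<in>{..<m} - {?t}. if ?rho' (max i ?t) < ?rho' (min i ?t) then sigma (min i ?t) (max i ?t) else 1) =
   (\<Prod>i\<in>{..<m} - {?t}. (if i < ?t then 1 else sigma i m) * (if rho m < rho i then sigma i m else 1))"
  proof (rule prod.cong[OF refl])
   fix i assume i: "i \<in> {..<m} - {?t}"
   have e: "?rho' i = rho i" "?rho' ?t = rho m" "rho i ~= rho m" using t(4)[of i] t(5) i by auto
   have s: "sigma i ?t = sigma i m" "sigma ?t i = sigma i m" using dt sigma(1)[of ?t i] by (auto simp: sigma_def)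
   show "(if ?rho' (max i ?t) < ?rho' (min i ?t) then sigma (min i ?t) (max i ?t) else 1) =
    (if i < ?t then 1 else sigma i m) * (if rho m < rho i then sigma i m else 1)"
    using i e s sigma(2)[of i m] by (cases "i < ?t") (auto simp: min_def max_def simp del: o_apply)
  qed
 qed
 finally have K': "ksgn ?rho' m d = ..." .
 show ?thesis unfolding K K' 1 2 by (simp add: prod.distrib mult_ac)
qed

text \<open>
  The trace of a permutation of the tensor factors times a tensor product of operators: each cycle contributes
  the supertrace of the product of the operators along it. Here these operators belong to a semigroup \<open>A n\<close>, so
  that only the sum of the exponents \<open>n\<close> along the cycle matters.
\<close>

lemma sum_over_cycles:
 fixes A :: "nat => 'e => 'e => 'a::comm_ring_1"
 assumes fin: "finite X"
  and semi: "!!n n' e e''. 1 \<le> n ==> 1 \<le> n' ==> e \<in> X ==> e'' \<in> X ==> (\<Sum>e'\<in>X. A n e e' * A n' e' e'') = A (n + n') e e''"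
  and deg: "!!n e e'. 1 \<le> n ==> e \<in> X ==> e' \<in> X ==> \<delta> e ~= \<delta> e' ==> A n e e' = 0"
  and rho: "rho permutes {..<m}" and n: "!!i. i < m ==> 1 \<le> n i"
 shows "(\<Sum>E\<in>{..<m} \<rightarrow>\<^sub>E X. ksgn rho m (%i. \<delta> (E i)) * (\<Prod>i<m. (-1) ^ \<delta> (E i) * A (n i) (E i) (E (rho i)))) =
  (\<Prod>c\<in>#cycle_lengths m rho n. \<Sum>e\<in>X. (-1) ^ \<delta> e * A c e e)"
 using rho n
proof (induction m arbitrary: rho n)
 case 0
 then show ?case by (simp add: ksgn_def)
next
 case (Suc m)
 note rho = Suc.prems(1)
 show ?case
 proof (cases "rho m = m")
  case True
  note rhom = permutes_lessThan_fixed[OF rho True]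
  have lt: "rho i < m" if "i < m" for i using permutes_in_image[OF rhom, of i] that by simp
  have "(\<Sum>E\<in>{..<Suc m} \<rightarrow>\<^sub>E X. ksgn rho (Suc m) (%i. \<delta> (E i)) *
    (\<Prod>i<Suc m. (-1) ^ \<delta> (E i) * A (n i) (E i) (E (rho i)))) =
   (\<Sum>y\<in>X. \<Sum>f\<in>{..<m} \<rightarrow>\<^sub>E X. ((-1) ^ \<delta> y * A (n m) y y) *
    (ksgn rho m (%i. \<delta> (f i)) * (\<Prod>i<m. (-1) ^ \<delta> (f i) * A (n i) (f i) (f (rho i)))))"
   unfolding lessThan_Suc
  proof (subst sum_PiE_insert, simp, intro sum.cong refl)
   fix y f
   have 1: "ksgn rho (Suc m) (%i. \<delta> ((f(m := y)) i)) = ksgn rho m (%i. \<delta> (f i))"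
    unfolding ksgn_fixed_last[OF rhom] by (rule ksgn_cong[OF rhom]) simp
   have 2: "(\<Prod>i<m. (-1) ^ \<delta> ((f(m := y)) i) * A (n i) ((f(m := y)) i) ((f(m := y)) (rho i))) =
     (\<Prod>i<m. (-1) ^ \<delta> (f i) * A (n i) (f i) (f (rho i)))"
    using lt by (intro prod.cong) (auto simp: less_imp_neq)
   show "ksgn rho (Suc m) (%i. \<delta> ((f(m := y)) i)) *
    (\<Prod>i\<in>insert m {..<m}. (-1) ^ \<delta> ((f(m := y)) i) * A (n i) ((f(m := y)) i) ((f(m := y)) (rho i))) =
    ((-1) ^ \<delta> y * A (n m) y y) *
    (ksgn rho m (%i. \<delta> (f i)) * (\<Prod>i<m. (-1) ^ \<delta> (f i) * A (n i) (f i) (f (rho i))))"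
    unfolding 1 by (subst prod.insert) (simp_all only: 2 finite_lessThan lessThan_iff less_irrefl not_False_eq_True
      fun_upd_same True mult_ac)
  qed
  also have "... = (\<Sum>y\<in>X. (-1) ^ \<delta> y * A (n m) y y) * (\<Prod>c\<in>#cycle_lengths m rho n. \<Sum>e\<in>X. (-1) ^ \<delta> e * A c e e)"
   unfolding sum_distrib_left[symmetric] sum_distrib_right[symmetric]
   using Suc.IH[OF rhom, of n] Suc.prems(2) by simp
  finally show ?thesis using True by simp
 next
  case False
  let ?t = "inv_into UNIV rho m" and ?rho' = "transpose m (rho m) \<circ> rho"
  let ?n' = "n(?t := n ?t + n m)"
  note t = last_point_facts[OF rho False] and rho' = permutes_lessThan_Suc[OF rho]
  let ?rest = "%f. \<Prod>i\<in>{..<m} - {?t}. (-1) ^ \<delta> (f i) * A (n i) (f i) (f (?rho' i))"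
  have main: "ksgn rho (Suc m) (%i. \<delta> ((f(m := y)) i)) *
    (\<Prod>i\<in>insert m {..<m}. (-1) ^ \<delta> ((f(m := y)) i) * A (n i) ((f(m := y)) i) ((f(m := y)) (rho i))) =
   ksgn ?rho' m (%i. \<delta> (f i)) * ((-1) ^ \<delta> (f ?t) * (A (n ?t) (f ?t) y * A (n m) y (f (rho m))) * ?rest f)"
   if y: "y \<in> X" and f: "f \<in> {..<m} \<rightarrow>\<^sub>E X" for y f
  proof -
   let ?E = "f(m := y)"
   have fX: "f i \<in> X" if "i < m" for i using f that by auto
   have EX: "?E i \<in> X" if "i < Suc m" for i using fX y that by (auto simp: less_Suc_eq)
   have pr: "(\<Prod>i\<in>insert m {..<m}. (-1) ^ \<delta> (?E i) * A (n i) (?E i) (?E (rho i))) =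
    ((-1) ^ \<delta> y * A (n m) y (f (rho m))) * (((-1) ^ \<delta> (f ?t) * A (n ?t) (f ?t) y) * ?rest f)"
   proof -
    have "(\<Prod>i<m. (-1) ^ \<delta> (?E i) * A (n i) (?E i) (?E (rho i))) =
     ((-1) ^ \<delta> (f ?t) * A (n ?t) (f ?t) y) * (\<Prod>i\<in>{..<m} - {?t}. (-1) ^ \<delta> (?E i) * A (n i) (?E i) (?E (rho i)))"
     using t(2,3) by (subst prod.remove[of _ ?t]) auto
    also have "(\<Prod>i\<in>{..<m} - {?t}. (-1) ^ \<delta> (?E i) * A (n i) (?E i) (?E (rho i))) = ?rest f"
     using t(4) by (intro prod.cong refl) (auto simp: less_imp_neq simp del: o_apply)
    finally show ?thesis using t(1) by (subst prod.insert) auto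
   qed
   show ?thesis
   proof (cases "\<forall>i<Suc m. \<delta> (?E (rho i)) = \<delta> (?E i)")
    case True
    have "ksgn rho (Suc m) (%i. \<delta> (?E i)) = (-1) ^ \<delta> (?E m) * ksgn ?rho' m (%i. \<delta> (?E i))"
     using True by (intro ksgn_remove_last[OF rho False]) auto
    also have "ksgn ?rho' m (%i. \<delta> (?E i)) = ksgn ?rho' m (%i. \<delta> (f i))"
     by (rule ksgn_cong[OF rho']) simp
    finally have k: "ksgn rho (Suc m) (%i. \<delta> (?E i)) = (-1) ^ \<delta> y * ksgn ?rho' m (%i. \<delta> (f i))" by simp
    have sq: "(-1) ^ \<delta> y * (-1) ^ \<delta> y = (1::'a)" by (simp flip: power_add mult_2)
    show ?thesis
     unfolding pr k using sq by (simp add: mult_ac)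
   next
    case nc: False
    then obtain i where i: "i < Suc m" "\<delta> (?E (rho i)) ~= \<delta> (?E i)" by blast
    have "rho i < Suc m" using permutes_in_image[OF rho, of i] i by simp
    then have A0: "A (n i) (?E i) (?E (rho i)) = 0"
     using i EX Suc.prems(2) by (intro deg) auto
    consider "i = m" | "i = ?t" | "i < m" "i ~= ?t" using i by linarith
    then have "A (n m) y (f (rho m)) = 0 \<or> A (n ?t) (f ?t) y = 0 \<or> ?rest f = 0"
    proof cases
     case 1
     then show ?thesis using A0 t(1) by simp
    next
     case 2
     then show ?thesis using A0 t(2,3) by simp
    next
     case 3
     then have "A (n i) (f i) (f (?rho' i)) = 0" using A0 t(4)[OF 3] by (simp del: o_apply)
     then have "(-1) ^ \<delta> (f i) * A (n i) (f i) (f (?rho' i)) = 0" by simp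
     then have "?rest f = 0" using 3 by (intro prod_zero) auto
     then show ?thesis by blast
    qed
    then show ?thesis unfolding pr by (elim disjE) simp_all
   qed
  qed
  have "(\<Sum>E\<in>{..<Suc m} \<rightarrow>\<^sub>E X. ksgn rho (Suc m) (%i. \<delta> (E i)) *
    (\<Prod>i<Suc m. (-1) ^ \<delta> (E i) * A (n i) (E i) (E (rho i)))) =
   (\<Sum>y\<in>X. \<Sum>f\<in>{..<m} \<rightarrow>\<^sub>E X. ksgn ?rho' m (%i. \<delta> (f i)) *
    ((-1) ^ \<delta> (f ?t) * (A (n ?t) (f ?t) y * A (n m) y (f (rho m))) * ?rest f))"
  proof -
   have "(\<Sum>E\<in>{..<Suc m} \<rightarrow>\<^sub>E X. ksgn rho (Suc m) (%i. \<delta> (E i)) *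
     (\<Prod>i<Suc m. (-1) ^ \<delta> (E i) * A (n i) (E i) (E (rho i)))) =
    (\<Sum>y\<in>X. \<Sum>f\<in>{..<m} \<rightarrow>\<^sub>E X. ksgn rho (Suc m) (%i. \<delta> ((f(m := y)) i)) *
     (\<Prod>i\<in>insert m {..<m}. (-1) ^ \<delta> ((f(m := y)) i) * A (n i) ((f(m := y)) i) ((f(m := y)) (rho i))))"
    unfolding lessThan_Suc by (rule sum_PiE_insert) simp
   then show ?thesis using main by (simp only: cong: sum.cong)
  qed
  also have "... = (\<Sum>f\<in>{..<m} \<rightarrow>\<^sub>E X. ksgn ?rho' m (%i. \<delta> (f i)) *
    (((-1) ^ \<delta> (f ?t) * (\<Sum>y\<in>X. A (n ?t) (f ?t) y * A (n m) y (f (rho m)))) * ?rest f))"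
   by (subst sum.swap) (simp only: sum_distrib_left sum_distrib_right)
  also have "... = (\<Sum>f\<in>{..<m} \<rightarrow>\<^sub>E X. ksgn ?rho' m (%i. \<delta> (f i)) *
    (\<Prod>i<m. (-1) ^ \<delta> (f i) * A (?n' i) (f i) (f (?rho' i))))"
  proof (intro sum.cong refl arg_cong2[of _ _ _ _ "(*)"])
   fix f assume f: "f \<in> {..<m} \<rightarrow>\<^sub>E X"
   have "(\<Sum>y\<in>X. A (n ?t) (f ?t) y * A (n m) y (f (rho m))) = A (?n' ?t) (f ?t) (f (?rho' ?t))"
    unfolding t(5) fun_upd_same using f t(1,2) Suc.prems(2) by (intro semi) auto
   moreover have "?rest f = (\<Prod>i\<in>{..<m} - {?t}. (-1) ^ \<delta> (f i) * A (?n' i) (f i) (f (?rho' i)))"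
    by (intro prod.cong) auto
   ultimately show "((-1) ^ \<delta> (f ?t) * (\<Sum>y\<in>X. A (n ?t) (f ?t) y * A (n m) y (f (rho m)))) * ?rest f =
    (\<Prod>i<m. (-1) ^ \<delta> (f i) * A (?n' i) (f i) (f (?rho' i)))"
    using t(2) by (subst prod.remove[of "{..<m}" ?t]) auto
  qed
  also have "... = (\<Prod>c\<in>#cycle_lengths m ?rho' ?n'. \<Sum>e\<in>X. (-1) ^ \<delta> e * A c e e)"
  proof (rule Suc.IH[OF rho'])
   show "1 \<le> ?n' i" if "i < m" for i using Suc.prems(2)[of i] Suc.prems(2)[of m] that by simp
  qed
  finally show ?thesis using False by (simp only: cycle_lengths.simps if_False)
 qed
qed

section \<open>Power series over a monoid\<close>

class fin_decomp = cancel_comm_monoid_add +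
 assumes finite_decomp: "finite {(a, b). a + b = c}"
  and zero_sum_free: "a + b = 0 ==> a = 0"

instance nat :: fin_decomp
proof
 show "finite {(a, b). a + b = (c::nat)}" for c
  by (rule finite_subset[of _ "{..c} \<times> {..c}"]) auto
qed simp

instance prod :: (fin_decomp, fin_decomp) fin_decomp
proof
 fix c :: "'a \<times> 'b"
 let ?f = "%((a, a'), (b, b')). ((a, b), (a', b'))"
 have "finite (?f ` ({(a, a'). a + a' = fst c} \<times> {(b, b'). b + b' = snd c}))"
  by (intro finite_imageI finite_cartesian_product finite_decomp)
 moreover have "{(a, b). a + b = c} \<subseteq> ?f ` ({(a, a'). a + a' = fst c} \<times> {(b, b'). b + b' = snd c})"
  by (auto simp: image_iff)
 ultimately show "finite {(a, b). a + b = c}" by (rule rev_finite_subset)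
qed (auto simp: zero_prod_def dest: zero_sum_free)

lemma finite_submultisets: "finite {A. A \<subseteq># C}"
proof (induction C)
 case (add x C)
 have "{A. A \<subseteq># add_mset x C} \<subseteq> {A. A \<subseteq># C} \<union> add_mset x ` {A. A \<subseteq># C}"
 proof
  fix A assume "A \<in> {A. A \<subseteq># add_mset x C}"
  then have A: "A \<subseteq># add_mset x C" by simp
  show "A \<in> {A. A \<subseteq># C} \<union> add_mset x ` {A. A \<subseteq># C}"
  proof (cases "x \<in># A")
   case True
   then obtain B where "A = add_mset x B" by (metis mset_add)
   then show ?thesis using A by auto
  next
   case False
   have "count A y \<le> count C y" for y
    using mset_subset_eq_count[OF A, of y] False by (cases "y = x") (auto simp: count_eq_zero_iff[THEN iffD2])
   then show ?thesis by (simp add: subseteq_mset_def)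
  qed
 qed
 then show ?case using add by (meson finite_UnI finite_imageI finite_subset)
qed simp

instance multiset :: (type) fin_decomp
proof
 fix C :: "'a multiset"
 have "finite {A. A \<subseteq># C}" by (rule finite_submultisets)
 then have "finite ((%A. (A, C - A)) ` {A. A \<subseteq># C})" by (rule finite_imageI)
 moreover have "{(A, B). A + B = C} \<subseteq> (%A. (A, C - A)) ` {A. A \<subseteq># C}" by auto
 ultimately show "finite {(A, B). A + B = C}" by (rule rev_finite_subset)
qed simp

instance poly_mapping :: (type, fin_decomp) fin_decomp
proof
 fix h :: "'a \<Rightarrow>\<^sub>0 'b"
 let ?K = "keys h"
 let ?r = "%(f, g). \<lambda>i\<in>?K. (lookup f i, lookup g i)"
 let ?D = "{(f, g). f + g = h}"
 have zero: "lookup f i = 0 & lookup g i = 0" if "f + g = h" "i \<notin> ?K" for f g i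
 proof -
  have "lookup f i + lookup g i = 0"
   using that by (metis lookup_add not_in_keys_iff_lookup_eq_zero)
  then show ?thesis using zero_sum_free by (metis add.commute)
 qed
 have inj: "inj_on ?r ?D"
 proof (rule inj_onI)
  fix x y assume xy: "x \<in> ?D" "y \<in> ?D" "?r x = ?r y"
  obtain f g f' g' where eq: "x = (f, g)" "y = (f', g')" by (cases x, cases y)
  have *: "(\<lambda>i\<in>?K. (lookup f i, lookup g i)) =
    (\<lambda>i\<in>?K. (lookup f' i, lookup g' i))" "f + g = h" "f' + g' = h"
   using xy by (simp_all add: eq)
  have "lookup f i = lookup f' i & lookup g i = lookup g' i" for i
  proof (cases "i \<in> ?K")
   case True
   then show ?thesis using fun_cong[OF *(1), of i] by simp
  next
   case False
   then show ?thesis using zero[of f g i] zero[of f' g' i] * by simp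
  qed
  then show "x = y" by (auto simp: eq intro: poly_mapping_eqI)
 qed
 have "?r ` ?D \<subseteq> (\<Pi>\<^sub>E i\<in>?K. {(a, b). a + b = lookup h i})"
  by (auto simp: lookup_add)
 then have "finite (?r ` ?D)"
  by (rule finite_subset) (intro finite_PiE finite_decomp finite_keys)
 then show "finite ?D" using inj by (rule finite_imageD)
next
 fix f g :: "'a \<Rightarrow>\<^sub>0 'b" assume "f + g = 0"
 then have "lookup f i + lookup g i = 0" for i by (metis lookup_add lookup_zero)
 from zero_sum_free[OF this] show "f = 0" by (intro poly_mapping_eqI) simp
qed

abbreviation decomps :: "'i::fin_decomp => ('i \<times> 'i) set" where
 "decomps c \<equiv> {(a, b). a + b = c}"

lemma finite_decomps [simp]: "finite {p. fst p + snd p = (c::'i::fin_decomp)}"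
 using finite_decomp[of c] by (simp add: split_def)

typedef ('i, 'k) ser = "UNIV :: ('i => 'k) set"
 morphisms coef Ser by simp

lemma coef_Ser [simp]: "coef (Ser f) = f"
 by (simp add: Ser_inverse)

lemma ser_eqI: "(!!i. coef f i = coef g i) ==> f = g"
 by (metis coef_inverse ext)

instantiation ser :: (fin_decomp, comm_ring_1) comm_ring_1
begin

definition "0 = Ser (%i. 0)"
definition "1 = Ser (%i. if i = 0 then 1 else 0)"
definition "f + g = Ser (%i. coef f i + coef g i)"
definition "- f = Ser (%i. - coef f i)"
definition "f - g = Ser (%i. coef f i - coef g i)"
definition "f * g = Ser (%i. \<Sum>(a, b)\<in>decomps i. coef f a * coef g b)"

instance
proof
 fix f g h :: "('a, 'b) ser"
 show "f * g * h = f * (g * h)"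
 proof (rule ser_eqI)
  fix i
  have "coef (f * g * h) i = (\<Sum>(x, c)\<in>decomps i. \<Sum>(a, b)\<in>decomps x. coef f a * coef g b * coef h c)"
   by (simp add: times_ser_def sum_distrib_right split_def)
  also have "... = (\<Sum>((x, c), (a, b))\<in>(SIGMA xc:decomps i. decomps (fst xc)). coef f a * coef g b * coef h c)"
   by (subst sum.Sigma[symmetric]) (auto simp: finite_decomp split_def)
  also have "... = (\<Sum>((a, x), (b, c))\<in>(SIGMA ax:decomps i. decomps (snd ax)). coef f a * coef g b * coef h c)"
   by (rule sum.reindex_bij_witness[where i = "%((a, x), (b, c)). ((a + b, c), (a, b))"
      and j = "%((x, c), (a, b)). ((a, b + c), (b, c))"])
    (auto simp: add.assoc)
  also have "... = (\<Sum>(a, x)\<in>decomps i. \<Sum>(b, c)\<in>decomps x. coef f a * coef g b * coef h c)"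
   by (subst sum.Sigma[symmetric]) (auto simp: finite_decomp split_def)
  also have "... = coef (f * (g * h)) i"
   by (simp add: times_ser_def sum_distrib_left split_def mult.assoc)
  finally show "coef (f * g * h) i = coef (f * (g * h)) i" .
 qed
 show "f * g = g * f"
  unfolding times_ser_def
  by (rule ser_eqI, simp, rule sum.reindex_bij_witness[where i = "%(a, b). (b, a)" and j = "%(a, b). (b, a)"])
   (auto simp: mult.commute add.commute)
 show "1 * f = f"
 proof (rule ser_eqI)
  fix i
  have "coef (1 * f) i = (\<Sum>p\<in>decomps i. if p = (0, i) then coef f i else 0)"
   unfolding times_ser_def one_ser_def by (auto intro!: sum.cong)
  also have "... = coef f i"
   by (simp add: sum.delta[OF finite_decomp])
  finally show "coef (1 * f) i = coef f i" .
 qed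
 show "(f + g) * h = f * h + g * h"
  by (rule ser_eqI) (simp add: times_ser_def plus_ser_def split_def distrib_right sum.distrib)
 show "(0 :: ('a, 'b) ser) ~= 1"
  by (auto simp: zero_ser_def one_ser_def Ser_inject fun_eq_iff)
qed (auto intro!: ser_eqI simp: plus_ser_def zero_ser_def uminus_ser_def minus_ser_def algebra_simps)

end

lemma coef_0 [simp]: "coef 0 i = 0" by (simp add: zero_ser_def)
lemma coef_add [simp]: "coef (f + g) i = coef f i + coef g i" by (simp add: plus_ser_def)
lemma coef_mult: "coef (f * g) i = (\<Sum>(a, b)\<in>decomps i. coef f a * coef g b)" by (simp add: times_ser_def)
lemma coef_sum [simp]: "coef (sum f I) i = (\<Sum>x\<in>I. coef (f x) i)"
 by (induction I rule: infinite_finite_induct) auto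

definition smono :: "'i => 'k => ('i::fin_decomp, 'k::comm_ring_1) ser" where
 "smono i c = Ser (%j. if j = i then c else 0)"

lemma coef_mono: "coef (smono i c) j = (if j = i then c else 0)"
 by (simp add: smono_def)

lemma coef_mono_mult: "coef (smono i c * f) (i + j) = c * coef f j"
proof -
 have "coef (smono i c * f) (i + j) = (\<Sum>p\<in>decomps (i + j). if p = (i, j) then c * coef f j else 0)"
  unfolding coef_mult by (intro sum.cong) (auto simp: coef_mono split: if_splits)
 also have "... = c * coef f j"
  by (simp add: sum.delta[OF finite_decomp])
 finally show ?thesis .
qed

lemma coef_mono_mult_0: "(!!j. k ~= i + j) ==> coef (smono i c * f) k = 0"
 unfolding coef_mult by (intro sum.neutral) (auto simp: coef_mono)

lemma coef_const_mult: "coef (smono 0 c * f) j = c * coef f j"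
 using coef_mono_mult[of 0 c f j] by simp

lemma mono_mult: "smono i c * smono j d = smono (i + j) (c * d)"
proof (rule ser_eqI)
 fix k
 show "coef (smono i c * smono j d) k = coef (smono (i + j) (c * d)) k"
 proof (cases "\<exists>k'. k = i + k'")
  case True
  then obtain k' where "k = i + k'" ..
  then show ?thesis using coef_mono_mult[of i c "smono j d" k'] by (simp add: coef_mono)
 next
  case False
  then show ?thesis using coef_mono_mult_0[of k i c "smono j d"] by (auto simp: coef_mono)
 qed
qed

lemma mono_0_1: "smono 0 1 = 1"
 by (simp add: smono_def one_ser_def)

text \<open>
  Substitution: \<open>\<Sum>\<^sub>t c\<^sub>t t \<mapsto> \<Sum>\<^sub>t c\<^sub>t Q\<^sub>t\<close> for a multiplicative family \<open>Q\<close>, the monomials outside \<open>V\<close> being sent to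
  zero. The sum converges because \<open>Q\<^sub>t\<close> has order at least \<open>w t\<close>.
\<close>

locale substitution =
 fixes V :: "'i::fin_decomp set" and w :: "'i => nat" and w' :: "'j::fin_decomp => nat"
  and Q :: "'i => ('j, 'k::comm_ring_1) ser"
 assumes V_0: "0 \<in> V" and V_add: "a + b \<in> V \<longleftrightarrow> a \<in> V & b \<in> V" and fin_V: "finite {t \<in> V. w t \<le> K}"
  and w_add: "w (a + b) = w a + w b" and w'_add: "w' (x + y) = w' x + w' y"
  and Q_0: "Q 0 = 1" and Q_add: "a \<in> V ==> b \<in> V ==> Q (a + b) = Q a * Q b"
  and Q_order: "t \<in> V ==> w' x < w t ==> coef (Q t) x = 0"
begin

definition subst :: "('i, 'k) ser => ('j, 'k) ser" where
 "subst c = Ser (%x. \<Sum>t\<in>{t \<in> V. w t \<le> w' x}. coef c t * coef (Q t) x)"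

lemma coef_subst: "w' x \<le> K ==> coef (subst c) x = (\<Sum>t\<in>{t \<in> V. w t \<le> K}. coef c t * coef (Q t) x)"
 unfolding subst_def by (simp, rule sum.mono_neutral_left) (auto simp: fin_V Q_order not_le)

lemma subst_add: "subst (c + d) = subst c + subst d"
 by (rule ser_eqI) (simp add: coef_subst[OF order.refl] algebra_simps sum.distrib)

lemma subst_mono:
 assumes "t \<in> V"
 shows "subst (smono t a) = smono 0 a * Q t"
proof (rule ser_eqI)
 fix x
 have "coef (subst (smono t a)) x = (\<Sum>t'\<in>{t' \<in> V. w t' \<le> max (w t) (w' x)}. if t' = t then a * coef (Q t) x else 0)"
  unfolding coef_subst[of x "max (w t) (w' x)", OF max.cobounded2] by (intro sum.cong) (auto simp: coef_mono)
 also have "... = a * coef (Q t) x" using assms fin_V[of "max (w t) (w' x)"] by simp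
 finally show "coef (subst (smono t a)) x = coef (smono 0 a * Q t) x" by (simp add: coef_const_mult)
qed

lemma subst_1: "subst 1 = 1"
 using subst_mono[OF V_0, of 1] by (simp add: mono_0_1 Q_0)

lemma subst_mult: "subst (c * d) = subst c * subst d"
proof (rule ser_eqI)
 fix x
 let ?K = "w' x"
 let ?B = "{t \<in> V. w t \<le> ?K}"
 have fB: "finite ?B" by (rule fin_V)
 have "coef (subst (c * d)) x = (\<Sum>t\<in>?B. \<Sum>(a, b)\<in>decomps t. coef c a * coef d b * coef (Q t) x)"
  by (simp add: coef_subst[OF order.refl] coef_mult sum_distrib_right split_def)
 also have "... = (\<Sum>(t, a, b)\<in>(SIGMA t:?B. decomps t). coef c a * coef d b * coef (Q t) x)"
  by (subst sum.Sigma) (auto simp: fB finite_decomp split_def)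
 also have "... = (\<Sum>(a, b)\<in>{(a, b). a \<in> ?B & b \<in> ?B & w (a + b) \<le> ?K}. coef c a * coef d b * coef (Q (a + b)) x)"
  by (rule sum.reindex_bij_witness[where i = "%(a, b). (a + b, a, b)" and j = snd])
   (auto simp: V_add w_add)
 also have "... = (\<Sum>(a, b)\<in>?B \<times> ?B. coef c a * coef d b * coef (Q a * Q b) x)"
 proof (rule sum.mono_neutral_cong_left)
  show "\<forall>i\<in>?B \<times> ?B - {(a, b). a \<in> ?B & b \<in> ?B & w (a + b) \<le> ?K}.
    (case i of (a, b) => coef c a * coef d b * coef (Q a * Q b) x) = 0"
  proof
   fix i assume i: "i \<in> ?B \<times> ?B - {(a, b). a \<in> ?B & b \<in> ?B & w (a + b) \<le> ?K}"
   obtain a b where ab: "i = (a, b)" by (cases i)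
   have "a \<in> V" "b \<in> V" "\<not> w (a + b) \<le> ?K" using i by (auto simp: ab)
   then have "coef (Q a * Q b) x = 0" using Q_order[of "a + b" x] by (simp add: V_add Q_add)
   then show "(case i of (a, b) => coef c a * coef d b * coef (Q a * Q b) x) = 0" by (simp add: ab)
  qed
 qed (use fB in \<open>auto simp: Q_add\<close>)
 also have "... = (\<Sum>(a, b)\<in>?B \<times> ?B. \<Sum>(y, z)\<in>decomps x. (coef c a * coef (Q a) y) * (coef d b * coef (Q b) z))"
  unfolding coef_mult sum_distrib_left split_def by (simp add: mult_ac)
 also have "... = (\<Sum>(y, z)\<in>decomps x. (\<Sum>a\<in>?B. coef c a * coef (Q a) y) * (\<Sum>b\<in>?B. coef d b * coef (Q b) z))"
  unfolding split_def by (subst sum.swap) (simp add: sum_product sum.cartesian_product split_def)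
 also have "... = (\<Sum>(y, z)\<in>decomps x. coef (subst c) y * coef (subst d) z)"
  by (intro sum.cong refl) (auto simp: coef_subst[of _ ?K] w'_add)
 also have "... = coef (subst c * subst d) x" by (simp add: coef_mult)
 finally show "coef (subst (c * d)) x = coef (subst c * subst d) x" .
qed

lemma subst_const: "subst (smono 0 a * c) = smono 0 a * subst c"
 by (simp add: subst_mult subst_mono[OF V_0] Q_0)

lemma subst_order:
 assumes "!!t. t \<in> V ==> w t < K ==> coef c t = 0" "w' x < K"
 shows "coef (subst c) x = 0"
 unfolding coef_subst[OF order.refl] using assms by (intro sum.neutral) auto

lemma subst_cong:
 assumes "!!t. t \<in> V ==> coef c t = coef d t"
 shows "subst c = subst d"
 by (rule ser_eqI) (auto simp: coef_subst[OF order.refl] assms intro!: sum.cong)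

lemma subst_prod_mset: "subst (\<Prod>i\<in>#M. f i) = (\<Prod>i\<in>#M. subst (f i))"
 by (induction M) (auto simp: subst_1 subst_mult)

lemma subst_sum: "subst (\<Sum>i\<in>I. f i) = (\<Sum>i\<in>I. subst (f i))"
proof (induction I rule: infinite_finite_induct)
 have "subst 0 = 0" by (rule ser_eqI) (simp add: coef_subst[OF order.refl])
 then show "subst (sum f A) = (\<Sum>i\<in>A. subst (f i))" if "infinite A" for A using that by simp
 show "subst (\<Sum>i\<in>{}. f i) = (\<Sum>i\<in>{}. subst (f i))" using \<open>subst 0 = 0\<close> by simp
qed (auto simp: subst_add)

end

section \<open>Symmetric series\<close>

type_synonym expo = "(nat \<Rightarrow>\<^sub>0 nat) \<times> (nat \<Rightarrow>\<^sub>0 nat) \<times> nat"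

definition wt :: "expo => nat" where
 "wt = (%(alpha, beta, d). mdeg alpha + mdeg beta + d)"

lemma mdeg_alt: "finite A ==> keys alpha \<subseteq> A ==> mdeg alpha = (\<Sum>i\<in>A. lookup alpha i)"
 unfolding mdeg_def by (rule sum.mono_neutral_left) (auto simp: in_keys_iff)

lemma mdeg_add: "mdeg (alpha + beta) = mdeg alpha + mdeg beta"
proof -
 let ?A = "keys alpha \<union> keys beta"
 have "keys (alpha + beta) \<subseteq> ?A" by (rule keys_add)
 then show ?thesis
  using mdeg_alt[of ?A "alpha + beta"] mdeg_alt[of ?A alpha] mdeg_alt[of ?A beta] by (simp add: lookup_add sum.distrib)
qed

lemma mdeg_0 [simp]: "mdeg 0 = 0" by (simp add: mdeg_def)
lemma mdeg_single [simp]: "mdeg (single i n) = n" by (simp add: mdeg_def)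

lemma mdeg_eq_0 [simp]: "mdeg alpha = 0 \<longleftrightarrow> alpha = 0"
proof
 assume "mdeg alpha = 0"
 then have "\<forall>i\<in>keys alpha. lookup alpha i = 0" by (simp add: mdeg_def)
 then have "lookup alpha i = 0" for i by (cases "i \<in> keys alpha") (auto simp: in_keys_iff)
 then show "alpha = 0" by (intro poly_mapping_eqI) simp
qed simp

lemma wt_add: "wt (x + y) = wt x + wt y"
 by (cases x; cases y) (simp add: wt_def mdeg_add)

lemma wt_0 [simp]: "wt 0 = 0" by (simp add: wt_def zero_prod_def)

lemma carrier_sym: "f \<in> carrier sym_series \<longleftrightarrow> (\<forall>\<pi> rho alpha beta d. bij \<pi> & bij rho -->
  f (map_key \<pi> alpha, map_key rho beta, d) = f (alpha, beta, d))"
 by (simp add: sym_series_def)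

definition symmetric :: "(expo, 'k::comm_ring_1) ser => bool" where
 "symmetric f \<longleftrightarrow> coef f \<in> carrier sym_series"

definition rename :: "(nat => nat) => (nat => nat) => expo => expo" where
 "rename \<pi> rho = (%(alpha, beta, d). (map_key \<pi> alpha, map_key rho beta, d))"

lemma symmetric_iff: "symmetric f \<longleftrightarrow> (\<forall>\<pi> rho x. bij \<pi> --> bij rho --> coef f (rename \<pi> rho x) = coef f x)"
 by (auto simp: symmetric_def carrier_sym rename_def)

lemma rename_add: "bij \<pi> ==> bij rho ==> rename \<pi> rho (x + y) = rename \<pi> rho x + rename \<pi> rho y"
 by (cases x; cases y) (simp add: rename_def map_key_plus bij_is_inj)

lemma rename_inv:
 assumes "bij \<pi>" "bij rho"
 shows "rename (inv_into UNIV \<pi>) (inv_into UNIV rho) (rename \<pi> rho x) = x"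
  "rename \<pi> rho (rename (inv_into UNIV \<pi>) (inv_into UNIV rho) x) = x"
proof -
 have inj: "inj \<pi>" "inj rho" "inj (inv_into UNIV \<pi>)" "inj (inv_into UNIV rho)"
  using assms by (auto simp: bij_is_inj bij_imp_bij_inv)
 have comp: "\<pi> \<circ> inv_into UNIV \<pi> = (%x. x)" "rho \<circ> inv_into UNIV rho = (%x. x)"
  "inv_into UNIV \<pi> \<circ> \<pi> = (%x. x)" "inv_into UNIV rho \<circ> rho = (%x. x)"
  using assms by (auto simp: fun_eq_iff bij_is_surj bij_is_inj surj_f_inv_f)
 show "rename (inv_into UNIV \<pi>) (inv_into UNIV rho) (rename \<pi> rho x) = x"
  "rename \<pi> rho (rename (inv_into UNIV \<pi>) (inv_into UNIV rho) x) = x"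
  by (cases x; simp add: rename_def map_key_compose inj comp map_key_id)+
qed

lemma symmetric_mult:
 assumes "symmetric f" "symmetric g"
 shows "symmetric (f * g)"
 unfolding symmetric_iff
proof (intro allI impI)
 fix \<pi> rho :: "nat => nat" and x assume b: "bij \<pi>" "bij rho"
 let ?i = "rename (inv_into UNIV \<pi>) (inv_into UNIV rho)" and ?r = "rename \<pi> rho"
 have b': "bij (inv_into UNIV \<pi>)" "bij (inv_into UNIV rho)" using b by (auto intro: bij_imp_bij_inv)
 have fg: "coef f (?i y) = coef f y" "coef g (?i y) = coef g y" for y
  using assms b' unfolding symmetric_iff by blast+
 show "coef (f * g) (?r x) = coef (f * g) x"
  unfolding coef_mult
 proof (rule sum.reindex_bij_witness[where i = "map_prod ?r ?r" and j = "map_prod ?i ?i"])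
  fix p assume p: "p \<in> decomps (?r x)"
  show "map_prod ?r ?r (map_prod ?i ?i p) = p" by (cases p) (simp add: rename_inv[OF b])
  have "?i (fst p) + ?i (snd p) = x"
   using p rename_add[OF b', of "fst p" "snd p"] rename_inv(1)[OF b, of x] by (simp add: split_def)
  then show "map_prod ?i ?i p \<in> decomps x" by (cases p) simp
  show "(case map_prod ?i ?i p of (y, z) => coef f y * coef g z) = (case p of (y, z) => coef f y * coef g z)"
   by (cases p) (simp add: fg)
 next
  fix p assume p: "p \<in> decomps x"
  show "map_prod ?i ?i (map_prod ?r ?r p) = p" by (cases p) (simp add: rename_inv[OF b])
  have "?r (fst p) + ?r (snd p) = ?r x" 
   using p rename_add[OF b, of "fst p" "snd p"] by (simp add: split_def)
  then show "map_prod ?r ?r p \<in> decomps (?r x)" by (cases p) simp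
 qed
qed

lemma symmetric_add: "symmetric f ==> symmetric g ==> symmetric (f + g)"
 by (simp add: symmetric_iff)

lemma symmetric_0: "symmetric 0" by (simp add: symmetric_iff)

lemma symmetric_mono: "symmetric (smono (0, 0, i) c)"
proof -
 have "(map_key \<pi> alpha = 0) = (alpha = 0)" if "bij \<pi>" for \<pi> :: "nat => nat" and alpha :: "nat \<Rightarrow>\<^sub>0 nat"
 proof
  assume *: "map_key \<pi> alpha = 0"
  have "lookup alpha (\<pi> i) = 0" for i
   using arg_cong[OF *, of "%f. lookup f i"] that by (simp add: map_key.rep_eq bij_is_inj)
  then show "alpha = 0" using that by (intro poly_mapping_eqI) (metis bij_pointE lookup_zero)
 qed (simp add: bij_is_inj that)
 then show ?thesis by (auto simp: symmetric_iff coef_mono rename_def)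
qed

lemma symmetric_1: "symmetric 1"
 using symmetric_mono[of 0 1] by (simp add: mono_0_1 flip: zero_prod_def)

lemma symmetric_prod_mset: "(!!x. x \<in># M ==> symmetric (f x)) ==> symmetric (\<Prod>x\<in>#M. f x)"
 by (induction M) (auto simp: symmetric_1 symmetric_mult)

lemma symmetric_sum: "(!!x. x \<in> I ==> symmetric (f x)) ==> symmetric (\<Sum>x\<in>I. f x)"
 by (induction I rule: infinite_finite_induct) (auto simp: symmetric_0 symmetric_add)

lemma wt_rename: "bij \<pi> ==> bij rho ==> wt (rename \<pi> rho x) = wt x"
proof -
 have "mdeg (map_key \<pi> alpha) = mdeg alpha" if "bij \<pi>" for \<pi> :: "nat => nat" and alpha
 proof -
  have "bij_betw \<pi> (\<pi> -` keys alpha) (keys alpha)"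
   using inj_on_subset[OF bij_is_inj[OF that] subset_UNIV] surj_image_vimage_eq[OF bij_is_surj[OF that]]
   by (simp add: bij_betw_def)
  from sum.reindex_bij_betw[OF this, of "lookup alpha"]
  show ?thesis using that by (simp add: mdeg_def keys_map_key bij_is_inj map_key.rep_eq)
 qed
 then show "bij \<pi> ==> bij rho ==> wt (rename \<pi> rho x) = wt x" by (cases x) (simp add: wt_def rename_def)
qed

lemma coef_sym_mult: "monoid.mult sym_series f g = coef (Ser f * Ser g)"
 by (simp add: sym_series_def fun_eq_iff coef_mult)

section \<open>Polynomials in power sums\<close>

type_synonym power_monomial = "nat multiset \<times> nat multiset \<times> nat"

definition ps_valid :: "power_monomial set" where
 "ps_valid = {(l, l', i). 0 \<notin># l & 0 \<notin># l'}"

definition ps_wt :: "power_monomial => nat" where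
 "ps_wt = (%(l, l', i). sum_mset l + sum_mset l' + i)"

definition ps_len :: "power_monomial => nat" where
 "ps_len = (%(l, l', i). size l + size l')"

definition ps_eval ::
 "(nat => (expo, 'k::comm_ring_1) ser) => (nat => (expo, 'k) ser) => power_monomial => (expo, 'k) ser" where
 "ps_eval X Y = (%(l, l', i). (\<Prod>n\<in>#l. X n) * (\<Prod>n\<in>#l'. Y n) * smono (0, 0, i) 1)"

definition order_ge :: "nat => (expo, 'k::comm_ring_1) ser => bool" where
 "order_ge K f \<longleftrightarrow> (\<forall>x. wt x < K --> coef f x = 0)"

lemma order_ge_iff: "series_order_ge K f \<longleftrightarrow> order_ge K (Ser f)"
 by (auto simp: series_order_ge_def order_ge_def wt_def)

lemma order_ge_mult:
 assumes "order_ge K f" "order_ge L g"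
 shows "order_ge (K + L) (f * g)"
 unfolding order_ge_def coef_mult
proof (intro allI impI sum.neutral ballI)
 fix x p assume x: "wt x < K + L" and p: "p \<in> decomps x"
 obtain a b where ab: "p = (a, b)" by (cases p)
 have "wt a + wt b < K + L" using x p by (auto simp: ab wt_add)
 then have "wt a < K \<or> wt b < L" by linarith
 then have "coef f a = 0 \<or> coef g b = 0" using assms unfolding order_ge_def by blast
 then show "(case p of (a, b) => coef f a * coef g b) = 0" by (auto simp: ab)
qed

lemma order_ge_prod_mset: "(!!n. n \<in># M ==> order_ge n (f n)) ==> order_ge (sum_mset M) (\<Prod>n\<in>#M. f n)"
proof (induction M)
 case (add n M)
 then show ?case using order_ge_mult[of n "f n" "sum_mset M" "\<Prod>n\<in>#M. f n"] by simp
qed (simp add: order_ge_def)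

lemma size_le_sum_mset: "0 \<notin># (M :: nat multiset) ==> size M \<le> sum_mset M"
 by (induction M) auto

lemma count_le_sum_mset: "0 \<notin># (M :: nat multiset) ==> count M k \<le> sum_mset M"
 using size_le_sum_mset[of M] count_le_size[of M k] by linarith

lemma finite_partitions: "finite {M :: nat multiset. 0 \<notin># M & sum_mset M \<le> K}"
proof (rule finite_subset[OF _ finite_submultisets[of "\<Sum>k\<le>K. replicate_mset K k"]], clarify)
 fix M :: "nat multiset" assume M: "0 \<notin># M" "sum_mset M \<le> K"
 have "count M k \<le> count (\<Sum>k\<le>K. replicate_mset K k) k" for k
 proof (cases "k \<in># M")
  case True
  then have "k \<le> K" using M(2) sum_mset.remove[of k M] by simp
  then have "count (\<Sum>k\<le>K. replicate_mset K k) k = K" by (simp add: count_sum)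
  then show ?thesis using count_le_sum_mset[OF M(1), of k] M(2) by simp
 qed (simp add: count_eq_zero_iff[THEN iffD2])
 then show "M \<subseteq># (\<Sum>k\<le>K. replicate_mset K k)" by (simp add: subseteq_mset_def)
qed

lemma finite_ps_valid: "finite {t \<in> ps_valid. ps_wt t \<le> K}"
proof -
 let ?A = "{M :: nat multiset. 0 \<notin># M & sum_mset M \<le> K}"
 have "{t \<in> ps_valid. ps_wt t \<le> K} \<subseteq> ?A \<times> ?A \<times> {..K}" by (auto simp: ps_valid_def ps_wt_def)
 then show ?thesis by (rule finite_subset) (intro finite_cartesian_product finite_partitions finite_atMost)
qed

text \<open>
  Series of order at least \<open>n\<close> may be substituted for the \<open>n\<close>-th power sums, because only finitely many products of
  power sums then contribute to a given coefficient.
\<close>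

lemma ps_substitution:
 assumes "!!n. 1 \<le> n ==> order_ge n (X n)" "!!n. 1 \<le> n ==> order_ge n (Y n)"
 shows "substitution ps_valid ps_wt wt (ps_eval X Y)"
proof
 fix t x assume t: "t \<in> ps_valid" and x: "wt x < ps_wt t"
 obtain l l' i where tt: "t = (l, l', i)" by (cases t)
 have "1 \<le> n" if "n \<in># l \<or> n \<in># l'" for n using that t by (cases n) (auto simp: tt ps_valid_def)
 then have "order_ge (sum_mset l) (\<Prod>n\<in>#l. X n)" "order_ge (sum_mset l') (\<Prod>n\<in>#l'. Y n)"
  using assms by (auto intro: order_ge_prod_mset)
 moreover have "order_ge i (smono (0, 0, i) 1)" by (auto simp: order_ge_def coef_mono wt_def)
 ultimately have "order_ge (ps_wt t) (ps_eval X Y t)"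
  unfolding tt ps_wt_def ps_eval_def case_prod_conv by (intro order_ge_mult)
 with x show "coef (ps_eval X Y t) x = 0" unfolding order_ge_def by blast
next
 fix a b assume "a \<in> ps_valid" "b \<in> ps_valid"
 show "ps_eval X Y (a + b) = ps_eval X Y a * ps_eval X Y b"
 proof -
  obtain l l' i m m' j where ab: "a = (l, l', i)" "b = (m, m', j)" by (cases a, cases b)
  have "smono (0, 0, i + j) 1 = (smono (0, 0, i) 1 * smono (0, 0, j) 1 :: (expo, 'a) ser)" by (simp add: mono_mult)
  then show ?thesis by (simp add: ab ps_eval_def mult_ac)
 qed
next
 show "finite {t \<in> ps_valid. ps_wt t \<le> K}" for K by (rule finite_ps_valid)
 have "smono (0 :: expo) 1 = (1 :: (expo, 'a) ser)" by (rule mono_0_1)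
 then have "smono (0, 0, 0) 1 = (1 :: (expo, 'a) ser)" by (simp add: zero_prod_def)
 then show "ps_eval X Y 0 = 1" by (simp add: ps_eval_def zero_prod_def)
qed (auto simp: ps_valid_def zero_prod_def ps_wt_def wt_add)

text \<open>Supports of series with coefficients in the natural numbers are additive.\<close>

definition nat_coefs :: "('i::fin_decomp, 'k::comm_ring_1) ser => bool" where
 "nat_coefs f \<longleftrightarrow> (\<forall>x. coef f x \<in> \<nat>)"

lemma sum_Nats: "(!!i. i \<in> I ==> f i \<in> \<nat>) ==> sum f I \<in> \<nat>"
 by (induction I rule: infinite_finite_induct) auto

lemma nat_coefs_mult: "nat_coefs f ==> nat_coefs g ==> nat_coefs (f * g)"
 unfolding nat_coefs_def coef_mult split_def by (auto intro!: sum_Nats Nats_mult)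

lemma coef_mult_nonzeroD: "coef (f * g) x ~= 0 ==> \<exists>a b. x = a + b & coef f a ~= 0 & coef g b ~= 0"
 unfolding coef_mult
 by (erule sum.not_neutral_contains_not_neutral) fastforce

lemma sum_Nats_nonzero:
 assumes "finite I" "!!i. i \<in> I ==> f i \<in> \<nat>" "j \<in> I" "f j ~= (0::'k::field_char_0)"
 shows "sum f I ~= 0"
proof -
 have "\<forall>i\<in>I. \<exists>n. f i = of_nat n" using assms(2) by (meson Nats_cases)
 then obtain n where n: "!!i. i \<in> I ==> f i = of_nat (n i)" by metis
 have "n j ~= 0" using n[OF assms(3)] assms(4) by (metis of_nat_0)
 then have "sum n I ~= 0" using assms(1,3) by auto
 moreover have "sum f I = of_nat (sum n I)" using n by simp
 ultimately show ?thesis by (metis of_nat_eq_0_iff)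
qed

lemma coef_mult_nonzeroI:
 assumes "nat_coefs f" "nat_coefs g" "coef f a ~= 0" "coef g b ~= (0::'k::field_char_0)"
 shows "coef (f * g) (a + b) ~= 0"
 unfolding coef_mult
 by (rule sum_Nats_nonzero[where j = "(a, b)"])
  (use assms in \<open>auto simp: nat_coefs_def finite_decomp intro: Nats_mult\<close>)

definition px :: "nat => (expo, 'k::comm_ring_1) ser" where "px n = Ser (power_sum_x n)"
definition py :: "nat => (expo, 'k::comm_ring_1) ser" where "py n = Ser (power_sum_y n)"

text \<open>The possible exponents of a product of power sums.\<close>

inductive part_sum :: "nat multiset => (nat \<Rightarrow>\<^sub>0 nat) => bool" where
 empty: "part_sum {#} 0"
| add: "part_sum l alpha ==> part_sum (add_mset n l) (single i n + alpha)"

definition shape :: "(nat \<Rightarrow>\<^sub>0 nat) => nat multiset" where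
 "shape alpha = image_mset (lookup alpha) (mset_set (keys alpha))"

lemma zero_notin_shape: "0 \<notin># shape alpha"
 by (auto simp: shape_def in_keys_iff)

lemma size_shape: "size (shape alpha) = card (keys alpha)"
 by (simp add: shape_def)

lemma sum_shape: "sum_mset (shape alpha) = mdeg alpha"
 by (simp add: shape_def mdeg_def sum_unfold_sum_mset)

lemma shape_0 [simp]: "shape 0 = {#}" by (simp add: shape_def)

lemma shape_add_fresh:
 assumes "i \<notin> keys alpha" "n ~= 0"
 shows "shape (single i n + alpha) = add_mset n (shape alpha)"
proof -
 have l: "lookup (single i n + alpha) j = (if j = i then n else lookup alpha j)" for j
  using assms by (auto simp: lookup_add lookup_single when_def in_keys_iff)
 have k: "keys (single i n + alpha) = insert i (keys alpha)"
  using assms by (auto simp: in_keys_iff l split: if_splits)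
 show ?thesis
  unfolding shape_def k using assms by (auto simp: l intro!: image_mset_cong)
qed

lemma part_sum_shape:
 "part_sum l alpha ==> 0 \<notin># l ==> mdeg alpha = sum_mset l & size (shape alpha) \<le> size l & (size (shape alpha) = size l --> shape alpha = l)"
proof (induction rule: part_sum.induct)
 case (add l alpha n i)
 then have IH: "mdeg alpha = sum_mset l" "size (shape alpha) \<le> size l" "size (shape alpha) = size l --> shape alpha = l" and n: "n ~= 0"
  by auto
 show ?case
 proof (cases "i \<in> keys alpha")
  case False
  then show ?thesis using shape_add_fresh[OF False n] IH by (simp add: mdeg_add)
 next
  case True
  have "keys (single i n + alpha) \<subseteq> keys alpha"
   using True keys_add[of "single i n" alpha] n by auto
  then have "size (shape (single i n + alpha)) \<le> size (shape alpha)"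
   unfolding size_shape by (intro card_mono) auto
  then show ?thesis using IH by (simp add: mdeg_add)
 qed
qed simp

lemma px_support: "coef (px n :: (expo, 'k::comm_ring_1) ser) (alpha, beta, d) ~= 0 \<longleftrightarrow>
  (\<exists>i. alpha = single i n) & beta = 0 & d = 0"
 by (auto simp: px_def power_sum_x_def)

lemma py_support: "coef (py n :: (expo, 'k::comm_ring_1) ser) (alpha, beta, d) ~= 0 \<longleftrightarrow>
  alpha = 0 & (\<exists>i. beta = single i n) & d = 0"
 by (auto simp: py_def power_sum_y_def)

lemma nat_coefs_basic: "nat_coefs (px n)" "nat_coefs (py n)" "nat_coefs (smono x 1)" "nat_coefs 1"
 by (auto simp: nat_coefs_def px_def py_def power_sum_x_def power_sum_y_def coef_mono mono_0_1[symmetric])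

lemma nat_coefs_prod_mset: "(!!n. nat_coefs (f n)) ==> nat_coefs (\<Prod>n\<in>#M. f n)"
 by (induction M) (auto simp: nat_coefs_basic nat_coefs_mult)

lemma px_prod_supportD: "coef (\<Prod>n\<in>#l. px n :: (expo, 'k::field_char_0) ser) (alpha, beta, d) ~= 0 ==> part_sum l alpha & beta = 0 & d = 0"
proof (induction l arbitrary: alpha beta d)
 case empty
 then show ?case by (auto simp: one_ser_def zero_prod_def part_sum.empty split: if_splits)
next
 case (add n l)
 then obtain a b where ab: "(alpha, beta, d) = a + b" "coef (px n :: (expo, 'k) ser) a ~= 0"
  "coef (\<Prod>n\<in>#l. px n :: (expo, 'k) ser) b ~= 0"
  using coef_mult_nonzeroD[of "px n" "\<Prod>n\<in>#l. px n :: (expo, 'k) ser" "(alpha, beta, d)"] by auto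
 obtain a1 a2 a3 b1 b2 b3 where e: "a = (a1, a2, a3)" "b = (b1, b2, b3)" by (cases a, cases b)
 show ?case using ab add.IH[of b1 b2 b3] part_sum.add unfolding e px_support by auto
qed

lemma py_prod_supportD: "coef (\<Prod>n\<in>#l. py n :: (expo, 'k::field_char_0) ser) (alpha, beta, d) ~= 0 ==> alpha = 0 & part_sum l beta & d = 0"
proof (induction l arbitrary: alpha beta d)
 case empty
 then show ?case by (auto simp: one_ser_def zero_prod_def part_sum.empty split: if_splits)
next
 case (add n l)
 then obtain a b where ab: "(alpha, beta, d) = a + b" "coef (py n :: (expo, 'k) ser) a ~= 0"
  "coef (\<Prod>n\<in>#l. py n :: (expo, 'k) ser) b ~= 0"
  using coef_mult_nonzeroD[of "py n" "\<Prod>n\<in>#l. py n :: (expo, 'k) ser" "(alpha, beta, d)"] by auto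
 obtain a1 a2 a3 b1 b2 b3 where e: "a = (a1, a2, a3)" "b = (b1, b2, b3)" by (cases a, cases b)
 show ?case using ab add.IH[of b1 b2 b3] part_sum.add unfolding e py_support by auto
qed

lemma ex_shape_px: "0 \<notin># l ==> \<exists>alpha. shape alpha = l & coef (\<Prod>n\<in>#l. px n :: (expo, 'k::field_char_0) ser) (alpha, 0, 0) ~= 0"
proof (induction l)
 case empty
 show ?case by (intro exI[of _ 0]) (simp add: one_ser_def zero_prod_def)
next
 case (add n l)
 then obtain alpha where alpha: "shape alpha = l" "coef (\<Prod>n\<in>#l. px n :: (expo, 'k) ser) (alpha, 0, 0) ~= 0" and n: "n ~= 0" by auto
 obtain i where i: "i \<notin> keys alpha" using ex_new_if_finite[OF infinite_UNIV_nat finite_keys] by blast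
 have "coef (px n * (\<Prod>n\<in>#l. px n) :: (expo, 'k) ser) ((single i n, 0, 0) + (alpha, 0, 0)) ~= 0"
  using alpha by (intro coef_mult_nonzeroI nat_coefs_basic nat_coefs_prod_mset) (auto simp: px_support)
 then show ?case using shape_add_fresh[OF i n] alpha by (intro exI[of _ "single i n + alpha"]) simp
qed

lemma ex_shape_py: "0 \<notin># l ==> \<exists>beta. shape beta = l & coef (\<Prod>n\<in>#l. py n :: (expo, 'k::field_char_0) ser) (0, beta, 0) ~= 0"
proof (induction l)
 case empty
 show ?case by (intro exI[of _ 0]) (simp add: one_ser_def zero_prod_def)
next
 case (add n l)
 then obtain alpha where alpha: "shape alpha = l" "coef (\<Prod>n\<in>#l. py n :: (expo, 'k) ser) (0, alpha, 0) ~= 0" and n: "n ~= 0" by auto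
 obtain i where i: "i \<notin> keys alpha" using ex_new_if_finite[OF infinite_UNIV_nat finite_keys] by blast
 have "coef (py n * (\<Prod>n\<in>#l. py n) :: (expo, 'k) ser) ((0, single i n, 0) + (0, alpha, 0)) ~= 0"
  using alpha by (intro coef_mult_nonzeroI nat_coefs_basic nat_coefs_prod_mset) (auto simp: py_support)
 then show ?case using shape_add_fresh[OF i n] alpha by (intro exI[of _ "single i n + alpha"]) simp
qed

abbreviation ps_prod :: "power_monomial => (expo, 'k::field_char_0) ser" where
 "ps_prod \<equiv> ps_eval px py"

definition ps_shape :: "expo => power_monomial" where
 "ps_shape = (%(alpha, beta, d). (shape alpha, shape beta, d))"

lemma ps_wt_shape: "ps_wt (ps_shape x) = wt x"
 by (cases x) (simp add: ps_wt_def ps_shape_def wt_def sum_shape)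

lemma ps_shape_valid: "ps_shape x \<in> ps_valid"
 by (cases x) (simp add: ps_shape_def ps_valid_def zero_notin_shape)

lemma ps_len_le: "t \<in> ps_valid ==> ps_len t \<le> ps_wt t"
 using size_le_sum_mset[of "fst t"] size_le_sum_mset[of "fst (snd t)"]
 by (cases t) (simp add: ps_valid_def ps_len_def ps_wt_def)

text \<open>
  Triangularity: a product of power sums involves, besides the monomials with exactly its parts as
  exponents, only monomials in fewer variables.
\<close>

lemma ps_prod_support:
 assumes "t \<in> ps_valid" "coef (ps_prod t :: (expo, 'k::field_char_0) ser) x ~= 0"
 shows "wt x = ps_wt t" "t = ps_shape x \<or> ps_len (ps_shape x) < ps_len t"
proof -
 obtain l l' i where t: "t = (l, l', i)" by (cases t)
 have v: "0 \<notin># l" "0 \<notin># l'" using assms(1) by (auto simp: t ps_valid_def)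
 obtain a b c where e: "x = a + b + c" "coef (\<Prod>n\<in>#l. px n :: (expo, 'k) ser) a ~= 0"
  "coef (\<Prod>n\<in>#l'. py n :: (expo, 'k) ser) b ~= 0" "coef (smono (0, 0, i) 1 :: (expo, 'k) ser) c ~= 0"
  using assms(2) unfolding t ps_eval_def case_prod_conv by (metis coef_mult_nonzeroD)
 obtain alpha beta d a2 a3 b1 b3 where ab: "a = (alpha, a2, a3)" "b = (b1, beta, b3)" by (cases a, cases b)
 have 1: "part_sum l alpha" "a2 = 0" "a3 = 0" using px_prod_supportD[OF e(2)[unfolded ab]] by auto
 have 2: "part_sum l' beta" "b1 = 0" "b3 = 0" using py_prod_supportD[OF e(3)[unfolded ab]] by auto
 have c: "c = (0, 0, i)" using e(4) by (auto simp: coef_mono split: if_splits)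
 have x: "x = (alpha, beta, i)" using e(1) 1 2 c ab by simp
 note s = part_sum_shape[OF 1(1) v(1)] part_sum_shape[OF 2(1) v(2)]
 show "wt x = ps_wt t" using s by (simp add: x t wt_def ps_wt_def)
 show "t = ps_shape x \<or> ps_len (ps_shape x) < ps_len t" using s by (auto simp: x t ps_shape_def ps_len_def)
qed

lemma ex_ps_rep: "t \<in> ps_valid ==> \<exists>x. ps_shape x = t & coef (ps_prod t :: (expo, 'k::field_char_0) ser) x ~= 0"
proof -
 assume t: "t \<in> ps_valid"
 obtain l l' i where tt: "t = (l, l', i)" by (cases t)
 obtain alpha where a: "shape alpha = l" "coef (\<Prod>n\<in>#l. px n :: (expo, 'k) ser) (alpha, 0, 0) ~= 0"
  using ex_shape_px t by (auto simp: tt ps_valid_def)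
 obtain beta where b: "shape beta = l'" "coef (\<Prod>n\<in>#l'. py n :: (expo, 'k) ser) (0, beta, 0) ~= 0"
  using ex_shape_py t by (auto simp: tt ps_valid_def)
 have "coef (ps_prod t :: (expo, 'k) ser) ((alpha, 0, 0) + (0, beta, 0) + (0, 0, i)) ~= 0"
  unfolding tt ps_eval_def case_prod_conv
  by (intro coef_mult_nonzeroI nat_coefs_mult nat_coefs_basic nat_coefs_prod_mset a b) (simp add: coef_mono)
 then show ?thesis using a b by (intro exI[of _ "(alpha, beta, i)"]) (simp add: ps_shape_def tt)
qed

definition ps_rep :: "'k::field_char_0 itself => power_monomial => expo" where
 "ps_rep _ t = (SOME x. ps_shape x = t & coef (ps_prod t :: (expo, 'k) ser) x ~= 0)"

lemma ps_rep:
 assumes "t \<in> ps_valid"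
 shows "ps_shape (ps_rep TYPE('k::field_char_0) t) = t" "coef (ps_prod t :: (expo, 'k) ser) (ps_rep TYPE('k) t) ~= 0"
 using someI_ex[OF ex_ps_rep[OF assms, where 'k = 'k]] by (auto simp: ps_rep_def)

text \<open>Exponents with the same parts are related by a renaming of the variables.\<close>

lemma shape_eq_rename:
 assumes "shape alpha = shape alpha'"
 shows "\<exists>\<pi>. bij \<pi> & map_key \<pi> alpha' = alpha"
proof -
 obtain N where N: "keys alpha \<union> keys alpha' \<subseteq> {..<N}"
  using finite_nat_set_iff_bounded[of "keys alpha \<union> keys alpha'"] by auto
 have ms: "mset (map (lookup gamma) [0..<N]) = shape gamma + replicate_mset (N - size (shape gamma)) 0"
  if "keys gamma \<subseteq> {..<N}" for gamma :: "nat \<Rightarrow>\<^sub>0 nat"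
 proof -
  have "mset_set {0..<N} = mset_set (keys gamma) + mset_set ({0..<N} - keys gamma)"
   using that by (subst mset_set_Union[symmetric]) (auto intro: arg_cong[of _ _ mset_set])
  moreover have "image_mset (lookup gamma) (mset_set ({0..<N} - keys gamma)) =
    image_mset (%_. 0) (mset_set ({0..<N} - keys gamma))"
   by (intro image_mset_cong) (auto simp: in_keys_iff)
  moreover have "card ({0..<N} - keys gamma) = N - size (shape gamma)"
   using that by (simp add: size_shape card_Diff_subset atLeast0LessThan)
  ultimately show ?thesis by (simp add: shape_def image_mset_const_eq)
 qed
 have "mset (map (lookup alpha) [0..<N]) = mset (map (lookup alpha') [0..<N])"
  using ms[of alpha] ms[of alpha'] N assms by simp
 then obtain p where p: "p permutes {..<N}"
  "permute_list p (map (lookup alpha') [0..<N]) = map (lookup alpha) [0..<N]"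
  by (metis mset_eq_permutation length_map length_upt diff_zero)
 have "lookup alpha' (p i) = lookup alpha i" for i
 proof (cases "i < N")
  case True
  then have "p i < N" using permutes_in_image[OF p(1), of i] by simp
  then show ?thesis
   using arg_cong[OF p(2), of "%xs. xs ! i"] True permute_list_nth[of p "map (lookup alpha') [0..<N]" i] p(1) by simp
 next
  case False
  then have "p i = i" using permutes_not_in[OF p(1), of i] by simp
  moreover have "i \<notin> keys alpha" "i \<notin> keys alpha'" using N False by auto
  ultimately show ?thesis by (simp add: in_keys_iff)
 qed
 then have "map_key p alpha' = alpha"
  using permutes_inj[OF p(1)] by (intro poly_mapping_eqI) (simp add: map_key.rep_eq)
 then show ?thesis using permutes_bij[OF p(1)] by blast
qed

lemma symmetric_shape:
 assumes "symmetric f" "ps_shape x = ps_shape y"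
 shows "coef f x = coef f y"
proof -
 obtain alpha beta d alpha' beta' d' where e: "x = (alpha, beta, d)" "y = (alpha', beta', d')" by (cases x, cases y)
 obtain \<pi> rho where "bij \<pi>" "bij rho" "map_key \<pi> alpha' = alpha" "map_key rho beta' = beta"
  using shape_eq_rename[of alpha alpha'] shape_eq_rename[of beta beta'] assms(2) by (auto simp: e ps_shape_def)
 moreover have "d = d'" using assms(2) by (simp add: e ps_shape_def)
 ultimately show ?thesis using assms(1) unfolding symmetric_iff e rename_def by (metis case_prod_conv)
qed

lemma order_ge_px: "order_ge n (px n :: (expo, 'k::comm_ring_1) ser)" "order_ge n (py n :: (expo, 'k::comm_ring_1) ser)"
 by (auto simp: order_ge_def px_def py_def power_sum_x_def power_sum_y_def wt_def)

interpretation ps: substitution ps_valid ps_wt wt "ps_prod :: power_monomial => (expo, 'k::field_char_0) ser"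
 by (intro ps_substitution order_ge_px)

text \<open>
  By triangularity the coefficient of a longest product of power sums can be read off at a monomial with exactly
  its parts as exponents; the shorter ones follow by induction.
\<close>

lemma ps_subst_injective:
 assumes 0: "order_ge K (ps.subst (c :: (power_monomial, 'k::field_char_0) ser))" and t: "t \<in> ps_valid" "ps_wt t < K"
 shows "coef c t = 0"
 using t
proof (induction "ps_wt t - ps_len t" arbitrary: t rule: less_induct)
 case less
 let ?x = "ps_rep TYPE('k) t"
 note r = ps_rep[OF less.prems(1), where 'k = 'k]
 have wx: "wt ?x = ps_wt t" using ps_wt_shape[of ?x] r(1) by simp
 have "coef c t' * coef (ps_prod t' :: (expo, 'k) ser) ?x = (if t' = t then coef c t * coef (ps_prod t) ?x else 0)"
  if "t' \<in> {t' \<in> ps_valid. ps_wt t' \<le> wt ?x}" for t'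
 proof (cases "t' = t \<or> coef (ps_prod t' :: (expo, 'k) ser) ?x = 0")
  case False
  then have "ps_wt t' = ps_wt t" "ps_len t < ps_len t'"
   using ps_prod_support[of t' ?x, where 'k = 'k] that r(1) wx by auto
  moreover have "ps_len t' \<le> ps_wt t'" using that by (intro ps_len_le) simp
  ultimately have "coef c t' = 0" using less.hyps[of t'] that less.prems by simp
  then show ?thesis using False by simp
 qed auto
 then have "coef (ps.subst c) ?x = (\<Sum>t'\<in>{t' \<in> ps_valid. ps_wt t' \<le> wt ?x}. if t' = t then coef c t * coef (ps_prod t) ?x else 0)"
  unfolding ps.coef_subst[OF order.refl] by (intro sum.cong) auto
 also have "... = coef c t * coef (ps_prod t) ?x"
  using less.prems wx finite_ps_valid[of "wt ?x"] by simp
 finally have "coef (ps.subst c) ?x = coef c t * coef (ps_prod t) ?x" .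
 moreover have "coef (ps.subst c) ?x = 0" using 0 wx less.prems(2) unfolding order_ge_def by metis
 ultimately show ?case using r(2) by simp
qed

text \<open>The coordinates of a symmetric series, solving the triangular system from the longest products downwards.\<close>

function ps_coord :: "(expo, 'k::field_char_0) ser => power_monomial => 'k" where
 "ps_coord f t = (coef f (ps_rep TYPE('k) t) -
   (\<Sum>t'\<in>{t' \<in> ps_valid. ps_wt t' = ps_wt t & ps_len t < ps_len t'}. ps_coord f t' * coef (ps_prod t') (ps_rep TYPE('k) t))) /
   coef (ps_prod t) (ps_rep TYPE('k) t)"
 by pat_completeness auto

termination
proof (relation "measure (%(f, t). ps_wt t - ps_len t)")
 fix t t' assume "t' \<in> {t' \<in> ps_valid. ps_wt t' = ps_wt t & ps_len t < ps_len t'}"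
 then show "((f, t'), f, t) \<in> measure (%(f, t). ps_wt t - ps_len t)" for f
  using ps_len_le[of t'] by auto
qed simp

declare ps_coord.simps [simp del]

lemma symmetric_px: "symmetric (px n :: (expo, 'k::comm_ring_1) ser)" "symmetric (py n :: (expo, 'k::comm_ring_1) ser)"
proof -
 have z: "(map_key \<pi> alpha = 0) = (alpha = 0)" if "bij \<pi>" for \<pi> :: "nat => nat" and alpha :: "nat \<Rightarrow>\<^sub>0 nat"
 proof
  assume *: "map_key \<pi> alpha = 0"
  have "lookup alpha (\<pi> i) = 0" for i
   using arg_cong[OF *, of "%f. lookup f i"] that by (simp add: map_key.rep_eq bij_is_inj)
  then show "alpha = 0" using that by (intro poly_mapping_eqI) (metis bij_pointE lookup_zero)
 qed (simp add: bij_is_inj that)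
 have s: "(\<exists>i. map_key \<pi> alpha = single i n) = (\<exists>i. alpha = single i n)" if "bij \<pi>"
  for \<pi> :: "nat => nat" and alpha :: "nat \<Rightarrow>\<^sub>0 nat"
 proof
  assume "\<exists>i. map_key \<pi> alpha = single i n"
  then obtain i where i: "map_key \<pi> alpha = single i n" ..
  have "lookup alpha (\<pi> j) = lookup (single (\<pi> i) n) (\<pi> j)" for j
   using arg_cong[OF i, of "%f. lookup f j"] that
   by (simp add: map_key.rep_eq bij_is_inj lookup_single when_def inj_eq)
  then have "alpha = single (\<pi> i) n" using that by (intro poly_mapping_eqI) (metis bij_pointE)
  then show "\<exists>i. alpha = single i n" ..
 next
  assume "\<exists>i. alpha = single i n"
  then obtain i where "alpha = single i n" ..
  then show "\<exists>i. map_key \<pi> alpha = single i n"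
   using that by (metis bij_pointE bij_is_inj map_key_single)
 qed
 show "symmetric (px n :: (expo, 'k) ser)" "symmetric (py n :: (expo, 'k) ser)"
  unfolding symmetric_iff rename_def px_def py_def coef_Ser power_sum_x_def power_sum_y_def
  by (auto simp: z s split del: if_split)
qed

lemma symmetric_ps_eval:
 assumes "t \<in> ps_valid" "!!n. 1 \<le> n ==> symmetric (X n)" "!!n. 1 \<le> n ==> symmetric (Y n)"
 shows "symmetric (ps_eval X Y t)"
proof -
 obtain l l' i where t: "t = (l, l', i)" by (cases t)
 have "1 \<le> n" if "n \<in># l \<or> n \<in># l'" for n using that assms(1) by (cases n) (auto simp: t ps_valid_def)
 then show ?thesis
  unfolding t ps_eval_def case_prod_conv using assms(2,3)
  by (intro symmetric_mult symmetric_prod_mset symmetric_mono) auto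
qed

lemma symmetric_subst:
 assumes "substitution ps_valid ps_wt wt Q" "!!t. t \<in> ps_valid ==> symmetric (Q t)"
 shows "symmetric (substitution.subst ps_valid ps_wt wt Q c)"
proof -
 interpret substitution ps_valid ps_wt wt Q by fact
 show ?thesis
  unfolding symmetric_iff using assms(2) unfolding symmetric_iff
  by (simp add: coef_subst[OF order.refl] wt_rename)
qed

lemma ps_subst_coord:
 assumes "symmetric f"
 shows "ps.subst (Ser (ps_coord f)) = (f :: (expo, 'k::field_char_0) ser)"
proof (rule ser_eqI)
 fix x
 let ?t = "ps_shape x"
 let ?x = "ps_rep TYPE('k) ?t"
 let ?U = "{t' \<in> ps_valid. ps_wt t' = ps_wt ?t & ps_len ?t < ps_len t'}"
 note t = ps_shape_valid[of x]
 note r = ps_rep[OF t, where 'k = 'k]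
 have wx: "wt ?x = ps_wt ?t" using ps_wt_shape[of ?x] r(1) by simp
 have sym: "symmetric (ps.subst (Ser (ps_coord f)))"
  by (rule symmetric_subst[OF ps.substitution_axioms]) (intro symmetric_ps_eval symmetric_px)
 have fU: "finite ?U" by (rule finite_subset[OF _ finite_ps_valid[of "ps_wt ?t"]]) auto
 have "coef (ps.subst (Ser (ps_coord f))) ?x =
  (\<Sum>t'\<in>insert ?t ?U. ps_coord f t' * coef (ps_prod t') ?x)"
  unfolding ps.coef_subst[OF order.refl]
 proof (rule sum.mono_neutral_cong_right)
  show "\<forall>t'\<in>{t \<in> ps_valid. ps_wt t \<le> wt ?x} - insert ?t ?U. coef (Ser (ps_coord f)) t' * coef (ps_prod t') ?x = 0"
  proof
   fix t' assume t': "t' \<in> {t \<in> ps_valid. ps_wt t \<le> wt ?x} - insert ?t ?U"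
   then have "coef (ps_prod t' :: (expo, 'k) ser) ?x = 0"
    using ps_prod_support[of t' ?x, where 'k = 'k] r(1) wx by auto
   then show "coef (Ser (ps_coord f)) t' * coef (ps_prod t') ?x = 0" by simp
  qed
 qed (use t wx in \<open>auto simp: finite_ps_valid\<close>)
 also have "... = ps_coord f ?t * coef (ps_prod ?t) ?x + (\<Sum>t'\<in>?U. ps_coord f t' * coef (ps_prod t') ?x)"
  using fU by (subst sum.insert) auto
 also have "... = coef f ?x" using r(2) by (subst ps_coord.simps[of f ?t]) simp
 finally have "coef (ps.subst (Ser (ps_coord f))) ?x = coef f ?x" .
 then show "coef (ps.subst (Ser (ps_coord f))) x = coef f x"
  using symmetric_shape[OF sym, of x ?x] symmetric_shape[OF assms, of x ?x] r(1) by simp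
qed

section \<open>Relative plethysm\<close>

lemma Ser_coef [simp]: "Ser (coef f) = f"
 by (rule ser_eqI) simp

lemma lookup_le_mdeg: "lookup alpha i \<le> mdeg alpha"
proof (cases "i \<in> keys alpha")
 case True
 then show ?thesis unfolding mdeg_def by (intro member_le_sum) auto
qed (simp add: in_keys_iff)

lemma small_dvd_mdeg:
 assumes "\<forall>i. n dvd lookup alpha i" "mdeg alpha < n"
 shows "alpha = 0"
proof (rule poly_mapping_eqI)
 fix i
 show "lookup alpha i = lookup 0 i"
  using dvd_imp_le[of n "lookup alpha i"] assms lookup_le_mdeg[of alpha i] by fastforce
qed

lemma lookup_map_div: "lookup (Poly_Mapping.map (%e. e div n) alpha) i = lookup alpha i div (n::nat)"
 by (simp add: Poly_Mapping.map.rep_eq when_def)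

lemma map_div_0: "Poly_Mapping.map (%e. e div n) 0 = (0 :: nat \<Rightarrow>\<^sub>0 nat)" for n :: nat
 by (rule poly_mapping_eqI) (simp add: lookup_map_div)

text \<open>
  The condition on the constant term is what makes the plethysm converge: every exponent of the substituted series is
  \<open>n\<close> times a non-zero exponent.
\<close>

lemma order_ge_power_subst:
 assumes "f 0 = 0" "1 \<le> n"
 shows "order_ge n (Ser (power_subst n f))"
 unfolding order_ge_def
proof (intro allI impI)
 fix x assume x: "wt x < n"
 obtain alpha beta d where e: "x = (alpha, beta, d)" by (cases x)
 have le: "mdeg alpha < n" "mdeg beta < n" "d < n" using x by (auto simp: e wt_def)
 show "coef (Ser (power_subst n f)) x = 0"
 proof (cases "(\<forall>i. n dvd lookup alpha i) & (\<forall>j. n dvd lookup beta j) & n dvd d")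
  case True
  then have "alpha = 0" "beta = 0" using small_dvd_mdeg le by blast+
  moreover have "d = 0" using True le(3) dvd_imp_le[of n d] by fastforce
  ultimately show ?thesis using assms by (simp add: e power_subst_def map_div_0 zero_prod_def)
 next
  case False
  then show ?thesis by (simp only: e coef_Ser power_subst_def case_prod_conv if_False)
 qed
qed

lemma symmetric_power_subst:
 assumes "f \<in> carrier sym_series"
 shows "symmetric (Ser (power_subst n f))"
proof -
 have all: "(\<forall>i. n dvd lookup (map_key \<pi> alpha) i) = (\<forall>i. n dvd lookup alpha i)"
  if "bij \<pi>" for \<pi> :: "nat => nat" and alpha :: "nat \<Rightarrow>\<^sub>0 nat"
  using that by (metis bij_is_inj bij_pointE map_key.rep_eq comp_apply)
 have mk: "Poly_Mapping.map (%e. e div n) (map_key \<pi> alpha) = map_key \<pi> (Poly_Mapping.map (%e. e div n) alpha)"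
  if "bij \<pi>" for \<pi> :: "nat => nat" and alpha :: "nat \<Rightarrow>\<^sub>0 nat"
  using that by (intro poly_mapping_eqI) (simp add: lookup_map_div map_key.rep_eq bij_is_inj)
 have f: "f (map_key \<pi> alpha, map_key rho beta, d) = f (alpha, beta, d)" if "bij \<pi>" "bij rho" for \<pi> rho alpha beta d
  using assms that unfolding carrier_sym by blast
 show ?thesis
  unfolding symmetric_iff rename_def power_subst_def
  by (auto simp: all mk f split del: if_split cong: if_cong)
qed

lemma ps_subst_inject:
 fixes c d :: "(power_monomial, 'k::field_char_0) ser"
 assumes "ps.subst c = ps.subst d" "t \<in> ps_valid"
 shows "coef c t = coef d t"
proof -
 have "ps.subst (c + smono 0 (- 1) * d) = ps.subst c + smono 0 (- 1) * ps.subst d"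
  by (simp add: ps.subst_add ps.subst_const)
 then have "coef (ps.subst (c + smono 0 (- 1) * d)) x = 0" for x
  using assms(1) by (simp add: coef_const_mult)
 then have "order_ge (Suc (ps_wt t)) (ps.subst (c + smono 0 (- 1) * d))" by (simp add: order_ge_def)
 from ps_subst_injective[OF this assms(2)] show ?thesis by (simp add: coef_const_mult)
qed

lemma symmetric_ps_subst: "symmetric (ps.subst c)"
 by (rule symmetric_subst[OF ps.substitution_axioms]) (intro symmetric_ps_eval symmetric_px)

lemma px_subst:
 assumes "1 \<le> n"
 shows "ps.subst (smono ({#n#}, {#}, 0) 1) = (px n :: (expo, 'k::field_char_0) ser)"
  "ps.subst (smono ({#}, {#n#}, 0) 1) = (py n :: (expo, 'k) ser)"
proof -
 have "smono (0 :: expo) 1 = (1 :: (expo, 'k) ser)" by (rule mono_0_1)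
 then have 1: "smono (0, 0, 0) 1 = (1 :: (expo, 'k) ser)" by (simp add: zero_prod_def)
 have v: "({#n#}, {#}, 0) \<in> ps_valid" "({#}, {#n#}, 0) \<in> ps_valid" using assms by (auto simp: ps_valid_def)
 show "ps.subst (smono ({#n#}, {#}, 0) 1) = (px n :: (expo, 'k) ser)"
  unfolding ps.subst_mono[OF v(1)] by (simp add: ps_eval_def 1 mono_0_1)
 show "ps.subst (smono ({#}, {#n#}, 0) 1) = (py n :: (expo, 'k) ser)"
  unfolding ps.subst_mono[OF v(2)] by (simp add: ps_eval_def 1 mono_0_1)
qed

definition hbar_ps :: "'k::zero fps => (power_monomial, 'k) ser" where
 "hbar_ps c = Ser (%(l, l', i). if l = {#} & l' = {#} then fps_nth c i else 0)"

lemma subst_hbar: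
 assumes "substitution ps_valid ps_wt wt (ps_eval X Y)"
 shows "substitution.subst ps_valid ps_wt wt (ps_eval X Y) (hbar_ps c) = Ser (hbar_series c)"
proof (rule ser_eqI)
 interpret substitution ps_valid ps_wt wt "ps_eval X Y" by fact
 fix x :: expo
 obtain alpha beta d where e: "x = (alpha, beta, d)" by (cases x)
 let ?t = "({#}, {#}, d) :: power_monomial"
 have "coef (subst (hbar_ps c)) x = (\<Sum>t\<in>{t \<in> ps_valid. ps_wt t \<le> wt x}. if t = ?t then (if alpha = 0 & beta = 0 then fps_nth c d else 0) else 0)"
  unfolding coef_subst[OF order.refl]
  by (intro sum.cong) (auto simp: hbar_ps_def e ps_eval_def coef_mono split: if_splits)
 also have "... = coef (Ser (hbar_series c)) x"
  using finite_ps_valid[of "wt x"]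
  by (auto simp: hbar_series_def e ps_valid_def ps_wt_def wt_def)
 finally show "coef (subst (hbar_ps c)) x = coef (Ser (hbar_series c)) x" .
qed

lemma coef_sym_add: "add sym_series f g = coef (Ser f + Ser g)"
 by (simp add: sym_series_def fun_eq_iff)

lemma coef_sym_one: "one sym_series = coef 1"
 by (simp add: sym_series_def one_ser_def)

lemma mono_hbar: "smono (0, 0, i) a = Ser (hbar_series (Abs_fps (%d. if d = i then a else 0)))"
 by (rule ser_eqI) (auto simp: coef_mono hbar_series_def split: if_splits)

locale plethysm =
 fixes gb g :: "'k::field_char_0 series"
 assumes gb: "gb \<in> carrier sym_series" "gb 0 = 0" and g: "g \<in> carrier sym_series" "g 0 = 0"
begin

definition X :: "nat => (expo, 'k) ser" where "X n = Ser (power_subst n gb)"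
definition Y :: "nat => (expo, 'k) ser" where "Y n = Ser (power_subst n g)"

sublocale pl: substitution ps_valid ps_wt wt "ps_eval X Y"
 by (intro ps_substitution) (auto simp: X_def Y_def gb g order_ge_power_subst)

lemma symmetric_pl: "symmetric (pl.subst c)"
 by (rule symmetric_subst[OF pl.substitution_axioms])
  (auto simp: X_def Y_def gb g symmetric_power_subst intro: symmetric_ps_eval)

text \<open>
  A symmetric series is rewritten in power sums, and these are replaced by the Adams operations of \<open>gb\<close> and \<open>g\<close>.
\<close>

definition plethysm_map :: "'k series => 'k series" where
 "plethysm_map f = coef (pl.subst (Ser (ps_coord (Ser f))))"

lemma plethysm_map_subst: "plethysm_map (coef (ps.subst c)) = coef (pl.subst c)"
proof -
 have "ps.subst (Ser (ps_coord (ps.subst c))) = ps.subst c" by (rule ps_subst_coord[OF symmetric_ps_subst])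
 then have "pl.subst (Ser (ps_coord (ps.subst c))) = pl.subst c"
  by (intro pl.subst_cong ps_subst_inject) auto
 then show ?thesis by (simp add: plethysm_map_def)
qed

lemma carrier_ps_subst:
 assumes "f \<in> carrier sym_series"
 obtains c where "f = coef (ps.subst c :: (expo, 'k) ser)"
 using ps_subst_coord[of "Ser f"] assms by (metis coef_Ser symmetric_def)

lemma is_rel_plethysm_map: "is_rel_plethysm gb g plethysm_map"
 unfolding is_rel_plethysm_def
proof (intro conjI allI ballI impI)
 show "plethysm_map \<in> ring_hom sym_series sym_series"
 proof (rule ring_hom_memI)
  fix f assume "f \<in> carrier (sym_series :: 'k series ring)"
  then show "plethysm_map f \<in> carrier sym_series"
   using symmetric_pl by (auto simp: plethysm_map_def symmetric_def)
 next
  fix f h assume fh: "f \<in> carrier (sym_series :: 'k series ring)" "h \<in> carrier (sym_series :: 'k series ring)"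
  obtain c where c: "f = coef (ps.subst c :: (expo, 'k) ser)" using fh(1) by (rule carrier_ps_subst)
  obtain d where d: "h = coef (ps.subst d :: (expo, 'k) ser)" using fh(2) by (rule carrier_ps_subst)
  have "monoid.mult sym_series f h = coef (ps.subst (c * d))" by (simp add: c d coef_sym_mult ps.subst_mult)
  then show "plethysm_map (f \<otimes>\<^bsub>sym_series\<^esub> h) = plethysm_map f \<otimes>\<^bsub>sym_series\<^esub> plethysm_map h"
   by (simp add: c d plethysm_map_subst) (simp add: coef_sym_mult pl.subst_mult)
  have "add sym_series f h = coef (ps.subst (c + d))" by (simp add: c d coef_sym_add ps.subst_add)
  then show "plethysm_map (f \<oplus>\<^bsub>sym_series\<^esub> h) = plethysm_map f \<oplus>\<^bsub>sym_series\<^esub> plethysm_map h"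
   by (simp add: c d plethysm_map_subst) (simp add: coef_sym_add pl.subst_add)
 next
  show "plethysm_map \<one>\<^bsub>sym_series\<^esub> = \<one>\<^bsub>sym_series\<^esub>"
   using plethysm_map_subst[of 1] by (simp add: coef_sym_one ps.subst_1 pl.subst_1)
 qed
 show "series_continuous plethysm_map"
  unfolding series_continuous_def
 proof (intro allI exI ballI impI)
  fix L f assume f: "f \<in> carrier (sym_series :: 'k series ring)" "series_order_ge L f"
  obtain c where c: "f = coef (ps.subst c :: (expo, 'k) ser)" using f(1) by (rule carrier_ps_subst)
  have "order_ge L (ps.subst c)" using f(2) by (simp add: c order_ge_iff)
  then have "order_ge L (pl.subst c)"
   unfolding order_ge_def[of L "pl.subst c"] by (intro allI impI pl.subst_order[of L]) (auto dest: ps_subst_injective)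
  then show "series_order_ge L (plethysm_map f)" by (simp add: c plethysm_map_subst order_ge_iff)
 qed
 show "plethysm_map (hbar_series c \<otimes>\<^bsub>sym_series\<^esub> f) = hbar_series c \<otimes>\<^bsub>sym_series\<^esub> plethysm_map f"
  if f: "f \<in> carrier sym_series" for c f
 proof -
  obtain d where d: "f = coef (ps.subst d :: (expo, 'k) ser)" using f by (rule carrier_ps_subst)
  have "monoid.mult sym_series (hbar_series c) f = coef (ps.subst (hbar_ps c * d))"
   by (simp add: d coef_sym_mult ps.subst_mult subst_hbar[OF ps.substitution_axioms])
  then show ?thesis
   by (simp add: d plethysm_map_subst) (simp add: coef_sym_mult pl.subst_mult subst_hbar[OF pl.substitution_axioms])
 qed
 fix n :: nat assume n: "1 \<le> n"
 have "smono (0 :: expo) 1 = (1 :: (expo, 'k) ser)" by (rule mono_0_1)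
 then have 1: "smono (0, 0, 0) 1 = (1 :: (expo, 'k) ser)" by (simp add: zero_prod_def)
 have v: "({#n#}, {#}, 0) \<in> ps_valid" "({#}, {#n#}, 0) \<in> ps_valid" using n by (auto simp: ps_valid_def)
 have "pl.subst (smono ({#n#}, {#}, 0) 1) = X n"
  unfolding pl.subst_mono[OF v(1)] by (simp add: ps_eval_def 1 mono_0_1)
 then show "plethysm_map (power_sum_x n) = power_subst n gb"
  using plethysm_map_subst[of "smono ({#n#}, {#}, 0) 1"] unfolding px_subst[OF n] by (simp add: px_def X_def)
 have "pl.subst (smono ({#}, {#n#}, 0) 1) = Y n"
  unfolding pl.subst_mono[OF v(2)] by (simp add: ps_eval_def 1 mono_0_1)
 then show "plethysm_map (power_sum_y n) = power_subst n g"
  using plethysm_map_subst[of "smono ({#}, {#n#}, 0) 1"] unfolding px_subst[OF n] by (simp add: py_def Y_def)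
qed

text \<open>
  The defining conditions fix the value on finite combinations of products of power sums. By continuity, a given
  coefficient of the value depends only on such a finite part of the argument.
\<close>

lemma rel_plethysm_map_unique:
 assumes "is_rel_plethysm gb g \<Phi>"
 shows "\<Phi> (coef (ps.subst c)) = coef (pl.subst c)"
proof -
 note hom = assms[unfolded is_rel_plethysm_def, THEN conjunct1]
 define theta :: "(expo, 'k) ser => (expo, 'k) ser" where "theta s = Ser (\<Phi> (coef s))" for s
 have theta_mult: "theta (s * s') = theta s * theta s'" if "symmetric s" "symmetric s'" for s s'
  using ring_hom_mult[OF hom, of "coef s" "coef s'"] that
  by (simp add: theta_def symmetric_def coef_sym_mult)
 have theta_add: "theta (s + s') = theta s + theta s'" if "symmetric s" "symmetric s'" for s s'
  using ring_hom_add[OF hom, of "coef s" "coef s'"] that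
  by (simp add: theta_def symmetric_def coef_sym_add)
 have theta_1: "theta 1 = 1" using ring_hom_one[OF hom] by (simp add: theta_def coef_sym_one)
 have theta_hbar: "theta (smono (0, 0, i) a * s) = smono (0, 0, i) a * theta s" if "symmetric s" for i a s
 proof -
  have "\<Phi> (monoid.mult sym_series (hbar_series h) (coef s)) = monoid.mult sym_series (hbar_series h) (\<Phi> (coef s))" for h
   using assms that unfolding is_rel_plethysm_def symmetric_def by blast
  from this[of "Abs_fps (%d. if d = i then a else 0)"] show ?thesis
   unfolding theta_def mono_hbar coef_sym_mult by simp
 qed
 have theta_px: "theta (px n) = X n" "theta (py n) = Y n" if "1 \<le> n" for n
  using assms that unfolding is_rel_plethysm_def by (simp_all add: theta_def px_def py_def X_def Y_def)
 have theta_prod: "symmetric (\<Prod>n\<in>#l. f n) & theta (\<Prod>n\<in>#l. f n) = (\<Prod>n\<in>#l. h n)"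
  if "!!n. n \<in># l ==> symmetric (f n) & theta (f n) = h n" for l :: "nat multiset" and f h
  using that by (induction l) (auto simp: theta_1 symmetric_1 theta_mult symmetric_mult)
 have theta_ps: "theta (ps_prod t) = ps_eval X Y t" if t: "t \<in> ps_valid" for t
 proof -
  obtain l l' i where tt: "t = (l, l', i)" by (cases t)
  have "1 \<le> n" if "n \<in># l \<or> n \<in># l'" for n using that t by (cases n) (auto simp: tt ps_valid_def)
  then have l: "symmetric (\<Prod>n\<in>#l. px n :: (expo, 'k) ser) & theta (\<Prod>n\<in>#l. px n) = (\<Prod>n\<in>#l. X n)"
   "symmetric (\<Prod>n\<in>#l'. py n :: (expo, 'k) ser) & theta (\<Prod>n\<in>#l'. py n) = (\<Prod>n\<in>#l'. Y n)"
   by (auto intro!: theta_prod simp: symmetric_px theta_px)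
  then show ?thesis
   using theta_hbar[of "(\<Prod>n\<in>#l. px n) * (\<Prod>n\<in>#l'. py n)" i 1]
   by (simp add: tt ps_eval_def theta_mult symmetric_mult mult.commute)
 qed
 have sym_ps: "symmetric (ps_prod t :: (expo, 'k) ser)" if "t \<in> ps_valid" for t
  using that by (intro symmetric_ps_eval symmetric_px)
 have theta_0: "theta 0 = 0" using theta_add[OF symmetric_0 symmetric_0] by simp
 have theta_sum: "theta (\<Sum>t\<in>T. smono (0, 0, 0) (coef c t) * ps_prod t) = (\<Sum>t\<in>T. smono (0, 0, 0) (coef c t) * ps_eval X Y t)"
  if "finite T" "T \<subseteq> ps_valid" for T
  using that
 proof (induction T rule: finite_induct)
  case (insert t T)
  then have t: "t \<in> ps_valid" and T: "T \<subseteq> ps_valid" by auto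
  have "symmetric (smono (0, 0, 0) (coef c t) * ps_prod t)"
   by (intro symmetric_mult symmetric_mono sym_ps t)
  moreover have "symmetric (\<Sum>t\<in>T. smono (0, 0, 0) (coef c t) * ps_prod t)"
   using T by (intro symmetric_sum symmetric_mult symmetric_mono sym_ps) auto
  ultimately show ?case
   using insert.IH[OF T] by (simp add: insert.hyps theta_add theta_hbar[OF sym_ps[OF t]] theta_ps[OF t])
 qed (simp add: theta_0)
 have "coef (theta (ps.subst c)) x = coef (pl.subst c) x" for x
 proof -
  have "series_continuous \<Phi>" using assms by (simp add: is_rel_plethysm_def)
  then obtain K where K: "\<forall>f\<in>carrier sym_series. series_order_ge K f --> series_order_ge (Suc (wt x)) (\<Phi> f)"
   unfolding series_continuous_def by blast
  define T where "T = {t \<in> ps_valid. ps_wt t \<le> max K (wt x)}"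
  define c1 where "c1 = (\<Sum>t\<in>T. smono t (coef c t))"
  define c2 where "c2 = Ser (%t. if t \<in> T then 0 else coef c t)"
  have fT: "finite T" "T \<subseteq> ps_valid" by (auto simp: T_def finite_ps_valid)
  have c: "c = c1 + c2"
   by (rule ser_eqI) (simp add: c1_def c2_def coef_sum coef_mono fT sum.delta)
  have c2: "coef c2 t = 0" if "t \<in> ps_valid" "ps_wt t < Suc (max K (wt x))" for t
   using that by (simp add: c2_def T_def)
  have "order_ge K (ps.subst c2)"
   unfolding order_ge_def by (intro allI impI ps.subst_order[where K = "Suc (max K (wt x))"] c2) auto
  then have "series_order_ge K (coef (ps.subst c2))" by (simp add: order_ge_iff)
  then have "order_ge (Suc (wt x)) (theta (ps.subst c2))"
   using K symmetric_ps_subst[of c2] by (auto simp: symmetric_def theta_def order_ge_iff)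
  then have 1: "coef (theta (ps.subst c2)) x = 0" unfolding order_ge_def by blast
  have 2: "coef (pl.subst c2) x = 0"
   by (intro pl.subst_order[where K = "Suc (max K (wt x))"] c2) auto
  have z: "smono (0 :: expo) a = smono (0, 0, 0) a" for a :: 'k by (simp add: zero_prod_def)
  have s1: "ps.subst c1 = (\<Sum>t\<in>T. smono (0, 0, 0) (coef c t) * ps_prod t)"
   unfolding c1_def ps.subst_sum using fT(2) by (intro sum.cong refl) (auto simp: ps.subst_mono z)
  have s2: "pl.subst c1 = (\<Sum>t\<in>T. smono (0, 0, 0) (coef c t) * ps_eval X Y t)"
   unfolding c1_def pl.subst_sum using fT(2) by (intro sum.cong refl) (auto simp: pl.subst_mono z)
  have "theta (ps.subst c) = theta (ps.subst c1) + theta (ps.subst c2)"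
   unfolding c ps.subst_add by (rule theta_add[OF symmetric_ps_subst symmetric_ps_subst])
  moreover have "theta (ps.subst c1) = pl.subst c1" unfolding s1 s2 by (rule theta_sum[OF fT])
  moreover have "pl.subst c = pl.subst c1 + pl.subst c2" unfolding c by (rule pl.subst_add)
  ultimately show ?thesis using 1 2 by simp
 qed
 then have "theta (ps.subst c) = pl.subst c" by (rule ser_eqI)
 then show ?thesis unfolding theta_def by (metis coef_Ser)
qed

theorem rel_plethysm_subst: "rel_plethysm (coef (ps.subst c)) gb g = coef (pl.subst c)"
 unfolding rel_plethysm_def
proof (rule the_equality)
 show "\<exists>\<Phi>. is_rel_plethysm gb g \<Phi> & coef (pl.subst c) = \<Phi> (coef (ps.subst c))"
  using is_rel_plethysm_map plethysm_map_subst by metis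
qed (auto simp: rel_plethysm_map_unique)

end

section \<open>Evaluation in finitely many variables\<close>

text \<open>
  Substituting into a substitution may be computed on products of power sums, where both are multiplicative.
\<close>

lemma subst_subst:
 assumes 1: "substitution V1 w1 w Q1" and 2: "substitution V2 w w' Q2"
 shows "coef (substitution.subst V2 w w' Q2 (substitution.subst V1 w1 w Q1 c)) y =
  (\<Sum>t\<in>{t \<in> V1. w1 t \<le> w' y}. coef c t * coef (substitution.subst V2 w w' Q2 (Q1 t)) y)"
proof -
 interpret S1: substitution V1 w1 w Q1 by fact
 interpret S2: substitution V2 w w' Q2 by fact
 have "coef (S2.subst (S1.subst c)) y =
  (\<Sum>u\<in>{u \<in> V2. w u \<le> w' y}. \<Sum>t\<in>{t \<in> V1. w1 t \<le> w' y}. coef c t * (coef (Q1 t) u * coef (Q2 u) y))"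
  unfolding S2.coef_subst[OF order.refl]
  by (intro sum.cong refl) (auto simp: S1.coef_subst[where K = "w' y"] sum_distrib_right mult.assoc)
 also have "... = (\<Sum>t\<in>{t \<in> V1. w1 t \<le> w' y}. coef c t * coef (S2.subst (Q1 t)) y)"
  by (subst sum.swap) (simp add: S2.coef_subst[OF order.refl] sum_distrib_left)
 finally show ?thesis .
qed

definition eval_valid :: "nat => nat => expo set" where
 "eval_valid r q = {(alpha, beta, d). keys alpha \<subseteq> {..<r} & keys beta \<subseteq> {..<q}}"

definition tri_wt :: "nat \<times> nat \<times> nat => nat" where "tri_wt = (%(k, l, d). k + l + d)"

definition eval_mono ::
 "nat => nat => (nat => 'k::comm_ring_1) => (nat => 'k) => expo => (nat \<times> nat \<times> nat, 'k) ser" where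
 "eval_mono r q a b = (%(alpha, beta, d). smono (mdeg alpha, mdeg beta, d) (monomial_value r alpha a * monomial_value q beta b))"

lemma keys_add_nat: "keys (alpha + beta) = keys alpha \<union> keys (beta :: nat \<Rightarrow>\<^sub>0 nat)"
 by (auto simp: in_keys_iff lookup_add)

lemma monomial_value_add: "monomial_value r (alpha + beta) a = monomial_value r alpha a * monomial_value r beta a"
 by (simp add: monomial_value_def lookup_add power_add prod.distrib)

lemma monomial_value_0: "monomial_value r 0 a = 1"
 by (simp add: monomial_value_def)

lemma finite_mdeg_le: "finite {alpha. keys alpha \<subseteq> {..<r} & mdeg alpha \<le> K}"
proof (rule finite_imageD)
 let ?f = "%alpha. \<lambda>i\<in>{..<r}. lookup alpha i"
 show "finite (?f ` {alpha. keys alpha \<subseteq> {..<r} & mdeg alpha \<le> K})"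
  by (rule finite_subset[of _ "{..<r} \<rightarrow>\<^sub>E {..K}"])
   (auto simp: PiE_iff extensional_def intro: order.trans[OF lookup_le_mdeg] intro!: finite_PiE split: if_splits)
 show "inj_on ?f {alpha. keys alpha \<subseteq> {..<r} & mdeg alpha \<le> K}"
 proof (rule inj_onI)
  fix alpha beta assume a: "alpha \<in> {alpha. keys alpha \<subseteq> {..<r} & mdeg alpha \<le> K}" "beta \<in> {alpha. keys alpha \<subseteq> {..<r} & mdeg alpha \<le> K}"
   and e: "?f alpha = ?f beta"
  show "alpha = beta"
  proof (rule poly_mapping_eqI)
   fix i
   show "lookup alpha i = lookup beta i"
   proof (cases "i < r")
    case True
    then show ?thesis using fun_cong[OF e, of i] by simp
   next
    case False
    then have "i \<notin> keys alpha" "i \<notin> keys beta" using a by auto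
    then show ?thesis by (simp add: in_keys_iff)
   qed
  qed
 qed
qed

lemma finite_monomials: "finite (monomials r k)"
 by (rule finite_subset[OF _ finite_mdeg_le[of r k]]) (auto simp: monomials_def)

lemma eval_substitution: "substitution (eval_valid r q) wt tri_wt (eval_mono r q a b)"
proof
 show "finite {t \<in> eval_valid r q. wt t \<le> K}" for K
 proof (rule finite_subset)
  let ?A = "%r. {alpha. keys alpha \<subseteq> {..<r} & mdeg alpha \<le> K}"
  show "{t \<in> eval_valid r q. wt t \<le> K} \<subseteq> ?A r \<times> ?A q \<times> {..K}" by (auto simp: eval_valid_def wt_def)
  show "finite (?A r \<times> ?A q \<times> {..K})" by (intro finite_cartesian_product finite_mdeg_le finite_atMost)
 qed
 have "smono (0 :: nat \<times> nat \<times> nat) 1 = (1 :: (_, 'a) ser)" by (rule mono_0_1)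
 then show "eval_mono r q a b 0 = 1" by (simp add: eval_mono_def zero_prod_def monomial_value_0)
 show "tri_wt (x + y) = tri_wt x + tri_wt y" for x y by (cases x; cases y) (simp add: tri_wt_def)
 show "eval_mono r q a b (x + y) = eval_mono r q a b x * eval_mono r q a b y" for x y
  by (cases x; cases y) (simp add: eval_mono_def mdeg_add monomial_value_add mono_mult mult_ac)
 show "coef (eval_mono r q a b t) x = 0" if "tri_wt x < wt t" for t x
  using that by (cases t) (auto simp: eval_mono_def coef_mono tri_wt_def wt_def)
 show "x + y \<in> eval_valid r q \<longleftrightarrow> x \<in> eval_valid r q & y \<in> eval_valid r q" for x y
  by (cases x; cases y) (simp add: eval_valid_def keys_add_nat, blast)
qed (auto simp: eval_valid_def zero_prod_def wt_add)

text \<open>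
  Evaluation at \<open>(a, b)\<close> keeps the degrees in \<open>x\<close>, \<open>y\<close> and \<open>\<hbar>\<close> apart. Then it is a ring homomorphism on all series,
  and no convergence in the field is needed.
\<close>

definition ev ::
 "nat => nat => (nat => 'k::comm_ring_1) => (nat => 'k) => (expo, 'k) ser => (nat \<times> nat \<times> nat, 'k) ser" where
 "ev r q a b = substitution.subst (eval_valid r q) wt tri_wt (eval_mono r q a b)"

lemma coef_ev:
 "coef (ev r q a b f) (k, l, d) = (\<Sum>alpha\<in>monomials r k. \<Sum>beta\<in>monomials q l.
   coef f (alpha, beta, d) * monomial_value r alpha a * monomial_value q beta b)"
proof -
 interpret substitution "eval_valid r q" wt tri_wt "eval_mono r q a b" by (rule eval_substitution)
 let ?S = "monomials r k \<times> monomials q l"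
 have "coef (ev r q a b f) (k, l, d) = (\<Sum>t\<in>(%(alpha, beta). (alpha, beta, d)) ` ?S. coef f t * coef (eval_mono r q a b t) (k, l, d))"
  unfolding ev_def coef_subst[OF order.refl]
 proof (rule sum.mono_neutral_right[OF fin_V])
  show "\<forall>t\<in>{t \<in> eval_valid r q. wt t \<le> tri_wt (k, l, d)} - (%(alpha, beta). (alpha, beta, d)) ` ?S.
    coef f t * coef (eval_mono r q a b t) (k, l, d) = 0"
   by (auto simp: monomials_def eval_valid_def eval_mono_def coef_mono)
 qed (auto simp: monomials_def eval_valid_def wt_def tri_wt_def)
 also have "... = (\<Sum>(alpha, beta)\<in>?S. coef f (alpha, beta, d) * monomial_value r alpha a * monomial_value q beta b)"
  by (subst sum.reindex) (auto simp: inj_on_def monomials_def eval_mono_def coef_mono mult.assoc split_def intro!: sum.cong)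
 finally have "coef (ev r q a b f) (k, l, d) = (\<Sum>(alpha, beta)\<in>?S. coef f (alpha, beta, d) * monomial_value r alpha a * monomial_value q beta b)" .
 then show ?thesis by (simp add: sum.cartesian_product split_def)
qed

lemma ev_mult: "ev r q a b (f * g) = ev r q a b f * ev r q a b g"
 and ev_prod_mset: "ev r q a b (\<Prod>n\<in>#M. F n) = (\<Prod>n\<in>#M. ev r q a b (F n))"
proof -
 interpret substitution "eval_valid r q" wt tri_wt "eval_mono r q a b" by (rule eval_substitution)
 show "ev r q a b (f * g) = ev r q a b f * ev r q a b g" unfolding ev_def by (rule subst_mult)
 show "ev r q a b (\<Prod>n\<in>#M. F n) = (\<Prod>n\<in>#M. ev r q a b (F n))" unfolding ev_def by (rule subst_prod_mset)
qed

lemma ev_hbar: "ev r q a b (smono (0, 0, i) 1) = smono (0, 0, i) 1"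
proof -
 interpret substitution "eval_valid r q" wt tri_wt "eval_mono r q a b" by (rule eval_substitution)
 have "smono (0 :: nat \<times> nat \<times> nat) 1 = (1 :: (_, 'a) ser)" by (rule mono_0_1)
 then show ?thesis
  unfolding ev_def by (subst subst_mono) (auto simp: eval_valid_def eval_mono_def monomial_value_0)
qed

lemma monomials_0: "monomials r 0 = {0}"
 by (auto simp: monomials_def)

lemma monomial_value_single: "i < r ==> monomial_value r (single i n) a = a i ^ n"
proof -
 assume "i < r"
 moreover have "monomial_value r (single i n) a = (\<Prod>j<r. if j = i then a i ^ n else 1)"
  unfolding monomial_value_def by (intro prod.cong) (auto simp: lookup_single)
 ultimately show ?thesis by simp
qed

lemma sum_monomials_power_sum:
 assumes "1 \<le> n"
 shows "(\<Sum>alpha\<in>monomials r k. if \<exists>i. alpha = single i n then monomial_value r alpha a else 0) =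
  (if k = n then \<Sum>i<r. a i ^ n else 0 :: 'k::comm_ring_1)"
proof -
 have "(\<Sum>alpha\<in>monomials r k. if \<exists>i. alpha = single i n then monomial_value r alpha a else 0) =
  (\<Sum>alpha\<in>(if k = n then (%i. single i n) ` {..<r} else {}). monomial_value r alpha a)"
 proof (rule sum.mono_neutral_cong_right[OF finite_monomials])
  show "\<forall>alpha\<in>monomials r k - (if k = n then (%i. single i n) ` {..<r} else {}).
   (if \<exists>i. alpha = single i n then monomial_value r alpha a else 0) = 0"
  proof (intro ballI, rule if_not_P, rule notI)
   fix alpha assume alpha: "alpha \<in> monomials r k - (if k = n then (%i. single i n) ` {..<r} else {})"
    and "\<exists>i. alpha = single i n"
   then obtain i where i: "alpha = single i n" by blast
   have "i < r" "k = n" using alpha assms unfolding i monomials_def by auto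
   then show False using alpha unfolding i by auto
  qed
 qed (auto simp: monomials_def split: if_splits)
 also have "... = (if k = n then \<Sum>i<r. a i ^ n else 0)"
 proof (cases "k = n")
  case True
  have "inj_on (%i. single i n) {..<r}"
   using assms by (intro inj_onI) (metis lookup_single_eq lookup_single_not_eq not_one_le_zero)
  then show ?thesis using True by (simp add: sum.reindex monomial_value_single)
 qed simp
 finally show ?thesis .
qed

lemma ev_px:
 assumes "1 \<le> n"
 shows "ev r q a b (px n) = smono (n, 0, 0) (\<Sum>i<r. a i ^ n)" "ev r q a b (py n) = smono (0, n, 0) (\<Sum>i<q. b i ^ n)"
proof -
 show "ev r q a b (px n) = smono (n, 0, 0) (\<Sum>i<r. a i ^ n)"
 proof (rule ser_eqI, clarify)
  fix k l d
  have "coef (ev r q a b (px n)) (k, l, d) = (\<Sum>alpha\<in>monomials r k. \<Sum>beta\<in>monomials q l.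
   (if \<exists>i. alpha = single i n then monomial_value r alpha a else 0) * (if beta = 0 then if d = 0 then 1 else 0 else 0))"
   unfolding coef_ev by (intro sum.cong refl) (auto simp: px_def power_sum_x_def monomial_value_0)
  also have "... = (\<Sum>alpha\<in>monomials r k. if \<exists>i. alpha = single i n then monomial_value r alpha a else 0) *
   (if l = 0 & d = 0 then 1 else 0)"
   by (simp add: sum_product[symmetric] sum.delta[OF finite_monomials]) (simp add: monomials_def)
  finally show "coef (ev r q a b (px n)) (k, l, d) = coef (smono (n, 0, 0) (\<Sum>i<r. a i ^ n)) (k, l, d)"
   unfolding sum_monomials_power_sum[OF assms] by (auto simp: coef_mono)
 qed
 show "ev r q a b (py n) = smono (0, n, 0) (\<Sum>i<q. b i ^ n)"
 proof (rule ser_eqI, clarify)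
  fix k l d
  have "coef (ev r q a b (py n)) (k, l, d) = (\<Sum>alpha\<in>monomials r k. \<Sum>beta\<in>monomials q l.
   (if alpha = 0 then if d = 0 then 1 else 0 else 0) * (if \<exists>i. beta = single i n then monomial_value q beta b else 0))"
   unfolding coef_ev by (intro sum.cong refl) (auto simp: py_def power_sum_y_def monomial_value_0)
  also have "... = (if k = 0 & d = 0 then 1 else 0) *
   (\<Sum>alpha\<in>monomials q l. if \<exists>i. alpha = single i n then monomial_value q alpha b else 0)"
   by (simp add: sum_product[symmetric] sum.delta[OF finite_monomials]) (simp add: monomials_def)
  finally show "coef (ev r q a b (py n)) (k, l, d) = coef (smono (0, n, 0) (\<Sum>i<q. b i ^ n)) (k, l, d)"
   unfolding sum_monomials_power_sum[OF assms] by (auto simp: coef_mono)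
 qed
qed

lemma lookup_map_times: "lookup (Poly_Mapping.map ((*) n) alpha) i = n * lookup alpha (i :: nat)" for n :: nat
 by (simp add: Poly_Mapping.map.rep_eq when_def)

lemma mdeg_map_times: "mdeg (Poly_Mapping.map ((*) n) alpha) = n * mdeg alpha"
proof -
 have "keys (Poly_Mapping.map ((*) n) alpha) \<subseteq> keys alpha"
  by (auto simp: in_keys_iff lookup_map_times)
 then show ?thesis
  using mdeg_alt[of "keys alpha" "Poly_Mapping.map ((*) n) alpha"]
  by (simp add: mdeg_def lookup_map_times sum_distrib_left)
qed

lemma map_times_div:
 "1 \<le> n ==> Poly_Mapping.map (%e. e div n) (Poly_Mapping.map ((*) n) alpha) = (alpha :: nat \<Rightarrow>\<^sub>0 nat)"
 "\<forall>i. n dvd lookup alpha i ==> Poly_Mapping.map ((*) n) (Poly_Mapping.map (%e. e div n) alpha) = (alpha :: nat \<Rightarrow>\<^sub>0 nat)"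
 by (auto intro!: poly_mapping_eqI simp: lookup_map_div lookup_map_times)

lemma keys_map_times: "1 \<le> n ==> keys (Poly_Mapping.map ((*) n) alpha) = keys (alpha :: nat \<Rightarrow>\<^sub>0 nat)"
 by (auto simp: in_keys_iff lookup_map_times)

lemma monomial_value_map_times: "monomial_value r (Poly_Mapping.map ((*) n) alpha) a = monomial_value r alpha (%i. a i ^ n)"
 by (simp add: monomial_value_def lookup_map_times power_mult)

text \<open>
  Adams operations become evaluations at the powers of the coordinates.
\<close>

lemma ev_power_subst:
 assumes n: "1 \<le> n"
 shows "coef (ev r q a b (Ser (power_subst n f))) (k, l, d) =
  (if n dvd k & n dvd l & n dvd d then coef (ev r q (%i. a i ^ n) (%i. b i ^ n) (Ser f)) (k div n, l div n, d div n) else 0)"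
proof -
 let ?dv = "%alpha. \<forall>i. n dvd lookup alpha i" and ?m = "%alpha. Poly_Mapping.map ((*) n) alpha"
 have md: "n dvd mdeg alpha & mdeg (Poly_Mapping.map (%e. e div n) alpha) = mdeg alpha div n" if "?dv alpha" for alpha
  using mdeg_map_times[of n "Poly_Mapping.map (%e. e div n) alpha"] map_times_div(2)[OF that] n by auto
 show ?thesis
 proof (cases "n dvd k & n dvd l & n dvd d")
  case True
  have mon: "?m alpha \<in> monomials r' k' \<longleftrightarrow> alpha \<in> monomials r' (k' div n)" if "n dvd k'" for alpha r' k'
   using that n by (auto simp: monomials_def keys_map_times[OF n] mdeg_map_times)
  have inj: "alpha = beta" if "?m alpha = ?m beta" for alpha beta :: "nat \<Rightarrow>\<^sub>0 nat" using arg_cong[OF that, of "Poly_Mapping.map (%e. e div n)"] by (simp add: map_times_div(1)[OF n])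
  have "coef (ev r q a b (Ser (power_subst n f))) (k, l, d) = (\<Sum>(alpha, beta)\<in>monomials r k \<times> monomials q l.
    power_subst n f (alpha, beta, d) * monomial_value r alpha a * monomial_value q beta b)"
   by (simp add: coef_ev sum.cartesian_product split_def)
  also have "... = (\<Sum>(alpha, beta)\<in>(%(alpha, beta). (?m alpha, ?m beta)) ` (monomials r (k div n) \<times> monomials q (l div n)).
    power_subst n f (alpha, beta, d) * monomial_value r alpha a * monomial_value q beta b)"
  proof (rule sum.mono_neutral_right)
   show "\<forall>i\<in>monomials r k \<times> monomials q l - (%(alpha, beta). (?m alpha, ?m beta)) ` (monomials r (k div n) \<times> monomials q (l div n)).
    (case i of (alpha, beta) => power_subst n f (alpha, beta, d) * monomial_value r alpha a * monomial_value q beta b) = 0"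
   proof (clarify, rule ccontr)
    fix alpha beta assume a: "alpha \<in> monomials r k" "beta \<in> monomials q l"
     and ni: "(alpha, beta) \<notin> (%(alpha, beta). (?m alpha, ?m beta)) ` (monomials r (k div n) \<times> monomials q (l div n))"
     and nz: "power_subst n f (alpha, beta, d) * monomial_value r alpha a * monomial_value q beta b ~= 0"
    have dv: "?dv alpha" "?dv beta" using nz by (auto simp: power_subst_def split: if_splits)
    let ?alpha = "Poly_Mapping.map (%e. e div n) alpha" and ?beta = "Poly_Mapping.map (%e. e div n) beta"
    have "?alpha \<in> monomials r (k div n)" "?beta \<in> monomials q (l div n)"
     using mon[of k ?alpha r] mon[of l ?beta q] a True by (auto simp: map_times_div(2)[OF dv(1)] map_times_div(2)[OF dv(2)])
    then have "(?m ?alpha, ?m ?beta) \<in> (%(alpha, beta). (?m alpha, ?m beta)) ` (monomials r (k div n) \<times> monomials q (l div n))" by auto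
    then show False using ni by (simp add: map_times_div(2)[OF dv(1)] map_times_div(2)[OF dv(2)])
   qed
  qed (use True mon in \<open>auto simp: finite_monomials\<close>)
  also have "... = (\<Sum>(alpha, beta)\<in>monomials r (k div n) \<times> monomials q (l div n).
    f (alpha, beta, d div n) * monomial_value r alpha (%i. a i ^ n) * monomial_value q beta (%i. b i ^ n))"
   using True by (subst sum.reindex)
    (auto simp: inj_on_def power_subst_def lookup_map_times map_times_div(1)[OF n] monomial_value_map_times split_def dest: inj intro!: sum.cong)
  finally show ?thesis using True by (simp add: coef_ev sum.cartesian_product split_def)
 next
  case False
  have "power_subst n f (alpha, beta, d) = 0" if "alpha \<in> monomials r k" "beta \<in> monomials q l" for alpha beta
   using that False md[of alpha] md[of beta] by (auto simp: power_subst_def monomials_def)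
  then have z: "coef (ev r q a b (Ser (power_subst n f))) (k, l, d) = 0" by (simp add: coef_ev)
  show ?thesis unfolding z if_not_P[OF False] ..
 qed
qed

text \<open>Distinct monomials are distinct characters of the monoid of points, hence linearly independent.\<close>

lemma monomial_values_independent:
 fixes c :: "(nat \<Rightarrow>\<^sub>0 nat) => 'k::field_char_0"
 assumes "finite S" "!!alpha. alpha \<in> S ==> keys alpha \<subseteq> {..<r}" "!!a. (\<Sum>alpha\<in>S. c alpha * monomial_value r alpha a) = 0" "alpha \<in> S"
 shows "c alpha = 0"
 using assms
proof (induction S arbitrary: c alpha rule: finite_induct)
 case (insert alpha0 S)
 have rest: "c alpha1 = 0" if alpha1: "alpha1 \<in> S" for alpha1
 proof -
  have "alpha1 ~= alpha0" using insert.hyps alpha1 by auto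
  then obtain i where i: "lookup alpha1 i ~= lookup alpha0 i" by (meson poly_mapping_eqI)
  have ir: "i < r"
  proof (rule ccontr)
   assume "\<not> i < r"
   then have "i \<notin> keys alpha1" "i \<notin> keys alpha0" using insert.prems(1) alpha1 by blast+
   then show False using i by (simp add: in_keys_iff)
  qed
  define b :: "nat => 'k" where "b j = (if j = i then 2 else 1)" for j
  have vb: "monomial_value r alpha b = 2 ^ lookup alpha i" for alpha
  proof -
   have "monomial_value r alpha b = (\<Prod>j<r. if j = i then 2 ^ lookup alpha i else 1)"
    unfolding monomial_value_def b_def by (intro prod.cong) auto
   then show ?thesis using ir by simp
  qed
  have vm: "monomial_value r alpha (%j. a j * b j) = monomial_value r alpha a * monomial_value r alpha b" for alpha a
   by (simp add: monomial_value_def power_mult_distrib prod.distrib)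
  have z: "(\<Sum>alpha\<in>S. c alpha * (monomial_value r alpha b - monomial_value r alpha0 b) * monomial_value r alpha a) = 0" for a
  proof -
   have "(\<Sum>alpha\<in>insert alpha0 S. c alpha * monomial_value r alpha (%j. a j * b j)) -
    monomial_value r alpha0 b * (\<Sum>alpha\<in>insert alpha0 S. c alpha * monomial_value r alpha a) = 0"
    by (simp add: insert.prems(2))
   then show ?thesis
    using insert.hyps by (simp add: vm algebra_simps sum_distrib_left sum_subtractf)
  qed
  have "c alpha1 * (monomial_value r alpha1 b - monomial_value r alpha0 b) = 0"
   by (rule insert.IH[OF _ z alpha1]) (use insert.prems(1) in auto)
  moreover have "(2::'k) ^ lookup alpha1 i ~= 2 ^ lookup alpha0 i"
  proof
   assume "(2::'k) ^ lookup alpha1 i = 2 ^ lookup alpha0 i"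
   then have "of_nat (2 ^ lookup alpha1 i) = (of_nat (2 ^ lookup alpha0 i) :: 'k)" by simp
   then have "(2::nat) ^ lookup alpha1 i = 2 ^ lookup alpha0 i" by (rule of_nat_eq_iff[THEN iffD1])
   then show False using i by simp
  qed
  ultimately show ?thesis by (simp add: vb)
 qed
 then have "c alpha0 * monomial_value r alpha0 (%_. 1) = 0"
  using insert.prems(2)[of "%_. 1"] insert.hyps by simp
 then have "c alpha0 = 0" by (simp add: monomial_value_def)
 then show ?case using rest insert.prems(3) by auto
qed simp

text \<open>
  The coefficients are recovered from the values by the independence of monomials, for \<open>x\<close> and then for \<open>y\<close>.
\<close>

lemma ev_injective:
 fixes f :: "(expo, 'k::field_char_0) ser"
 assumes ev: "!!r q a b. 1 \<le> r ==> 1 \<le> q ==> coef (ev r q a b f) (mdeg alpha, mdeg beta, d) = coef (ev r q a b g) (mdeg alpha, mdeg beta, d)"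
 shows "coef f (alpha, beta, d) = coef g (alpha, beta, d)"
proof -
 have "\<exists>r\<ge>1. keys gamma \<subseteq> {..<r}" for gamma :: "nat \<Rightarrow>\<^sub>0 nat"
 proof -
  obtain N where "\<forall>i\<in>keys gamma. i < N" using finite_nat_set_iff_bounded[of "keys gamma"] by auto
  then show ?thesis by (intro exI[of _ "Suc N"]) (auto simp: less_SucI)
 qed
 then obtain r q where r: "1 \<le> r" "keys alpha \<subseteq> {..<r}" and q: "1 \<le> q" "keys beta \<subseteq> {..<q}" by metis
 let ?h = "%alpha beta. coef f (alpha, beta, d) - coef g (alpha, beta, d)"
 have alpha: "alpha \<in> monomials r (mdeg alpha)" and beta: "beta \<in> monomials q (mdeg beta)" using r q by (auto simp: monomials_def)
 have z: "(\<Sum>beta'\<in>monomials q (mdeg beta). ?h alpha beta' * monomial_value q beta' b) = 0" for b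
 proof (rule monomial_values_independent[OF finite_monomials _ _ alpha,
    where c = "%alpha'. \<Sum>beta'\<in>monomials q (mdeg beta). ?h alpha' beta' * monomial_value q beta' b"])
  show "(\<Sum>alpha'\<in>monomials r (mdeg alpha). (\<Sum>beta'\<in>monomials q (mdeg beta). ?h alpha' beta' * monomial_value q beta' b) * monomial_value r alpha' a) = 0" for a
   using ev[OF r(1) q(1), of a b] by (simp add: coef_ev sum_distrib_right sum_distrib_left algebra_simps sum_subtractf)
 qed (auto simp: monomials_def)
 have "?h alpha beta = 0"
  by (rule monomial_values_independent[OF finite_monomials _ z beta]) (auto simp: monomials_def)
 then show ?thesis by simp
qed

definition cyc :: "nat => (nat => nat) => nat multiset" where
 "cyc m sigma = cycle_lengths m sigma (%_. 1)"

text \<open>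
  A word fixed by a permutation is constant on its cycles. Here this is the case of diagonal matrices in the general
  formula for sums over cycles.
\<close>

lemma fixed_word_sum_cycles:
 assumes "sigma permutes {..<m}"
 shows "fixed_word_sum m r sigma a = (\<Prod>c\<in>#cyc m sigma. \<Sum>i<r. a i ^ c :: 'k::comm_ring_1)"
proof -
 define A where "A n i j = (if i = j then a i ^ n else 0)" for n and i j :: nat
 have k: "ksgn sigma m (%_. 0) = (1::'k)" unfolding ksgn_def by (intro prod.neutral) auto
 have "fixed_word_sum m r sigma a = (\<Sum>E\<in>{..<m} \<rightarrow>\<^sub>E {..<r}. ksgn sigma m (%i. 0) * (\<Prod>i<m. (-1) ^ 0 * A 1 (E i) (E (sigma i))))"
  unfolding fixed_word_sum_def
 proof (intro sum.cong refl)
  fix w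
  have "(\<Prod>i<m. A 1 (w i) (w (sigma i))) = (if \<forall>i\<in>{..<m}. w (sigma i) = w i then \<Prod>i<m. a (w i) else 0)"
   unfolding A_def by (subst prod_if_0[symmetric]) (auto intro!: prod.cong)
  then show "(if \<forall>i<m. w (sigma i) = w i then \<Prod>i<m. a (w i) else 0) = ksgn sigma m (%i. 0) * (\<Prod>i<m. (-1) ^ 0 * A 1 (w i) (w (sigma i)))"
   by (simp add: k)
 qed
 also have "... = (\<Prod>c\<in>#cycle_lengths m sigma (%_. 1). \<Sum>i<r. (-1) ^ 0 * A c i i)"
 proof (rule sum_over_cycles[where \<delta> = "%_. 0"])
  show "(\<Sum>e'\<in>{..<r}. A n e e' * A n' e' e'') = A (n + n') e e''" if "e \<in> {..<r}" for n n' e e''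
  proof -
   have "(\<Sum>e'\<in>{..<r}. A n e e' * A n' e' e'') = (\<Sum>e'\<in>{..<r}. if e' = e then a e ^ n * A n' e e'' else 0)"
    by (intro sum.cong) (auto simp: A_def)
   then show ?thesis using that by (simp add: A_def power_add)
  qed
 qed (use assms in auto)
 finally show ?thesis by (simp add: A_def cyc_def)
qed

text \<open>The Frobenius characteristic in power sum coordinates, from the traces \<open>chi\<close> of pairs of permutations.\<close>

definition frobenius :: "(nat => nat => nat => (nat => nat) => (nat => nat) => 'k::field_char_0) => (power_monomial, 'k) ser" where
 "frobenius chi = Ser (%(l, l', i). let m = sum_mset l; n = sum_mset l' in (-1) ^ i / (fact m * fact n) *
   (\<Sum>(sigma, tau)\<in>{(sigma, tau) \<in> perms m \<times> perms n. cyc m sigma = l & cyc n tau = l'}. chi m n i sigma tau))"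

definition cycle_type :: "nat \<times> nat \<times> nat => (nat => nat) \<times> (nat => nat) => power_monomial" where
 "cycle_type = (%(m, n, i) (sigma, tau). (cyc m sigma, cyc n tau, i))"

lemma sum_cycle_lengths_1: "sigma \<in> perms m ==> sum_mset (cyc m sigma) = m"
 by (simp add: perms_iff sum_cycle_lengths cyc_def)

lemma zero_notin_cycle_lengths: "sigma \<in> perms m ==> 0 \<notin># cyc m sigma"
 using cycle_lengths_pos[of sigma m "%_. 1" 0] by (auto simp: perms_iff cyc_def)

text \<open>
  Pairs of permutations are grouped by their cycle types. The function \<open>G\<close> stands for an arbitrary
  evaluation of the products of power sums, so that the formula serves the character and its plethysm alike.
\<close>

lemma sum_frobenius:
 "(\<Sum>t\<in>{t \<in> ps_valid. ps_wt t \<le> K}. coef (frobenius chi) t * G t) =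
  (\<Sum>(m, n, i)\<in>{x. tri_wt x \<le> K}. (-1) ^ i / (fact m * fact n) *
   (\<Sum>sigma\<in>perms m. \<Sum>tau\<in>perms n. chi m n i sigma tau * G (cyc m sigma, cyc n tau, i)))"
proof -
 let ?T = "{t \<in> ps_valid. ps_wt t \<le> K}" and ?I = "{x. tri_wt x \<le> K}"
 let ?P = "%x. perms (fst x) \<times> perms (fst (snd x))"
 let ?J = "SIGMA x:?I. ?P x"
 let ?c = "%(m, n, i) (sigma, tau). (-1) ^ i / (fact m * fact n) * chi m n i sigma tau"
 have fI: "finite ?I" by (rule finite_subset[of _ "{..K} \<times> {..K} \<times> {..K}"]) (auto simp: tri_wt_def)
 have fJ: "finite ?J" using fI by (intro finite_SigmaI) auto
 have "(\<Sum>(m, n, i)\<in>?I. (-1) ^ i / (fact m * fact n) *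
   (\<Sum>sigma\<in>perms m. \<Sum>tau\<in>perms n. chi m n i sigma tau * G (cyc m sigma, cyc n tau, i))) =
  (\<Sum>x\<in>?I. \<Sum>y\<in>?P x. ?c x y * G (cycle_type x y))"
  by (intro sum.cong refl) (auto simp: sum_distrib_left sum.cartesian_product cycle_type_def split_def mult.assoc)
 also have "... = (\<Sum>(x, y)\<in>?J. ?c x y * G (cycle_type x y))"
  by (rule sum.Sigma) (use fI in auto)
 also have "... = (\<Sum>t\<in>?T. \<Sum>(x, y)\<in>{j \<in> ?J. (case j of (x, y) => cycle_type x y) = t}. ?c x y * G (cycle_type x y))"
 proof (rule sum.group[symmetric, OF fJ finite_ps_valid])
  show "(%(x, y). cycle_type x y) ` ?J \<subseteq> ?T"
   by (auto simp: cycle_type_def ps_valid_def ps_wt_def tri_wt_def zero_notin_cycle_lengths sum_cycle_lengths_1)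
 qed
 also have "... = (\<Sum>t\<in>?T. coef (frobenius chi) t * G t)"
 proof (rule sum.cong[OF refl])
  fix t assume t: "t \<in> ?T"
  obtain l l' i where tt: "t = (l, l', i)" by (cases t)
  let ?m = "sum_mset l" and ?n = "sum_mset l'"
  let ?S = "{(sigma, tau) \<in> perms ?m \<times> perms ?n. cyc ?m sigma = l & cyc ?n tau = l'}"
  have "(\<Sum>(x, y)\<in>{j \<in> ?J. (case j of (x, y) => cycle_type x y) = t}. ?c x y * G (cycle_type x y)) =
   (\<Sum>y\<in>?S. ?c (?m, ?n, i) y * G t)"
  proof (rule sum.reindex_bij_witness[where i = "%y. ((?m, ?n, i), y)" and j = snd])
   fix j assume j: "j \<in> {j \<in> ?J. (case j of (x, y) => cycle_type x y) = t}"
   obtain m n i' sigma tau where jj: "j = ((m, n, i'), sigma, tau)" by (metis prod.exhaust)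
   have p: "sigma \<in> perms m" "tau \<in> perms n" using j by (auto simp: jj)
   have c: "cyc m sigma = l" "cyc n tau = l'" "i' = i"
    using j by (auto simp: jj cycle_type_def tt)
   have mn: "m = ?m" "n = ?n" using c sum_cycle_lengths_1[OF p(1)] sum_cycle_lengths_1[OF p(2)] by auto
   show "((?m, ?n, i), snd j) = j" using mn c by (simp add: jj)
   show "snd j \<in> ?S" using mn c p by (simp add: jj)
   show "?c (?m, ?n, i) (snd j) * G t = (case j of (x, y) => ?c x y * G (cycle_type x y))"
    using mn c by (simp add: jj tt cycle_type_def)
  qed (use t in \<open>auto simp: tt cycle_type_def tri_wt_def ps_wt_def\<close>)
  also have "... = coef (frobenius chi) t * G t"
   by (simp add: frobenius_def tt Let_def sum_distrib_left sum_distrib_right split_def)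
  finally show "(\<Sum>(x, y)\<in>{j \<in> ?J. (case j of (x, y) => cycle_type x y) = t}. ?c x y * G (cycle_type x y)) = coef (frobenius chi) t * G t" .
 qed
 finally show ?thesis by simp
qed

lemma coef_ev_frobenius:
 "coef (ev r q a b (ps.subst (frobenius chi))) (k, l, d) = (-1) ^ d / (fact k * fact l) *
  (\<Sum>sigma\<in>perms k. \<Sum>tau\<in>perms l. chi k l d sigma tau * (fixed_word_sum k r sigma a * fixed_word_sum l q tau b))"
proof -
 have pp: "(\<Prod>c\<in>#M. smono (c, 0, 0) (f c)) = (smono (sum_mset M, 0, 0) (\<Prod>c\<in>#M. f c) :: (nat \<times> nat \<times> nat, 'a) ser)"
  "(\<Prod>c\<in>#M. smono (0, c, 0) (f c)) = (smono (0, sum_mset M, 0) (\<Prod>c\<in>#M. f c) :: (nat \<times> nat \<times> nat, 'a) ser)" for M and f :: "nat => 'a"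
 proof -
  have "smono (0 :: nat \<times> nat \<times> nat) 1 = (1 :: (_, 'a) ser)" by (rule mono_0_1)
  then have "smono (0, 0, 0) 1 = (1 :: (nat \<times> nat \<times> nat, 'a) ser)" by (simp add: zero_prod_def)
  then show "(\<Prod>c\<in>#M. smono (c, 0, 0) (f c)) = (smono (sum_mset M, 0, 0) (\<Prod>c\<in>#M. f c) :: (nat \<times> nat \<times> nat, 'a) ser)"
   "(\<Prod>c\<in>#M. smono (0, c, 0) (f c)) = (smono (0, sum_mset M, 0) (\<Prod>c\<in>#M. f c) :: (nat \<times> nat \<times> nat, 'a) ser)"
   by (induction M) (simp_all add: mono_mult)
 qed
 have G: "coef (ev r q a b (ps_prod (cyc m sigma, cyc n tau, i))) (k, l, d) =
  (if (m, n, i) = (k, l, d) then fixed_word_sum m r sigma a * fixed_word_sum n q tau b else 0)"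
  if p: "sigma \<in> perms m" "tau \<in> perms n" for m n i sigma tau
 proof -
  have c1: "1 \<le> c" if "c \<in># cyc m sigma" for c using zero_notin_cycle_lengths[OF p(1)] that by (cases c) auto
  have c2: "1 \<le> c" if "c \<in># cyc n tau" for c using zero_notin_cycle_lengths[OF p(2)] that by (cases c) auto
  have "(\<Prod>c\<in>#cyc m sigma. ev r q a b (px c)) = (\<Prod>c\<in>#cyc m sigma. smono (c, 0, 0) (\<Sum>i<r. a i ^ c))"
   "(\<Prod>c\<in>#cyc n tau. ev r q a b (py c)) = (\<Prod>c\<in>#cyc n tau. smono (0, c, 0) (\<Sum>i<q. b i ^ c))"
   by (rule arg_cong[of _ _ prod_mset], rule image_mset_cong, rule ev_px, erule c1 c2)+
  then have "ev r q a b (ps_prod (cyc m sigma, cyc n tau, i)) =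
   smono (m, n, i) (fixed_word_sum m r sigma a * fixed_word_sum n q tau b)"
   using p by (simp add: ps_eval_def ev_mult ev_prod_mset ev_hbar pp mono_mult sum_cycle_lengths_1 fixed_word_sum_cycles[OF p(1)[unfolded perms_iff]] fixed_word_sum_cycles[OF p(2)[unfolded perms_iff]])
  then show ?thesis by (auto simp: coef_mono)
 qed
 have "coef (ev r q a b (ps.subst (frobenius chi))) (k, l, d) =
  (\<Sum>t\<in>{t \<in> ps_valid. ps_wt t \<le> tri_wt (k, l, d)}. coef (frobenius chi) t * coef (ev r q a b (ps_prod t)) (k, l, d))"
  unfolding ev_def by (rule subst_subst[OF ps.substitution_axioms eval_substitution])
 also have "... = (\<Sum>x\<in>{x. tri_wt x \<le> tri_wt (k, l, d)}. if x = (k, l, d) then (-1) ^ d / (fact k * fact l) *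
  (\<Sum>sigma\<in>perms k. \<Sum>tau\<in>perms l. chi k l d sigma tau * (fixed_word_sum k r sigma a * fixed_word_sum l q tau b)) else 0)"
  unfolding sum_frobenius
 proof (rule sum.cong[OF refl])
  fix x :: "nat \<times> nat \<times> nat"
  obtain m n i where x: "x = (m, n, i)" by (cases x)
  have "(\<Sum>sigma\<in>perms m. \<Sum>tau\<in>perms n. chi m n i sigma tau * coef (ev r q a b (ps_prod (cyc m sigma, cyc n tau, i))) (k, l, d)) =
   (\<Sum>sigma\<in>perms m. \<Sum>tau\<in>perms n. chi m n i sigma tau *
    (if (m, n, i) = (k, l, d) then fixed_word_sum m r sigma a * fixed_word_sum n q tau b else 0))"
   by (intro sum.cong refl arg_cong2[of _ _ _ _ "(*)"] G)
  then show "(case x of (m, n, i) => (-1) ^ i / (fact m * fact n) *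
   (\<Sum>sigma\<in>perms m. \<Sum>tau\<in>perms n. chi m n i sigma tau * coef (ev r q a b (ps_prod (cyc m sigma, cyc n tau, i))) (k, l, d))) =
   (if x = (k, l, d) then (-1) ^ d / (fact k * fact l) *
  (\<Sum>sigma\<in>perms k. \<Sum>tau\<in>perms l. chi k l d sigma tau * (fixed_word_sum k r sigma a * fixed_word_sum l q tau b)) else 0)"
   unfolding x case_prod_conv by (cases "(m, n, i) = (k, l, d)") auto
 qed
 also have "... = (-1) ^ d / (fact k * fact l) *
  (\<Sum>sigma\<in>perms k. \<Sum>tau\<in>perms l. chi k l d sigma tau * (fixed_word_sum k r sigma a * fixed_word_sum l q tau b))"
 proof -
  have "finite {x. tri_wt x \<le> tri_wt (k, l, d)}"
   by (rule finite_subset[of _ "{..k+l+d} \<times> {..k+l+d} \<times> {..k+l+d}"]) (auto simp: tri_wt_def)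
  then show ?thesis by simp
 qed
 finally show ?thesis .
qed

section \<open>Characters as traces over the alphabet\<close>

definition word_match :: "nat => (nat => nat) => (nat => nat) => (nat => nat) => 'k::comm_semiring_1" where
 "word_match k h u u' = (if \<forall>j<k. u j = u' (h j) then 1 else 0)"

lemma word_match_comp:
 assumes h: "h permutes {..<k}" and g: "g permutes {..<k}" and u'': "u'' \<in> {..<k} \<rightarrow>\<^sub>E {..<r}"
 shows "(\<Sum>u'\<in>{..<k} \<rightarrow>\<^sub>E {..<r}. word_match k h u u' * word_match k g u' u'') =
  (word_match k (g \<circ> h) u u'' :: 'k::comm_semiring_1)"
proof -
 let ?u = "\<lambda>j\<in>{..<k}. u'' (g j)"
 have lt: "h j < k" "g j < k" if "j < k" for j
  using permutes_in_image[OF h, of j] permutes_in_image[OF g, of j] that by auto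
 have mem: "?u \<in> {..<k} \<rightarrow>\<^sub>E {..<r}" using u'' lt by (auto simp: PiE_iff)
 have eq: "word_match k g u' u'' = (if u' = ?u then 1 else 0 :: 'k)" if "u' \<in> {..<k} \<rightarrow>\<^sub>E {..<r}" for u'
 proof -
  have "(\<forall>j<k. u' j = u'' (g j)) \<longleftrightarrow> u' = ?u"
   using that by (auto simp: PiE_iff extensional_def fun_eq_iff)
  then show ?thesis by (simp add: word_match_def)
 qed
 have "(\<Sum>u'\<in>{..<k} \<rightarrow>\<^sub>E {..<r}. word_match k h u u' * word_match k g u' u'') =
  (\<Sum>u'\<in>{..<k} \<rightarrow>\<^sub>E {..<r}. if u' = ?u then word_match k h u ?u else 0 :: 'k)"
  by (intro sum.cong) (auto simp: eq)
 also have "... = word_match k h u ?u"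
  using mem by (simp add: sum.delta[OF finite_PiE])
 also have "... = word_match k (g \<circ> h) u u''" using lt by (simp add: word_match_def)
 finally show ?thesis .
qed

lemma fixed_word_sum_match: "fixed_word_sum k r h a = (\<Sum>u\<in>{..<k} \<rightarrow>\<^sub>E {..<r}. word_match k h u u * (\<Prod>j<k. a (u j)))"
proof -
 have "(\<forall>i<k. u (h i) = u i) \<longleftrightarrow> (\<forall>j<k. u j = u (h j))" for u :: "nat => nat" by metis
 then show ?thesis unfolding fixed_word_sum_def word_match_def by (intro sum.cong) auto
qed

lemma letter_proj_type: "fst E ~= fst E' ==> letter_proj s N E E' = 0"
 by (cases E; cases E') (auto simp: letter_proj_def split: prod.splits)

lemma letter_proj_eq:
 "letter_proj s N ((k, l, d), e, u, v) ((k, l, d), e', u', v') = (1 / (fact k * fact l)) *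
  (\<Sum>x\<in>perms k \<times> perms l. coord_of s (bpiece N k l d) e (bact N k l d (fst x) (snd x) e') *
   (word_match k (fst x) u u' * word_match l (snd x) v v'))"
 by (simp add: letter_proj_def word_match_def sum.cartesian_product split_def mult.assoc)

text \<open>
  The projector permutes the coordinates of the words, and therefore commutes with the weights.
\<close>

lemma letter_proj_weight:
 assumes "letter_proj s N E E' ~= 0"
 shows "letter_weight a b E = letter_weight a b E'"
proof -
 obtain k l d e u v where E: "E = ((k, l, d), e, u, v)" by (metis prod.exhaust)
 obtain e' u' v' where E': "E' = ((k, l, d), e', u', v')"
  using letter_proj_type[of E E' s N] assms by (cases E') (auto simp: E)
 obtain x where x: "x \<in> perms k \<times> perms l" "word_match k (fst x) u u' ~= (0 :: 'a)" "word_match l (snd x) v v' ~= (0 :: 'a)"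
  using assms unfolding E E' letter_proj_eq
  by (metis (no_types, lifting) mult_zero_right mult_zero_left sum.neutral)
 have p: "fst x permutes {..<k}" "snd x permutes {..<l}" using x(1) by (auto simp: perms_iff)
 have "\<forall>j<k. u j = u' (fst x j)" "\<forall>j<l. v j = v' (snd x j)" using x(2,3) by (auto simp: word_match_def split: if_splits)
 then have "(\<Prod>j<k. a (u j)) = (\<Prod>j<k. a (u' (fst x j)))" "(\<Prod>j<l. b (v j)) = (\<Prod>j<l. b (v' (snd x j)))" by auto
 then show ?thesis
  using prod.permute[OF p(1), of "%j. a (u' j)"] prod.permute[OF p(2), of "%j. b (v' j)"]
  by (simp add: E E' letter_weight_def comp_def)
qed

lemma sum_alphabet_type:
 assumes "finite (alphabet s N r q K)" "(k, l, d) \<in> K"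
  "!!E. E \<in> alphabet s N r q K ==> fst E ~= (k, l, d) ==> F E = 0"
 shows "sum F (alphabet s N r q K) =
  (\<Sum>(e, u, v)\<in>basis_of s (bpiece N k l d) \<times> ({..<k} \<rightarrow>\<^sub>E {..<r}) \<times> ({..<l} \<rightarrow>\<^sub>E {..<q}). F ((k, l, d), e, u, v))"
proof -
 have "sum F (alphabet s N r q K) =
  sum F (Pair (k, l, d) ` (basis_of s (bpiece N k l d) \<times> ({..<k} \<rightarrow>\<^sub>E {..<r}) \<times> ({..<l} \<rightarrow>\<^sub>E {..<q})))"
 proof (rule sum.mono_neutral_right[OF assms(1)])
  show "\<forall>E\<in>alphabet s N r q K - Pair (k, l, d) ` (basis_of s (bpiece N k l d) \<times> ({..<k} \<rightarrow>\<^sub>E {..<r}) \<times> ({..<l} \<rightarrow>\<^sub>E {..<q})). F E = 0"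
   by (intro ballI assms(3)) (auto simp: alphabet_def)
 qed (use assms(2) in \<open>auto simp: alphabet_def\<close>)
 then show ?thesis by (simp add: sum.reindex inj_on_def split_def)
qed

definition tri_mult :: "nat => nat \<times> nat \<times> nat => nat \<times> nat \<times> nat" where
 "tri_mult n = (%(k, l, d). (n * k, n * l, n * d))"

text \<open>
  The matrix entry is placed at \<open>n\<close> times the biarity and degree of the letter: all letters along a cycle of length \<open>n\<close>
  have the same biarity and degree, and these add up over the cycle.
\<close>

definition letter_ser ::
 "('k::field_char_0 => 'v::ab_group_add => 'v) => 'v bisymmetric_seq => (nat => 'k) => (nat => 'k) =>
  nat => 'v letter => 'v letter => (nat \<times> nat \<times> nat, 'k) ser" where
 "letter_ser s N a b n E E' = smono (tri_mult n (fst E)) (letter_mat s N a b n E E')"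

lemma smono_0 [simp]: "smono i 0 = 0" by (rule ser_eqI) (simp add: coef_mono)

lemma smono_sum: "smono i (sum f I) = (\<Sum>x\<in>I. smono i (f x))"
 by (rule ser_eqI) (simp add: coef_mono)

lemma neg_1_power_ser: "(-1) ^ n = (smono 0 ((-1) ^ n) :: ('i::fin_decomp, 'k::comm_ring_1) ser)"
proof -
 have "smono 0 (-1) + 1 = (0 :: ('i, 'k) ser)"
  unfolding mono_0_1[symmetric] by (rule ser_eqI) (simp add: coef_mono)
 then have *: "- 1 = (smono 0 (- 1) :: ('i, 'k) ser)" by (metis add_eq_0_iff add.commute)
 show ?thesis
 proof (induction n)
  case (Suc n)
  have "(- 1) ^ Suc n = smono 0 (- 1) * (smono 0 ((- 1) ^ n) :: ('i, 'k) ser)" using Suc * by simp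
  then show ?case by (simp add: mono_mult)
 qed (simp add: mono_0_1)
qed

lemma letter_deg_neutral: "letter_deg E ~= letter_deg E' ==> letter_ser s N a b n E E' = 0"
 using letter_proj_type[of E E' s N] by (cases "fst E = fst E'") (auto simp: letter_ser_def letter_mat_def)

locale letters = bisymmetric_sequence s N
 for s :: "'k::field_char_0 => 'v::ab_group_add => 'v" and N :: "'v bisymmetric_seq" +
 assumes fin: "finite_dim s (bpiece N k l d)"
begin

lemma subsp_piece: "subsp s (bpiece N k l d)"
 using subspace_piece vector_space_axioms by blast

lemma basis: "is_basis s (bpiece N k l d) (basis_of s (bpiece N k l d)) (coord_of s (bpiece N k l d))"
 by (rule is_basis_of[OF subsp_piece fin])

lemma basisD:
 "finite (basis_of s (bpiece N k l d))"
 "e \<in> basis_of s (bpiece N k l d) ==> e \<in> bpiece N k l d"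
 "e \<in> basis_of s (bpiece N k l d) ==> linear_on s (*) (bpiece N k l d) (coord_of s (bpiece N k l d) e)"
 "x \<in> bpiece N k l d ==> x = (\<Sum>e\<in>basis_of s (bpiece N k l d). s (coord_of s (bpiece N k l d) e x) e)"
 using basis[of k l d] unfolding is_basis_def by blast+

lemma bact_lin: "h permutes {..<k} ==> h' permutes {..<l} ==> bact N k l d h h' \<in> lin_maps s (bpiece N k l d) s (bpiece N k l d)"
 using linear_act act_closed by (auto simp: lin_maps_def)

lemma coord_act:
 assumes h: "h permutes {..<k}" "h' permutes {..<l}" and e: "e \<in> basis_of s (bpiece N k l d)" and x: "x \<in> bpiece N k l d"
 shows "(\<Sum>e'\<in>basis_of s (bpiece N k l d). coord_of s (bpiece N k l d) e (bact N k l d h h' e') * coord_of s (bpiece N k l d) e' x) =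
  coord_of s (bpiece N k l d) e (bact N k l d h h' x)"
proof -
 let ?c = "coord_of s (bpiece N k l d)"
 have lin: "linear_on s (*) (bpiece N k l d) (%x. ?c e (bact N k l d h h' x))"
  by (rule linear_on_comp[OF bact_lin[OF h] basisD(3)[OF e]])
 have "?c e (bact N k l d h h' x) = ?c e (bact N k l d h h' (\<Sum>e'\<in>basis_of s (bpiece N k l d). s (?c e' x) e'))"
  using basisD(4)[OF x] by simp
 also have "... = (\<Sum>e'\<in>basis_of s (bpiece N k l d). ?c e' x * ?c e (bact N k l d h h' e'))"
  by (rule linear_on_lincomb[OF subsp_piece vector_space_mult lin]) (rule basisD(2))
 finally show ?thesis by (simp add: mult.commute)
qed

definition act_trace :: "nat => nat => nat => (nat => nat) => (nat => nat) => 'k" where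
 "act_trace k l d h h' = (\<Sum>e\<in>basis_of s (bpiece N k l d). coord_of s (bpiece N k l d) e (bact N k l d h h' e))"

lemma has_trace_act:
 assumes "h permutes {..<k}" "h' permutes {..<l}"
 shows "has_trace s (bpiece N k l d) (bact N k l d h h') (act_trace k l d h h')"
 unfolding act_trace_def
 by (rule has_trace_basis[OF subsp_piece bact_lin[OF assms] basisD(1)]) (auto simp: basisD(2,3) basisD(4)[symmetric])

lemma trace_eq: "bisym_schur_trace s N k l d r q a b = (1 / (fact k * fact l)) *
  (\<Sum>h\<in>perms k. \<Sum>h'\<in>perms l. act_trace k l d h h' * (fixed_word_sum k r h a * fixed_word_sum l q h' b))"
 by (rule bisym_schur_trace_eq[OF bisymmetric_sequence_axioms has_trace_act])

lemma finite_alphabet: "finite K ==> finite (alphabet s N r q K)"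
 unfolding alphabet_def by (auto intro!: finite_SigmaI finite_PiE basisD(1))

text \<open>The averaging projector is idempotent.\<close>

lemma letter_proj_idem:
 assumes K: "finite K" and E: "E \<in> alphabet s N r q K" and E'': "E'' \<in> alphabet s N r q K"
 shows "(\<Sum>E'\<in>alphabet s N r q K. letter_proj s N E E' * letter_proj s N E' E'') = letter_proj s N E E''"
proof (cases "fst E = fst E''")
 case False
 have "(\<Sum>E'\<in>alphabet s N r q K. letter_proj s N E E' * letter_proj s N E' E'') = 0"
  by (intro sum.neutral ballI) (metis False letter_proj_type mult_zero_left mult_zero_right)
 then show ?thesis by (simp add: letter_proj_type[OF False])
next
 case True
 obtain k l d e u v where EE: "E = ((k, l, d), e, u, v)" by (metis prod.exhaust)
 obtain e'' u'' v'' where EE'': "E'' = ((k, l, d), e'', u'', v'')" using True by (cases E'') (auto simp: EE)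
 have kld: "(k, l, d) \<in> K" and e: "e \<in> basis_of s (bpiece N k l d)" and e'': "e'' \<in> basis_of s (bpiece N k l d)"
  and u'': "u'' \<in> {..<k} \<rightarrow>\<^sub>E {..<r}" and v'': "v'' \<in> {..<l} \<rightarrow>\<^sub>E {..<q}"
  using E E'' by (auto simp: EE EE'' alphabet_def)
 let ?H = "perms k \<times> perms l" and ?beta = "coord_of s (bpiece N k l d)" and ?B = "basis_of s (bpiece N k l d)"
 let ?U = "{..<k} \<rightarrow>\<^sub>E {..<r}" and ?V = "{..<l} \<rightarrow>\<^sub>E {..<q}"
 let ?c = "1 / (fact k * fact l) :: 'k"
 let ?a = "%x. bact N k l d (fst x) (snd x)"
 define f where "f x e' u' v' = ?beta e (?a x e') * (word_match k (fst x) u u' * word_match l (snd x) v v')" for x e' u' v'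
 define g where "g x e' u' v' = ?beta e' (?a x e'') * (word_match k (fst x) u' u'' * word_match l (snd x) v' v'')" for x e' u' v'
 define G where "G x = ?beta e (?a x e'') * (word_match k (fst x) u u'' * word_match l (snd x) v v'')" for x
 have fH: "finite ?H" by simp
 have inner: "(\<Sum>(e', u', v')\<in>?B \<times> ?U \<times> ?V. f x e' u' v' * g y e' u' v') = G (fst y \<circ> fst x, snd y \<circ> snd x)"
  if x: "x \<in> ?H" and y: "y \<in> ?H" for x y
 proof -
  have p: "fst x permutes {..<k}" "snd x permutes {..<l}" "fst y permutes {..<k}" "snd y permutes {..<l}"
   using x y by (auto simp: perms_iff)
  have "(\<Sum>(e', u', v')\<in>?B \<times> ?U \<times> ?V. f x e' u' v' * g y e' u' v') =
   (\<Sum>e'\<in>?B. ?beta e (?a x e') * ?beta e' (?a y e'')) * ((\<Sum>u'\<in>?U. word_match k (fst x) u u' * word_match k (fst y) u' u'') *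
    (\<Sum>v'\<in>?V. word_match l (snd x) v v' * word_match l (snd y) v' v''))"
   unfolding sum3_product f_def g_def by (intro sum.cong refl) (auto simp: mult_ac)
  also have "... = ?beta e (?a x (?a y e'')) * (word_match k (fst y \<circ> fst x) u u'' * word_match l (snd y \<circ> snd x) v v'')"
   using coord_act[OF p(1,2) e act_closed[OF p(3,4) basisD(2)[OF e'']]]
   by (simp add: word_match_comp[OF p(1,3) u''] word_match_comp[OF p(2,4) v''])
  also have "?a x (?a y e'') = bact N k l d (fst y \<circ> fst x) (snd y \<circ> snd x) e''"
   by (rule act_comp[symmetric, OF p(3,1,4,2) basisD(2)[OF e'']])
  finally show ?thesis by (simp only: G_def fst_conv snd_conv)
 qed
 have "(\<Sum>E'\<in>alphabet s N r q K. letter_proj s N E E' * letter_proj s N E' E'') =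
  (\<Sum>(e', u', v')\<in>?B \<times> ?U \<times> ?V. letter_proj s N E ((k, l, d), e', u', v') * letter_proj s N ((k, l, d), e', u', v') E'')"
  by (rule sum_alphabet_type[OF finite_alphabet[OF K] kld]) (metis EE fst_conv letter_proj_type mult_zero_left)
 also have "... = (\<Sum>(e', u', v')\<in>?B \<times> ?U \<times> ?V. (?c * ?c) * (\<Sum>x\<in>?H. \<Sum>y\<in>?H. f x e' u' v' * g y e' u' v'))"
  unfolding EE EE'' letter_proj_eq f_def[symmetric] g_def[symmetric]
  by (intro sum.cong refl) (auto simp: sum_product[symmetric] mult_ac)
 also have "... = (?c * ?c) * (\<Sum>x\<in>?H. \<Sum>y\<in>?H. \<Sum>(e', u', v')\<in>?B \<times> ?U \<times> ?V. f x e' u' v' * g y e' u' v')"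
 proof -
  have "(\<Sum>w\<in>W. c * (\<Sum>x\<in>?H. \<Sum>y\<in>?H. F x y w)) = c * (\<Sum>x\<in>?H. \<Sum>y\<in>?H. \<Sum>w\<in>W. F x y w)"
   for W :: "('v \<times> (nat => nat) \<times> (nat => nat)) set" and c :: 'k and F
  proof -
   have "(\<Sum>w\<in>W. c * (\<Sum>x\<in>?H. \<Sum>y\<in>?H. F x y w)) = c * (\<Sum>x\<in>?H. \<Sum>w\<in>W. \<Sum>y\<in>?H. F x y w)"
    by (simp only: sum_distrib_left[symmetric] sum.swap[of _ ?H W])
   also have "(\<Sum>x\<in>?H. \<Sum>w\<in>W. \<Sum>y\<in>?H. F x y w) = (\<Sum>x\<in>?H. \<Sum>y\<in>?H. \<Sum>w\<in>W. F x y w)"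
    by (intro sum.cong refl sum.swap)
   finally show ?thesis .
  qed
  from this[where F = "%x y (e', u', v'). f x e' u' v' * g y e' u' v'"] show ?thesis by (simp only: split_def)
 qed
 also have "... = (?c * ?c) * (\<Sum>x\<in>?H. \<Sum>y\<in>?H. G (fst y \<circ> fst x, snd y \<circ> snd x))"
  by (simp only: inner cong: sum.cong)
 also have "(\<Sum>x\<in>?H. \<Sum>y\<in>?H. G (fst y \<circ> fst x, snd y \<circ> snd x)) = (\<Sum>y\<in>?H. \<Sum>x\<in>?H. G (fst y \<circ> fst x, snd y \<circ> snd x))"
  by (rule sum.swap)
 also have "... = (\<Sum>y\<in>?H. \<Sum>x\<in>?H. G x)"
 proof (rule sum.cong[OF refl])
  fix y assume y: "y \<in> ?H"
  show "(\<Sum>x\<in>?H. G (fst y \<circ> fst x, snd y \<circ> snd x)) = (\<Sum>x\<in>?H. G x)"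
   by (rule sum.reindex_bij_betw[OF bij_perms_pair[OF y]])
 qed
 also have "(?c * ?c) * ... = ?c * (\<Sum>x\<in>?H. G x)"
  by (simp add: card_cartesian_product)
 also have "... = letter_proj s N E E''" unfolding EE EE'' letter_proj_eq G_def ..
 finally show ?thesis .
qed

lemma letter_ser_semigroup:
 assumes K: "finite K" and E: "E \<in> alphabet s N r q K" and E'': "E'' \<in> alphabet s N r q K"
 shows "(\<Sum>E'\<in>alphabet s N r q K. letter_ser s N a b n E E' * letter_ser s N a b n' E' E'') = letter_ser s N a b (n + n') E E''"
proof -
 have eq: "letter_ser s N a b n E E' * letter_ser s N a b n' E' E'' =
   smono (tri_mult (n + n') (fst E)) (letter_proj s N E E' * letter_proj s N E' E'' * letter_weight a b E'' ^ (n + n'))" for E'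
 proof (cases "fst E = fst E' & letter_proj s N E' E'' ~= 0")
  case True
  have "letter_weight a b E' = letter_weight a b E''" using True letter_proj_weight by blast
  moreover have "tri_mult n (fst E) + tri_mult n' (fst E') = tri_mult (n + n') (fst E)"
   using True by (cases "fst E'") (simp add: tri_mult_def algebra_simps)
  ultimately show ?thesis by (simp add: letter_ser_def letter_mat_def mono_mult power_add mult_ac)
 next
  case False
  then show ?thesis using letter_proj_type[of E E' s N] by (auto simp: letter_ser_def letter_mat_def)
 qed
 show ?thesis
  unfolding eq smono_sum[symmetric] sum_distrib_right[symmetric] letter_proj_idem[OF K E E'']
  by (simp add: letter_ser_def letter_mat_def)
qed

lemma letter_cycles:
 assumes K: "finite K" and sigma: "sigma \<in> perms m"
 shows "(\<Sum>E\<in>{..<m} \<rightarrow>\<^sub>E alphabet s N r q K. ksgn sigma m (%i. letter_deg (E i)) *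
   (\<Prod>i<m. (-1) ^ letter_deg (E i) * letter_ser s N a b 1 (E i) (E (sigma i)))) =
  (\<Prod>c\<in>#cyc m sigma. \<Sum>E\<in>alphabet s N r q K. (-1) ^ letter_deg E * letter_ser s N a b c E E)"
 unfolding cyc_def
 by (rule sum_over_cycles[OF finite_alphabet[OF K] letter_ser_semigroup[OF K] letter_deg_neutral])
  (use sigma in \<open>auto simp: perms_iff\<close>)

text \<open>
  The trace of the averaging projector times the weights is the trace on the coinvariants.
\<close>

lemma letter_trace:
 assumes K: "finite K" "(k, l, d) \<in> K"
 shows "(\<Sum>E\<in>alphabet s N r q K. if fst E = (k, l, d) then letter_mat s N a b c E E else 0) =
  bisym_schur_trace s N k l d r q (%i. a i ^ c) (%i. b i ^ c)"
proof -
 let ?H = "perms k \<times> perms l" and ?beta = "coord_of s (bpiece N k l d)" and ?B = "basis_of s (bpiece N k l d)"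
 let ?U = "{..<k} \<rightarrow>\<^sub>E {..<r}" and ?V = "{..<l} \<rightarrow>\<^sub>E {..<q}"
 let ?c = "1 / (fact k * fact l) :: 'k"
 let ?f = "%x e. ?beta e (bact N k l d (fst x) (snd x) e)"
 let ?u = "%x u. word_match k (fst x) u u * (\<Prod>j<k. a (u j) ^ c)" and ?v = "%x v. word_match l (snd x) v v * (\<Prod>j<l. b (v j) ^ c)"
 have "(\<Sum>E\<in>alphabet s N r q K. if fst E = (k, l, d) then letter_mat s N a b c E E else 0) =
  (\<Sum>(e, u, v)\<in>?B \<times> ?U \<times> ?V. letter_mat s N a b c ((k, l, d), e, u, v) ((k, l, d), e, u, v))"
  by (subst sum_alphabet_type[OF finite_alphabet[OF K(1)] K(2)]) auto
 also have "... = (\<Sum>w\<in>?B \<times> ?U \<times> ?V. ?c * (\<Sum>x\<in>?H. ?f x (fst w) * (?u x (fst (snd w)) * ?v x (snd (snd w)))))"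
  by (intro sum.cong refl)
   (auto simp: letter_mat_def letter_proj_eq letter_weight_def sum_distrib_left sum_distrib_right power_mult_distrib prod_power_distrib mult_ac)
 also have "... = ?c * (\<Sum>x\<in>?H. \<Sum>w\<in>?B \<times> ?U \<times> ?V. ?f x (fst w) * (?u x (fst (snd w)) * ?v x (snd (snd w))))"
  by (simp only: sum_distrib_left[symmetric] sum.swap[of _ ?H])
 also have "... = ?c * (\<Sum>x\<in>?H. act_trace k l d (fst x) (snd x) * (fixed_word_sum k r (fst x) (%i. a i ^ c) * fixed_word_sum l q (snd x) (%i. b i ^ c)))"
  unfolding act_trace_def fixed_word_sum_match sum3_product by (simp add: split_def)
 also have "... = bisym_schur_trace s N k l d r q (%i. a i ^ c) (%i. b i ^ c)"
  by (simp add: trace_eq sum.cartesian_product split_def)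
 finally show ?thesis .
qed

lemma coef_letter_cycle:
 assumes K: "finite K" and c: "1 \<le> c" and x: "(k div c, l div c, d div c) \<in> K"
 shows "coef (\<Sum>E\<in>alphabet s N r q K. (-1) ^ letter_deg E * letter_ser s N a b c E E) (k, l, d) =
  (if c dvd k & c dvd l & c dvd d then (-1) ^ (d div c) * bisym_schur_trace s N (k div c) (l div c) (d div c) r q (%i. a i ^ c) (%i. b i ^ c) else 0)"
proof -
 have t: "(k, l, d) = tri_mult c y \<longleftrightarrow> (c dvd k & c dvd l & c dvd d) & y = (k div c, l div c, d div c)" for y
  using c by (cases y) (auto simp: tri_mult_def)
 have "coef (\<Sum>E\<in>alphabet s N r q K. (-1) ^ letter_deg E * letter_ser s N a b c E E) (k, l, d) =
  (\<Sum>E\<in>alphabet s N r q K. if (k, l, d) = tri_mult c (fst E) then (-1) ^ letter_deg E * letter_mat s N a b c E E else 0)"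
  by (simp add: letter_ser_def neg_1_power_ser mono_mult coef_mono)
 also have "... = (if c dvd k & c dvd l & c dvd d then (-1) ^ (d div c) *
   (\<Sum>E\<in>alphabet s N r q K. if fst E = (k div c, l div c, d div c) then letter_mat s N a b c E E else 0) else 0)"
  unfolding t sum_distrib_left by (auto intro!: sum.cong sum.neutral)
 finally show ?thesis unfolding letter_trace[OF K x] .
qed

end

subsection \<open>Existence and uniqueness of the characters\<close>

lemma is_bisym_char_ev: "is_bisym_char s M f \<longleftrightarrow> f \<in> carrier sym_series & (\<forall>r\<ge>1. \<forall>q\<ge>1. \<forall>m n d a b.
  coef (ev r q a b (Ser f)) (m, n, d) = (-1) ^ d * bisym_schur_trace s M m n d r q a b)"
 by (simp add: is_bisym_char_def coef_ev)

lemma is_bisym_char_unique: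
 fixes s :: "'k::field_char_0 => 'v::ab_group_add => 'v"
 assumes "is_bisym_char s M f" "is_bisym_char s M g"
 shows "f = g"
proof
 fix x :: expo
 obtain alpha beta d where x: "x = (alpha, beta, d)" by (cases x)
 have "coef (Ser f) (alpha, beta, d) = coef (Ser g) (alpha, beta, d)"
  by (rule ev_injective) (use assms in \<open>simp add: is_bisym_char_ev\<close>)
 then show "f x = g x" by (simp add: x)
qed

lemma bisym_charI:
 fixes s :: "'k::field_char_0 => 'v::ab_group_add => 'v"
 assumes "is_bisym_char s M f"
 shows "bisym_char s M = f"
 unfolding bisym_char_def by (rule the_equality[of "is_bisym_char s M", OF assms]) (rule is_bisym_char_unique[OF _ assms])

context letters
begin

lemma is_bisym_char_frobenius: "is_bisym_char s N (coef (ps.subst (frobenius act_trace)))"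
 unfolding is_bisym_char_ev Ser_coef coef_ev_frobenius trace_eq
 using symmetric_ps_subst[of "frobenius act_trace"] by (simp add: symmetric_def)

lemma bisym_char_eq: "bisym_char s N = coef (ps.subst (frobenius act_trace))"
 by (rule bisym_charI[OF is_bisym_char_frobenius])

lemma is_bisym_char: "is_bisym_char s N (bisym_char s N)"
 unfolding bisym_char_eq by (rule is_bisym_char_frobenius)

lemma schur_trace_zero:
 assumes "bpiece N k l d = {0}"
 shows "bisym_schur_trace s N k l d r q a b = 0"
proof -
 have "has_trace s (bpiece N k l d) (bact N k l d h h') 0" if "h permutes {..<k}" "h' permutes {..<l}" for h h'
  using linear_on_0[OF subsp_piece vector_space_axioms linear_act[OF that]] assms by (intro has_trace_0) auto
 from bisym_schur_trace_eq[OF bisymmetric_sequence_axioms this] show ?thesis by simp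
qed

lemma bisym_char_0:
 assumes "bpiece N 0 0 0 = {0}"
 shows "bisym_char s N 0 = 0"
proof -
 have "coef (ev 1 1 (%_. 1) (%_. 1) (Ser (bisym_char s N))) (0, 0, 0) = 0"
  using is_bisym_char unfolding is_bisym_char_ev by (simp add: schur_trace_zero[OF assms])
 then show ?thesis by (simp add: coef_ev monomials_0 monomial_value_0 zero_prod_def)
qed

text \<open>The trace of a \<open>c\<close>-cycle is the \<open>c\<close>-th Adams operation applied to the character.\<close>

lemma letter_cycle_ev:
 assumes c: "1 \<le> c" and r: "1 \<le> r" "1 \<le> q" and x: "x + y = (k, l, d)"
 shows "coef (\<Sum>E\<in>alphabet s N r q ({..k} \<times> {..l} \<times> {..d}). (-1) ^ letter_deg E * letter_ser s N a b c E E) x =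
  coef (ev r q a b (Ser (power_subst c (bisym_char s N)))) x"
proof -
 obtain k' l' d' where xx: "x = (k', l', d')" by (cases x)
 have le: "k' div c \<le> k" "l' div c \<le> l" "d' div c \<le> d"
  using x order.trans[OF div_le_dividend] by (cases y; auto simp: xx)+
 have "coef (ev r q a b (Ser (power_subst c (bisym_char s N)))) x =
  (if c dvd k' & c dvd l' & c dvd d' then (-1) ^ (d' div c) * bisym_schur_trace s N (k' div c) (l' div c) (d' div c) r q (%i. a i ^ c) (%i. b i ^ c) else 0)"
  using is_bisym_char r unfolding xx ev_power_subst[OF c] is_bisym_char_ev by simp
 then show ?thesis
  unfolding xx using le by (subst coef_letter_cycle[OF _ c]) auto
qed

end

text \<open>
  Products only need the coefficients below \<open>kappa\<close>; this allows one to work with finitely many letters.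
\<close>

lemma agree_prod_mset:
 assumes "!!c x y. c \<in># M ==> x + y = kappa ==> coef (F c) x = coef (G c) x" "x + y = kappa"
 shows "coef (\<Prod>c\<in>#M. F c) x = coef (\<Prod>c\<in>#M. G c :: ('i::fin_decomp, 'k::comm_ring_1) ser) x"
 using assms
proof (induction M arbitrary: x y)
 case (add c M)
 have "coef (F c) (fst p) * coef (\<Prod>c\<in>#M. F c) (snd p) = coef (G c) (fst p) * coef (\<Prod>c\<in>#M. G c) (snd p)"
  if "p \<in> decomps x" for p
 proof -
  have "fst p + (snd p + y) = kappa" "snd p + (fst p + y) = kappa" using that add.prems(2) by (auto simp: split_def add_ac)
  then show ?thesis using add.IH[of "snd p" "fst p + y"] add.prems(1) by auto
 qed
 then show ?case by (auto simp: coef_mult split_def intro!: sum.cong)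
qed simp

subsection \<open>Symmetric sequences as bisymmetric sequences\<close>

text \<open>
  A symmetric sequence is treated as a bisymmetric one, so that both kinds of factors fall under the same formulas.
\<close>

lemma letters_as_bisymmetric:
 fixes s :: "'k::field_char_0 => 'v::ab_group_add => 'v"
 assumes "symmetric_sequence s N" and "symmetric_finite_type s N"
 shows "letters s (as_bisymmetric N)"
proof -
 interpret symmetric_sequence s N by fact
 have sub: "subsp s (spiece N n d)" for n d using subspace_piece vector_space_axioms by blast
 have z: "sact N n d tau 0 = 0" if "tau permutes {..<n}" for n d tau
  by (rule linear_on_0[OF sub vector_space_axioms linear_act[OF that]])
 have in0: "0 \<in> spiece N n d" for n d using subspace_0[OF subspace_piece] .
 have fd: "finite_dim s (spiece N n d)" "finite_dim s {0}" for n d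
  using assms(2) by (auto simp: symmetric_finite_type_def finite_dim_def)
 show ?thesis
 proof unfold_locales
  show "subspace (bpiece (as_bisymmetric N) m n d)" for m n d
   using subspace_piece by (auto simp: as_bisymmetric_def subspace_single_0)
  show "linear_on s s (bpiece (as_bisymmetric N) m n d) (bact (as_bisymmetric N) m n d sigma tau)"
   if "sigma permutes {..<m}" "tau permutes {..<n}" for m n d sigma tau
   using linear_act[OF that(2), of d] z[OF that(2), of d] by (auto simp: as_bisymmetric_def linear_on_def)
  show "bact (as_bisymmetric N) m n d sigma tau v \<in> bpiece (as_bisymmetric N) m n d"
   if "sigma permutes {..<m}" "tau permutes {..<n}" "v \<in> bpiece (as_bisymmetric N) m n d" for m n d sigma tau v
   using that act_closed[OF that(2)] z[OF that(2)] by (auto simp: as_bisymmetric_def split: if_splits)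
  show "bact (as_bisymmetric N) m n d id id v = v" if "v \<in> bpiece (as_bisymmetric N) m n d" for m n d v
   using that act_id in0 by (auto simp: as_bisymmetric_def split: if_splits)
  show "bact (as_bisymmetric N) m n d (sigma \<circ> sigma') (tau \<circ> tau') v =
    bact (as_bisymmetric N) m n d sigma' tau' (bact (as_bisymmetric N) m n d sigma tau v)"
   if "sigma permutes {..<m}" "sigma' permutes {..<m}" "tau permutes {..<n}" "tau' permutes {..<n}" "v \<in> bpiece (as_bisymmetric N) m n d"
   for m n d sigma sigma' tau tau' v
   using that(5) act_comp[OF that(3,4)] in0 by (auto simp: as_bisymmetric_def split: if_splits)
  show "finite_dim s (bpiece (as_bisymmetric N) k l d)" for k l d
   using fd by (auto simp: as_bisymmetric_def)
 qed
qed

lemma is_sym_char_ev: "is_sym_char s N f \<longleftrightarrow> f \<in> carrier sym_series & (\<forall>alpha beta d. alpha ~= 0 --> f (alpha, beta, d) = 0) &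
  (\<forall>q\<ge>1. \<forall>n d b r a. coef (ev r q a b (Ser f)) (0, n, d) = (-1) ^ d * sym_schur_trace s N n d q b)"
 by (simp add: is_sym_char_def coef_ev monomials_0 monomial_value_0)

lemma sym_char_as_bisymmetric:
 fixes s :: "'k::field_char_0 => 'v::ab_group_add => 'v"
 assumes N: "symmetric_sequence s N" and fin: "symmetric_finite_type s N"
 shows "sym_char s N = bisym_char s (as_bisymmetric N)"
proof -
 interpret letters s "as_bisymmetric N" by (rule letters_as_bisymmetric[OF assms])
 let ?f = "bisym_char s (as_bisymmetric N)"
 note char = is_bisym_char[unfolded is_bisym_char_ev]
 have "?f (alpha, beta, d) = 0" if "alpha ~= 0" for alpha beta d
 proof -
  have "bpiece (as_bisymmetric N) (mdeg alpha) (mdeg beta) d = {0}" using that by (simp add: as_bisymmetric_def)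
  from schur_trace_zero[OF this] have "coef (Ser ?f) (alpha, beta, d) = coef 0 (alpha, beta, d)"
   by (intro ev_injective) (use char in \<open>simp add: coef_ev[of _ _ _ _ 0]\<close>)
  then show ?thesis by simp
 qed
 moreover have "coef (ev r q a b (Ser ?f)) (0, n, d) = (-1) ^ d * sym_schur_trace s N n d q b" if "1 \<le> q" for q n d b r a
 proof -
  have p0: "perms 0 = {id}" by (auto simp: perms_def)
  have "sym_schur_trace s N n d q b = (1 / fact n) * (\<Sum>tau\<in>perms n. act_trace 0 n d id tau * fixed_word_sum n q tau b)"
  proof (rule sym_schur_trace_eq[OF N])
   show "has_trace s (spiece N n d) (sact N n d tau) (act_trace 0 n d id tau)" if "tau permutes {..<n}" for tau
    using has_trace_act[of id 0 tau n d] that by (simp add: as_bisymmetric_def permutes_id)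
  qed
  then have "bisym_schur_trace s (as_bisymmetric N) 0 n d 1 q a b = sym_schur_trace s N n d q b"
   by (simp add: trace_eq p0 fixed_word_sum_def)
  moreover have "coef (ev r q a b (Ser ?f)) (0, n, d) = coef (ev 1 q a b (Ser ?f)) (0, n, d)"
   by (simp add: coef_ev monomials_0 monomial_value_0)
  ultimately show ?thesis using char that by simp
 qed
 ultimately have is_char: "is_sym_char s N ?f" using char unfolding is_sym_char_ev by blast
 show ?thesis
  unfolding sym_char_def
 proof (rule the_equality[of "is_sym_char s N", OF is_char])
  fix f assume f: "is_sym_char s N f"
  show "f = ?f"
  proof
   fix x :: expo
   obtain alpha beta d where x: "x = (alpha, beta, d)" by (cases x)
   show "f x = ?f x"
   proof (cases "alpha = 0")
    case True
    have "coef (Ser f) (alpha, beta, d) = coef (Ser ?f) (alpha, beta, d)"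
     by (rule ev_injective) (use f is_char True in \<open>simp add: is_sym_char_ev\<close>)
    then show ?thesis by (simp add: x)
   next
    case False
    then show ?thesis using f is_char by (simp add: x is_sym_char_ev)
   qed
  qed
 qed
qed

section \<open>Words with two kinds of factors\<close>

lemma prod_lessThan_add: "(\<Prod>i<m + n. f i) = (\<Prod>i<m. f i) * (\<Prod>i<n. f (m + i) :: 'a::comm_monoid_mult)" for m n :: nat
 by (induction n) (simp_all add: mult_ac)

lemma sum_lessThan_add: "(\<Sum>i<m + n. f i) = (\<Sum>i<m. f i) + (\<Sum>i<n. f (m + i) :: 'a::comm_monoid_add)" for m n :: nat
 by (induction n) (simp_all add: add_ac)

lemma block_perm_comp:
 assumes "sigma' permutes {..<m}"
 shows "block_perm m (sigma \<circ> sigma') (tau \<circ> tau') = block_perm m sigma tau \<circ> block_perm m sigma' tau'"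
proof
 fix i
 have "sigma' i < m" if "i < m" using permutes_in_image[OF assms, of i] that by auto
 then show "block_perm m (sigma \<circ> sigma') (tau \<circ> tau') i = (block_perm m sigma tau \<circ> block_perm m sigma' tau') i"
  by (simp add: block_perm_def)
qed

lemma block_perm_id: "block_perm m id id = id"
 by (auto simp: block_perm_def)

lemma block_perm_permutes:
 assumes sigma: "sigma permutes {..<m}" and tau: "tau permutes {..<n}"
 shows "block_perm m sigma tau permutes {..<m + n}"
proof -
 have 1: "block_perm m (inv_into UNIV sigma) (inv_into UNIV tau) \<circ> block_perm m sigma tau = id"
  unfolding block_perm_comp[OF sigma, symmetric] by (simp add: permutes_inv_o[OF sigma] permutes_inv_o[OF tau] block_perm_id)
 have 2: "block_perm m sigma tau \<circ> block_perm m (inv_into UNIV sigma) (inv_into UNIV tau) = id"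
  unfolding block_perm_comp[OF permutes_inv[OF sigma], symmetric] by (simp add: permutes_inv_o[OF sigma] permutes_inv_o[OF tau] block_perm_id)
 have "bij (block_perm m sigma tau)" by (rule o_bij[OF 1 2])
 moreover have "block_perm m sigma tau i = i" if "i \<notin> {..<m + n}" for i
  using that permutes_not_in[OF tau, of "i - m"] by (simp add: block_perm_def)
 ultimately show ?thesis unfolding permutes_def bij_iff by blast
qed

lemma ksgn_alt: "ksgn rho m d = (\<Prod>j<m. \<Prod>i<j. if rho j < rho i then (-1) ^ (d (rho i) * d (rho j)) else 1)"
 by (induction m) (simp_all add: ksgn_def prod_pairs_Suc)

text \<open>
  A block permutation has no inversions between the two blocks.
\<close>

lemma ksgn_block:
 assumes sigma: "sigma permutes {..<m}" and tau: "tau permutes {..<n}"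
 shows "ksgn (block_perm m sigma tau) (m + n) d = (ksgn sigma m d * ksgn tau n (%i. d (m + i)) :: 'a::comm_ring_1)"
proof -
 let ?f = "%i j. if block_perm m sigma tau j < block_perm m sigma tau i then (-1) ^ (d (block_perm m sigma tau i) * d (block_perm m sigma tau j)) else 1 :: 'a"
 have lt: "sigma i < m" if "i < m" for i using permutes_in_image[OF sigma, of i] that by auto
 have "(\<Prod>i<m. ?f i (m + j)) = 1" for j
 proof (rule prod.neutral, rule ballI)
  fix i assume "i \<in> {..<m}"
  then show "?f i (m + j) = 1" using lt[of i] by (simp add: block_perm_def)
 qed
 moreover have bp: "block_perm m sigma tau (m + i) = m + tau i" for i by (simp add: block_perm_def)
 ultimately have "(\<Prod>j<n. \<Prod>i<m + j. ?f i (m + j)) = ksgn tau n (%i. d (m + i))"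
  unfolding ksgn_alt prod_lessThan_add by (simp add: bp cong: if_cong)
 moreover have "(\<Prod>j<m. \<Prod>i<j. ?f i j) = ksgn sigma m d"
  unfolding ksgn_alt by (intro prod.cong) (auto simp: block_perm_def)
 ultimately show ?thesis unfolding ksgn_alt[of _ "m + n"] prod_lessThan_add by simp
qed

lemma prod_smono: "(\<Prod>i<m. smono (f i) (g i)) = (smono (\<Sum>i<m. f i) (\<Prod>i<m. g i) :: ('i::fin_decomp, 'k::comm_ring_1) ser)" for m :: nat
 by (induction m) (simp_all add: mono_mult mono_0_1)

lemma letter_product:
 "ksgn sigma m (%i. letter_deg (E i)) * (\<Prod>i<m. (-1) ^ letter_deg (E i) * letter_ser s N a b 1 (E i) (E (sigma i))) =
  smono (\<Sum>i<m. fst (E i)) (ksgn sigma m (%i. letter_deg (E i)) *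
   ((-1) ^ (\<Sum>i<m. letter_deg (E i)) * (\<Prod>i<m. letter_mat s N a b 1 (E i) (E (sigma i)))))"
proof -
 have "(-1) ^ letter_deg (E i) * letter_ser s N a b 1 (E i) (E (sigma i)) =
   smono (fst (E i)) ((-1) ^ letter_deg (E i) * letter_mat s N a b 1 (E i) (E (sigma i)))" for i
  by (cases "fst (E i)") (simp add: letter_ser_def tri_mult_def neg_1_power_ser mono_mult)
 then show ?thesis
  unfolding ksgn_power neg_1_power_ser
  by (simp add: prod_smono mono_mult prod.distrib power_sum)
qed

text \<open>
  The words in the two kinds of letters are cut into their first \<open>m\<close> and last \<open>n\<close> letters, and each part is summed
  over cycles.
\<close>

lemma block_words:
 fixes s :: "'k::field_char_0 => 'v::ab_group_add => 'v" and k l d :: nat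
 assumes "letters s N1" "letters s N2" and sigma: "sigma \<in> perms m" and tau: "tau \<in> perms n"
 defines "K \<equiv> {..k} \<times> {..l} \<times> {..d}" and "Ns \<equiv> replicate m N1 @ replicate n N2" and "rho \<equiv> block_perm m sigma tau"
 shows "(-1) ^ d * (\<Sum>E\<in>Pi\<^sub>E {..<m + n} (%i. alphabet s (Ns ! i) r q K).
   if (\<Sum>i<m + n. fst (E i)) = (k, l, d) then koszul_sign rho (map (%i. letter_deg (E i)) [0..<m + n]) *
    (\<Prod>i<m + n. letter_mat s (Ns ! i) a b 1 (E i) (E (rho i))) else 0) =
  coef ((\<Prod>c\<in>#cyc m sigma. \<Sum>E\<in>alphabet s N1 r q K. (-1) ^ letter_deg E * letter_ser s N1 a b c E E) *
   (\<Prod>c\<in>#cyc n tau. \<Sum>E\<in>alphabet s N2 r q K. (-1) ^ letter_deg E * letter_ser s N2 a b c E E)) (k, l, d)"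
proof -
 have psigma: "sigma permutes {..<m}" and ptau: "tau permutes {..<n}" using sigma tau by (auto simp: perms_iff)
 have rho: "rho permutes {..<m + n}" unfolding rho_def by (rule block_perm_permutes[OF psigma ptau])
 have lt: "sigma i < m" if "i < m" for i using permutes_in_image[OF psigma, of i] that by auto
 have lt': "tau i < n" if "i < n" for i using permutes_in_image[OF ptau, of i] that by auto
 have finK: "finite K" by (simp add: K_def)
 let ?X1 = "alphabet s N1 r q K" and ?X2 = "alphabet s N2 r q K"
 let ?P1 = "{..<m} \<rightarrow>\<^sub>E ?X1" and ?P2 = "{..<n} \<rightarrow>\<^sub>E ?X2"
 let ?W1 = "%E. ksgn sigma m (%i. letter_deg (E i)) * ((-1) ^ (\<Sum>i<m. letter_deg (E i)) * (\<Prod>i<m. letter_mat s N1 a b 1 (E i) (E (sigma i))))"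
 let ?W2 = "%E. ksgn tau n (%i. letter_deg (E i)) * ((-1) ^ (\<Sum>i<n. letter_deg (E i)) * (\<Prod>i<n. letter_mat s N2 a b 1 (E i) (E (tau i))))"
 let ?F = "%E. if (\<Sum>i<m + n. fst (E i)) = (k, l, d) then koszul_sign rho (map (%i. letter_deg (E i)) [0..<m + n]) *
    (\<Prod>i<m + n. letter_mat s (Ns ! i) a b 1 (E i) (E (rho i))) else 0"
 define glue where "glue E1 E2 = (\<lambda>i\<in>{..<m + n}. if i < m then E1 i else E2 (i - m))" for E1 E2 :: "nat => 'v letter"
 have glue: "glue E1 E2 i = E1 i" if "i < m" for i E1 E2 using that by (simp add: glue_def)
 have glue': "glue E1 E2 (m + i) = E2 i" if "i < n" for i E1 E2 using that by (simp add: glue_def)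
 have Ns: "Ns ! i = N1" if "i < m" for i using that by (simp add: Ns_def nth_append)
 have Ns': "Ns ! (m + i) = N2" if "i < n" for i using that by (simp add: Ns_def nth_append)
 have A: "(\<Sum>E\<in>Pi\<^sub>E {..<m + n} (%i. alphabet s (Ns ! i) r q K). ?F E) = (\<Sum>(E1, E2)\<in>?P1 \<times> ?P2. ?F (glue E1 E2))"
 proof (rule sum.reindex_bij_witness[where i = "%(E1, E2). glue E1 E2" and j = "%E. (\<lambda>i\<in>{..<m}. E i, \<lambda>i\<in>{..<n}. E (m + i))"])
  fix E assume E: "E \<in> Pi\<^sub>E {..<m + n} (%i. alphabet s (Ns ! i) r q K)"
  have ext: "E i = undefined" if "\<not> i < m + n" for i using E that by (auto simp: PiE_def extensional_def)
  show g: "(case (\<lambda>i\<in>{..<m}. E i, \<lambda>i\<in>{..<n}. E (m + i)) of (E1, E2) => glue E1 E2) = E"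
   unfolding glue_def case_prod_conv by (rule HOL.ext) (simp add: restrict_def ext)
  have "E i \<in> ?X1" if "i < m" for i using PiE_mem[OF E, of i] Ns[OF that] that by simp
  moreover have "E (m + i) \<in> ?X2" if "i < n" for i using PiE_mem[OF E, of "m + i"] Ns'[OF that] that by simp
  ultimately show "(\<lambda>i\<in>{..<m}. E i, \<lambda>i\<in>{..<n}. E (m + i)) \<in> ?P1 \<times> ?P2" by auto
  show "(case (\<lambda>i\<in>{..<m}. E i, \<lambda>i\<in>{..<n}. E (m + i)) of (E1, E2) => ?F (glue E1 E2)) = ?F E"
   using g unfolding case_prod_conv by simp
 next
  fix w assume "w \<in> ?P1 \<times> ?P2"
  then obtain E1 E2 where w: "w = (E1, E2)" and E1: "E1 \<in> ?P1" and E2: "E2 \<in> ?P2" by auto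
  have ext: "E1 i = undefined" if "\<not> i < m" for i using E1 that by (auto simp: PiE_def extensional_def)
  have ext': "E2 i = undefined" if "\<not> i < n" for i using E2 that by (auto simp: PiE_def extensional_def)
  have "(\<lambda>i\<in>{..<m}. glue E1 E2 i) = E1" by (rule HOL.ext) (simp add: restrict_def glue ext)
  moreover have "(\<lambda>i\<in>{..<n}. glue E1 E2 (m + i)) = E2" by (rule HOL.ext) (simp add: restrict_def glue' ext')
  ultimately
  show "(\<lambda>i\<in>{..<m}. (case w of (E1, E2) => glue E1 E2) i, \<lambda>i\<in>{..<n}. (case w of (E1, E2) => glue E1 E2) (m + i)) = w"
   by (simp add: w)
  show "(case w of (E1, E2) => glue E1 E2) \<in> Pi\<^sub>E {..<m + n} (%i. alphabet s (Ns ! i) r q K)"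
   unfolding w case_prod_conv
  proof (rule PiE_I)
   fix i assume i: "i \<in> {..<m + n}"
   show "glue E1 E2 i \<in> alphabet s (Ns ! i) r q K"
   proof (cases "i < m")
    case True
    then show ?thesis using PiE_mem[OF E1, of i] by (simp add: glue Ns)
   next
    case False
    then obtain i' where "i = m + i'" "i' < n" using i by (metis add_diff_inverse_nat lessThan_iff nat_add_left_cancel_less)
    then show ?thesis using PiE_mem[OF E2, of i'] by (simp add: glue' Ns')
   qed
  qed (simp add: glue_def)
 qed
 have "(-1) ^ d * (\<Sum>E\<in>Pi\<^sub>E {..<m + n} (%i. alphabet s (Ns ! i) r q K). ?F E) = (\<Sum>(E1, E2)\<in>?P1 \<times> ?P2. coef (smono (\<Sum>i<m. fst (E1 i)) (?W1 E1) * smono (\<Sum>i<n. fst (E2 i)) (?W2 E2)) (k, l, d))"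
  unfolding A sum_distrib_left
 proof (rule sum.cong[OF refl], clarify)
  fix E1 E2
  let ?E = "glue E1 E2"
  have s: "(\<Sum>i<m + n. fst (?E i)) = (\<Sum>i<m. fst (E1 i)) + (\<Sum>i<n. fst (E2 i))"
   by (simp add: sum_lessThan_add glue glue')
  have k: "koszul_sign rho (map (%i. letter_deg (?E i)) [0..<m + n]) =
   (ksgn sigma m (%i. letter_deg (E1 i)) * ksgn tau n (%i. letter_deg (E2 i)) :: 'k)"
   unfolding koszul_sign_ksgn[OF rho] unfolding rho_def ksgn_block[OF psigma ptau]
   by (intro arg_cong2[of _ _ _ _ "(*)"] ksgn_cong psigma ptau) (auto simp: glue glue')
  have p: "(\<Prod>i<m + n. letter_mat s (Ns ! i) a b 1 (?E i) (?E (rho i))) =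
   (\<Prod>i<m. letter_mat s N1 a b 1 (E1 i) (E1 (sigma i))) * (\<Prod>i<n. letter_mat s N2 a b 1 (E2 i) (E2 (tau i)))"
   unfolding prod_lessThan_add using lt lt'
   by (intro arg_cong2[of _ _ _ _ "(*)"] prod.cong refl) (auto simp: glue glue' Ns Ns' rho_def block_perm_def)
  have d: "(\<Sum>i<m. letter_deg (E1 i)) + (\<Sum>i<n. letter_deg (E2 i)) = d"
   if "(\<Sum>i<m. fst (E1 i)) + (\<Sum>i<n. fst (E2 i)) = (k, l, d)"
  proof -
   have *: "snd (snd (sum f I)) = (\<Sum>i\<in>I. snd (snd (f i)))" for f :: "nat => nat \<times> nat \<times> nat" and I
    by (induction I rule: infinite_finite_induct) auto
   show ?thesis using arg_cong[OF that, of "%x. snd (snd x)"] by (simp add: *)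
  qed
  show "(-1) ^ d * ?F ?E = coef (smono (\<Sum>i<m. fst (E1 i)) (?W1 E1) * smono (\<Sum>i<n. fst (E2 i)) (?W2 E2)) (k, l, d)"
  proof (cases "(\<Sum>i<m. fst (E1 i)) + (\<Sum>i<n. fst (E2 i)) = (k, l, d)")
   case True
   have "((-1) ^ d :: 'k) = (-1) ^ (\<Sum>i<m. letter_deg (E1 i)) * (-1) ^ (\<Sum>i<n. letter_deg (E2 i))"
    unfolding d[OF True, symmetric] by (rule power_add)
   then show ?thesis unfolding s k p mono_mult coef_mono using True by (simp add: mult_ac)
  next
   case False
   then show ?thesis unfolding s mono_mult coef_mono by auto
  qed
 qed
 also have "... = coef ((\<Sum>E\<in>?P1. smono (\<Sum>i<m. fst (E i)) (?W1 E)) * (\<Sum>E\<in>?P2. smono (\<Sum>i<n. fst (E i)) (?W2 E))) (k, l, d)"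
  by (simp only: sum_product sum.cartesian_product coef_sum split_def)
 also have "... = coef ((\<Prod>c\<in>#cyc m sigma. \<Sum>E\<in>?X1. (-1) ^ letter_deg E * letter_ser s N1 a b c E E) *
   (\<Prod>c\<in>#cyc n tau. \<Sum>E\<in>?X2. (-1) ^ letter_deg E * letter_ser s N2 a b c E E)) (k, l, d)"
  unfolding letters.letter_cycles[OF assms(1) finK sigma, symmetric] letters.letter_cycles[OF assms(2) finK tau, symmetric] letter_product ..
 finally show ?thesis .
qed

section \<open>The relative composition product\<close>

text \<open>
  The trace of an operator on a direct summand, extended by zero.
\<close>

lemma has_trace_embed:
 assumes "subsp s X" and t: "vector_space t" and iota: "iota \<in> lin_maps s X t Y" and \<pi>: "\<pi> \<in> lin_maps t Y s X"
  and \<pi>iota: "!!x. x \<in> X ==> \<pi> (iota x) = x" and T: "has_trace s X T c"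
 shows "has_trace t Y (%y. iota (T (\<pi> y))) c"
proof -
 obtain n :: nat and phi v where *: "!!i. i < n ==> linear_on s (*) X (phi i)" "!!i. i < n ==> v i \<in> X"
  "!!x. x \<in> X ==> T x = (\<Sum>i<n. s (phi i x) (v i))" "c = (\<Sum>i<n. phi i (v i))"
  using T by (rule has_traceE) blast
 show ?thesis
 proof (rule has_traceI[of "{..<n}" t Y "%i y. phi i (\<pi> y)" "%i. iota (v i)"])
  show "linear_on t (*) Y (%y. phi i (\<pi> y))" if "i \<in> {..<n}" for i
   using that by (intro linear_on_comp[OF \<pi>] *(1)) simp
  show "iota (v i) \<in> Y" if "i \<in> {..<n}" for i using that *(2) lin_mapsD(2)[OF iota] by simp
  show "iota (T (\<pi> y)) = (\<Sum>i<n. t (phi i (\<pi> y)) (iota (v i)))" if "y \<in> Y" for y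
   using linear_on_lincomb[OF assms(1) t lin_mapsD(1)[OF iota], of "{..<n}" v "%i. phi i (\<pi> y)"]
    *(3)[OF lin_mapsD(2)[OF \<pi> that]] *(2) by simp
 qed (simp_all add: *(4) \<pi>iota *(2))
qed

locale rel_composition =
 fixes sM :: "'k::field_char_0 => 'u::ab_group_add => 'u" and M :: "'u bisymmetric_seq"
  and sN :: "'k => 'v::ab_group_add => 'v" and Nb :: "'v bisymmetric_seq" and N :: "'v symmetric_seq"
 assumes M: "letters sM M" and Nb: "letters sN Nb" and Nt: "letters sN (as_bisymmetric N)"
  and Nb_0: "bpiece Nb 0 0 0 = {0}" and N_0: "spiece N 0 0 = {0}"
begin

sublocale M: letters sM M by (rule M)
sublocale Nb: letters sN Nb by (rule Nb)
sublocale Nt: letters sN "as_bisymmetric N" by (rule Nt)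

abbreviation "Ns m n \<equiv> rel_factors Nb N m n"

lemma length_Ns [simp]: "length (Ns m n) = m + n" by (simp add: rel_factors_def)

lemma Ns_nth: "i < m + n ==> Ns m n ! i = (if i < m then Nb else as_bisymmetric N)"
 by (simp add: rel_factors_def nth_append)

lemma factors: "factor_list sN (Ns m n)"
proof (rule factor_list.intro)
 show "vector_space sN" by (rule Nb.vector_space_axioms)
 show "bisymmetric_sequence sN (Ns m n ! i)" if "i < length (Ns m n)" for i
  using that Nb.bisymmetric_sequence_axioms Nt.bisymmetric_sequence_axioms by (simp add: Ns_nth)
qed

abbreviation "Y m n k l j \<equiv> bpiece (bisym_tensor sN (Ns m n)) k l j"
abbreviation "Yact m n k l j \<equiv> bact (bisym_tensor sN (Ns m n)) k l j"
abbreviation "X k l m n i j \<equiv> tensor2 sM (bpiece M m n i) day_scale (Y m n k l j)"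
abbreviation "map_X k l m n i j \<equiv> map_tensor2 sM (bpiece M m n i) day_scale (Y m n k l j)"

definition perm_X :: "nat => nat => nat => nat => nat => nat => (nat => nat) \<times> (nat => nat) => ('k, 'u, ('k, 'v) day) tensor2 => ('k, 'u, ('k, 'v) day) tensor2" where
 "perm_X k l m n i j g = map_X k l m n i j (bact M m n i (fst g) (snd g))
   (permute_factors sN (Ns m n) k l (block_perm m (fst g) (snd g)))"

definition op_X :: "nat => nat => nat => nat => nat => nat => (nat => nat) => (nat => nat) => ('k, 'u, ('k, 'v) day) tensor2 => ('k, 'u, ('k, 'v) day) tensor2" where
 "op_X k l m n i j g g' = map_X k l m n i j id (Yact m n k l j g g')"

abbreviation "C k l m n i j \<equiv> rel_comp_component sM M sN Nb N k l m n i j"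

lemma component: "C k l m n i j = {zeta \<in> X k l m n i j. \<forall>g\<in>perms m \<times> perms n. perm_X k l m n i j g zeta = zeta}"
 by (auto simp: rel_comp_component_def Let_def perm_X_def perms_iff)

lemma perm_factors:
 assumes "g \<in> perms m \<times> perms n"
 shows "factor_list.permutes_factors (Ns m n) (block_perm m (fst g) (snd g))"
proof -
 interpret F: factor_list sN "Ns m n" by (rule factors)
 have p: "fst g permutes {..<m}" "snd g permutes {..<n}" using assms by (auto simp: perms_iff)
 have "Ns m n ! block_perm m (fst g) (snd g) i = Ns m n ! i" if i: "i < m + n" for i
 proof -
  have "block_perm m (fst g) (snd g) i < m + n"
   using permutes_in_image[OF block_perm_permutes[OF p], of i] i by simp
  moreover have "block_perm m (fst g) (snd g) i < m \<longleftrightarrow> i < m"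
   using permutes_in_image[OF p(1), of i] by (simp add: block_perm_def)
  ultimately show ?thesis using i by (simp add: Ns_nth)
 qed
 then show ?thesis using block_perm_permutes[OF p] by (simp add: F.permutes_factors_def)
qed

lemma subsp_Y: "subsp day_scale (Y m n k l j)"
proof -
 interpret F: factor_list sN "Ns m n" by (rule factors)
 show ?thesis by (rule F.subsp_Y)
qed

lemma perm_lin:
 assumes "g \<in> perms m \<times> perms n"
 shows "bact M m n i (fst g) (snd g) \<in> lin_maps sM (bpiece M m n i) sM (bpiece M m n i)"
  "permute_factors sN (Ns m n) k l (block_perm m (fst g) (snd g)) \<in> lin_maps day_scale (Y m n k l j) day_scale (Y m n k l j)"
proof -
 interpret F: factor_list sN "Ns m n" by (rule factors)
 show "bact M m n i (fst g) (snd g) \<in> lin_maps sM (bpiece M m n i) sM (bpiece M m n i)"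
  using assms by (intro M.bact_lin) (auto simp: perms_iff)
 show "permute_factors sN (Ns m n) k l (block_perm m (fst g) (snd g)) \<in> lin_maps day_scale (Y m n k l j) day_scale (Y m n k l j)"
  by (rule F.permute_factors_lin_maps[OF perm_factors[OF assms]])
qed

lemma Yact_lin:
 assumes "g permutes {..<k}" "g' permutes {..<l}"
 shows "Yact m n k l j g g' \<in> lin_maps day_scale (Y m n k l j) day_scale (Y m n k l j)"
proof -
 interpret F: factor_list sN "Ns m n" by (rule factors)
 show ?thesis by (rule F.bact_lin_maps[OF assms])
qed

lemma perm_X_lin: "g \<in> perms m \<times> perms n ==> perm_X k l m n i j g \<in> lin_maps fscale (X k l m n i j) fscale (X k l m n i j)"
 unfolding perm_X_def by (intro map_tensor2_lin_maps perm_lin)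

lemma op_X_lin: "g permutes {..<k} ==> g' permutes {..<l} ==> op_X k l m n i j g g' \<in> lin_maps fscale (X k l m n i j) fscale (X k l m n i j)"
 unfolding op_X_def by (intro map_tensor2_lin_maps lin_maps_id Yact_lin)

lemma perm_X_comp:
 assumes g: "g \<in> perms m \<times> perms n" and h: "h \<in> perms m \<times> perms n" and x: "x \<in> X k l m n i j"
 shows "perm_X k l m n i j g (perm_X k l m n i j h x) = perm_X k l m n i j (fst h \<circ> fst g, snd h \<circ> snd g) x"
proof -
 interpret F: factor_list sN "Ns m n" by (rule factors)
 have p: "fst g permutes {..<m}" "snd g permutes {..<n}" "fst h permutes {..<m}" "snd h permutes {..<n}"
  using g h by (auto simp: perms_iff)
 have hg: "(fst h \<circ> fst g, snd h \<circ> snd g) \<in> perms m \<times> perms n"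
  using p by (simp add: perms_iff permutes_compose)
 show ?thesis
  unfolding perm_X_def map_tensor2_comp[OF perm_lin[OF g]]
 proof (rule map_tensor2_cong[OF _ _ _ _ _ _ x])
  show "bact M m n i (fst g) (snd g) (bact M m n i (fst h) (snd h) v) =
    bact M m n i (fst (fst h \<circ> fst g, snd h \<circ> snd g)) (snd (fst h \<circ> fst g, snd h \<circ> snd g)) v" if "v \<in> bpiece M m n i" for v
   using M.act_comp[OF p(3,1,4,2) that] by simp
  show "permute_factors sN (Ns m n) k l (block_perm m (fst g) (snd g)) (permute_factors sN (Ns m n) k l (block_perm m (fst h) (snd h)) xi) =
    permute_factors sN (Ns m n) k l (block_perm m (fst (fst h \<circ> fst g, snd h \<circ> snd g)) (snd (fst h \<circ> fst g, snd h \<circ> snd g))) xi"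
   if "xi \<in> Y m n k l j" for xi
   using F.permute_factors_comp[OF perm_factors[OF h] perm_factors[OF g] that] by (simp add: block_perm_comp[OF p(1)])
 qed (intro lin_maps_comp[OF perm_lin(1)[OF h] perm_lin(1)[OF g]] lin_maps_comp[OF perm_lin(2)[OF h] perm_lin(2)[OF g]] perm_lin[OF hg])+
qed

lemma perm_X_op:
 assumes g: "g \<in> perms m \<times> perms n" and h: "h permutes {..<k}" "h' permutes {..<l}" and x: "x \<in> X k l m n i j"
 shows "perm_X k l m n i j g (op_X k l m n i j h h' x) = op_X k l m n i j h h' (perm_X k l m n i j g x)"
proof -
 interpret F: factor_list sN "Ns m n" by (rule factors)
 show ?thesis
  unfolding perm_X_def op_X_def map_tensor2_comp[OF perm_lin[OF g]] map_tensor2_comp[OF lin_maps_id(1) Yact_lin[OF h]]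
 proof (rule map_tensor2_cong[OF _ _ _ _ _ _ x])
  show "permute_factors sN (Ns m n) k l (block_perm m (fst g) (snd g)) (Yact m n k l j h h' xi) =
    Yact m n k l j h h' (permute_factors sN (Ns m n) k l (block_perm m (fst g) (snd g)) xi)" if "xi \<in> Y m n k l j" for xi
   by (rule F.bact_permute_factors[OF perm_factors[OF g] h that, symmetric])
 qed (intro lin_maps_comp[OF lin_maps_id(1) perm_lin(1)[OF g]] lin_maps_comp[OF perm_lin(1)[OF g] lin_maps_id(1)]
   lin_maps_comp[OF Yact_lin[OF h] perm_lin(2)[OF g]] lin_maps_comp[OF perm_lin(2)[OF g] Yact_lin[OF h]] | simp)+
qed

text \<open>
  The trace on the invariants is the average of the traces on the tensor product. There, the trace is the product of the
  traces of the two factors.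
\<close>

lemma has_trace_component:
 assumes h: "h permutes {..<k}" "h' permutes {..<l}"
 shows "has_trace fscale (C k l m n i j) (op_X k l m n i j h h') ((1 / (fact m * fact n)) *
  (\<Sum>g\<in>perms m \<times> perms n. M.act_trace m n i (fst g) (snd g) *
   factor_list.day_trace sN (Ns m n) (block_perm m (fst g) (snd g)) k l j h h'))"
proof -
 interpret F: factor_list sN "Ns m n" by (rule factors)
 let ?G = "perms m \<times> perms n"
 have fin: F.fin_pieces unfolding F.fin_pieces_def using Nb.fin Nt.fin by (simp add: Ns_nth)
 have "has_trace fscale {zeta \<in> X k l m n i j. \<forall>g\<in>?G. perm_X k l m n i j g zeta = zeta} (op_X k l m n i j h h')
  ((1 / of_nat (card ?G)) * (\<Sum>g\<in>?G. M.act_trace m n i (fst g) (snd g) * F.day_trace (block_perm m (fst g) (snd g)) k l j h h'))"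
 proof (rule has_trace_invariants[OF subsp_tensor2])
  fix g x assume g: "g \<in> ?G" and x: "x \<in> X k l m n i j"
  have p: "fst g permutes {..<m}" "snd g permutes {..<n}" using g by (auto simp: perms_iff)
  have "(\<Sum>f\<in>?G. perm_X k l m n i j g (perm_X k l m n i j f x)) = (\<Sum>f\<in>?G. perm_X k l m n i j (fst f \<circ> fst g, snd f \<circ> snd g) x)"
   by (intro sum.cong refl) (rule perm_X_comp[OF g _ x])
  also have "... = (\<Sum>f\<in>?G. perm_X k l m n i j f x)"
   by (rule sum.reindex_bij_witness[where i = "%f. (fst f \<circ> inv_into UNIV (fst g), snd f \<circ> inv_into UNIV (snd g))"
      and j = "%f. (fst f \<circ> fst g, snd f \<circ> snd g)"])
    (use p in \<open>auto simp: perms_iff permutes_compose permutes_inv comp_assoc permutes_inv_o\<close>)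
  finally show "(\<Sum>f\<in>?G. perm_X k l m n i j g (perm_X k l m n i j f x)) = (\<Sum>f\<in>?G. perm_X k l m n i j f x)" .
  show "perm_X k l m n i j g (op_X k l m n i j h h' x) = op_X k l m n i j h h' (perm_X k l m n i j g x)"
   by (rule perm_X_op[OF g h x])
 next
  fix g assume g: "g \<in> ?G"
  have p: "fst g permutes {..<m}" "snd g permutes {..<n}" using g by (auto simp: perms_iff)
  have tr: "has_trace fscale (X k l m n i j)
   (map_X k l m n i j (%v. id (bact M m n i (fst g) (snd g) v))
    (%xi. Yact m n k l j h h' (permute_factors sN (Ns m n) k l (block_perm m (fst g) (snd g)) xi)))
   (M.act_trace m n i (fst g) (snd g) * F.day_trace (block_perm m (fst g) (snd g)) k l j h h')"
  proof (rule has_trace_tensor2[OF M.subsp_piece subsp_Y])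
   show "(%v. id (bact M m n i (fst g) (snd g) v)) \<in> lin_maps sM (bpiece M m n i) sM (bpiece M m n i)"
    by (rule lin_maps_comp[OF perm_lin(1)[OF g] lin_maps_id(1)])
   show "has_trace sM (bpiece M m n i) (%v. id (bact M m n i (fst g) (snd g) v)) (M.act_trace m n i (fst g) (snd g))"
    using M.has_trace_act[OF p] by simp
   show "(%xi. Yact m n k l j h h' (permute_factors sN (Ns m n) k l (block_perm m (fst g) (snd g)) xi)) \<in> lin_maps day_scale (Y m n k l j) day_scale (Y m n k l j)"
    by (rule lin_maps_comp[OF perm_lin(2)[OF g] Yact_lin[OF h]])
   show "has_trace day_scale (Y m n k l j) (%xi. Yact m n k l j h h' (permute_factors sN (Ns m n) k l (block_perm m (fst g) (snd g)) xi))
    (F.day_trace (block_perm m (fst g) (snd g)) k l j h h')"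
    unfolding F.day_trace_def by (rule F.has_trace_day[OF fin perm_factors[OF g] h])
  qed
  show "has_trace fscale (X k l m n i j) (%x. op_X k l m n i j h h' (perm_X k l m n i j g x))
   (M.act_trace m n i (fst g) (snd g) * F.day_trace (block_perm m (fst g) (snd g)) k l j h h')"
   using tr unfolding op_X_def perm_X_def map_tensor2_comp[OF lin_maps_id(1) Yact_lin[OF h]] .
 qed (auto simp: card_cartesian_product perm_X_lin op_X_lin[OF h])
 then show ?thesis by (simp add: component card_cartesian_product)
qed

text \<open>
  As \<open>Nb(0, 0)\<close> and \<open>N(0)\<close> vanish in degree zero, every factor contributes at least one to the sum of the biarity
  and the degree. Hence only finitely many components are non-zero in a given biarity and degree.
\<close>

lemma component_0:
 assumes "k + l + j < m + n"
 shows "C k l m n i j \<subseteq> {0}"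
proof -
 interpret F: factor_list sN "Ns m n" by (rule factors)
 have zero: "xi = 0" if xi: "xi \<in> Y m n k l j" for xi
 proof
  fix z
  show "xi z = 0 z"
  proof (cases "z \<in> F.Z k l j")
   case False
   then show ?thesis using F.YD(3)[OF xi] by simp
  next
   case True
   obtain ks ls ds b c where z: "z = (ks, ls, ds, b, c)" by (cases z)
   have len: "length ks = m + n" "length ls = m + n" "length ds = m + n"
    and sums: "sum_list ks = k" "sum_list ls = l" "sum_list ds = j"
    using True by (auto simp: z day_indices_deg_iff)
   have "\<exists>a<m + n. ks ! a = 0 & ls ! a = 0 & ds ! a = 0"
   proof (rule ccontr)
    assume "\<not> ?thesis"
    then have "1 \<le> ks ! a + ls ! a + ds ! a" if "a < m + n" for a
     using that by (metis add_is_0 less_one not_le)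
    then have "(\<Sum>a<m + n. 1) \<le> (\<Sum>a<m + n. ks ! a + ls ! a + ds ! a)" by (intro sum_mono) simp
    also have "... = k + l + j"
     using sums len by (simp add: sum_list_sum_nth sum.distrib atLeast0LessThan)
    finally show False using assms by simp
   qed
   then obtain a where a: "a < m + n" "ks ! a = 0" "ls ! a = 0" "ds ! a = 0" by blast
   have sp: "F.spaces z ! a = {0}"
    using a Nb_0 N_0 by (simp add: z F.spaces_nth Ns_nth as_bisymmetric_def)
   have "pure sN (F.spaces z) vs = 0" if vs: "vs \<in> listset (F.spaces z)" for vs
   proof
    fix phi
    have len': "length vs = m + n" and va: "vs ! a = 0"
     using vs a(1) sp by (auto simp: listset_iff)
    show "pure sN (F.spaces z) vs phi = 0 phi"
    proof (cases "multilinear_on sN (F.spaces z) phi")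
     case m: True
     have "linear_on sN (*) {0} (%x. phi (vs[a := x]))"
      using m vs a(1) sp unfolding multilinear_on_def by (metis F.length_spaces length_Ns)
     moreover have "subsp sN {0}" using Nb.subsp_piece[of 0 0 0] Nb_0 by simp
     ultimately have "phi (vs[a := 0]) = 0" using linear_on_0[OF _ vector_space_mult] by blast
     moreover have "vs[a := 0] = vs" using va a(1) len' by (metis list_update_id)
     ultimately show ?thesis by (simp add: pure_def)
    qed (simp add: pure_def)
   qed
   then have "pure sN (F.spaces z) ` listset (F.spaces z) \<subseteq> {0}" by blast
   then have "tensor sN (F.spaces z) \<subseteq> {0}"
    unfolding tensor_def
    by (rule module.span_minimal[OF vs_module[OF vector_space_fscale]])
     (rule module.subspace_single_0[OF vs_module[OF vector_space_fscale]])
   then show ?thesis using F.YD(1)[OF xi True] by auto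
  qed
 qed
 have "pure2 sM (bpiece M m n i) day_scale (Y m n k l j) x y = 0" if x: "x \<in> bpiece M m n i" and y: "y \<in> Y m n k l j" for x y
 proof
  fix phi
  have "phi x y = 0" if "bilinear_on sM (bpiece M m n i) day_scale (Y m n k l j) phi"
   using linear_on_0[OF subsp_Y[of m n k l j] vector_space_mult, of "phi x"] that x zero[OF y] by (simp add: bilinear_on_def)
  then show "pure2 sM (bpiece M m n i) day_scale (Y m n k l j) x y phi = 0 phi" by (simp add: pure2_def)
 qed
 then have "{pure2 sM (bpiece M m n i) day_scale (Y m n k l j) x y |x y. x \<in> bpiece M m n i & y \<in> Y m n k l j} \<subseteq> {0}" by blast
 then have "X k l m n i j \<subseteq> {0}"
  unfolding tensor2_def
  by (rule module.span_minimal[OF vs_module[OF vector_space_fscale]])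
   (rule module.subspace_single_0[OF vs_module[OF vector_space_fscale]])
 then show ?thesis unfolding component by blast
qed

abbreviation "RC \<equiv> rel_comp sM M sN Nb N"

lemma rel_comp_piece: "omega \<in> bpiece RC k l d \<longleftrightarrow> finite {q. omega q ~= 0} &
  (\<forall>m n i j. if i + j = d then omega (m, n, i, j) \<in> C k l m n i j else omega (m, n, i, j) = 0)"
 by (simp add: rel_comp_def)

lemma rel_comp_act: "bact RC k l d g g' omega (m, n, i, j) = op_X k l m n i j g g' (omega (m, n, i, j))"
 by (simp add: rel_comp_def Let_def op_X_def)

lemma vs_rel: "vector_space (rel_comp_scale :: 'k => ('k, 'u, 'v) rel_comp => _)"
 unfolding rel_comp_scale_def[abs_def] by (rule vector_space_pscale[OF vector_space_fscale])

lemma op_X_0: "op_X k l m n i j g g' 0 = 0"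
 by (auto simp: op_X_def map_tensor2_def fun_eq_iff)

lemma subsp_component: "subsp fscale (C k l m n i j)"
proof -
 have "0 \<in> C k l m n i j"
  unfolding component
  using subsp_0[OF subsp_tensor2] linear_on_0[OF subsp_tensor2 vector_space_fscale lin_mapsD(1)[OF perm_X_lin]] by blast
 moreover have "x + y \<in> C k l m n i j" if "x \<in> C k l m n i j" "y \<in> C k l m n i j" for x y
  using that lin_mapsD(1)[OF perm_X_lin[of _ m n k l i j]] subsp_add[OF subsp_tensor2]
  unfolding component linear_on_def by fastforce
 moreover have "fscale c x \<in> C k l m n i j" if "x \<in> C k l m n i j" for c x
  using that lin_mapsD(1)[OF perm_X_lin[of _ m n k l i j]] subsp_scale[OF subsp_tensor2]
  unfolding component linear_on_def by fastforce
 ultimately show ?thesis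
  using vector_space_fscale by (auto simp: module.subspace_def[OF vs_module[OF vector_space_fscale]])
qed

lemma op_X_component:
 assumes g: "g permutes {..<k}" "g' permutes {..<l}" and x: "x \<in> C k l m n i j"
 shows "op_X k l m n i j g g' x \<in> C k l m n i j"
proof -
 have xX: "x \<in> X k l m n i j" and inv: "!!h. h \<in> perms m \<times> perms n ==> perm_X k l m n i j h x = x"
  using x by (auto simp: component)
 show ?thesis
  unfolding component
  using lin_mapsD(2)[OF op_X_lin[OF g] xX] perm_X_op[OF _ g xX] inv by simp
qed

lemma subsp_rel_comp: "subsp rel_comp_scale (bpiece RC k l d)"
proof -
 have "0 \<in> bpiece RC k l d" unfolding rel_comp_piece using subsp_0[OF subsp_component] by auto
 moreover have "omega + omega' \<in> bpiece RC k l d" if omega: "omega \<in> bpiece RC k l d" "omega' \<in> bpiece RC k l d" for omega omega'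
 proof -
  have "finite {q. (omega + omega') q ~= 0}"
   by (rule finite_subset[of _ "{q. omega q ~= 0} \<union> {q. omega' q ~= 0}"]) (use omega in \<open>auto simp: rel_comp_piece\<close>)
  moreover have "if i + j = d then (omega + omega') (m, n, i, j) \<in> C k l m n i j else (omega + omega') (m, n, i, j) = 0" for m n i j
   using omega subsp_add[OF subsp_component] by (auto simp: rel_comp_piece)
  ultimately show ?thesis unfolding rel_comp_piece by blast
 qed
 moreover have "rel_comp_scale c omega \<in> bpiece RC k l d" if omega: "omega \<in> bpiece RC k l d" for c omega
 proof -
  have z: "fscale c 0 = (0 :: ('k, 'u, ('k, 'v) day) tensor2)" by (auto simp: pscale_def fun_eq_iff)
  have "finite {q. rel_comp_scale c omega q ~= 0}"
   by (rule finite_subset[of _ "{q. omega q ~= 0}"]) (use omega z in \<open>auto simp: rel_comp_piece rel_comp_scale_def pscale_def[of fscale]\<close>)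
  moreover have "if i + j = d then rel_comp_scale c omega (m, n, i, j) \<in> C k l m n i j else rel_comp_scale c omega (m, n, i, j) = 0" for m n i j
   using omega subsp_scale[OF subsp_component] z by (auto simp: rel_comp_piece rel_comp_scale_def pscale_def[of fscale])
  ultimately show ?thesis unfolding rel_comp_piece by blast
 qed
 ultimately show ?thesis
  using vs_rel by (auto simp: module.subspace_def[OF vs_module[OF vs_rel]])
qed

lemma rel_comp_act_in:
 assumes g: "g permutes {..<k}" "g' permutes {..<l}" and omega: "omega \<in> bpiece RC k l d"
 shows "bact RC k l d g g' omega \<in> bpiece RC k l d"
proof -
 have "finite {q. bact RC k l d g g' omega q ~= 0}"
  by (rule finite_subset[of _ "{q. omega q ~= 0}"]) (use omega op_X_0 in \<open>auto simp: rel_comp_piece rel_comp_act\<close>)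
 moreover have "if i + j = d then bact RC k l d g g' omega (m, n, i, j) \<in> C k l m n i j else bact RC k l d g g' omega (m, n, i, j) = 0" for m n i j
  using omega op_X_component[OF g] op_X_0 by (auto simp: rel_comp_piece rel_comp_act)
 ultimately show ?thesis unfolding rel_comp_piece by blast
qed

lemma rel_comp_component_X:
 assumes "omega \<in> bpiece RC k l d"
 shows "omega (m, n, i, j) \<in> X k l m n i j"
proof (cases "i + j = d")
 case True
 then have "omega (m, n, i, j) \<in> C k l m n i j" using assms unfolding rel_comp_piece by metis
 then show ?thesis by (simp add: component)
next
 case False
 then have "omega (m, n, i, j) = 0" using assms unfolding rel_comp_piece by metis
 then show ?thesis using subsp_0[OF subsp_tensor2] by simp
qed

lemma bisymmetric_rel_comp: "bisymmetric_sequence rel_comp_scale RC"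
proof (intro bisymmetric_sequence.intro bisymmetric_sequence_axioms.intro vs_rel)
 show "module.subspace rel_comp_scale (bpiece RC m n d)" for m n d using subsp_rel_comp by blast
 fix k l d and g g' :: "nat => nat"
 assume g: "g permutes {..<k}" "g' permutes {..<l}"
 have "op_X k l m n i j g g' (x + y) = op_X k l m n i j g g' x + op_X k l m n i j g g' y"
  "op_X k l m n i j g g' (fscale c x) = fscale c (op_X k l m n i j g g' x)" for m n i j x y c
  using linear_on_map_tensor2[of UNIV] unfolding op_X_def linear_on_def by blast+
 then show "linear_on rel_comp_scale rel_comp_scale (bpiece RC k l d) (bact RC k l d g g')"
  unfolding linear_on_def by (auto simp: fun_eq_iff[of "bact _ _ _ _ _ _ _"] rel_comp_act rel_comp_scale_def pscale_def[of fscale])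
 show "bact RC k l d g g' omega \<in> bpiece RC k l d" if "omega \<in> bpiece RC k l d" for omega
  by (rule rel_comp_act_in[OF g that])
next
 fix k l d omega assume omega: "omega \<in> bpiece RC k l d"
 have "op_X k l m n i j id id x = x" if x: "x \<in> X k l m n i j" for m n i j x
 proof -
  interpret F: factor_list sN "Ns m n" by (rule factors)
  have "op_X k l m n i j id id x = map_X k l m n i j (%x. x) (%y. y) x"
   unfolding op_X_def
   by (rule map_tensor2_cong[OF lin_maps_id(1) Yact_lin lin_maps_id(2) lin_maps_id(2) _ _ x])
    (auto simp: F.bact_id permutes_id)
  then show ?thesis by (simp add: map_tensor2_id[OF x])
 qed
 then show "bact RC k l d id id omega = omega"
  using rel_comp_component_X[OF omega] by (auto simp: fun_eq_iff[of "bact _ _ _ _ _ _ _"] rel_comp_act)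
next
 fix k l d omega and f g f' g' :: "nat => nat"
 assume p: "f permutes {..<k}" "g permutes {..<k}" "f' permutes {..<l}" "g' permutes {..<l}" and omega: "omega \<in> bpiece RC k l d"
 have "op_X k l m n i j (f \<circ> g) (f' \<circ> g') x = op_X k l m n i j g g' (op_X k l m n i j f f' x)" if x: "x \<in> X k l m n i j" for m n i j x
 proof -
  interpret F: factor_list sN "Ns m n" by (rule factors)
  show ?thesis
   unfolding op_X_def map_tensor2_comp[OF lin_maps_id(1) Yact_lin[OF p(2,4)]]
   by (rule map_tensor2_cong[OF lin_maps_id(1) Yact_lin lin_maps_comp[OF lin_maps_id(1) lin_maps_id(1)]
      lin_maps_comp[OF Yact_lin[OF p(1,3)] Yact_lin[OF p(2,4)]] _ _ x])
    (auto simp: F.bact_comp[OF p(2,4,1,3)] permutes_compose p)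
 qed
 then show "bact RC k l d (f \<circ> g) (f' \<circ> g') omega = bact RC k l d g g' (bact RC k l d f f' omega)"
  using rel_comp_component_X[OF omega] by (auto simp: fun_eq_iff[of "bact _ _ _ _ _ _ _"] rel_comp_act)
qed

definition support :: "nat => nat => nat => (nat \<times> nat \<times> nat \<times> nat) set" where
 "support k l d = {(m, n, i, j). i + j = d & m + n + i \<le> k + l + d}"

lemma finite_support: "finite (support k l d)"
 by (rule finite_subset[of _ "{..k+l+d} \<times> {..k+l+d} \<times> {..d} \<times> {..d}"]) (auto simp: support_def)

definition component_trace :: "nat => nat => (nat => nat) => (nat => nat) => nat \<times> nat \<times> nat \<times> nat => 'k" where
 "component_trace k l h h' = (%(m, n, i, j). (1 / (fact m * fact n)) *
  (\<Sum>g\<in>perms m \<times> perms n. M.act_trace m n i (fst g) (snd g) *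
   factor_list.day_trace sN (Ns m n) (block_perm m (fst g) (snd g)) k l j h h'))"

lemma has_trace_rel_comp:
 assumes h: "h permutes {..<k}" "h' permutes {..<l}"
 shows "has_trace rel_comp_scale (bpiece RC k l d) (bact RC k l d h h') (\<Sum>q\<in>support k l d. component_trace k l h h' q)"
proof -
 define iota where "iota q zeta = (%q'. if q' = q then zeta else 0)" for q :: "nat \<times> nat \<times> nat \<times> nat" and zeta :: "('k, 'u, ('k, 'v) day) tensor2"
 define Tq where "Tq = (%(m, n, i, j). op_X k l m n i j h h')"
 have "has_trace rel_comp_scale (bpiece RC k l d) (%omega. \<Sum>q\<in>support k l d. iota q (Tq q (omega q))) (\<Sum>q\<in>support k l d. component_trace k l h h' q)"
 proof (rule has_trace_sum[OF finite_support])
  fix q assume "q \<in> support k l d"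
  then obtain m n i j where q: "q = (m, n, i, j)" and ij: "i + j = d" by (auto simp: support_def)
  show "has_trace rel_comp_scale (bpiece RC k l d) (%omega. iota q (Tq q (omega q))) (component_trace k l h h' q)"
  proof (rule has_trace_embed[where s = fscale and X = "C k l m n i j" and t = rel_comp_scale and Y = "bpiece RC k l d"
     and iota = "iota q" and \<pi> = "%omega. omega q" and T = "Tq q" and c = "component_trace k l h h' q", OF subsp_component vs_rel])
   show "iota q \<in> lin_maps fscale (C k l m n i j) rel_comp_scale (bpiece RC k l d)"
   proof (rule lin_mapsI)
    have z: "fscale c 0 = (0 :: ('k, 'u, ('k, 'v) day) tensor2)" for c :: 'k
     by (rule module.scale_zero_right[OF vs_module[OF vector_space_fscale]])
    have "iota q (x + y) = iota q x + iota q y" for x y by (rule ext) (simp add: iota_def)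
    moreover have "iota q (fscale c x) = rel_comp_scale c (iota q x)" for c x
     by (rule ext) (simp add: iota_def rel_comp_scale_def pscale_def[of fscale] z)
    ultimately show "linear_on fscale rel_comp_scale (C k l m n i j) (iota q)"
     unfolding linear_on_def by blast
    show "iota q zeta \<in> bpiece RC k l d" if "zeta \<in> C k l m n i j" for zeta
    proof -
     have "finite {q'. iota q zeta q' ~= 0}" by (rule finite_subset[of _ "{q}"]) (auto simp: iota_def)
     moreover have "if i' + j' = d then iota q zeta (m', n', i', j') \<in> C k l m' n' i' j' else iota q zeta (m', n', i', j') = 0" for m' n' i' j'
      using that ij subsp_0[OF subsp_component] by (auto simp: iota_def q)
     ultimately show ?thesis unfolding rel_comp_piece by blast
    qed
   qed
   show "(%omega. omega q) \<in> lin_maps rel_comp_scale (bpiece RC k l d) fscale (C k l m n i j)"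
   proof (rule lin_mapsI)
    show "linear_on rel_comp_scale fscale (bpiece RC k l d) (%omega. omega q)"
     unfolding linear_on_def rel_comp_scale_def pscale_def[of fscale] by simp
    show "omega q \<in> C k l m n i j" if "omega \<in> bpiece RC k l d" for omega
     using that ij unfolding rel_comp_piece q by metis
   qed
   show "has_trace fscale (C k l m n i j) (Tq q) (component_trace k l h h' q)"
    unfolding Tq_def component_trace_def q case_prod_conv by (rule has_trace_component[OF h])
  qed (simp add: iota_def)
 qed
 then show ?thesis
 proof (rule has_trace_cong)
  fix omega assume omega: "omega \<in> bpiece RC k l d"
  show "bact RC k l d h h' omega = (\<Sum>q\<in>support k l d. iota q (Tq q (omega q)))"
  proof
   fix q :: "nat \<times> nat \<times> nat \<times> nat"
   obtain m n i j where q: "q = (m, n, i, j)" by (cases q)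
   have "(\<Sum>q\<in>support k l d. iota q (Tq q (omega q))) q = (\<Sum>q'\<in>support k l d. iota q' (Tq q' (omega q')) q)"
    by (rule sum_apply)
   also have "... = (\<Sum>q'\<in>support k l d. if q' = q then Tq q (omega q) else 0)"
    by (intro sum.cong refl) (auto simp: iota_def)
   also have "... = (if q \<in> support k l d then Tq q (omega q) else 0)"
    using finite_support by simp
   also have "... = bact RC k l d h h' omega q"
   proof (cases "q \<in> support k l d")
    case True
    then show ?thesis by (simp add: q Tq_def rel_comp_act)
   next
    case False
    have "omega q = 0"
    proof (cases "i + j = d")
     case True
     then have "omega q \<in> C k l m n i j" using omega unfolding rel_comp_piece q by metis
     moreover have "k + l + j < m + n" using False True by (auto simp: support_def q)
     ultimately show ?thesis using component_0 by blast
    next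
     case False
     then show ?thesis using omega unfolding rel_comp_piece q by metis
    qed
    then show ?thesis using False op_X_0 by (simp add: q rel_comp_act)
   qed
   finally show "bact RC k l d h h' omega q = (\<Sum>q\<in>support k l d. iota q (Tq q (omega q))) q" ..
  qed
 qed
qed

sublocale P: plethysm "bisym_char sN Nb" "bisym_char sN (as_bisymmetric N)"
proof
 show "bisym_char sN Nb \<in> carrier sym_series" "bisym_char sN (as_bisymmetric N) \<in> carrier sym_series"
  using Nb.is_bisym_char Nt.is_bisym_char by (auto simp: is_bisym_char_def)
 show "bisym_char sN Nb 0 = 0" by (rule Nb.bisym_char_0[OF Nb_0])
 show "bisym_char sN (as_bisymmetric N) 0 = 0" by (rule Nt.bisym_char_0) (simp add: as_bisymmetric_def N_0)
qed

abbreviation cycles_ev ::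
 "nat => nat => (nat => 'k) => (nat => 'k) => nat => nat => (nat => nat) \<times> (nat => nat) => (nat \<times> nat \<times> nat, 'k) ser" where
 "cycles_ev r q a b m n g \<equiv> (\<Prod>c\<in>#cyc m (fst g). ev r q a b (P.X c)) * (\<Prod>c\<in>#cyc n (snd g). ev r q a b (P.Y c))"

text \<open>
  The trace of a block permutation on the tensor product, evaluated at \<open>(a, b)\<close>, is a product over its cycles.
\<close>

lemma day_trace_cycles:
 assumes r: "1 \<le> r" "1 \<le> q" and g: "g \<in> perms m \<times> perms n"
 shows "(-1) ^ j * ((1 / (fact k * fact l)) * (\<Sum>x\<in>perms k \<times> perms l.
   factor_list.day_trace sN (Ns m n) (block_perm m (fst g) (snd g)) k l j (fst x) (snd x) *
   (fixed_word_sum k r (fst x) a * fixed_word_sum l q (snd x) b))) =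
  coef (cycles_ev r q a b m n g) (k, l, j)"
proof -
 interpret F: factor_list sN "Ns m n" by (rule factors)
 have fin: F.fin_pieces unfolding F.fin_pieces_def using Nb.fin Nt.fin by (simp add: Ns_nth)
 have g1: "fst g \<in> perms m" "snd g \<in> perms n" using g by auto
 let ?K = "{..k} \<times> {..l} \<times> {..j}"
 let ?S1 = "%c. \<Sum>E\<in>alphabet sN Nb r q ?K. (-1) ^ letter_deg E * letter_ser sN Nb a b c E E"
 let ?S2 = "%c. \<Sum>E\<in>alphabet sN (as_bisymmetric N) r q ?K. (-1) ^ letter_deg E * letter_ser sN (as_bisymmetric N) a b c E E"
 have c1: "1 \<le> c" if "c \<in># cyc m (fst g)" for c using zero_notin_cycle_lengths[OF g1(1)] that by (cases c) auto
 have c2: "1 \<le> c" if "c \<in># cyc n (snd g)" for c using zero_notin_cycle_lengths[OF g1(2)] that by (cases c) auto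
 have e1: "coef (\<Prod>c\<in>#cyc m (fst g). ?S1 c) x = coef (\<Prod>c\<in>#cyc m (fst g). ev r q a b (P.X c)) x" if "x + y = (k, l, j)" for x y
 proof (rule agree_prod_mset[OF _ that])
  fix c x y assume "c \<in># cyc m (fst g)" "x + y = (k, l, j)"
  then show "coef (?S1 c) x = coef (ev r q a b (P.X c)) x"
   unfolding P.X_def by (intro Nb.letter_cycle_ev[OF _ r] c1)
 qed
 have e2: "coef (\<Prod>c\<in>#cyc n (snd g). ?S2 c) x = coef (\<Prod>c\<in>#cyc n (snd g). ev r q a b (P.Y c)) x" if "x + y = (k, l, j)" for x y
 proof (rule agree_prod_mset[OF _ that])
  fix c x y assume "c \<in># cyc n (snd g)" "x + y = (k, l, j)"
  then show "coef (?S2 c) x = coef (ev r q a b (P.Y c)) x"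
   unfolding P.Y_def by (intro Nt.letter_cycle_ev[OF _ r] c2)
 qed
 have "(1 / (fact k * fact l)) * (\<Sum>x\<in>perms k \<times> perms l. F.day_trace (block_perm m (fst g) (snd g)) k l j (fst x) (snd x) *
   (fixed_word_sum k r (fst x) a * fixed_word_sum l q (snd x) b)) =
  (1 / (fact k * fact l)) * (\<Sum>h\<in>perms k. \<Sum>h'\<in>perms l. F.day_trace (block_perm m (fst g) (snd g)) k l j h h' *
   (fixed_word_sum k r h a * fixed_word_sum l q h' b))"
  by (simp only: sum.cartesian_product split_def)
 also note F.day_trace_words[OF fin perm_factors[OF g]]
 also have "length (Ns m n) = m + n" by simp
 finally have "(-1) ^ j * ((1 / (fact k * fact l)) * (\<Sum>x\<in>perms k \<times> perms l. F.day_trace (block_perm m (fst g) (snd g)) k l j (fst x) (snd x) *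
   (fixed_word_sum k r (fst x) a * fixed_word_sum l q (snd x) b))) =
  coef ((\<Prod>c\<in>#cyc m (fst g). ?S1 c) * (\<Prod>c\<in>#cyc n (snd g). ?S2 c)) (k, l, j)"
  unfolding block_words[OF Nb Nt g1, symmetric] rel_factors_def by simp
 also have "... = coef (cycles_ev r q a b m n g) (k, l, j)"
  unfolding coef_mult
 proof (rule sum.cong[OF refl], clarify)
  fix x1 x2 x3 y1 y2 y3 :: nat assume xy: "(x1, x2, x3) + (y1, y2, y3) = (k, l, j)"
  have yx: "(y1, y2, y3) + (x1, x2, x3) = (k, l, j)" using xy by (simp add: add.commute)
  show "coef (\<Prod>c\<in>#cyc m (fst g). ?S1 c) (x1, x2, x3) * coef (\<Prod>c\<in>#cyc n (snd g). ?S2 c) (y1, y2, y3) =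
   coef (\<Prod>c\<in>#cyc m (fst g). ev r q a b (P.X c)) (x1, x2, x3) * coef (\<Prod>c\<in>#cyc n (snd g). ev r q a b (P.Y c)) (y1, y2, y3)"
   unfolding e1[OF xy] e2[OF yx] ..
 qed
 finally show ?thesis .
qed

lemma sum_weighted_swap:
 "(\<Sum>x\<in>H. (c * (\<Sum>g\<in>G. f g * h g x)) * w x) = (c * (\<Sum>g\<in>G. f g * (\<Sum>x\<in>H. h g x * w x)) :: 'b::comm_ring_1)"
proof -
 have "(\<Sum>x\<in>H. (c * (\<Sum>g\<in>G. f g * h g x)) * w x) = (\<Sum>x\<in>H. \<Sum>g\<in>G. c * (f g * (h g x * w x)))"
  by (simp only: sum_distrib_left sum_distrib_right mult.assoc)
 also have "... = (\<Sum>g\<in>G. \<Sum>x\<in>H. c * (f g * (h g x * w x)))" by (rule sum.swap)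
 finally show ?thesis by (simp only: sum_distrib_left)
qed

lemma sum_scale_out: "(\<Sum>g\<in>G. f g * (c * (d * S g))) = (c * (d * (\<Sum>g\<in>G. f g * S g)) :: 'b::comm_ring_1)"
 by (simp add: sum_distrib_left mult_ac)

lemma component_trace_cycles:
 assumes r: "1 \<le> r" "1 \<le> q"
 shows "(-1) ^ (i + j) * ((1 / (fact k * fact l)) * (\<Sum>x\<in>perms k \<times> perms l. component_trace k l (fst x) (snd x) (m, n, i, j) *
   (fixed_word_sum k r (fst x) a * fixed_word_sum l q (snd x) b))) =
  (-1) ^ i / (fact m * fact n) * (\<Sum>g\<in>perms m \<times> perms n. M.act_trace m n i (fst g) (snd g) * coef (cycles_ev r q a b m n g) (k, l, j))"
proof -
 let ?S = "%g. \<Sum>x\<in>perms k \<times> perms l. factor_list.day_trace sN (Ns m n) (block_perm m (fst g) (snd g)) k l j (fst x) (snd x) *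
   (fixed_word_sum k r (fst x) a * fixed_word_sum l q (snd x) b)"
 let ?G = "perms m \<times> perms n" and ?chi = "%g. M.act_trace m n i (fst g) (snd g)"
 have "(-1) ^ (i + j) * ((1 / (fact k * fact l)) * (\<Sum>x\<in>perms k \<times> perms l. component_trace k l (fst x) (snd x) (m, n, i, j) *
   (fixed_word_sum k r (fst x) a * fixed_word_sum l q (snd x) b))) =
  (-1) ^ (i + j) * ((1 / (fact k * fact l)) * ((1 / (fact m * fact n)) * (\<Sum>g\<in>?G. ?chi g * ?S g)))"
  unfolding component_trace_def case_prod_conv sum_weighted_swap ..
 also have "... = (-1) ^ i / (fact m * fact n) * (\<Sum>g\<in>?G. ?chi g * ((-1) ^ j * ((1 / (fact k * fact l)) * ?S g)))"
 proof -
  have "(\<Sum>g\<in>?G. ?chi g * ((-1) ^ j * ((1 / (fact k * fact l)) * ?S g))) = (-1) ^ j * ((1 / (fact k * fact l)) * (\<Sum>g\<in>?G. ?chi g * ?S g))"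
   by (rule sum_scale_out)
  then show ?thesis unfolding power_add by (simp add: mult_ac)
 qed
 also have "... = (-1) ^ i / (fact m * fact n) * (\<Sum>g\<in>?G. ?chi g * coef (cycles_ev r q a b m n g) (k, l, j))"
  by (intro arg_cong2[of _ _ _ _ "(*)"] refl sum.cong day_trace_cycles r)
 finally show ?thesis .
qed

lemma ev_ps_eval:
 "coef (ev r q a b (ps_eval P.X P.Y (cyc m sigma, cyc n tau, i))) (k, l, d) =
  (if i \<le> d then coef (cycles_ev r q a b m n (sigma, tau)) (k, l, d - i) else 0)"
proof -
 have e: "ev r q a b (ps_eval P.X P.Y (cyc m sigma, cyc n tau, i)) = smono (0, 0, i) 1 * cycles_ev r q a b m n (sigma, tau)"
  by (simp add: ps_eval_def ev_mult ev_prod_mset ev_hbar mult.commute)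
 show ?thesis
 proof (cases "i \<le> d")
  case True
  then show ?thesis
   unfolding e using coef_mono_mult[of "(0, 0, i)" 1 "cycles_ev r q a b m n (sigma, tau)" "(k, l, d - i)"] by simp
 next
  case False
  then have "coef (smono (0, 0, i) 1 * cycles_ev r q a b m n (sigma, tau)) (k, l, d) = 0"
   by (intro coef_mono_mult_0) auto
  then show ?thesis unfolding e using False by simp
 qed
qed

lemma sum_pairs: "(\<Sum>h\<in>A. \<Sum>h'\<in>B. F h h') = (\<Sum>x\<in>A \<times> B. F (fst x) (snd x))"
 by (simp only: sum.cartesian_product split_def)

text \<open>
  The summands of the plethysm, indexed by \<open>(m, n, i)\<close>, match the components \<open>(m, n, i, d - i)\<close> of the composition
  product in degree \<open>d\<close>.
\<close>

lemma is_bisym_char_rel_comp: "is_bisym_char rel_comp_scale RC (coef (P.pl.subst (frobenius M.act_trace)))"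
 unfolding is_bisym_char_ev Ser_coef
proof (intro conjI allI impI)
 show "coef (P.pl.subst (frobenius M.act_trace)) \<in> carrier sym_series"
  using P.symmetric_pl by (simp add: symmetric_def)
 fix r q k l d :: nat and a b :: "nat => 'k" assume r: "1 \<le> r" "1 \<le> q"
 let ?H = "perms k \<times> perms l"
 let ?w = "%x. fixed_word_sum k r (fst x) a * fixed_word_sum l q (snd x) b"
 let ?B = "%(m, n, i, j). (-1) ^ i / (fact m * fact n) *
  (\<Sum>g\<in>perms m \<times> perms n. M.act_trace m n i (fst g) (snd g) * coef (cycles_ev r q a b m n g) (k, l, j))"
 let ?I = "{x. tri_wt x \<le> tri_wt (k, l, d)}"
 have "coef (ev r q a b (P.pl.subst (frobenius M.act_trace))) (k, l, d) =
  (\<Sum>t\<in>{t \<in> ps_valid. ps_wt t \<le> tri_wt (k, l, d)}. coef (frobenius M.act_trace) t * coef (ev r q a b (ps_eval P.X P.Y t)) (k, l, d))"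
  unfolding ev_def by (rule subst_subst[OF P.pl.substitution_axioms eval_substitution])
 also have "... = (\<Sum>(m, n, i)\<in>?I. if i \<le> d then ?B (m, n, i, d - i) else 0)"
  unfolding sum_frobenius
 proof (rule sum.cong[OF refl])
  fix x :: "nat \<times> nat \<times> nat"
  obtain m n i where x: "x = (m, n, i)" by (cases x)
  show "(case x of (m, n, i) => (-1) ^ i / (fact m * fact n) * (\<Sum>sigma\<in>perms m. \<Sum>tau\<in>perms n. M.act_trace m n i sigma tau *
    coef (ev r q a b (ps_eval P.X P.Y (cyc m sigma, cyc n tau, i))) (k, l, d))) =
   (case x of (m, n, i) => if i \<le> d then ?B (m, n, i, d - i) else 0)"
   unfolding x case_prod_conv ev_ps_eval by (simp add: sum.cartesian_product split_def)
 qed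
 also have "... = (\<Sum>(m, n, i)\<in>{(m, n, i) \<in> ?I. i \<le> d}. ?B (m, n, i, d - i))"
 proof (rule sum.mono_neutral_cong_right)
  show "finite ?I" by (rule finite_subset[of _ "{..k+l+d} \<times> {..k+l+d} \<times> {..k+l+d}"]) (auto simp: tri_wt_def)
 qed (auto split: if_splits)
 also have "... = (\<Sum>q\<in>support k l d. ?B q)"
  by (rule sum.reindex_bij_witness[where i = "%(m, n, i, j). (m, n, i)" and j = "%(m, n, i). (m, n, i, d - i)"])
   (auto simp: support_def tri_wt_def)
 also have "... = (\<Sum>z\<in>support k l d. (-1) ^ d * ((1 / (fact k * fact l)) * (\<Sum>x\<in>?H. component_trace k l (fst x) (snd x) z * ?w x)))"
 proof (rule sum.cong[OF refl])
  fix z assume "z \<in> support k l d"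
  then obtain m n i j where z: "z = (m, n, i, j)" and d: "d = i + j" by (auto simp: support_def)
  show "?B z = (-1) ^ d * ((1 / (fact k * fact l)) * (\<Sum>x\<in>?H. component_trace k l (fst x) (snd x) z * ?w x))"
   unfolding z d case_prod_conv by (rule component_trace_cycles[OF r, symmetric])
 qed
 also have "... = (-1) ^ d * ((1 / (fact k * fact l)) * (\<Sum>z\<in>support k l d. \<Sum>x\<in>?H. component_trace k l (fst x) (snd x) z * ?w x))"
  by (simp only: sum_distrib_left)
 also have "(\<Sum>z\<in>support k l d. \<Sum>x\<in>?H. component_trace k l (fst x) (snd x) z * ?w x) =
   (\<Sum>h\<in>perms k. \<Sum>h'\<in>perms l. (\<Sum>z\<in>support k l d. component_trace k l h h' z) * (fixed_word_sum k r h a * fixed_word_sum l q h' b))"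
 proof -
  have "(\<Sum>h\<in>perms k. \<Sum>h'\<in>perms l. (\<Sum>z\<in>support k l d. component_trace k l h h' z) * (fixed_word_sum k r h a * fixed_word_sum l q h' b)) =
   (\<Sum>x\<in>?H. (\<Sum>z\<in>support k l d. component_trace k l (fst x) (snd x) z) * ?w x)"
   by (rule sum_pairs)
  then show ?thesis unfolding sum_distrib_right by (simp only: sum.swap[of _ "support k l d" ?H])
 qed
 also have "(1 / (fact k * fact l)) * ... = bisym_schur_trace rel_comp_scale RC k l d r q a b"
  by (rule bisym_schur_trace_eq[OF bisymmetric_rel_comp has_trace_rel_comp, symmetric])
 finally show "coef (ev r q a b (P.pl.subst (frobenius M.act_trace))) (k, l, d) = (-1) ^ d * bisym_schur_trace rel_comp_scale RC k l d r q a b" .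
qed

lemma rel_comp_char:
 "bisym_char rel_comp_scale RC = rel_plethysm (bisym_char sM M) (bisym_char sN Nb) (bisym_char sN (as_bisymmetric N))"
 unfolding bisym_charI[OF is_bisym_char_rel_comp] M.bisym_char_eq P.rel_plethysm_subst ..

end

theorem theorem1:
  fixes sM :: "'k::field_char_0 \<Rightarrow> 'u::ab_group_add \<Rightarrow> 'u" and M :: "'u bisymmetric_seq"
    and sN :: "'k \<Rightarrow> 'v::ab_group_add \<Rightarrow> 'v"
    and Nb :: "'v bisymmetric_seq" and N :: "'v symmetric_seq"
  assumes "bisymmetric_sequence sM M" and "bisymmetric_finite_type sM M"
    and "bisymmetric_sequence sN Nb" and "bisymmetric_finite_type sN Nb"
    and "symmetric_sequence sN N" and "symmetric_finite_type sN N"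
    and "bpiece Nb 0 0 0 = {0}" and "spiece N 0 0 = {0}"
  shows "bisym_char rel_comp_scale (rel_comp sM M sN Nb N) =
    rel_plethysm (bisym_char sM M) (bisym_char sN Nb) (sym_char sN N)"
proof -
  have "letters sM M" "letters sN Nb"
    using assms(1-4) by (auto intro!: letters.intro letters_axioms.intro simp: bisymmetric_finite_type_def)
  then interpret rel_composition sM M sN Nb N
    using letters_as_bisymmetric[OF assms(5,6)] assms(7,8) by (intro rel_composition.intro)
  show ?thesis unfolding sym_char_as_bisymmetric[OF assms(5,6)] by (rule rel_comp_char)
qed

end
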